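(* Suppose the triple $(k,l,2)$ is realised by a generalised football pattern on $S^2$. Then every realisation of $(k,l,2)$ on $S^2$ is a branched cover, branched only in the vertices, of the minimal realisation of $(k,l,2)$. In particular the minimal realisation is unique (up to isomorphism of patterns).
   Context: A map on $S^2$ is a finite connected graph embedded in $S^2$ such that the complementary components (faces) are open discs. Loops and multiple edges are not excluded. A face is a $k$-gon if its boundary walk has $k$ edges, counted with multiplicity. A generalised football pattern of type $(k,l,n)$ (a realisation of the triple $(k,l,n)$) is a map on $S^2$ in which at least three edges meet at every vertex, whose faces are divided into two classes, black faces, all $k$-gons, and white faces, all $l$-gons (when $k=l$ the division into classes is part of the data), such that across every edge of a black face there is a white face, and in the cyclic sequence of the $l$ edges of each white face every $n$-th edge has a black face on its other side while all other edges have a white face on their other side. It is always assumed that $k\geq 3$, $l\geq 3$ and that $l$ is a positive multiple of $n$. For $n=2$ the condition says that the edges of each white $l$-gon alternately meet black and white faces. A minimal realisation of a triple is one with the smallest number of faces among all realisations. For $n=2$ the realisable triples and their minimal realisations are: $(3,6,2)$ truncated tetrahedron; $(3,8,2)$ truncated cube; $(4,6,2)$ truncated octahedron; $(3,10,2)$ truncated dodecahedron; $(5,6,2)$ truncated icosahedron (in all these cases the black faces are those created by cutting off vertices); and $(k,4,2)$ for $k\geq 3$, the $k$-prism with its two $k$-gonal ends black and its $k$ lateral quadrilaterals white. A realisation $P'$ is a branched cover of a realisation $P$, branched only in the vertices, if there is a finite branched covering $S^2\to S^2$, branched only in vertices of the pattern, such that $P'$ is the preimage (lift) of $P$ including the colours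 of faces. *)

theory Defs
  imports "HOL-Analysis.Analysis"
begin

abbreviation S2 :: "(real^3) set"
  where "S2 \<equiv> sphere 0 1"

text \<open>
  A coloured cell structure is given by its finite vertex set, its set of \<^emph>\<open>open\<close> edges (edges
  without their end points, as point sets), and its sets of black and white faces.
\<close>

record pattern =
  verts :: "(real^3) set"
  edges :: "(real^3) set set"
  black :: "(real^3) set set"
  white :: "(real^3) set set"

text \<open>
  A simple path may have coinciding end points, so loops are allowed.
\<close>

definition edge_on :: "(real^3) set \<Rightarrow> (real^3) set \<Rightarrow> bool"
  where "edge_on V e \<longleftrightarrow>
    (\<exists>g. simple_path g \<and> path_image g \<subseteq> S2 \<and>
         path_image g \<inter> V = {pathstart g, pathfinish g} \<and> e = path_image g - V)"

definition graph_on_S2 :: "pattern \<Rightarrow> bool"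
  where "graph_on_S2 P \<longleftrightarrow>
    finite (verts P) \<and> verts P \<subseteq> S2 \<and>
    finite (edges P) \<and> (\<forall>e\<in>edges P. edge_on (verts P) e) \<and> pairwise disjnt (edges P) \<and>
    connected (verts P \<union> \<Union>(edges P))"

definition faces :: "pattern \<Rightarrow> (real^3) set set"
  where "faces P = components (S2 - (verts P \<union> \<Union>(edges P)))"

definition map_on_S2 :: "pattern \<Rightarrow> bool"
  where "map_on_S2 P \<longleftrightarrow>
    graph_on_S2 P \<and> (\<forall>F\<in>faces P. F homeomorphic (ball 0 1 :: complex set))"

text \<open>Number of edge ends at a vertex: a loop is counted twice.\<close>

definition degree_at :: "pattern \<Rightarrow> real^3 \<Rightarrow> nat"
  where "degree_at P v =
    card {e \<in> edges P. v \<in> closure e} + card {e \<in> edges P. closure e \<inter> verts P = {v}}"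

text \<open>
  The \<open>i\<close>-th open side of the closed unit disc, regarded as a \<open>k\<close>-gon with corners at the \<open>k\<close>-th
  roots of unity.
\<close>

definition side :: "nat \<Rightarrow> nat \<Rightarrow> complex set"
  where "side k i = (\<lambda>t. cis (2 * pi * (real i + t) / real k)) ` {0<..<1}"

text \<open>
  The list \<open>es\<close> is the sequence of edges traversed when walking once around the boundary of the
  face \<open>F\<close>. The walk is recorded by a map \<open>h\<close> from the closed disc that is a homeomorphism from
  the open disc to \<open>F\<close> and from each open side to an edge, with corners going to vertices. An edge
  having \<open>F\<close> on both sides occurs twice in \<open>es\<close>. The starting point and the direction of the walk
  are arbitrary.
\<close>

definition boundary_walk :: "pattern \<Rightarrow> (real^3) set \<Rightarrow> (real^3) set list \<Rightarrow> bool"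
  where "boundary_walk P F es \<longleftrightarrow>
    es \<noteq> [] \<and> set es \<subseteq> edges P \<and>
    (\<exists>h. continuous_on (cball 0 1) h \<and>
         (\<exists>h'. homeomorphism (ball 0 1) F h h') \<and>
         (\<forall>i<length es. h (cis (2 * pi * real i / real (length es))) \<in> verts P \<and>
                        bij_betw h (side (length es) i) (es ! i)))"

definition is_gon :: "pattern \<Rightarrow> nat \<Rightarrow> (real^3) set \<Rightarrow> bool"
  where "is_gon P k F \<longleftrightarrow> (\<exists>es. boundary_walk P F es \<and> length es = k)"

text \<open>
  \<open>G\<close> is the face on the other side of the edge \<open>e\<close> as seen from the face \<open>F\<close>. An edge has two
  sides, so it lies on the boundary of one or two faces; in the former case \<open>G = F\<close>.
\<close>

definition across :: "pattern \<Rightarrow> (real^3) set \<Rightarrow> (real^3) set \<Rightarrow> (real^3) set \<Rightarrow> bool"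
  where "across P F e G \<longleftrightarrow> {F, G} = {H \<in> faces P. e \<subseteq> closure H}"

definition football_pattern :: "nat \<Rightarrow> nat \<Rightarrow> nat \<Rightarrow> pattern \<Rightarrow> bool"
  where "football_pattern k l n P \<longleftrightarrow>
    3 \<le> k \<and> 3 \<le> l \<and> n dvd l \<and>
    map_on_S2 P \<and>
    (\<forall>v\<in>verts P. 3 \<le> degree_at P v) \<and>
    black P \<union> white P = faces P \<and> black P \<inter> white P = {} \<and>
    (\<forall>F\<in>black P. is_gon P k F) \<and>
    (\<forall>F\<in>black P. \<forall>e\<in>edges P. e \<subseteq> closure F \<longrightarrow> (\<exists>G\<in>white P. across P F e G)) \<and>
    (\<forall>F\<in>white P. \<exists>es. boundary_walk P F es \<and> length es = l \<and>
       (\<exists>r<n. \<forall>i<l. \<exists>G. across P F (es ! i) G \<and>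
                      (if i mod n = r then G \<in> black P else G \<in> white P)))"

definition minimal_realisation :: "nat \<Rightarrow> nat \<Rightarrow> nat \<Rightarrow> pattern \<Rightarrow> bool"
  where "minimal_realisation k l n = is_arg_min (\<lambda>P. card (faces P)) (football_pattern k l n)"

text \<open>
  Finite branched coverings \<open>S\<^sup>2 \<rightarrow> S\<^sup>2\<close> with branch values in the finite set \<open>B\<close>. No local normal
  form needs to be required over \<open>B\<close>: a finite covering of a punctured disc is a disjoint union of
  copies of \<open>z \<mapsto> z\<^sup>m\<close>, so continuity and finiteness of the fibres imply it. The covering may
  preserve or reverse orientation.
\<close>

definition branched_covering :: "(real^3) set \<Rightarrow> (real^3 \<Rightarrow> real^3) \<Rightarrow> bool"
  where "branched_covering B f \<longleftrightarrow>
    finite B \<and> B \<subseteq> S2 \<and>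
    continuous_on S2 f \<and> f ` S2 = S2 \<and>
    (\<forall>y\<in>S2. finite (S2 \<inter> f -` {y})) \<and>
    covering_space (S2 - f -` B) f (S2 - B)"

text \<open>
  The cells of the lift are the connected components of the preimages of the cells.
\<close>

definition is_lift :: "(real^3 \<Rightarrow> real^3) \<Rightarrow> pattern \<Rightarrow> pattern \<Rightarrow> bool"
  where "is_lift f P P' \<longleftrightarrow>
    verts P' = S2 \<inter> f -` verts P \<and>
    edges P' = (\<Union>e\<in>edges P. components (S2 \<inter> f -` e)) \<and>
    black P' = (\<Union>F\<in>black P. components (S2 \<inter> f -` F)) \<and>
    white P' = (\<Union>F\<in>white P. components (S2 \<inter> f -` F))"

definition branched_cover_of :: "pattern \<Rightarrow> pattern \<Rightarrow> bool"
  where "branched_cover_of P' P \<longleftrightarrow> (\<exists>f. branched_covering (verts P) f \<and> is_lift f P P')"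

definition isomorphic_patterns :: "pattern \<Rightarrow> pattern \<Rightarrow> bool"
  where "isomorphic_patterns P Q \<longleftrightarrow>
    (\<exists>f g. homeomorphism S2 S2 f g \<and>
       f ` verts P = verts Q \<and>
       (`) f ` edges P = edges Q \<and>
       (`) f ` black P = black Q \<and>
       (`) f ` white P = white Q)"

end

theory Submission
  imports Defs "HOL-Library.Code_Binary_Nat"
begin

text \<open>
  Cut every face into \<^emph>\<open>flags\<close>: a side of the face together with one of its ends. In a pattern of type
  \<open>(k, 2m, 2)\<close> there are three types of flags: those of black faces, and those of white faces at edges
  towards black and towards white faces. Turning around a vertex from corner to corner (\<open>ac \<circ> cr\<close>) runs
  through the three types in cyclic order. So every vertex lies on a black face, and the number of corners
  around it is a multiple of three. Counting black flags gives at most \<open>k b\<close> vertices, where \<open>b\<close> is the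
  number of black faces; there are \<open>3 k b / 2\<close> edges, and Euler's inequality turns this into
  \<open>k b + 4 \<le> 2 (b + w)\<close>. Together with \<open>k b = m w\<close> this leaves \<open>m = 2\<close> and five further pairs \<open>(k, m)\<close>.
  If the inequality is an equality, every vertex has exactly three corners.

  Let \<open>Q\<close> be a pattern in which equality holds, and \<open>P\<close> any pattern of the same type. Put a face of \<open>P\<close> on a
  face of \<open>Q\<close> of the same colour so that flag types match, and continue across the edges. A turn around a
  vertex of \<open>P\<close> takes a multiple of three steps, and three steps around a vertex of \<open>Q\<close> lead back; so there
  is no monodromy around vertices, and none at all because the sphere is simply connected. This last
  step is combinatorial (\<open>flag_morphism\<close>): the faces are placed along a cotree, the complement of a
  spanning tree of the graph, and the edges of the spanning tree follow from its leaves inwards. Rotating and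
  reflecting the discs that parametrise the faces realises the placement by a branched covering
  (\<open>covering_map\<close>). When \<open>P\<close> has as many faces as \<open>Q\<close>, this covering is a homeomorphism.

  What remains is to attain equality for each of the possible types; then the minimal patterns are exactly
  those with equality. Patterns are drawn by cutting faces of the sphere into two, along a path
  between two of their vertices, starting from two hemispheres (\<open>drawable_step\<close>, \<open>drawable_initial\<close>). The
  prisms arise by induction on the number of lateral faces, and the five truncated regular solids from explicit
  sequences of cuts, whose face lists are checked by rewriting.
\<close>

section \<open>Gluing parametrised pieces\<close>

text \<open>
  Images of compact sets are closed, so continuity on a set covered by finitely many compact parametrised pieces can
  be checked on each piece before parametrisation.
\<close>

lemma continuous_on_glue:
 fixes q :: "'j => 'a::topological_space => 'b::t2_space"
  and f :: "'b => 'c::topological_space"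
 assumes "finite J"
  and cpt: "\<And>j. j \<in> J ==> compact (K j)"
  and q: "\<And>j. j \<in> J ==> continuous_on (K j) (q j)"
  and F: "\<And>j. j \<in> J ==> continuous_on (K j \<inter> q j -` X) (F j)"
  and X: "X \<subseteq> (\<Union>j\<in>J. q j ` K j)"
  and f: "\<And>j y. j \<in> J ==> y \<in> K j ==> q j y \<in> X ==> f (q j y) = F j y"
 shows "continuous_on X f"
 unfolding continuous_on_closed_invariant
proof (intro allI impI)
 fix B :: "'c set" assume B: "closed B"
 have "\<exists>Z. closed Z \<and> Z \<inter> (K j \<inter> q j -` X) = F j -` B \<inter> (K j \<inter> q j -` X)" if "j \<in> J" for j
  using F[OF that] B unfolding continuous_on_closed_invariant by blast
 then obtain Z where Z: "\<And>j. j \<in> J ==> closed (Z j)"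
  "\<And>j. j \<in> J ==> Z j \<inter> (K j \<inter> q j -` X) = F j -` B \<inter> (K j \<inter> q j -` X)"
  by metis
 let ?A = "\<Union>j\<in>J. q j ` (K j \<inter> Z j)"
 have "compact (q j ` (K j \<inter> Z j))" if "j \<in> J" for j
  by (meson Int_lower1 compact_Int_closed compact_continuous_image continuous_on_subset cpt q that Z)
 then have "closed ?A" using \<open>finite J\<close> by (auto intro!: compact_imp_closed)
 moreover have "?A \<inter> X = f -` B \<inter> X"
 proof (intro set_eqI iffI)
  fix x assume "x \<in> ?A \<inter> X"
  then obtain j y where "j \<in> J" "y \<in> K j" "y \<in> Z j" "x = q j y" "x \<in> X" by blast
  then show "x \<in> f -` B \<inter> X" using Z(2)[of j] f[of j y] by auto
 next
  fix x assume x: "x \<in> f -` B \<inter> X"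
  then obtain j y where "j \<in> J" "y \<in> K j" "x = q j y" using X by blast
  then show "x \<in> ?A \<inter> X" using Z(2)[of j] f[of j y] x by auto
 qed
 ultimately show "\<exists>A. closed A \<and> A \<inter> X = f -` B \<inter> X" by blast
qed

lemma homeomorphism_saturated:
 fixes f :: "'a::topological_space => 'b::t2_space"
 assumes "compact K" "continuous_on K f" "inj_on f A" "A = K \<inter> f -` B" "f ` A = B"
 shows "homeomorphism A B f (inv_into A f)"
proof -
 have "continuous_on B (inv_into A f)"
  by (rule continuous_on_glue[where J="{()}" and K="\<lambda>_. K" and q="\<lambda>_. f" and F="\<lambda>_. id"])
   (use assms in \<open>auto simp: inv_into_f_f\<close>)
 moreover have "continuous_on A f" using assms(2,4) continuous_on_subset by blast
 ultimately show ?thesis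
  using assms(3,5) by (auto simp: homeomorphism_def inv_into_f_f f_inv_into_f image_image)
qed

text \<open>
  Extend the parametrisation of the frontier radially: every ray from the interior point \<open>c\<close> of a compact
  convex set meets the frontier exactly once.
\<close>

lemma cone_homeomorphism:
 fixes \<beta> :: "complex => complex"
 assumes A: "convex A" "compact A" "c \<in> interior A"
  and \<beta>: "continuous_on (sphere 0 1) \<beta>" "inj_on \<beta> (sphere 0 1)" "\<beta> ` sphere 0 1 = frontier A"
 obtains H where "continuous_on (cball 0 1) H" "inj_on H (cball 0 1)" "H ` cball 0 1 = A"
  "H ` ball 0 1 = interior A" "\<And>z. norm z = 1 ==> H z = \<beta> z"
proof -
 define H where "H z = c + norm z *\<^sub>R (\<beta> (sgn z) - c)" for z
 have sph: "sgn z \<in> sphere 0 1" if "z \<noteq> 0" for z :: complex using that by (simp add: norm_sgn)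
 have fr: "\<beta> (sgn z) \<in> frontier A" if "z \<noteq> 0" for z using \<beta>(3) sph[OF that] by blast
 have cA: "c \<notin> frontier A" using A(3) by (simp add: frontier_def)
 have int: "c + r *\<^sub>R (p - c) \<in> interior A" if "p \<in> frontier A" "0 \<le> r" "r < 1" for p r
 proof (cases "r = 0")
  case False
  have "p - (1 - r) *\<^sub>R (p - c) \<in> interior A"
   using mem_interior_closure_convex_shrink[OF A(1,3), of p "1 - r"] that False
   by (simp add: frontier_def)
  then show ?thesis by (simp add: algebra_simps)
 qed (use A in simp)
 have sep: False if "p \<in> frontier A" "p' \<in> frontier A" "0 < r" "r < r'" "r *\<^sub>R (p - c) = r' *\<^sub>R (p' - c)" for p p' r r'
 proof -
  have "p' - c = (r / r') *\<^sub>R (p - c)"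
   using that by (metis (no_types, lifting) divideR_right less_trans nless_le scaleR_scaleR divide_inverse mult.commute)
  then have "p' = c + (r / r') *\<^sub>R (p - c)" by (simp add: algebra_simps)
  then have "p' \<in> interior A" using int[of p "r / r'"] that by simp
  then show False using that(2) by (simp add: frontier_def)
 qed
 have inj: "inj_on H (cball 0 1)"
 proof (rule inj_onI)
  fix z w assume zw: "z \<in> cball 0 1" "w \<in> cball 0 1" "H z = H w"
  have eq: "norm z *\<^sub>R (\<beta> (sgn z) - c) = norm w *\<^sub>R (\<beta> (sgn w) - c)" using zw by (simp add: H_def)
  show "z = w"
  proof (cases "z = 0 \<or> w = 0")
   case True
   moreover have "norm z *\<^sub>R (\<beta> (sgn z) - c) \<noteq> 0" if "z \<noteq> 0" for z using fr[OF that] cA that by auto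
   ultimately show ?thesis using eq by (metis norm_zero scaleR_zero_left)
  next
   case False
   have n: "norm z = norm w"
    using sep[of "\<beta> (sgn z)" "\<beta> (sgn w)" "norm z" "norm w"] sep[of "\<beta> (sgn w)" "\<beta> (sgn z)" "norm w" "norm z"]
     fr False eq by (metis linorder_neqE_linordered_idom zero_less_norm_iff)
   then have "\<beta> (sgn z) = \<beta> (sgn w)" using eq False by simp
   then have "sgn z = sgn w" using \<beta>(2) sph False by (meson inj_onD)
   then show ?thesis using n False by (metis norm_eq_zero scaleR_left_imp_eq sgn_div_norm inverse_nonzero_iff_nonzero scaleR_cancel_left)
  qed
 qed
 have cont: "continuous_on (cball 0 1) H"
 proof (rule continuous_on_eq_continuous_within[THEN iffD2, rule_format])
  fix z :: complex assume z: "z \<in> cball 0 1"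
  show "continuous (at z within cball 0 1) H"
  proof (cases "z = 0")
   case False
   have "continuous_on (- {0}) H"
    unfolding H_def
    by (intro continuous_intros continuous_on_compose2[OF \<beta>(1)]) (auto simp: norm_sgn split: if_splits)
   then show ?thesis using False
    by (meson ComplI continuous_at_imp_continuous_at_within continuous_on_eq_continuous_at open_Compl closed_singleton singletonD)
  next
   case True
   have "bounded (frontier A)" using A(2) by (simp add: compact_frontier compact_imp_bounded)
   then obtain B where B: "\<And>p. p \<in> frontier A ==> norm (p - c) \<le> B"
    by (metis bounded_iff bounded_translation_minus image_eqI)
   have "((\<lambda>z. norm z *\<^sub>R (\<beta> (sgn z) - c)) \<longlongrightarrow> 0) (at 0 within cball 0 1)"
   proof (rule Lim_null_comparison[where g="\<lambda>z. norm z * B"])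
    show "\<forall>\<^sub>F z in at 0 within cball 0 1. norm (norm z *\<^sub>R (\<beta> (sgn z) - c)) \<le> norm z * B"
     unfolding eventually_at_filter using fr B by (intro always_eventually) (auto intro!: mult_left_mono)
    show "((\<lambda>z. norm z * B) \<longlongrightarrow> 0) (at 0 within cball 0 1)"
     by (rule tendsto_eq_intros refl)+ simp
   qed
   then have "(H \<longlongrightarrow> c + 0) (at 0 within cball 0 1)" unfolding H_def[abs_def] by (intro tendsto_add tendsto_const)
   then show ?thesis using True by (simp add: continuous_within H_def)
  qed
 qed
 have Hint: "H z \<in> interior A" if "norm z < 1" for z
  using int[OF fr, of z "norm z"] that A(3) by (cases "z = 0") (auto simp: H_def)
 have Hs: "H z = \<beta> z" if "norm z = 1" for z using that by (simp add: H_def sgn_div_norm)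
 have sur: "x \<in> H ` cball 0 1" if "x \<in> A" for x
 proof (cases "x = c")
  case True then show ?thesis by (intro image_eqI[of _ _ 0]) (auto simp: H_def)
 next
  case False
  obtain d where d: "0 < d" "c + d *\<^sub>R (x - c) \<in> frontier A"
   "\<And>e. 0 \<le> e ==> e < d ==> c + e *\<^sub>R (x - c) \<in> interior A"
   using ray_to_frontier[of A c "x - c"] A False by (auto simp: compact_imp_bounded)
  have "1 \<le> d"
  proof (rule ccontr)
   assume "\<not> 1 \<le> d"
   then have "x - (1 - d) *\<^sub>R (x - c) \<in> interior A"
    using mem_interior_closure_convex_shrink[OF A(1,3), of x "1 - d"] that d(1) closure_subset by auto
   then show False using d(2) by (auto simp: frontier_def algebra_simps)
  qed
  obtain u where u: "norm u = 1" "\<beta> u = c + d *\<^sub>R (x - c)" using \<beta>(3) d(2) by (metis imageE mem_sphere_0)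
  let ?z = "(1 / d) *\<^sub>R u"
  have "sgn ?z = u" using u d(1) by (simp add: sgn_scaleR sgn_div_norm)
  then have "H ?z = x" using u d(1) by (simp add: H_def)
  moreover have "?z \<in> cball 0 1" using u d(1) \<open>1 \<le> d\<close> by simp
  ultimately show ?thesis by (metis image_eqI)
 qed
 have clA: "closed A" using A(2) compact_imp_closed by blast
 have frA: "frontier A = A - interior A" using clA by (simp add: frontier_def)
 have 1: "H ` cball 0 1 = A"
 proof
  show "H ` cball 0 1 \<subseteq> A"
  proof clarify
   fix z :: complex assume "z \<in> cball 0 1"
   then consider "norm z < 1" | "norm z = 1" by (auto simp: le_less)
   then show "H z \<in> A"
    using Hint interior_subset Hs \<beta>(3) frA by cases (blast, metis DiffD1 image_eqI mem_sphere_0)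
  qed
 qed (use sur in blast)
 have 2: "H ` ball 0 1 = interior A"
 proof
  show "interior A \<subseteq> H ` ball 0 1"
  proof
   fix x assume x: "x \<in> interior A"
   then obtain z where z: "z \<in> cball 0 1" "H z = x" using 1 interior_subset by blast
   have "norm z \<noteq> 1" using Hs[of z] z x \<beta>(3) by (metis Diff_iff frA image_eqI mem_sphere_0)
   then show "x \<in> H ` ball 0 1" using z by auto
  qed
 qed (use Hint in auto)
 show ?thesis using that[OF cont inj 1 2] Hs by blast
qed

section \<open>Points of the unit circle\<close>

text \<open>
  The boundary of a disc regarded as an \<open>n\<close>-gon: the corners are at integral positions, and position
  \<open>i + t\<close> is the point of parameter \<open>t\<close> on side \<open>i\<close>.
\<close>

definition pt :: "nat => real => complex"
 where "pt n s = cis (2 * pi * s / real n)"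

lemma norm_pt [simp]: "norm (pt n s) = 1" by (simp add: pt_def)
lemma pt_nonzero [simp]: "pt n s \<noteq> 0" by (metis norm_pt norm_zero zero_neq_one)

lemma continuous_on_pt [continuous_intros]: "continuous_on S f ==> continuous_on S (\<lambda>x. pt n (f x))"
 unfolding pt_def cis_conv_exp divide_inverse by (intro continuous_intros)

lemma cis_eq_cis_iff: "cis x = cis y \<longleftrightarrow> (\<exists>k::int. x = y + 2 * pi * k)"
proof -
 have "cis x = cis y \<longleftrightarrow> (\<exists>k::int. \<i> * complex_of_real x = \<i> * complex_of_real y + of_int (2 * k) * pi * \<i>)"
  by (simp add: cis_conv_exp exp_eq)
 also have "\<dots> \<longleftrightarrow> (\<exists>k::int. x = y + 2 * pi * k)"
  by (auto simp: complex_eq_iff algebra_simps)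
 finally show ?thesis .
qed

lemma pt_eq_iff:
 assumes "n > 0" shows "pt n s = pt n s' \<longleftrightarrow> (\<exists>k::int. s = s' + real n * k)"
proof -
 have "2 * pi * s / real n = 2 * pi * s' / real n + 2 * pi * real_of_int k \<longleftrightarrow> s = s' + real n * k" for k
 proof -
  have "2 * pi * s / real n = 2 * pi * s' / real n + 2 * pi * real_of_int k \<longleftrightarrow>
    (2 * pi / real n) * s = (2 * pi / real n) * (s' + real n * k)"
   using assms by (simp add: field_simps)
  also have "\<dots> \<longleftrightarrow> s = s' + real n * k" using assms by (subst mult_cancel_left) auto
  finally show ?thesis .
 qed
 then show ?thesis by (simp add: pt_def cis_eq_cis_iff)
qed

lemma pt_mod: "n > 0 ==> pt n (real (i mod n) + t) = pt n (real i + t)"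
proof -
 assume "n > 0"
 have "real i + t = (real (i mod n) + t) + real n * of_int (int (i div n))"
  by (metis (no_types, opaque_lifting) add.assoc add.commute mult_div_mod_eq of_int_of_nat_eq of_nat_add of_nat_mult)
 then show ?thesis using \<open>n > 0\<close> pt_eq_iff by metis
qed

lemma pt_inj:
 assumes "i < n" "j < n" "0 \<le> t" "t < 1" "0 \<le> u" "u < 1" "pt n (real i + t) = pt n (real j + u)"
 shows "i = j \<and> t = u"
proof -
 have "n > 0" using assms by simp
 obtain k :: int where k: "real i + t = real j + u + real n * k"
  using assms(7) unfolding pt_eq_iff[OF \<open>n > 0\<close>] by blast
 have a: "i = \<lfloor>real i + t\<rfloor>" "j = \<lfloor>real j + u\<rfloor>" using assms by linarith+
 have "real j + u + real n * k = (real j + u) + of_int (int n * k)" by simp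
 then have "\<lfloor>real i + t\<rfloor> = \<lfloor>real j + u\<rfloor> + int n * k" using k by (metis floor_add_int)
 then have eq: "int i = int j + int n * k" using a by linarith
 then have "int i mod int n = int j mod int n" by simp
 then have "i = j" using assms by simp
 then show ?thesis using eq k assms by auto
qed

lemma sphere_pt_cases:
 assumes "n > 0" "norm (z::complex) = 1"
 obtains i t where "i < n" "0 \<le> t" "t < 1" "z = pt n (real i + t)"
proof -
 have z: "z = cis (Arg2pi z)" using assms Arg2pi[of z] by (simp add: cis_conv_exp is_Arg_def)
 define s where "s = Arg2pi z * n / (2 * pi)"
 have s: "0 \<le> s" "s < n" using Arg2pi[of z] assms by (auto simp: s_def field_simps)
 have zs: "z = pt n s" using z assms by (simp add: pt_def s_def)
 let ?i = "nat \<lfloor>s\<rfloor>"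
 show ?thesis
  by (rule that[of ?i "s - ?i"]) (use s zs in \<open>auto simp: nat_less_iff floor_less_iff of_nat_nat; linarith\<close>)+
qed

lemma pt_corner: "n > 0 ==> i < n ==> pt n (real i + 1) = pt n (real ((i + 1) mod n) + 0)"
 using pt_mod[of n "i+1" 0] by (simp add: add.commute)

lemma side_pt: "side n i = (\<lambda>t. pt n (real i + t)) ` {0<..<1}"
 by (simp add: side_def pt_def)

lemma circle_map:
 fixes p :: "nat => real => 'a::topological_space"
 assumes "n > 0" and p: "\<And>i. i < n ==> continuous_on {0..1} (p i)"
  and c: "\<And>i. i < n ==> p i 1 = p ((i + 1) mod n) 0"
 obtains \<beta> where "continuous_on (sphere 0 1) \<beta>" "\<And>i t. i < n ==> 0 \<le> t ==> t \<le> 1 ==> \<beta> (pt n (real i + t)) = p i t"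
proof -
 define \<beta> where "\<beta> z = (case (SOME (i, t). i < n \<and> 0 \<le> t \<and> t < 1 \<and> z = pt n (real i + t)) of (i, t) => p i t)" for z
 have b: "\<beta> (pt n (real i + t)) = p i t" if "i < n" "0 \<le> t" "t < 1" for i t
 proof -
  have "(SOME (j, u). j < n \<and> 0 \<le> u \<and> u < 1 \<and> pt n (real i + t) = pt n (real j + u)) = (i, t)"
  proof (rule some_equality)
   show "case (i, t) of (j, u) => j < n \<and> 0 \<le> u \<and> u < 1 \<and> pt n (real i + t) = pt n (real j + u)" using that by simp
   fix x assume "case x of (j, u) => j < n \<and> 0 \<le> u \<and> u < 1 \<and> pt n (real i + t) = pt n (real j + u)"
   then show "x = (i, t)" using that pt_inj[of i n "fst x" t "snd x"] by (cases x) auto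
  qed
  then show ?thesis by (simp add: \<beta>_def)
 qed
 have b1: "\<beta> (pt n (real i + t)) = p i t" if "i < n" "0 \<le> t" "t \<le> 1" for i t
 proof (cases "t = 1")
  case True
  then show ?thesis using pt_corner[of n i] b[of "(i+1) mod n" 0] c[of i] that by auto
 qed (use b that in auto)
 have "continuous_on (sphere 0 1) \<beta>"
 proof (rule continuous_on_glue[where J="{..<n}" and K="\<lambda>_. {0..1}" and q="\<lambda>i t. pt n (real i + t)" and F=p])
  show "sphere 0 1 \<subseteq> (\<Union>i\<in>{..<n}. (\<lambda>t. pt n (real i + t)) ` {0..1})"
  proof
   fix z :: complex assume "z \<in> sphere 0 1"
   then obtain i t where "i < n" "0 \<le> t" "t < 1" "z = pt n (real i + t)" using sphere_pt_cases[of n z] assms(1) by auto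
   then show "z \<in> (\<Union>i\<in>{..<n}. (\<lambda>t. pt n (real i + t)) ` {0..1})" by force
  qed
  show "continuous_on ({0..1} \<inter> (\<lambda>t. pt n (real i + t)) -` sphere 0 1) (p i)" if "i \<in> {..<n}" for i
   using p that by (auto intro: continuous_on_subset)
 qed (use b1 in \<open>auto intro!: continuous_intros\<close>)
 then show ?thesis using that b1 by blast
qed

section \<open>Planar topology on the sphere\<close>

lemma stereographic:
 fixes p :: "real^3" assumes "p \<in> S2"
 obtains \<phi> \<psi> where "homeomorphism (S2 - {p}) (UNIV :: complex set) \<phi> \<psi>"
 using homeomorphic_punctured_sphere_affine[of 1 p 0 "UNIV :: complex set"] assms
 by (auto simp: homeomorphic_def aff_dim_UNIV)

lemma openin_S2_punctured:
 "openin (top_of_set (S2 - {p})) U ==> openin (top_of_set S2) U"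
 by (erule openin_trans) (metis Diff_eq openin_open closed_singleton open_Compl)

text \<open>
  Invariance of domain in the plane, carried over by stereographic projection.
\<close>

lemma invariance_of_domain_S2:
 fixes f :: "complex => real^3"
 assumes "open U" "continuous_on U f" "inj_on f U" "f ` U \<subseteq> S2"
 shows "openin (top_of_set S2) (f ` U)"
proof (cases "f ` U = S2")
 case True then show ?thesis by simp
next
 case False
 then obtain p where p: "p \<in> S2" "p \<notin> f ` U" using assms by blast
 obtain \<phi> \<psi> where h: "homeomorphism (S2 - {p}) (UNIV :: complex set) \<phi> \<psi>" using stereographic p by blast
 have sub: "f ` U \<subseteq> S2 - {p}" using p assms by blast
 have "open ((\<phi> \<circ> f) ` U)"
 proof (rule invariance_of_domain)
  show "continuous_on U (\<phi> \<circ> f)" using assms(2) h sub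
   by (meson continuous_on_compose continuous_on_subset homeomorphism_cont1)
  have "inj_on \<phi> (S2 - {p})" using h by (metis homeomorphism_def inj_on_inverseI)
  then show "inj_on (\<phi> \<circ> f) U" using assms(3) sub by (meson comp_inj_on inj_on_subset)
 qed (use assms in auto)
 then have "openin (top_of_set (S2 - {p})) (\<psi> ` (\<phi> \<circ> f) ` U)"
  using homeomorphism_imp_open_map[OF homeomorphism_symD[OF h]] by auto
 moreover have "\<psi> ` (\<phi> \<circ> f) ` U = f ` U"

 proof -
  have "\<psi> (\<phi> (f x)) = f x" if "x \<in> U" for x using h sub that by (auto simp: homeomorphism_def)
  then show ?thesis by (simp add: image_image)
 qed
 ultimately show ?thesis using openin_S2_punctured by metis
qed

lemma connected_S2_delete_finite:
 fixes U :: "(real^3) set"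
 assumes "openin (top_of_set S2) U" "connected U" "finite T"
 shows "connected (U - T)"
proof -
 have *: "connected (U - T)" if U: "openin (top_of_set S2) U" "connected U" "q \<in> S2" "q \<notin> U" "finite T" for U T and q :: "real^3"
 proof -
  obtain \<phi> \<psi> where h: "homeomorphism (S2 - {q}) (UNIV :: complex set) \<phi> \<psi>" using stereographic U by blast
  have sub: "U \<subseteq> S2 - {q}" using U openin_imp_subset by blast
  have "openin (top_of_set (S2 - {q})) U" using U sub by (meson Diff_subset openin_subset_trans)
  then have "open (\<phi> ` U)" using homeomorphism_imp_open_map[OF h] by simp
  have "connected (\<phi> ` U)" using U h sub by (meson connected_continuous_image continuous_on_subset homeomorphism_cont1)
  have "connected (\<phi> ` U - \<phi> ` (T \<inter> U))"
   using connected_open_delete_finite[OF \<open>open (\<phi> ` U)\<close> \<open>connected (\<phi> ` U)\<close>] U by simp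
  then have "connected (\<psi> ` (\<phi> ` U - \<phi> ` (T \<inter> U)))"
   by (rule connected_continuous_image[rotated]) (rule continuous_on_subset[OF homeomorphism_cont2[OF h]], simp)
  moreover have "\<psi> ` (\<phi> ` U - \<phi> ` (T \<inter> U)) = U - T"
  proof -
   have id: "\<psi> (\<phi> x) = x" if "x \<in> U" for x using h sub that by (auto simp: homeomorphism_def)
   have inj: "inj_on \<phi> U" using id by (metis inj_on_inverseI)
   have "\<phi> ` U - \<phi> ` (T \<inter> U) = \<phi> ` (U - T)" using inj_on_image_set_diff[OF inj, of U "T \<inter> U"] by (simp add: Diff_Int)
   then show ?thesis using id by (simp add: image_image)
  qed
  ultimately show ?thesis by simp
 qed
 show ?thesis
 proof (cases "U = S2")
  case False
  then show ?thesis using * assms openin_imp_subset by (metis subsetI subset_antisym)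
 next
  case True
  show ?thesis
  proof (cases "T \<inter> S2 = {}")
   case True then show ?thesis using \<open>U = S2\<close> assms(2) by (metis Diff_triv inf_commute)
  next
   case False
   then obtain p where p: "p \<in> T" "p \<in> S2" by blast
   obtain \<phi> \<psi> where h: "homeomorphism (S2 - {p}) (UNIV :: complex set) \<phi> \<psi>" using stereographic p by blast
   have "connected (S2 - {p})" using h homeomorphic_connectedness[of "S2 - {p}" "UNIV :: complex set"] by (auto simp: homeomorphic_def)
   moreover have "openin (top_of_set S2) (S2 - {p})" by (metis Diff_eq openin_open closed_singleton open_Compl)
   ultimately have "connected ((S2 - {p}) - T)" using *[of "S2 - {p}" p T] p assms by blast
   then show ?thesis using p True by (metis Diff_insert2 insert_absorb)
  qed
 qed
qed

text \<open>
  The dual of Janiszewski's theorem: two continua that meet in a disconnected set separate the sphere. It plays the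
  part of the Jordan curve theorem in the proof of Euler's inequality.
\<close>

lemma Janiszewski_dual_S2:
 fixes A B :: "(real^3) set"
 assumes A: "compact A" "connected A" "A \<subseteq> S2" and B: "compact B" "connected B" "B \<subseteq> S2"
  and c: "connected (S2 - (A \<union> B))" "S2 - (A \<union> B) \<noteq> {}"
 shows "connected (A \<inter> B)"
proof -
 obtain p where p: "p \<in> S2" "p \<notin> A" "p \<notin> B" using c by blast
 obtain \<phi> \<psi> where h: "homeomorphism (S2 - {p}) (UNIV :: complex set) \<phi> \<psi>" using stereographic p by blast
 have sA: "A \<subseteq> S2 - {p}" and sB: "B \<subseteq> S2 - {p}" using A B p by auto
 have inj: "inj_on \<phi> (S2 - {p})" using h by (metis homeomorphism_def inj_on_inverseI)
 have "closed (A \<union> B)" using A B by (simp add: closed_Un compact_imp_closed)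
 then have "openin (top_of_set S2) (S2 - (A \<union> B))" by (metis Diff_eq openin_open open_Compl)
 then have con: "connected (S2 - (A \<union> B) - {p})" using connected_S2_delete_finite c by blast
 have *: "continuous_on X \<phi>" if "X \<subseteq> S2 - {p}" for X using h that by (meson continuous_on_subset homeomorphism_cont1)
 have "connected (\<phi> ` A \<inter> \<phi> ` B)"
 proof (rule Janiszewski_dual)
  have "- (\<phi> ` A \<union> \<phi> ` B) = \<phi> ` (S2 - (A \<union> B) - {p})"
  proof -
   have "UNIV = \<phi> ` (S2 - {p})" using h by (simp add: homeomorphism_def)
   moreover have "\<phi> ` (S2 - {p}) - \<phi> ` (A \<union> B) = \<phi> ` ((S2 - {p}) - (A \<union> B))"
    using inj_on_image_set_diff[OF inj, of "S2 - {p}" "A \<union> B"] sA sB by blast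
   moreover have "(S2 - {p}) - (A \<union> B) = S2 - (A \<union> B) - {p}" by blast
   ultimately show ?thesis by (metis Compl_eq_Diff_UNIV image_Un)
  qed
  then show "connected (- (\<phi> ` A \<union> \<phi> ` B))" using con by (metis Diff_mono Diff_subset connected_continuous_image * order_refl)
 qed (use A B sA sB * in \<open>auto intro: compact_continuous_image connected_continuous_image\<close>)
 then have "connected (\<phi> ` (A \<inter> B))" using inj_on_image_Int[OF inj sA sB] by simp
 then have "connected (\<psi> ` \<phi> ` (A \<inter> B))"
  using h by (meson connected_continuous_image continuous_on_subset homeomorphism_cont2 subset_UNIV)
 moreover have "\<psi> ` \<phi> ` (A \<inter> B) = A \<inter> B" 
 proof -
  have "\<psi> (\<phi> x) = x" if "x \<in> A" for x using h sA that by (auto simp: homeomorphism_def)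
  then show ?thesis by (simp add: image_image)
 qed
 ultimately show ?thesis by simp
qed

lemma components_finite_disjoint_closed:
 assumes "finite C" and dis: "pairwise disjnt C"
  and con: "\<And>c. c \<in> C ==> connected c \<and> c \<noteq> {}"
  and cl: "\<And>c. c \<in> C ==> closedin (top_of_set (\<Union>C)) c"
 shows "components (\<Union>C) = C"
proof -
 have op: "openin (top_of_set (\<Union>C)) c" if "c \<in> C" for c
 proof -
  have "closedin (top_of_set (\<Union>C)) (\<Union>(C - {c}))" using cl assms(1) by (intro closedin_Union) auto
  moreover have "\<Union>C - \<Union>(C - {c}) = c" using dis that by (auto simp: pairwise_def disjnt_iff)
  ultimately show ?thesis by (metis openin_diff openin_subtopology_refl subset_UNIV topspace_euclidean openin_topspace topspace_euclidean_subtopology)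
 qed
 have comp: "c \<in> components (\<Union>C)" if "c \<in> C" for c
 proof -
  obtain x where x: "x \<in> c" using con[OF \<open>c \<in> C\<close>] by blast
  have "connected_component_set (\<Union>C) x = c"
  proof
   show "c \<subseteq> connected_component_set (\<Union>C) x" using con that x by (intro connected_component_maximal) auto
   let ?D = "connected_component_set (\<Union>C) x"
   have D: "connected ?D" "?D \<subseteq> \<Union>C" "x \<in> ?D" using that x by (auto simp: connected_component_subset connected_component_refl)
   obtain T Z where "open T" "c = \<Union>C \<inter> T" "closed Z" "c = \<Union>C \<inter> Z"
    using op[OF \<open>c \<in> C\<close>] cl[OF \<open>c \<in> C\<close>] unfolding openin_open closedin_closed by metis
   then have "open T \<and> ?D \<inter> c = ?D \<inter> T" "closed Z \<and> ?D \<inter> c = ?D \<inter> Z" using D(2) by auto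
   then have "openin (top_of_set ?D) (?D \<inter> c)" "closedin (top_of_set ?D) (?D \<inter> c)"
    unfolding openin_open closedin_closed by blast+
   then show "?D \<subseteq> c" using D x unfolding connected_clopen by blast
  qed
  then show ?thesis using x that by (auto simp: components_def)
 qed
 moreover have "d \<in> C" if d: "d \<in> components (\<Union>C)" for d
 proof -
  obtain x c where "x \<in> d" "x \<in> c" "c \<in> C" using d in_components_nonempty in_components_subset by blast
  then show ?thesis using comp d components_nonoverlap by (metis disjoint_iff)
 qed
 ultimately show ?thesis by blast
qed

section \<open>Cellular maps with parametrised edges and faces\<close>

lemma not_open_real_in_complex:
 assumes "open U" "U \<subseteq> range complex_of_real" shows "U = {}"
proof (rule ccontr)
 assume "U \<noteq> {}"
 then obtain x e where x: "x \<in> U" "e > 0" "ball x e \<subseteq> U" using assms(1) open_contains_ball by blast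
 have "x + \<i> * complex_of_real (e/2) \<in> ball x e" using x(2) by (simp add: dist_norm norm_mult)
 then obtain r where "x + \<i> * complex_of_real (e/2) = complex_of_real r" using x(3) assms(2) by blast
 then have "Im (x + \<i> * complex_of_real (e/2)) = 0" by simp
 then have "Im x + e/2 = 0" by simp
 moreover have "Im x = 0" using x(1) assms(2) by auto
 ultimately show False using x(2) by simp
qed

lemma open_arc_homeomorphism:
 fixes g :: "real => 'a::t2_space"
 assumes "continuous_on {0..1} g" "inj_on g {0<..<1}" "g ` {0<..<1} = e" "g 0 \<notin> e" "g 1 \<notin> e"
 shows "homeomorphism {0<..<1} e g (inv_into {0<..<1} g)"
proof (rule homeomorphism_saturated[OF compact_Icc[of 0 1]])
 have "0 < t \<and> t < 1" if "g t \<in> e" "0 \<le> t" "t \<le> 1" for t using that assms(4,5) by (cases "t = 0 \<or> t = 1") auto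
 then have "{0..1} \<inter> g -` e \<subseteq> {0<..<1}" by force
 moreover have "{0<..<1} \<subseteq> {0..1} \<inter> g -` e" unfolding assms(3)[symmetric] by force
 ultimately show "{0<..<1} = {0..1} \<inter> g -` e" by (rule equalityI[rotated])
qed (use assms in auto)

lemma open_arc_not_openin_S2:
 fixes g :: "real => real^3"
 assumes g: "continuous_on {0..1} g" "inj_on g {0<..<1}" "g ` {0<..<1} = e" "g 0 \<notin> e" "g 1 \<notin> e"
 shows "\<not> openin (top_of_set S2) e"
proof
 assume op: "openin (top_of_set S2) e"
 have hm: "homeomorphism {0<..<1} e g (inv_into {0<..<1} g)" using open_arc_homeomorphism[OF g] .
 let ?f = "complex_of_real \<circ> inv_into {0<..<1} g"
 have "openin (top_of_set UNIV) (?f ` e)"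
 proof (rule invariance_of_domain_sphere_affine_set[where a="0::real^3" and r=1])
  show "continuous_on e ?f" using hm by (intro continuous_on_compose homeomorphism_cont2[OF hm] continuous_intros)
  show "inj_on ?f e" using hm by (auto simp: inj_on_def homeomorphism_def)
 qed (use op in \<open>auto simp: aff_dim_UNIV\<close>)
 then have "open (?f ` e)" by simp
 then have "?f ` e = {}" by (rule not_open_real_in_complex) auto
 moreover have "g (1/2) \<in> e" using g(3) by force
 ultimately show False by auto
qed

text \<open>
  A map with matching parametrisations: \<open>g e\<close> of the edge \<open>e\<close>, and \<open>h F\<close> of the
  face \<open>F\<close> by a disc with \<open>n F\<close> sides, the \<open>i\<close>-th of which runs along the edge
  \<open>es F i\<close>, in the direction of \<open>g\<close> if \<open>dr F i\<close>. As face and edge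
  parametrisations agree on the boundary, a motion of the discs that permutes sides induces a map on the sphere.
\<close>

locale polygonal_map =
 fixes V :: "(real^3) set" and E :: "(real^3) set set" and Fs :: "(real^3) set set"
  and g :: "(real^3) set => real => real^3"
  and n :: "(real^3) set => nat"
  and h :: "(real^3) set => complex => real^3"
  and es :: "(real^3) set => nat => (real^3) set"
  and dr :: "(real^3) set => nat => bool"
 assumes finV: "finite V" and finE: "finite E" and finF: "finite Fs"
  and cover: "V \<union> \<Union>E \<union> \<Union>Fs = S2"
  and VE: "V \<inter> \<Union>E = {}" and VF: "V \<inter> \<Union>Fs = {}" and EF: "\<Union>E \<inter> \<Union>Fs = {}"
  and disjE: "pairwise disjnt E" and disjF: "pairwise disjnt Fs"
  and g_cont: "\<And>e. e \<in> E ==> continuous_on {0..1} (g e)"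
  and g_inj: "\<And>e. e \<in> E ==> inj_on (g e) {0<..<1}"
  and g_im: "\<And>e. e \<in> E ==> g e ` {0<..<1} = e"
  and g_ends: "\<And>e. e \<in> E ==> g e 0 \<in> V \<and> g e 1 \<in> V"
  and n_pos: "\<And>F. F \<in> Fs ==> 0 < n F"
  and h_cont: "\<And>F. F \<in> Fs ==> continuous_on (cball 0 1) (h F)"
  and h_inj: "\<And>F. F \<in> Fs ==> inj_on (h F) (ball 0 1)"
  and h_im: "\<And>F. F \<in> Fs ==> h F ` ball 0 1 = F"
  and es_E: "\<And>F i. F \<in> Fs ==> i < n F ==> es F i \<in> E"
  and h_side: "\<And>F i t. F \<in> Fs ==> i < n F ==> 0 \<le> t ==> t \<le> 1 ==>
    h F (pt (n F) (real i + t)) = g (es F i) (if dr F i then t else 1 - t)"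
  and connG: "connected (V \<union> \<Union>E)"
  and Fs_ne: "Fs \<noteq> {}"
begin

lemma V_S2: "V \<subseteq> S2" and E_S2: "e \<in> E ==> e \<subseteq> S2" and F_S2: "F \<in> Fs ==> F \<subseteq> S2"
 using cover by auto

lemma E_eq: "e \<in> E ==> e' \<in> E ==> x \<in> e ==> x \<in> e' ==> e = e'"
 using disjE by (auto simp: pairwise_def disjnt_iff)

lemma F_eq: "F \<in> Fs ==> G \<in> Fs ==> x \<in> F ==> x \<in> G ==> F = G"
 using disjF by (auto simp: pairwise_def disjnt_iff)

lemma x_VE: "x \<in> V ==> e \<in> E ==> x \<notin> e" using VE by blast
lemma x_VF: "x \<in> V ==> F \<in> Fs ==> x \<notin> F" using VF by blast
lemma x_EF: "x \<in> e ==> e \<in> E ==> F \<in> Fs ==> x \<notin> F" using EF by blast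

lemma S2_cases:
 assumes "x \<in> S2"
 obtains (V) "x \<in> V" | (E) e where "e \<in> E" "x \<in> e" | (F) F where "F \<in> Fs" "x \<in> F"
 using assms unfolding cover[symmetric] by blast

lemma g_mem: "e \<in> E ==> 0 < t ==> t < 1 ==> g e t \<in> e" using g_im by force

lemma E_nonempty: "e \<in> E ==> e \<noteq> {}" using g_mem[of e "1/2"] by auto

lemma E_connected: "e \<in> E ==> connected e"
 by (metis connected_continuous_image continuous_on_subset g_cont g_im connected_Ioo greaterThanLessThan_subseteq_atLeastAtMost_iff order_refl)

lemma closed_edge_compact: "e \<in> E ==> compact (g e ` {0..1})"
 by (simp add: compact_continuous_image g_cont)

lemma closed_edge_eq: assumes "e \<in> E" shows "g e ` {0..1} = insert (g e 0) (insert (g e 1) e)"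
proof -
 have "{0..1} = insert 0 (insert 1 {0<..<1::real})" by auto
 then show ?thesis using g_im[OF assms] by auto
qed

lemma closure_edge: assumes "e \<in> E" shows "closure e = g e ` {0..1}"
proof
 have "closed (g e ` {0..1})" using closed_edge_compact[OF assms] compact_imp_closed by blast
 then show "closure e \<subseteq> g e ` {0..1}" by (metis assms closed_edge_eq closure_minimal subset_insertI2 subset_insertI)
 have "g e ` closure {0<..<1} \<subseteq> closure (g e ` {0<..<1})"
  by (rule image_closure_subset[OF _ closed_closure closure_subset]) (use g_cont[OF assms] in simp)
 then show "g e ` {0..1} \<subseteq> closure e" using g_im[OF assms] by simp
qed

lemma h_ball: "F \<in> Fs ==> norm z < 1 ==> h F z \<in> F" using h_im by force

lemma h_corner: "F \<in> Fs ==> i < n F ==> h F (pt (n F) (real i)) \<in> V"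
 using h_side[of F i 0] g_ends[of "es F i"] es_E by auto

lemma h_open_side: "F \<in> Fs ==> i < n F ==> 0 < t ==> t < 1 ==> h F (pt (n F) (real i + t)) \<in> es F i"
 using h_side[of F i t] g_mem[of "es F i"] es_E by auto

lemma cball_cases:
 assumes "F \<in> Fs" "z \<in> cball 0 1"
 obtains (inside) "norm z < 1" "h F z \<in> F"
 | (side) i t where "i < n F" "0 < t" "t < 1" "z = pt (n F) (real i + t)" "h F z \<in> es F i"
 | (corner) i where "i < n F" "z = pt (n F) (real i)" "h F z \<in> V"
proof (cases "norm z < 1")
 case True then show ?thesis using inside h_ball assms by blast
next
 case False
 then have "norm z = 1" using assms by simp
 then obtain i t where it: "i < n F" "0 \<le> t" "t < 1" "z = pt (n F) (real i + t)"
  using sphere_pt_cases n_pos[OF assms(1)] by blast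
 show ?thesis
 proof (cases "t = 0")
  case True then show ?thesis using corner[of i] it h_corner[OF assms(1) it(1)] by simp
 next
  case False then show ?thesis using side[of i t] it h_open_side[OF assms(1) it(1), of t] by simp
 qed
qed

lemma h_in_edge:
 assumes "F \<in> Fs" "z \<in> cball 0 1" "e \<in> E" "h F z \<in> e"
 obtains i t where "i < n F" "0 < t" "t < 1" "z = pt (n F) (real i + t)" "es F i = e"
 using assms(1,2)
proof (cases rule: cball_cases)
 case inside then show ?thesis using assms EF by blast
next
 case (side i t) then show ?thesis using that assms es_E E_eq by blast
next
 case corner then show ?thesis using assms VE by blast
qed

lemma h_in_face:
 assumes "F \<in> Fs" "z \<in> cball 0 1" "G \<in> Fs" "h F z \<in> G" shows "norm z < 1 \<and> G = F"
 using assms(1,2) by (cases rule: cball_cases) (metis F_eq assms, metis x_EF es_E assms, metis x_VF assms)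

lemma h_in_V: assumes "F \<in> Fs" "z \<in> cball 0 1" "h F z \<in> V" obtains i where "i < n F" "z = pt (n F) (real i)"
 using assms(1,2) by (cases rule: cball_cases) (metis x_VF assms, metis x_VE es_E assms, use that in blast)

lemma closed_face_compact: "F \<in> Fs ==> compact (h F ` cball 0 1)"
 by (simp add: compact_continuous_image h_cont)

lemma closure_face: assumes "F \<in> Fs" shows "closure F = h F ` cball 0 1"
proof
 have "closed (h F ` cball 0 1)" using closed_face_compact[OF assms] compact_imp_closed by blast
 moreover have "F \<subseteq> h F ` cball 0 1" using h_im[OF assms] by force
 ultimately show "closure F \<subseteq> h F ` cball 0 1" by (rule closure_minimal[rotated])
 have "h F ` closure (ball 0 1) \<subseteq> closure (h F ` ball 0 1)"
  by (rule image_closure_subset[OF _ closed_closure closure_subset]) (use h_cont[OF assms] in simp)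
 then show "h F ` cball 0 1 \<subseteq> closure F" using h_im[OF assms] by simp
qed

lemma F_connected: assumes "F \<in> Fs" shows "connected F"
 by (metis assms ball_subset_cball connected_ball connected_continuous_image continuous_on_subset h_cont h_im)

lemma F_nonempty: "F \<in> Fs ==> F \<noteq> {}" using h_ball[of F 0] by auto

lemma F_open: assumes "F \<in> Fs" shows "openin (top_of_set S2) F"
 using invariance_of_domain_S2[of "ball 0 1" "h F"] h_cont[OF assms] h_inj[OF assms] h_im[OF assms] F_S2[OF assms]
 by (metis ball_subset_cball continuous_on_subset open_ball)

lemma V_nonempty: "V \<noteq> {}"
 using Fs_ne h_corner n_pos by blast

definition sides_of :: "(real^3) set => ((real^3) set \<times> nat) set"
 where "sides_of e = {(F, i). F \<in> Fs \<and> i < n F \<and> es F i = e}"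

lemma edge_in_closure_iff:
 assumes "F \<in> Fs" "e \<in> E" shows "e \<subseteq> closure F \<longleftrightarrow> (\<exists>i. (F, i) \<in> sides_of e)"
proof
 assume "e \<subseteq> closure F"
 then have "g e (1/2) \<in> h F ` cball 0 1" using closure_face assms g_mem[of e "1/2"] by auto
 moreover have "g e (1/2) \<in> e" using g_mem[OF assms(2)] by simp
 ultimately obtain z where "z \<in> cball 0 1" "h F z \<in> e" by auto
 then obtain i where "i < n F" "es F i = e" using h_in_edge[OF assms(1) _ assms(2)] by blast
 then show "\<exists>i. (F, i) \<in> sides_of e" using assms by (auto simp: sides_of_def)
next
 assume "\<exists>i. (F, i) \<in> sides_of e"
 then obtain i where i: "i < n F" "es F i = e" by (auto simp: sides_of_def)
 show "e \<subseteq> closure F"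
 proof
  fix x assume "x \<in> e"
  then obtain u where u: "0 < u" "u < 1" "x = g e u" using g_im[OF assms(2)] by (metis greaterThanLessThan_iff imageE)
  then have "x = h F (pt (n F) (real i + (if dr F i then u else 1 - u)))" using h_side[of F i "if dr F i then u else 1 - u"] assms i by auto
  then show "x \<in> closure F" using closure_face[OF assms(1)] by auto
 qed
qed

lemma edge_not_in_closure:
 assumes "F \<in> Fs" "e \<in> E" "\<And>i. (F, i) \<notin> sides_of e" shows "e \<inter> closure F = {}"
proof (rule ccontr)
 assume "e \<inter> closure F \<noteq> {}"
 then obtain z where "z \<in> cball 0 1" "h F z \<in> e" using closure_face assms by auto
 then obtain i where "i < n F" "es F i = e" using h_in_edge[OF assms(1) _ assms(2)] by blast
 then show False using assms by (auto simp: sides_of_def)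
qed

lemma closed_V_edges: "closed (V \<union> \<Union>D)" if "D \<subseteq> E" for D
proof -
 have "V \<union> g e ` {0..1} = V \<union> e" if "e \<in> D" for e
  by (subst closed_edge_eq) (use g_ends[of e] that \<open>D \<subseteq> E\<close> in auto)
 then have "V \<union> \<Union>D = V \<union> (\<Union>e\<in>D. g e ` {0..1})" by blast
 moreover have "compact (V \<union> (\<Union>e\<in>D. g e ` {0..1}))"
  using finite_subset[OF that finE] finV closed_edge_compact that by (intro compact_Un compact_UN) (auto intro: finite_imp_compact)
 ultimately show ?thesis by (metis compact_imp_closed)
qed

text \<open>
  The complement is a finite union of closed cells.
\<close>

lemma edge_star_open:
 assumes e: "e \<in> E"
 shows "openin (top_of_set S2) (e \<union> \<Union>(fst ` sides_of e))"
proof -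
 let ?H = "Fs - fst ` sides_of e"
 have "closed ((V \<union> \<Union>(E - {e})) \<union> \<Union>(closure ` ?H))" using finF by (intro closed_Un closed_V_edges closed_Union) auto
 moreover have "e \<union> \<Union>(fst ` sides_of e) = S2 - ((V \<union> \<Union>(E - {e})) \<union> \<Union>(closure ` ?H))"
 proof (intro set_eqI iffI)
  fix x assume x: "x \<in> S2 - ((V \<union> \<Union>(E - {e})) \<union> \<Union>(closure ` ?H))"
  then have "x \<in> S2" by blast
  then show "x \<in> e \<union> \<Union>(fst ` sides_of e)"
  proof (cases rule: S2_cases)
   case (F F) then have "F \<notin> ?H" using x closure_subset[of F] by blast
   then show ?thesis using F by blast
  qed (use x in blast)+
 next
  fix x assume x: "x \<in> e \<union> \<Union>(fst ` sides_of e)"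
  have sf: "fst ` sides_of e \<subseteq> Fs" by (auto simp: sides_of_def)
  have "x \<in> S2" using x e cover sf by blast
  moreover have "x \<notin> V" using x e VE VF sf by blast
  moreover have "x \<notin> d" if "d \<in> E - {e}" for d using x e E_eq[of d e x] that EF sf by blast
  moreover have "x \<notin> closure H" if H: "H \<in> ?H" for H
  proof
   assume xH: "x \<in> closure H"
   have "(H, i) \<notin> sides_of e" for i using H by force
   then have "x \<notin> e" using edge_not_in_closure[of H e] H e xH by blast
   then obtain F where F: "F \<in> fst ` sides_of e" "x \<in> F" using x by blast
   obtain z where z: "z \<in> cball 0 1" "x = h H z" using xH closure_face H by auto
   then have "F = H" using h_in_face[of H z F] H F sf by blast
   then show False using F H by blast
  qed
  ultimately show "x \<in> S2 - ((V \<union> \<Union>(E - {e})) \<union> \<Union>(closure ` ?H))" by blast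
 qed
 ultimately show ?thesis by (metis Diff_eq openin_open open_Compl)
qed

lemma edge_not_open: assumes e: "e \<in> E" shows "\<not> openin (top_of_set S2) e"
 using open_arc_not_openin_S2[of "g e" e] e g_cont g_inj g_im x_VE g_ends by blast

lemma side_exists: assumes e: "e \<in> E" shows "sides_of e \<noteq> {}"
 using edge_star_open[OF e] edge_not_open[OF e] by auto

lemma h_homeomorphism_sides:
 assumes F: "F \<in> Fs" and D: "\<And>i. i < n F ==> es F i \<in> D ==> i \<in> I" "\<And>i. i \<in> I ==> i < n F \<and> es F i \<in> D" "D \<subseteq> E"
  and inj: "inj_on (es F) I" and DI: "D = es F ` I"
 shows "\<exists>k. homeomorphism (ball 0 1 \<union> (\<Union>i\<in>I. side (n F) i)) (F \<union> \<Union>D) (h F) k"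
proof -
 let ?A = "ball 0 1 \<union> (\<Union>i\<in>I. side (n F) i)"
 have im: "h F ` ?A = F \<union> \<Union>D"
 proof
  show "h F ` ?A \<subseteq> F \<union> \<Union>D" 
  proof
   fix x assume "x \<in> h F ` ?A"
   then consider z where "norm z < 1" "x = h F z" | i t where "i \<in> I" "0 < t" "t < 1" "x = h F (pt (n F) (real i + t))"
    by (auto simp: side_pt)
   then show "x \<in> F \<union> \<Union>D"
    by cases (use h_ball[OF F] h_open_side[OF F] D(2) in blast)+
  qed
  show "F \<union> \<Union>D \<subseteq> h F ` ?A"
  proof
   fix x assume "x \<in> F \<union> \<Union>D"
   then consider "x \<in> F" | i where "i \<in> I" "x \<in> es F i" using DI by blast
   then show "x \<in> h F ` ?A"
   proof cases
    case 1 then show ?thesis using h_im[OF F] by blast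
   next
    case 2
    then have i: "i < n F" "es F i \<in> E" using D(2,3) by auto
    obtain u where u: "0 < u" "u < 1" "x = g (es F i) u" using g_im[OF i(2)] 2 by (metis greaterThanLessThan_iff imageE)
    let ?t = "if dr F i then u else 1 - u"
    have "x = h F (pt (n F) (real i + ?t))" using h_side[of F i ?t] F i u by auto
    moreover have "pt (n F) (real i + ?t) \<in> side (n F) i" using u by (auto simp: side_pt)
    ultimately show ?thesis using 2 by blast
   qed
  qed
 qed
 have A: "?A = cball 0 1 \<inter> h F -` (F \<union> \<Union>D)"
 proof
  have "?A \<subseteq> cball 0 1" by (auto simp: side_pt)
  then show "?A \<subseteq> cball 0 1 \<inter> h F -` (F \<union> \<Union>D)" using im by blast
  show "cball 0 1 \<inter> h F -` (F \<union> \<Union>D) \<subseteq> ?A"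
  proof
   fix z assume "z \<in> cball 0 1 \<inter> h F -` (F \<union> \<Union>D)"
   then have z: "z \<in> cball 0 1" "h F z \<in> F \<union> \<Union>D" by auto
   show "z \<in> ?A"
   proof (cases "h F z \<in> F")
    case True then show ?thesis using h_in_face[OF F z(1) F] by simp
   next
    case False
    then obtain d where d: "d \<in> D" "h F z \<in> d" using z by blast
    then obtain i t where "i < n F" "0 < t" "t < 1" "z = pt (n F) (real i + t)" "es F i = d"
     using h_in_edge[OF F z(1), of d] D(3) by (metis subsetD)
    moreover from this have "z \<in> side (n F) i" by (auto simp: side_pt)
    ultimately show ?thesis using d D(1) by blast
   qed
  qed
 qed
 have "inj_on (h F) ?A"
 proof (rule inj_onI)
  fix z w assume zw: "z \<in> ?A" "w \<in> ?A" "h F z = h F w"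
  have c: "z \<in> cball 0 1" "w \<in> cball 0 1" using zw A by blast+
  show "z = w"
  proof (cases "norm z < 1")
   case True
   then have "norm w < 1" using h_in_face[OF F c(2) F] h_ball[OF F True] zw(3) by simp
   then show ?thesis using True zw h_inj[OF F] by (auto dest: inj_onD)
  next
   case False
   then obtain i t where i: "i \<in> I" "0 < t" "t < 1" "z = pt (n F) (real i + t)" using zw(1) by (auto simp: side_pt)
   have inn: "i < n F" using i D by blast
   have "norm w \<noteq> 1 ==> False" using h_in_face[OF F c(1) F] h_ball[OF F, of w] c(2) zw(3) False by force
   then obtain j u where j: "j \<in> I" "0 < u" "u < 1" "w = pt (n F) (real j + u)" using zw(2) by (auto simp: side_pt)
   have jnn: "j < n F" using j D by blast
   have mem: "h F z \<in> es F i" "h F z \<in> es F j" 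
    using h_open_side[OF F inn i(2,3)] h_open_side[OF F jnn j(2,3)] i(4) j(4) zw(3) by simp_all
   then have "es F i = es F j" using E_eq es_E[OF F] inn jnn by blast
   then have ij: "i = j" using inj i j by (auto dest: inj_onD)
   let ?t = "if dr F i then t else 1 - t" and ?u = "if dr F i then u else 1 - u"
   have "g (es F i) ?t = g (es F i) ?u" using h_side[OF F inn, of t] h_side[OF F inn, of u] i j ij zw by simp
   then have "?t = ?u" by (rule inj_onD[OF g_inj[OF es_E[OF F inn]]]) (use i j in auto)
   then have "t = u" by (cases "dr F i") simp_all
   then show ?thesis using i j ij by simp
  qed
 qed
 then show ?thesis using homeomorphism_saturated[OF compact_cball h_cont[OF F] _ A im] by blast
qed

text \<open>
  Otherwise \<open>F \<union> e\<close> would be open in the sphere and homeomorphic to an open disc with one open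
  boundary arc, against invariance of domain.
\<close>

lemma two_sides_exist:
 assumes e: "e \<in> E" and s: "(F, i) \<in> sides_of e"
 shows "\<exists>s \<in> sides_of e. s \<noteq> (F, i)"
proof (rule ccontr)
 assume "\<not> ?thesis"
 then have only: "sides_of e = {(F, i)}" using s by blast
 have F: "F \<in> Fs" and i: "i < n F" "es F i = e" using s by (auto simp: sides_of_def)
 have op: "openin (top_of_set S2) (F \<union> e)" using edge_star_open[OF e] only by (simp add: Un_commute)
 have "\<exists>k. homeomorphism (ball 0 1 \<union> (\<Union>i\<in>{i}. side (n F) i)) (F \<union> \<Union>{e}) (h F) k"
  by (rule h_homeomorphism_sides[OF F]) (use only i e F in \<open>auto simp: sides_of_def\<close>)
 then obtain k where k: "homeomorphism (ball 0 1 \<union> side (n F) i) (F \<union> e) (h F) k" by auto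
 have "openin (top_of_set UNIV) (k ` (F \<union> e))"
 proof (rule invariance_of_domain_sphere_affine_set[where a="0::real^3" and r=1])
  show "continuous_on (F \<union> e) k" using homeomorphism_cont2[OF k] .
  show "inj_on k (F \<union> e)" using k by (metis homeomorphism_def inj_on_inverseI)
 qed (use op in \<open>auto simp: aff_dim_UNIV\<close>)
 then have "open (ball 0 1 \<union> side (n F) i)" using k by (simp add: homeomorphism_def)
 moreover have "ball 0 1 \<union> side (n F) i \<subseteq> cball 0 1" by (auto simp: side_pt)
 ultimately have "ball 0 1 \<union> side (n F) i \<subseteq> ball 0 1" using interior_maximal interior_cball by metis
 moreover have "pt (n F) (real i + 1/2) \<in> side (n F) i" by (auto simp: side_pt)
 ultimately have "pt (n F) (real i + 1/2) \<in> ball 0 1" by blast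
 then show False by simp
qed

text \<open>Polar coordinates next to a side.\<close>

definition strip :: "(real^3) set => nat => real => real => real^3"
 where "strip F i t y = h F ((1 - y) *\<^sub>R pt (n F) (real i + t))"

lemma strip_0: "F \<in> Fs ==> i < n F ==> 0 \<le> t ==> t \<le> 1 ==> strip F i t 0 = g (es F i) (if dr F i then t else 1 - t)"
 by (simp add: strip_def h_side)

lemma strip_edge: "F \<in> Fs ==> i < n F ==> 0 < t ==> t < 1 ==> strip F i t 0 \<in> es F i"
 by (simp add: strip_def h_open_side)

lemma strip_face: "F \<in> Fs ==> 0 < y ==> y \<le> 1 ==> strip F i t y \<in> F"
 unfolding strip_def by (rule h_ball) auto

lemma strip_inj:
 assumes "F \<in> Fs" "G \<in> Fs" "i < n F" "j < n G" "0 \<le> t" "t < 1" "0 \<le> u" "u < 1"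
  "0 < y" "y < 1" "0 < x" "x < 1" "strip F i t y = strip G j u x"
 shows "F = G \<and> i = j \<and> t = u \<and> y = x"
proof -
 have FG: "F = G" using assms strip_face[of F y i t] strip_face[of G x j u] F_eq by force
 have "(1 - y) *\<^sub>R pt (n F) (real i + t) = (1 - x) *\<^sub>R pt (n F) (real j + u)"
  using assms(9-13) FG h_inj[OF assms(1)] unfolding strip_def by (auto dest!: inj_onD)
 moreover from this have "norm ((1 - y) *\<^sub>R pt (n F) (real i + t)) = norm ((1 - x) *\<^sub>R pt (n F) (real j + u))" by simp
 then have "y = x" using assms by simp
 ultimately have "pt (n F) (real i + t) = pt (n F) (real j + u)" using assms by simp
 then show ?thesis using pt_inj[of i "n F" j t u] assms FG \<open>y = x\<close> by simp
qed

lemma strip_cont: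
 assumes "F \<in> Fs" "continuous_on S a" "continuous_on S b" "\<And>x. x \<in> S ==> 0 \<le> b x \<and> b x \<le> 1"
 shows "continuous_on S (\<lambda>x. strip F i (a x) (b x))"
 unfolding strip_def
 by (rule continuous_on_compose2[OF h_cont[OF assms(1)]]) (use assms in \<open>auto intro!: continuous_intros\<close>)

text \<open>
  Two strips glued along the common edge, one on either side of the real axis; the second one is reversed if the two
  sides traverse the edge in opposite directions.
\<close>

definition collar :: "(real^3) set => nat => (real^3) set => nat => complex => real^3"
 where "collar F i G j w =
  (if 0 \<le> Im w then strip F i (Re w) (Im w)
   else strip G j (if dr F i = dr G j then Re w else 1 - Re w) (- Im w))"

definition collar_dom :: "complex set"
 where "collar_dom = {w. 0 < Re w \<and> Re w < 1 \<and> -1 < Im w \<and> Im w < 1}"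

lemma open_collar_dom: "open collar_dom"
 unfolding collar_dom_def by (intro open_Collect_conj open_Collect_less continuous_intros)

lemma collar_at_edge:
 assumes "(F, i) \<in> sides_of e" "(G, j) \<in> sides_of e" "0 \<le> t" "t \<le> 1"
 shows "strip F i t 0 = strip G j (if dr F i = dr G j then t else 1 - t) 0"
 using assms strip_0[of F i t] strip_0[of G j "if dr F i = dr G j then t else 1 - t"] by (auto simp: sides_of_def)

lemma collar_cont:
 assumes s: "(F, i) \<in> sides_of e" "(G, j) \<in> sides_of e"
 shows "continuous_on collar_dom (collar F i G j)"
proof -
 have FG: "F \<in> Fs" "G \<in> Fs" using s by (auto simp: sides_of_def)
 have "continuous_on ({w \<in> collar_dom. 0 \<le> Im w} \<union> {w \<in> collar_dom. Im w \<le> 0}) (collar F i G j)"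
  unfolding collar_def
 proof (rule continuous_on_cases_local)
  show "closedin (top_of_set ({w \<in> collar_dom. 0 \<le> Im w} \<union> {w \<in> collar_dom. Im w \<le> 0})) {w \<in> collar_dom. 0 \<le> Im w}"
   unfolding closedin_closed by (intro exI[of _ "{w. 0 \<le> Im w}"]) (auto intro!: closed_Collect_le continuous_intros)
  show "closedin (top_of_set ({w \<in> collar_dom. 0 \<le> Im w} \<union> {w \<in> collar_dom. Im w \<le> 0})) {w \<in> collar_dom. Im w \<le> 0}"
   unfolding closedin_closed by (intro exI[of _ "{w. Im w \<le> 0}"]) (auto intro!: closed_Collect_le continuous_intros)
  show "continuous_on {w \<in> collar_dom. 0 \<le> Im w} (\<lambda>w. strip F i (Re w) (Im w))"
   by (rule strip_cont) (use FG in \<open>auto simp: collar_dom_def intro!: continuous_intros\<close>)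
  have "continuous_on {w \<in> collar_dom. Im w \<le> 0} (\<lambda>w. if dr F i = dr G j then Re w else 1 - Re w)"
   by (cases "dr F i = dr G j") (auto intro!: continuous_intros)
  then show "continuous_on {w \<in> collar_dom. Im w \<le> 0} (\<lambda>w. strip G j (if dr F i = dr G j then Re w else 1 - Re w) (- Im w))"
   by (rule strip_cont[OF FG(2)]) (auto simp: collar_dom_def intro!: continuous_intros)
  show "strip F i (Re w) (Im w) = strip G j (if dr F i = dr G j then Re w else 1 - Re w) (- Im w)"
   if "w \<in> {w \<in> collar_dom. 0 \<le> Im w} \<and> \<not> 0 \<le> Im w \<or> w \<in> {w \<in> collar_dom. Im w \<le> 0} \<and> 0 \<le> Im w" for w
   using collar_at_edge[OF s, of "Re w"] that by (auto simp: collar_dom_def)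
 qed
 moreover have "{w \<in> collar_dom. 0 \<le> Im w} \<union> {w \<in> collar_dom. Im w \<le> 0} = collar_dom" by auto
 ultimately show ?thesis by simp
qed

lemma collar_inj:
 assumes s: "(F, i) \<in> sides_of e" "(G, j) \<in> sides_of e" "(F, i) \<noteq> (G, j)"
 shows "inj_on (collar F i G j) collar_dom"
proof (rule inj_onI)
 fix v w assume vw: "v \<in> collar_dom" "w \<in> collar_dom" "collar F i G j v = collar F i G j w"
 have FG: "F \<in> Fs" "G \<in> Fs" "i < n F" "j < n G" "es F i = e" "es G j = e" "e \<in> E" using s es_E by (auto simp: sides_of_def)
 have bounds: "0 < Re v" "Re v < 1" "0 < Re w" "Re w < 1" "-1 < Im v" "Im v < 1" "-1 < Im w" "Im w < 1"
  using vw by (auto simp: collar_dom_def)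
 have inE: "collar F i G j u \<in> e \<longleftrightarrow> Im u = 0" if "u \<in> collar_dom" for u
 proof -
  consider "Im u = 0" | "Im u > 0" | "Im u < 0" by linarith
  then show ?thesis
  proof cases
   case 1 then show ?thesis using strip_edge[of F i "Re u"] FG that by (auto simp: collar_def collar_dom_def)
  next
   case 2 then show ?thesis using strip_face[of F "Im u" i "Re u"] FG EF that by (auto simp: collar_def collar_dom_def)
  next
   case 3
   then have "collar F i G j u \<in> G" using strip_face[of G "- Im u" j] FG that by (auto simp: collar_def collar_dom_def)
   then show ?thesis using 3 x_EF FG by auto
  qed
 qed
 consider "Im v = 0" | "Im v > 0" "Im w > 0" | "Im v > 0" "Im w < 0" | "Im v < 0" "Im w > 0" | "Im v < 0" "Im w < 0"
  using inE[OF vw(1)] inE[OF vw(2)] vw(3) by fastforce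
 then show "v = w"
 proof cases
  case 1
  then have "Im w = 0" using inE[OF vw(1)] inE[OF vw(2)] vw(3) by simp
  then have "g e (if dr F i then Re v else 1 - Re v) = g e (if dr F i then Re w else 1 - Re w)"
   using 1 vw(3) strip_0[of F i "Re v"] strip_0[of F i "Re w"] FG bounds by (simp add: collar_def)
  then have "(if dr F i then Re v else 1 - Re v) = (if dr F i then Re w else 1 - Re w)"
   by (rule inj_onD[OF g_inj[OF FG(7)]]) (use bounds in auto)
  then have "Re v = Re w" by (cases "dr F i") auto
  then show ?thesis using 1 \<open>Im w = 0\<close> by (simp add: complex_eq_iff)
 next
  case 2 then show ?thesis using vw(3) strip_inj[of F F i i "Re v" "Re w" "Im v" "Im w"] FG bounds by (simp add: collar_def complex_eq_iff)
 next
  case 3 then show ?thesis using vw(3) strip_inj[of F G i j "Re v" "if dr F i = dr G j then Re w else 1 - Re w" "Im v" "- Im w"] FG bounds s(3)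
   by (auto simp: collar_def split: if_splits)
 next
  case 4 then show ?thesis using vw(3) strip_inj[of F G i j "Re w" "if dr F i = dr G j then Re v else 1 - Re v" "Im w" "- Im v"] FG bounds s(3)
   by (auto simp: collar_def split: if_splits)
 next
  case 5
  then have "strip G j (if dr F i = dr G j then Re v else 1 - Re v) (- Im v) = strip G j (if dr F i = dr G j then Re w else 1 - Re w) (- Im w)"
   using vw(3) by (simp add: collar_def)
  then have "(if dr F i = dr G j then Re v else 1 - Re v) = (if dr F i = dr G j then Re w else 1 - Re w) \<and> - Im v = - Im w"
   using strip_inj[of G G j j "if dr F i = dr G j then Re v else 1 - Re v" "if dr F i = dr G j then Re w else 1 - Re w" "- Im v" "- Im w"] FG bounds 5 by auto
  then show ?thesis by (auto simp: complex_eq_iff split: if_splits)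
 qed
qed

lemma collar_S2:
 assumes "(F, i) \<in> sides_of e" "(G, j) \<in> sides_of e" "w \<in> collar_dom"
 shows "collar F i G j w \<in> F \<union> e \<union> G"
proof -
 have FG: "F \<in> Fs" "G \<in> Fs" "i < n F" "j < n G" "es F i = e" "es G j = e" using assms by (auto simp: sides_of_def)
 consider "Im w = 0" | "Im w > 0" | "Im w < 0" by linarith
 then show ?thesis
  by cases (use assms(3) FG strip_edge[of F i "Re w"] strip_face[of F "Im w" i "Re w"] strip_face[of G "- Im w" j] in \<open>auto simp: collar_def collar_dom_def\<close>)
qed

lemma collar_open:
 assumes s: "(F, i) \<in> sides_of e" "(G, j) \<in> sides_of e" "(F, i) \<noteq> (G, j)" and U: "open U" "U \<subseteq> collar_dom"
 shows "openin (top_of_set S2) (collar F i G j ` U)"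
proof (rule invariance_of_domain_S2[OF U(1)])
 have "F \<in> Fs \<and> G \<in> Fs \<and> e \<in> E" using s es_E by (auto simp: sides_of_def)
 then have "F \<subseteq> S2" "G \<subseteq> S2" "e \<subseteq> S2" using F_S2 E_S2 by auto
 then show "collar F i G j ` U \<subseteq> S2" using collar_S2[OF s(1,2)] U(2) by blast
qed (use U collar_cont[OF s(1,2)] collar_inj[OF s] continuous_on_subset inj_on_subset in blast)+

text \<open>
  The collar of two sides of \<open>e\<close> is open in the sphere by invariance of domain, hence contains all points
  near \<open>e\<close>; a third side has no room.
\<close>

theorem sides_of_card2:
 assumes e: "e \<in> E"
 shows "\<exists>a b. a \<noteq> b \<and> sides_of e = {a, b}"
proof -
 obtain F i where a: "(F, i) \<in> sides_of e" using side_exists[OF e] by auto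
 then obtain G j where b: "(G, j) \<in> sides_of e" "(F, i) \<noteq> (G, j)" using two_sides_exist[OF e a] by fastforce
 have "(H, k) = (F, i) \<or> (H, k) = (G, j)" if c: "(H, k) \<in> sides_of e" for H k
 proof (rule ccontr)
  assume ne: "\<not> ?thesis"
  have FG: "F \<in> Fs" "G \<in> Fs" "H \<in> Fs" "i < n F" "j < n G" "k < n H" "es H k = e" using a b c by (auto simp: sides_of_def)
  let ?U = "collar F i G j ` collar_dom"
  have op: "openin (top_of_set S2) ?U" using collar_open[OF a b open_collar_dom] by simp
  then obtain T where T: "open T" "?U = S2 \<inter> T" by (auto simp: openin_open)
  let ?t = "if dr H k = dr F i then 1/2 else 1 - 1/2 :: real"
  have "strip H k (1/2) 0 = collar F i G j (Complex (1/2) 0)"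
   using collar_at_edge[OF c a, of "1/2"] by (auto simp: collar_def)
  moreover have "Complex (1/2) 0 \<in> collar_dom" by (simp add: collar_dom_def)
  ultimately have x: "strip H k (1/2) 0 \<in> T" using T by blast
  have "continuous_on {0..1} (\<lambda>y. strip H k (1/2) y)"
   by (rule strip_cont[OF FG(3)]) (auto intro!: continuous_intros)
  then obtain A where A: "open A" "A \<inter> {0..1} = (\<lambda>y. strip H k (1/2) y) -` T \<inter> {0..1}"
   using T(1) unfolding continuous_on_open_invariant by blast
  have "0 \<in> (\<lambda>y. strip H k (1/2) y) -` T \<inter> {0..1}" using x by simp
  then have "0 \<in> A" unfolding A(2)[symmetric] by blast
  then obtain d where d: "d > 0" "ball 0 d \<subseteq> A" using A(1) open_contains_ball by blast
  define y where "y = min (d/2) (1/2)"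
  have y: "0 < y" "y < 1" "y \<in> ball 0 d" using d by (auto simp: y_def)
  then have "y \<in> A \<inter> {0..1}" using d(2) by auto
  then have "strip H k (1/2) y \<in> T" unfolding A(2) by blast
  moreover have yH: "strip H k (1/2) y \<in> H" using strip_face FG y by simp
  ultimately obtain w where w: "w \<in> collar_dom" "strip H k (1/2) y = collar F i G j w" using T(2) F_S2[OF FG(3)] by blast
  then have wb: "0 < Re w" "Re w < 1" "-1 < Im w" "Im w < 1" by (auto simp: collar_dom_def)
  have "Im w \<noteq> 0"
  proof
   assume "Im w = 0"
   then have "strip H k (1/2) y \<in> es F i" using w(2) strip_edge[of F i "Re w"] FG wb by (simp add: collar_def)
   then show False using yH EF FG es_E by blast
  qed
  then consider "Im w > 0" | "Im w < 0" by linarith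
  then show False
  proof cases
   case 1 then show ?thesis using strip_inj[of H F k i "1/2" "Re w" y "Im w"] w wb FG y ne by (auto simp: collar_def)
  next
   case 2 then show ?thesis
    using strip_inj[of H G k j "1/2" "if dr F i = dr G j then Re w else 1 - Re w" y "- Im w"] w wb FG y ne by (auto simp: collar_def split: if_splits)
  qed
 qed
 then show ?thesis using a b by (intro exI[of _ "(F, i)"] exI[of _ "(G, j)"]) auto
qed

end

section \<open>Spanning trees, cotrees and Euler's inequality\<close>

context polygonal_map
begin

inductive tree :: "(real^3) set => (real^3) set set => bool" where
 base: "v \<in> V ==> tree {v} {}"
| step: "tree W T ==> e \<in> E ==> {g e 0, g e 1} = {a, b} ==> a \<in> W ==> b \<notin> W ==> tree (insert b W) (insert e T)"

lemma tree_props: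
 assumes "tree W T"
 shows "W \<subseteq> V \<and> T \<subseteq> E \<and> (\<forall>e\<in>T. g e 0 \<in> W \<and> g e 1 \<in> W) \<and> card W = Suc (card T) \<and> connected (W \<union> \<Union>T)"
 using assms
proof induction
 case (step W T e a b)
 have "b \<in> V" using g_ends step.hyps by (metis insertCI insertE singletonD)
 have "e \<notin> T" using step by (metis insertCI insertE singletonD)
 have fin: "finite W" "finite T" using step finV finE finite_subset by blast+
 have "connected (g e ` {0..1})" using connected_continuous_image[OF g_cont[OF step.hyps(2)]] by simp
 moreover have "a \<in> g e ` {0..1}" using step.hyps(3) by (metis atLeastAtMost_iff image_eqI insertCI insertE order_refl singletonD zero_le_one)
 moreover have "connected (W \<union> \<Union>T)" "a \<in> W \<union> \<Union>T" using step by auto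
 ultimately have "connected ((W \<union> \<Union>T) \<union> g e ` {0..1})" by (intro connected_Un[of "W \<union> \<Union>T"]) blast+
 moreover have "(W \<union> \<Union>T) \<union> g e ` {0..1} = insert b W \<union> \<Union>(insert e T)"
  unfolding closed_edge_eq[OF step.hyps(2)] using step.hyps(3,4) by auto
 ultimately show ?case using step \<open>b \<in> V\<close> \<open>e \<notin> T\<close> fin by auto
qed (auto)

text \<open>
  The edge of \<open>B\<close> that was added last brought a new vertex, which lies on no other edge of
  \<open>B\<close>.
\<close>

lemma tree_leaf:
 assumes "tree W T" "B \<subseteq> T" "B \<noteq> {}"
 shows "\<exists>v e. e \<in> B \<and> v \<in> {g e 0, g e 1} \<and> g e 0 \<noteq> g e 1 \<and> (\<forall>e'\<in>B. v \<in> {g e' 0, g e' 1} \<longrightarrow> e' = e)"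
 using assms
proof (induction arbitrary: B)
 case (step W T e a b)
 show ?case
 proof (cases "e \<in> B")
  case True
  have "b \<in> {g e 0, g e 1}" "g e 0 \<noteq> g e 1" using step.hyps by (metis insertCI, metis doubleton_eq_iff)
  moreover have "e' = e" if "e' \<in> B" "b \<in> {g e' 0, g e' 1}" for e'
   using tree_props[OF step.hyps(1)] step.hyps(5) step.prems(1) that by auto
  ultimately show ?thesis using True by blast
 qed (use step in blast)
qed auto

lemma spanning_tree: obtains T where "tree V T"
proof -
 have "\<exists>W T. tree W T" using V_nonempty tree.base by blast
 then obtain W T where WT: "tree W T" and max: "\<And>W' T'. tree W' T' ==> card W' \<le> card W"
 proof -
  have "\<And>W T. tree W T ==> card W < Suc (card V)" using tree_props card_mono[OF finV] by (metis less_Suc_eq_le)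
  then have "\<exists>x. (case x of (W, T) => tree W T) \<and> (\<forall>y. (case y of (W, T) => tree W T) \<longrightarrow> card (fst y) \<le> card (fst x))"
   using \<open>\<exists>W T. tree W T\<close> by (elim exE, intro ex_has_greatest_nat[where b="Suc (card V)" and k="(_, _)"]) auto
  then show ?thesis using that by auto
 qed
 note props = tree_props[OF WT]
 have same: "g e 0 \<in> W \<longleftrightarrow> g e 1 \<in> W" if e: "e \<in> E" for e
 proof (rule ccontr)
  assume "\<not> ?thesis"
  then obtain a b where "{g e 0, g e 1} = {a, b}" "a \<in> W" "b \<notin> W" by blast
  then have "tree (insert b W) (insert e T)" using tree.step[OF WT e] by blast
  then have "card (insert b W) \<le> card W" using max by blast
  moreover have "finite W" using props finV finite_subset by blast
  ultimately show False using \<open>b \<notin> W\<close> by simp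
 qed
 have "W = V"
 proof (rule ccontr)
  assume ne: "W \<noteq> V"
  let ?D = "{e \<in> E. g e 0 \<in> W}"
  have cl: "closed (X \<union> \<Union>D)" if "X \<subseteq> V" "D \<subseteq> E" "\<And>e. e \<in> D ==> g e 0 \<in> X \<and> g e 1 \<in> X" for X D
  proof -
   have "X \<union> g e ` {0..1} = X \<union> e" if "e \<in> D" for e
    by (subst closed_edge_eq) (use that \<open>D \<subseteq> E\<close> \<open>\<And>e. e \<in> D ==> g e 0 \<in> X \<and> g e 1 \<in> X\<close> in auto)
   then have "X \<union> \<Union>D = X \<union> (\<Union>e\<in>D. g e ` {0..1})" by blast
   moreover have "compact (X \<union> (\<Union>e\<in>D. g e ` {0..1}))"
    using finite_subset[OF that(2) finE] finite_subset[OF that(1) finV] closed_edge_compact that(2)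
    by (intro compact_Un compact_UN) (auto intro: finite_imp_compact)
   ultimately show ?thesis by (metis compact_imp_closed)
  qed
  have c1: "closed (W \<union> \<Union>?D)" using same props by (intro cl) auto
  have c2: "closed ((V - W) \<union> \<Union>(E - ?D))" using same g_ends by (intro cl) auto
  have un: "(W \<union> \<Union>?D) \<union> ((V - W) \<union> \<Union>(E - ?D)) = V \<union> \<Union>E" using props by blast
  have "(W \<union> \<Union>?D) \<inter> ((V - W) \<union> \<Union>(E - ?D)) = {}"
  proof -
   have "x \<notin> W \<union> \<Union>?D" if x: "x \<in> (V - W) \<union> \<Union>(E - ?D)" for x
    using x
   proof
    assume "x \<in> V - W" then show ?thesis using x_VE by blast
   next
    assume "x \<in> \<Union>(E - ?D)"
    then obtain e where e: "e \<in> E" "e \<notin> ?D" "x \<in> e" by blast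
    then have "x \<notin> W" using x_VE props by blast
    moreover have "x \<notin> \<Union>?D" using e E_eq by blast
    ultimately show ?thesis by blast
   qed
   then show ?thesis by blast
  qed
  moreover have "W \<noteq> {}" using props by force
  moreover have "V - W \<noteq> {}" using ne props by blast
  moreover define X Y where "X = W \<union> \<Union>?D" and "Y = (V - W) \<union> \<Union>(E - ?D)"
  ultimately have "closed X" "closed Y" "X \<union> Y = V \<union> \<Union>E" "X \<inter> Y = {}" "X \<noteq> {}" "Y \<noteq> {}"
   using c1 c2 un by auto
  moreover from this have "X \<inter> (V \<union> \<Union>E) = {} \<or> Y \<inter> (V \<union> \<Union>E) = {}"
   by (intro connected_closedD[OF connG]) auto
  ultimately show False by auto
 qed
 then show ?thesis using WT that by blast
qed

inductive cotree :: "(real^3) set set => (real^3) set set => (real^3) set set => bool" for D where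
 base: "F \<in> Fs ==> cotree D {F} {}"
| step: "cotree D C S ==> e \<in> D ==> e \<in> E ==> sides_of e = {(F, i), (G, j)} ==> F \<in> C ==> G \<notin> C ==> cotree D (insert G C) (insert e S)"

lemma cotree_props:
 assumes "cotree D C S"
 shows "C \<subseteq> Fs \<and> S \<subseteq> D \<and> S \<subseteq> E \<and> C \<noteq> {} \<and> (\<forall>e\<in>S. \<forall>(F, i)\<in>sides_of e. F \<in> C) \<and> connected (\<Union>C \<union> \<Union>S)"
 using assms
proof induction
 case (base F) then show ?case using F_connected by auto
next
 case (step C S e F i G j)
 have FG: "F \<in> Fs" "G \<in> Fs" using step.hyps(4) by (auto simp: sides_of_def)
 have star: "connected (F \<union> e \<union> G)"
 proof -
  have "\<And>H. H \<in> {F, G} ==> connected (H \<union> e)"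
  proof -
   fix H assume "H \<in> {F, G}"
   then have H: "H \<in> Fs" "e \<subseteq> closure H" using FG edge_in_closure_iff[of H e] step.hyps(3,4) by auto
   then show "connected (H \<union> e)" by (intro connected_intermediate_closure[OF F_connected[OF H(1)]]) (auto simp: closure_subset)
  qed
  moreover have "(F \<union> e) \<inter> (G \<union> e) \<noteq> {}" using E_nonempty[OF step.hyps(3)] by blast
  ultimately have "connected ((F \<union> e) \<union> (G \<union> e))" by (simp add: connected_Un)
  moreover have "(F \<union> e) \<union> (G \<union> e) = F \<union> e \<union> G" by blast
  ultimately show ?thesis by simp
 qed
 have "connected ((\<Union>C \<union> \<Union>S) \<union> (F \<union> e \<union> G))"
 proof (rule connected_Un)
  show "connected (\<Union>C \<union> \<Union>S)" using step.IH by blast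
  show "(\<Union>C \<union> \<Union>S) \<inter> (F \<union> e \<union> G) \<noteq> {}" using step.hyps(5) F_nonempty[OF FG(1)] by blast
 qed (rule star)
 moreover have "(\<Union>C \<union> \<Union>S) \<union> (F \<union> e \<union> G) = \<Union>(insert G C) \<union> \<Union>(insert e S)" using step.hyps(5) by blast
 ultimately have "connected (\<Union>(insert G C) \<union> \<Union>(insert e S))" by simp
 moreover have "\<forall>d\<in>insert e S. \<forall>(H, k)\<in>sides_of d. H \<in> insert G C" using step by auto
 ultimately show ?case using step FG by blast
qed

text \<open>
  Let \<open>L\<close> be the complement of the open set formed by the cotree and \<open>e\<close>; it is connected,
  consisting of the tree and of closed cells that have vertices on their boundaries. Cut \<open>e\<close> at its
  middle. Then \<open>L\<close> with one half of \<open>e\<close>, and the other half, are continua whose union has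
  the connected cotree as its complement, but they meet in just two points, the middle and an end of \<open>e\<close>.
\<close>

lemma cotree_acyclic:
 assumes K: "connected (V \<union> \<Union>T)" "T \<subseteq> E" and CS: "cotree (E - T) C S" and e: "e \<in> E - T" "e \<notin> S"
  and s: "\<And>F i. (F, i) \<in> sides_of e ==> F \<in> C"
 shows False
proof -
 note props = cotree_props[OF CS]
 have eE: "e \<in> E" using e by simp
 define L where "L = S2 - (\<Union>C \<union> \<Union>S \<union> e)"
 have openO: "openin (top_of_set S2) (\<Union>C \<union> \<Union>S \<union> e)"
 proof -
  have "\<Union>C \<union> \<Union>S \<union> e = \<Union>C \<union> \<Union>((\<lambda>d. d \<union> \<Union>(fst ` sides_of d)) ` insert e S)"
   using props s by fastforce
  moreover have "openin (top_of_set S2) (\<Union>C)" using props F_open by (intro openin_Union) auto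
  moreover have "openin (top_of_set S2) (\<Union>((\<lambda>d. d \<union> \<Union>(fst ` sides_of d)) ` insert e S))"
   using props edge_star_open eE by (intro openin_Union) auto
  ultimately show ?thesis by (simp only: openin_Un)
 qed
 then have cL: "compact L"
 proof -
  obtain U where "open U" "\<Union>C \<union> \<Union>S \<union> e = S2 \<inter> U" using openO by (auto simp: openin_open)
  then have "L = S2 - U" unfolding L_def by blast
  then show ?thesis using \<open>open U\<close> by (simp add: compact_diff)
 qed
 have VL: "V \<subseteq> L"
 proof
  fix x assume x: "x \<in> V"
  then show "x \<in> L" using V_S2 x_VE[OF x] x_VF[OF x] props eE unfolding L_def by blast
 qed
 have edL: "d \<subseteq> L" if d: "d \<in> E" "d \<notin> S" "d \<noteq> e" for d
 proof
  fix x assume x: "x \<in> d"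
  have "x \<in> S2" using x d E_S2 by blast
  moreover have "x \<notin> \<Union>C" using x_EF[OF x d(1)] props by blast
  moreover have "x \<notin> \<Union>S" "x \<notin> e" using E_eq[of d _ x] x d props eE by blast+
  ultimately show "x \<in> L" by (simp add: L_def)
 qed
 have fcL: "closure H \<subseteq> L" if H: "H \<in> Fs" "H \<notin> C" for H
 proof
  fix x assume "x \<in> closure H"
  then obtain z where z: "z \<in> cball 0 1" "x = h H z" using closure_face H by auto
  show "x \<in> L" using H(1) z(1)
  proof (cases rule: cball_cases)
   case inside
   then have x: "x \<in> H" using z by simp
   have "x \<in> S2" using x H F_S2 by blast
   moreover have "x \<notin> \<Union>C" using F_eq[of H _ x] x H props by blast
   moreover have "x \<notin> \<Union>S" "x \<notin> e" using x_EF[of x _ H] x H props eE by blast+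
   ultimately show ?thesis by (simp add: L_def)
  next
   case (side i t)
   have "(H, i) \<in> sides_of (es H i)" using side H by (simp add: sides_of_def)
   then have "es H i \<notin> S" "es H i \<noteq> e" using props s H by blast+
   then show ?thesis using edL[of "es H i"] es_E side H z by blast
  next
   case corner then show ?thesis using VL z by blast
  qed
 qed
 have conL: "connected L"
 proof -
  let ?K = "V \<union> \<Union>T"
  let ?Z = "closure ` (E - S - {e}) \<union> closure ` (Fs - C)"
  have KL: "?K \<subseteq> L" using VL edL K(2) e props by blast
  have Z: "connected z \<and> z \<inter> V \<noteq> {} \<and> z \<subseteq> L" if z: "z \<in> ?Z" for z
   using z
  proof
   assume "z \<in> closure ` (E - S - {e})"
   then obtain d where d: "d \<in> E" "d \<notin> S" "d \<noteq> e" "z = closure d" by blast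
   have zz: "z = insert (g d 0) (insert (g d 1) d)" using d closure_edge closed_edge_eq by simp
   then show ?thesis using connected_imp_connected_closure[OF E_connected[OF d(1)]] g_ends[OF d(1)] d VL edL[OF d(1-3)] by auto
  next
   assume "z \<in> closure ` (Fs - C)"
   then obtain H where H: "H \<in> Fs" "H \<notin> C" "z = closure H" by blast
   have "h H (pt (n H) (real 0)) \<in> z \<inter> V" using closure_face[OF H(1)] h_corner[OF H(1), of 0] n_pos[OF H(1)] H(3) by auto
   then show ?thesis using connected_imp_connected_closure[OF F_connected[OF H(1)]] fcL[OF H(1,2)] unfolding H(3) by (intro conjI) auto
  qed
  have "connected (\<Union>((\<lambda>z. ?K \<union> z) ` insert {} ?Z))"
  proof (rule connected_Union)
   show "connected X" if "X \<in> (\<lambda>z. ?K \<union> z) ` insert {} ?Z" for X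
   proof -
    from that obtain z where z: "z \<in> insert {} ?Z" "X = ?K \<union> z" by (rule imageE)
    show ?thesis
    proof (cases "z = {}")
     case False
     then have zZ: "z \<in> ?Z" using z(1) by blast
     have "?K \<inter> z \<noteq> {}" using Z[OF zZ] by blast
     then show ?thesis using Z[OF zZ] K(1) z(2) by (simp add: connected_Un)
    qed (use K(1) z(2) in simp)
   qed
   have "V \<subseteq> \<Inter>((\<lambda>z. ?K \<union> z) ` insert {} ?Z)" by blast
   then show "\<Inter>((\<lambda>z. ?K \<union> z) ` insert {} ?Z) \<noteq> {}" using V_nonempty by blast
  qed
  moreover have "\<Union>((\<lambda>z. ?K \<union> z) ` insert {} ?Z) = L"
  proof
   show "\<Union>((\<lambda>z. ?K \<union> z) ` insert {} ?Z) \<subseteq> L" using KL Z by blast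
   show "L \<subseteq> \<Union>((\<lambda>z. ?K \<union> z) ` insert {} ?Z)"
   proof
    fix x assume x: "x \<in> L"
    then have "x \<in> S2" by (simp add: L_def)
    then show "x \<in> \<Union>((\<lambda>z. ?K \<union> z) ` insert {} ?Z)"
    proof (cases rule: S2_cases)
     case (E d)
     then have "d \<in> E - S - {e}" using x by (auto simp: L_def)
     then show ?thesis using E closure_subset[of d] by blast
    next
     case (F H)
     then have "H \<in> Fs - C" using x by (auto simp: L_def)
     then show ?thesis using F closure_subset[of H] by blast
    qed blast
   qed
  qed
  ultimately show ?thesis by simp
 qed
 let ?x = "g e (1/2)"
 let ?e1 = "g e ` {0..1/2}" and ?e2 = "g e ` {1/2..1}"
 have gc: "continuous_on {0..1/2} (g e)" "continuous_on {1/2..1} (g e)"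
  by (rule continuous_on_subset[OF g_cont[OF eE]], simp)+
 have x: "?x \<in> e" using g_mem[OF eE] by simp
 have gsub: "g e ` {0..1} \<subseteq> S2" using closed_edge_eq[OF eE] g_ends[OF eE] V_S2 E_S2[OF eE] by auto
 have eL: "e \<inter> L = {}" by (auto simp: L_def)
 have un: "(L \<union> ?e1) \<union> ?e2 = L \<union> e"
 proof -
  have "{0..1/2} \<union> {1/2..1} = {0..1::real}" by auto
  then have "?e1 \<union> ?e2 = insert (g e 0) (insert (g e 1) e)" using closed_edge_eq[OF eE] by (metis image_Un)
  moreover have "L \<union> insert (g e 0) (insert (g e 1) e) = L \<union> e" using g_ends[OF eE] VL by blast
  ultimately have "L \<union> (?e1 \<union> ?e2) = L \<union> e" by metis
  then show ?thesis by (simp add: Un_assoc)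
 qed
 have O: "S2 - ((L \<union> ?e1) \<union> ?e2) = \<Union>C \<union> \<Union>S"
 proof -
  have "y \<notin> e" if "y \<in> \<Union>C \<union> \<Union>S" for y
   using that E_eq[OF _ eE, of _ y] x_EF[OF _ eE, of y] props e(2) by blast
  moreover have "\<Union>C \<union> \<Union>S \<subseteq> S2" using props F_S2 E_S2 by blast
  ultimately show ?thesis unfolding un unfolding L_def by blast
 qed
 have "connected ((L \<union> ?e1) \<inter> ?e2)"
 proof (rule Janiszewski_dual_S2)
  show "compact (L \<union> ?e1)" using cL gc by (intro compact_Un compact_continuous_image) auto
  show "compact ?e2" using gc by (intro compact_continuous_image) auto
  have "g e 0 \<in> L \<inter> ?e1" using g_ends[OF eE] VL by auto
  then show "connected (L \<union> ?e1)" using conL gc by (intro connected_Un connected_continuous_image) auto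
  show "connected ?e2" using gc by (intro connected_continuous_image) auto
  show "L \<union> ?e1 \<subseteq> S2" "?e2 \<subseteq> S2" using gsub by (auto simp: L_def image_subset_iff)
  show "connected (S2 - ((L \<union> ?e1) \<union> ?e2))" using O props by simp
  obtain F where "F \<in> C" using props by blast
  then show "S2 - ((L \<union> ?e1) \<union> ?e2) \<noteq> {}" using O props F_nonempty[of F] by blast
 qed
 moreover have "(L \<union> ?e1) \<inter> ?e2 = {g e 1, ?x}"
 proof
  show "{g e 1, ?x} \<subseteq> (L \<union> ?e1) \<inter> ?e2" using g_ends[OF eE] VL by auto
  show "(L \<union> ?e1) \<inter> ?e2 \<subseteq> {g e 1, ?x}"
  proof
   fix y assume y: "y \<in> (L \<union> ?e1) \<inter> ?e2"
   then obtain t where t: "1/2 \<le> t" "t \<le> 1" "y = g e t" by auto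
   show "y \<in> {g e 1, ?x}"
   proof (cases "t = 1")
    case False
    then have ye: "y \<in> e" using g_mem[OF eE, of t] t by simp
    then have "y \<in> ?e1" using y eL by blast
    then obtain u where u: "0 \<le> u" "u \<le> 1/2" "y = g e u" by auto
    have "u \<noteq> 0" using ye u x_VE[OF _ eE] g_ends[OF eE] by metis
    then have "u = t" using inj_onD[OF g_inj[OF eE], of u t] u t False by simp
    then have "t = 1/2" using u t by linarith
    then have "y = ?x" using t(3) by (simp only:)
    then show ?thesis by simp
   qed (use t in simp)
  qed
 qed
 ultimately have "connected {g e 1, ?x}" by simp
 moreover have "g e 1 \<noteq> ?x" using x x_VE[OF _ eE] g_ends[OF eE] by metis
 ultimately show False using connected_finite_iff_sing[of "{g e 1, ?x}"] by auto
qed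

text \<open>
  The faces are the nodes of a graph whose edges are the members of \<open>B\<close>; by \<open>cotree_acyclic\<close>
  it has no cycles, so one of its nodes is a leaf.
\<close>

lemma cotree_leaf:
 assumes K: "connected (V \<union> \<Union>T)" "T \<subseteq> E" and B: "B \<subseteq> E - T" "B \<noteq> {}"
 shows "\<exists>e G j. e \<in> B \<and> (G, j) \<in> sides_of e \<and> (\<forall>e'\<in>B. \<forall>j'. (G, j') \<in> sides_of e' \<longrightarrow> e' = e \<and> j' = j)"
proof -
 have sub: "cotree (E - T) C S" if "cotree B C S" for C S
  using that
 proof induction
  case (step C S e F i G j)
  then have "e \<in> E - T" using B(1) by blast
  then show ?case using cotree.step[OF step.IH _ step.hyps(3-6)] by blast
 qed (rule cotree.base)
 have acyc: False if "cotree B C S" "e \<in> B" "e \<notin> S" "\<And>F i. (F, i) \<in> sides_of e ==> F \<in> C" for C S e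
  using cotree_acyclic[OF K sub[OF that(1)], of e] that B(1) by blast
 have ext: "\<exists>C' S'. cotree B C' S' \<and> card C' = Suc (card C) \<and> S' \<noteq> {}"
  if CS: "cotree B C S" and e: "e \<in> B" "e \<notin> S" "(F, i) \<in> sides_of e" "F \<in> C" for C S e F i
 proof -
  have eE: "e \<in> E" using e(1) B(1) by blast
  obtain G j where G: "(G, j) \<in> sides_of e" "G \<notin> C" using acyc[OF CS e(1,2)] by blast
  then have "sides_of e = {(F, i), (G, j)}" using sides_of_card2[OF eE] e(3,4) by fastforce
  then have "cotree B (insert G C) (insert e S)" using cotree.step[OF CS e(1) eE _ e(4) G(2)] by blast
  moreover have "finite C" using cotree_props[OF CS] finF finite_subset by blast
  ultimately show ?thesis using G(2) by (metis card_insert_disjoint insert_not_empty)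
 qed
 obtain e where e: "e \<in> B" using B by blast
 then obtain F i where F: "(F, i) \<in> sides_of e" using side_exists[of e] B(1) by fastforce
 then have "F \<in> Fs" by (simp add: sides_of_def)
 then have ex: "\<exists>C S. cotree B C S \<and> S \<noteq> {}" using ext[OF cotree.base[OF \<open>F \<in> Fs\<close>], of e F i] e F by blast
 have "\<And>C S. cotree B C S ==> card C < Suc (card Fs)" using cotree_props card_mono[OF finF] by (simp add: less_Suc_eq_le)
 then have "\<exists>x. (case x of (C, S) => cotree B C S \<and> S \<noteq> {}) \<and> (\<forall>y. (case y of (C, S) => cotree B C S \<and> S \<noteq> {}) \<longrightarrow> card (fst y) \<le> card (fst x))"
  using ex by (elim exE, intro ex_has_greatest_nat[where b="Suc (card Fs)" and k="(_, _)"]) auto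
 then obtain C S where CS: "cotree B C S" "S \<noteq> {}" and max: "\<And>C' S'. cotree B C' S' ==> S' \<noteq> {} ==> card C' \<le> card C" by auto
 show ?thesis using CS(1)
 proof cases
  case (step C' S' d F i G j)
  have p: "\<forall>e\<in>S'. \<forall>(F, i)\<in>sides_of e. F \<in> C'" using cotree_props[OF step(3)] by blast
  have "e' = d \<and> j' = j" if e': "e' \<in> B" "(G, j') \<in> sides_of e'" for e' j'
  proof -
   have "e' \<notin> S'" using p e'(2) step(8) by blast
   moreover have "e' \<in> S"
   proof (rule ccontr)
    assume "e' \<notin> S"
    then have "\<exists>C' S'. cotree B C' S' \<and> card C' = Suc (card C) \<and> S' \<noteq> {}"
     using ext[OF CS(1) e'(1) _ e'(2)] step(1) by blast
    then show False using max by fastforce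
   qed
   ultimately have "e' = d" using step(2) by blast
   then show ?thesis using e'(2) step by auto
  qed
  then show ?thesis using step by blast
 qed (use CS(2) in simp)
qed

lemma card_cotree_edges:
 assumes K: "connected (V \<union> \<Union>T)" "T \<subseteq> E"
 shows "card (E - T) < card Fs"
proof -
 have "card B < card A" if "finite A" "A \<subseteq> Fs" "A \<noteq> {}" "B \<subseteq> E - T" "\<And>e F i. e \<in> B ==> (F, i) \<in> sides_of e ==> F \<in> A" for A B
  using that
 proof (induction "card B" arbitrary: A B)
  case 0 then show ?case by (metis card_gt_0_iff)
 next
  case (Suc m)
  have "B \<noteq> {}" using Suc(2) by force
  then obtain e G j where e: "e \<in> B" "(G, j) \<in> sides_of e" and leaf: "\<And>e' j'. e' \<in> B ==> (G, j') \<in> sides_of e' ==> e' = e \<and> j' = j"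
   using cotree_leaf[OF K Suc.prems(4)] by metis
  obtain s where s: "s \<in> sides_of e" "s \<noteq> (G, j)" using sides_of_card2[of e] e Suc.prems(4) by blast
  obtain H k where Hk: "s = (H, k)" by (cases s)
  then have H: "H \<noteq> G" "H \<in> A" using leaf[OF e(1)] s Suc.prems(5)[OF e(1)] by blast+
  have GA: "G \<in> A" using Suc.prems(5) e by blast
  have fB: "finite B" using Suc.prems(4) finE by (meson Diff_subset finite_subset)
  have "card (B - {e}) < card (A - {G})"
  proof (rule Suc.hyps(1))
   show "m = card (B - {e})" using Suc.hyps(2) e fB by simp
   show "F \<in> A - {G}" if "d \<in> B - {e}" "(F, i) \<in> sides_of d" for d F i using that leaf Suc.prems(5) by blast
  qed (use Suc.prems H in auto)
  then show ?case using e GA fB Suc.prems(1) by (simp add: card_Diff_singleton)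
 qed
 then show ?thesis using finF Fs_ne by (force simp: sides_of_def)
qed

text \<open>
  A spanning tree has one edge less than there are vertices, and the other edges form a forest on the set of faces.
\<close>

theorem Euler_inequality: "card E + 2 \<le> card V + card Fs"
proof -
 obtain T where T: "tree V T" using spanning_tree by blast
 note p = tree_props[OF T]
 have "card (E - T) < card Fs" using card_cotree_edges p by blast
 moreover have "card E = card (E - T) + card T"
  using p finE by (metis card_Diff_subset card_mono finite_subset le_add_diff_inverse2)
 ultimately show ?thesis using p by linarith
qed

end

section \<open>Normalising boundary walks\<close>

lemma increasing_extension:
 fixes \<theta> :: "real => real"
 assumes bij: "\<theta> ` {0<..<1} = {0<..<1}" and mono: "strict_mono_on {0<..<1} \<theta>"
 shows "\<exists>\<sigma>. continuous_on {0..1} \<sigma> \<and> inj_on \<sigma> {0..1} \<and> \<sigma> ` {0..1} = {0..1} \<and> \<sigma> 0 = 0 \<and> \<sigma> 1 = 1 \<and>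
   (\<forall>t\<in>{0<..<1}. \<sigma> t = \<theta> t)"
proof -
 define \<sigma> where "\<sigma> t = (if t \<le> 0 \<or> 1 \<le> t then t else \<theta> t)" for t
 have r: "0 < \<theta> t \<and> \<theta> t < 1" if "0 < t" "t < 1" for t using bij that by (metis greaterThanLessThan_iff image_eqI)
 have sm: "\<sigma> s < \<sigma> t" if "s < t" for s t
  using that r[of s] r[of t] strict_mono_onD[OF mono, of s t] unfolding \<sigma>_def
  by (smt (verit) greaterThanLessThan_iff)
 have surj: "range \<sigma> = UNIV"
 proof (intro set_eqI iffI UNIV_I)
  fix y show "y \<in> range \<sigma>"
  proof (cases "0 < y \<and> y < 1")
   case True
   then obtain t where "t \<in> {0<..<1}" "y = \<theta> t" using bij by (metis greaterThanLessThan_iff imageE)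
   then have "\<sigma> t = y" by (simp add: \<sigma>_def)
   then show ?thesis by blast
  next
   case False
   then have "\<sigma> y = y" by (auto simp: \<sigma>_def)
   then show ?thesis by (metis rangeI)
  qed
 qed
 have c: "continuous_on UNIV \<sigma>"
  by (rule continuous_onI_mono) (use surj sm in \<open>auto simp: le_less\<close>)
 have "\<sigma> ` {0..1} = {0..1}"
 proof
  have "0 \<le> \<sigma> t \<and> \<sigma> t \<le> 1" if "0 \<le> t" "t \<le> 1" for t
   using r[of t] that unfolding \<sigma>_def by (cases "t = 0 \<or> t = 1") (auto simp: less_le)
  then show "\<sigma> ` {0..1} \<subseteq> {0..1}" by auto
  show "{0..1} \<subseteq> \<sigma> ` {0..1}"
  proof
   fix y :: real assume y: "y \<in> {0..1}"
   obtain t where t: "\<sigma> t = y" using surj by (metis UNIV_I imageE)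
   then have "t \<in> {0..1}" using y r[of t] by (auto simp: \<sigma>_def split: if_splits)
   then show "y \<in> \<sigma> ` {0..1}" using t by blast
  qed
 qed
 moreover have "inj_on \<sigma> {0..1}" by (rule inj_onI) (metis linorder_neqE_linordered_idom order_less_irrefl sm)
 ultimately show ?thesis using continuous_on_subset[OF c, of "{0..1}"] by (intro exI[of _ \<sigma>]) (auto simp: \<sigma>_def)
qed

text \<open>
  Two parametrisations of an open arc differ by a monotone bijection of the open interval, which extends to the closed
  interval.
\<close>

lemma arc_reparametrisation:
 fixes \<gamma> g :: "real => 'a::real_normed_vector"
 assumes \<gamma>: "continuous_on {0..1} \<gamma>" "inj_on \<gamma> {0<..<1}" "\<gamma> ` {0<..<1} = e" "\<gamma> 0 \<notin> e" "\<gamma> 1 \<notin> e"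
  and g: "continuous_on {0..1} g" "inj_on g {0<..<1}" "g ` {0<..<1} = e" "g 0 \<notin> e" "g 1 \<notin> e"
 shows "\<exists>\<sigma> d. continuous_on {0..1} \<sigma> \<and> inj_on \<sigma> {0..1} \<and> \<sigma> ` {0..1} = {0..1} \<and> \<sigma> 0 = 0 \<and> \<sigma> 1 = 1 \<and>
   (\<forall>t\<in>{0..1}. \<gamma> (\<sigma> t) = g (if d then t else 1 - t))"
proof -
 define \<theta> where "\<theta> = inv_into {0<..<1} \<gamma> \<circ> g"
 have h\<gamma>: "homeomorphism {0<..<1} e \<gamma> (inv_into {0<..<1} \<gamma>)" by (rule open_arc_homeomorphism[OF \<gamma>])
 have hg: "homeomorphism {0<..<1} e g (inv_into {0<..<1} g)" by (rule open_arc_homeomorphism[OF g])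
 have h: "homeomorphism {0<..<1} {0<..<1} \<theta> (inv_into {0<..<1} g \<circ> \<gamma>)"
  unfolding \<theta>_def by (rule homeomorphism_compose[OF hg homeomorphism_symD[OF h\<gamma>]])
 have c: "continuous_on {0<..<1} \<theta>" and im: "\<theta> ` {0<..<1} = {0<..<1}"
  using h by (simp_all add: homeomorphism_def)
 have inj: "inj_on \<theta> {0<..<1}" using h by (metis homeomorphism_def inj_on_inverseI)
 have \<gamma>\<theta>: "\<gamma> (\<theta> t) = g t" if "t \<in> {0<..<1}" for t
 proof -
  have "g t \<in> e" using that g(3) by blast
  then show ?thesis using h\<gamma> by (simp add: \<theta>_def homeomorphism_def)
 qed
 have "strict_mono_on {0<..<1} \<theta> \<or> strict_antimono_on {0<..<1} \<theta>"
  using injective_eq_monotone_map[of "{0<..<1}" \<theta>] c inj by (simp add: is_interval_oo)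
 then obtain d \<theta>' where \<theta>': "strict_mono_on {0<..<1} \<theta>'" "\<theta>' ` {0<..<1} = {0<..<1}"
  "\<And>t. t \<in> {0<..<1} ==> \<gamma> (\<theta>' t) = g (if d then t else 1 - t)"
 proof
  assume "strict_mono_on {0<..<1} \<theta>"
  then show ?thesis using that[of \<theta> True] im \<gamma>\<theta> by simp
 next
  assume a: "strict_antimono_on {0<..<1} \<theta>"
  show ?thesis
  proof (rule that[of "\<lambda>t. \<theta> (1 - t)" False])
   show "strict_mono_on {0<..<1} (\<lambda>t. \<theta> (1 - t))"
    using a by (auto simp: monotone_on_def)
   have "(\<lambda>t. 1 - t) ` {0<..<1} = {0<..<1::real}"
   proof (intro set_eqI iffI)
    fix x :: real assume "x \<in> {0<..<1}"
    then show "x \<in> (\<lambda>t. 1 - t) ` {0<..<1}" by (intro image_eqI[of _ _ "1 - x"]) auto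
   qed auto
   then show "(\<lambda>t. \<theta> (1 - t)) ` {0<..<1} = {0<..<1}" using im by (metis (no_types, lifting) image_cong image_image)
  qed (use \<gamma>\<theta> in auto)
 qed
 obtain \<sigma> where \<sigma>: "continuous_on {0..1} \<sigma>" "inj_on \<sigma> {0..1}" "\<sigma> ` {0..1} = {0..1}" "\<sigma> 0 = 0" "\<sigma> 1 = 1"
   "\<And>t. t \<in> {0<..<1} ==> \<sigma> t = \<theta>' t" using increasing_extension[OF \<theta>'(2,1)] by blast
 have "\<gamma> (\<sigma> t) - g (if d then t else 1 - t) = 0" if "t \<in> {0..1}" for t
 proof (rule continuous_constant_on_closure[of "{0<..<1}" "\<lambda>t. \<gamma> (\<sigma> t) - g (if d then t else 1 - t)"])
  have "continuous_on {0..1} (\<lambda>t. g (if d then t else 1 - t))"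
   by (rule continuous_on_compose2[OF g(1)]) (cases d, auto intro!: continuous_intros)
  then show "continuous_on (closure {0<..<1}) (\<lambda>t. \<gamma> (\<sigma> t) - g (if d then t else 1 - t))"
   using continuous_on_compose2[OF \<gamma>(1) \<sigma>(1)] \<sigma>(3) by (auto intro!: continuous_intros)
  show "t \<in> closure {0<..<1}" using that by simp
 qed (use \<theta>'(3) \<sigma>(6) in simp)
 then show ?thesis using \<sigma> by (intro exI[of _ \<sigma>] exI[of _ d]) auto
qed

text \<open>
  The cone over a reparametrisation of the boundary circle that fixes the corners.
\<close>

lemma disc_reparametrisation:
 assumes n: "n > 0" and \<sigma>: "\<And>i. i < n ==> continuous_on {0..1} (\<sigma> i)" "\<And>i. i < n ==> inj_on (\<sigma> i) {0..1}"
  "\<And>i. i < n ==> \<sigma> i ` {0..1} = {0..1}" "\<And>i. i < n ==> \<sigma> i 0 = 0" "\<And>i. i < n ==> \<sigma> i 1 = (1::real)"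
 obtains \<rho> where "continuous_on (cball 0 1) \<rho>" "inj_on \<rho> (cball 0 1)" "\<rho> ` cball 0 1 = cball 0 1" "\<rho> ` ball 0 1 = ball 0 1"
  "\<And>i t. i < n ==> 0 \<le> t ==> t \<le> 1 ==> \<rho> (pt n (real i + t)) = pt n (real i + \<sigma> i t)"
proof -
 obtain \<beta> where \<beta>: "continuous_on (sphere 0 1) \<beta>"
  "\<And>i t. i < n ==> 0 \<le> t ==> t \<le> 1 ==> \<beta> (pt n (real i + t)) = pt n (real i + \<sigma> i t)"
 proof (rule circle_map[OF n, of "\<lambda>i t. pt n (real i + \<sigma> i t)"])
  show "pt n (real i + \<sigma> i 1) = pt n (real ((i + 1) mod n) + \<sigma> ((i + 1) mod n) 0)" if "i < n" for i
   using pt_corner[OF n that] \<sigma>(4)[of "(i + 1) mod n"] \<sigma>(5)[OF that] n by simp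
 qed (use \<sigma>(1) in \<open>auto intro!: continuous_intros\<close>)
 have r: "0 \<le> \<sigma> i t \<and> \<sigma> i t < 1" if "i < n" "0 \<le> t" "t < 1" for i t
 proof -
  have "\<sigma> i t \<in> {0..1}" using \<sigma>(3)[OF that(1)] that by (metis atLeastAtMost_iff image_eqI less_eq_real_def)
  moreover have "\<sigma> i t \<noteq> 1" using inj_onD[OF \<sigma>(2)[OF that(1)], of t 1] \<sigma>(5) that by auto
  ultimately show ?thesis by auto
 qed
 have inj: "inj_on \<beta> (sphere 0 1)"
 proof (rule inj_onI)
  fix z w :: complex assume zw: "z \<in> sphere 0 1" "w \<in> sphere 0 1" "\<beta> z = \<beta> w"
  obtain i t where i: "i < n" "0 \<le> t" "t < 1" "z = pt n (real i + t)" using sphere_pt_cases[OF n] zw(1) by (metis mem_sphere_0)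
  obtain j u where j: "j < n" "0 \<le> u" "u < 1" "w = pt n (real j + u)" using sphere_pt_cases[OF n] zw(2) by (metis mem_sphere_0)
  have "pt n (real i + \<sigma> i t) = pt n (real j + \<sigma> j u)" using zw(3) i j \<beta>(2)[of i t] \<beta>(2)[of j u] by simp
  then have "i = j \<and> \<sigma> i t = \<sigma> j u" using pt_inj r[OF i(1-3)] r[OF j(1-3)] i j by metis
  then have "i = j \<and> t = u" using inj_onD[OF \<sigma>(2)[OF i(1)], of t u] i j by auto
  then show "z = w" using i j by simp
 qed
 have im: "\<beta> ` sphere 0 1 = sphere 0 1"
 proof
  show "\<beta> ` sphere 0 1 \<subseteq> sphere 0 1"
  proof clarify
   fix z :: complex assume "z \<in> sphere 0 1"
   then obtain i t where i: "i < n" "0 \<le> t" "t < 1" "z = pt n (real i + t)" using sphere_pt_cases[OF n] by (metis mem_sphere_0)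
   then show "\<beta> z \<in> sphere 0 1" using \<beta>(2)[of i t] by simp
  qed
  show "sphere 0 1 \<subseteq> \<beta> ` sphere 0 1"
  proof
   fix z :: complex assume "z \<in> sphere 0 1"
   then obtain i t where i: "i < n" "0 \<le> t" "t < 1" "z = pt n (real i + t)" using sphere_pt_cases[OF n] by (metis mem_sphere_0)
   then obtain s where s: "s \<in> {0..1}" "\<sigma> i s = t" using \<sigma>(3)[OF i(1)] by (metis atLeastAtMost_iff imageE less_eq_real_def)
   then have "z = \<beta> (pt n (real i + s))" using \<beta>(2)[of i s] i by simp
   then show "z \<in> \<beta> ` sphere 0 1" by simp
  qed
 qed
 obtain \<rho> where \<rho>: "continuous_on (cball 0 1) \<rho>" "inj_on \<rho> (cball 0 1)" "\<rho> ` cball 0 1 = cball 0 1" "\<rho> ` ball 0 1 = interior (cball 0 1)"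
  "\<And>z. norm z = 1 ==> \<rho> z = \<beta> z"
  using cone_homeomorphism[of "cball 0 1" 0 \<beta>] \<beta>(1) inj im by auto
 show ?thesis using that[of \<rho>] \<rho> \<beta>(2) by simp
qed

lemma edge_on_path:
 assumes "edge_on V e"
 obtains g :: "real => real^3" where "continuous_on {0..1} g" "inj_on g {0<..<1}" "g ` {0<..<1} = e" "g 0 \<in> V" "g 1 \<in> V" "e \<inter> V = {}" "g ` {0..1} \<subseteq> S2"
proof -
 obtain g where g: "simple_path g" "path_image g \<subseteq> S2" "path_image g \<inter> V = {pathstart g, pathfinish g}" "e = path_image g - V"
  using assms by (auto simp: edge_on_def)
 have inj: "x = y \<or> x = 0 \<and> y = 1 \<or> x = 1 \<and> y = 0" if "x \<in> {0..1}" "y \<in> {0..1}" "g x = g y" for x y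
  using g(1) that by (auto simp: simple_path_def loop_free_def)
 have "g ` {0<..<1} = e"
 proof
  show "g ` {0<..<1} \<subseteq> e"
  proof clarify
   fix t :: real assume t: "t \<in> {0<..<1}"
   then have "g t \<in> path_image g" by (auto simp: path_image_def)
   moreover have "g t \<noteq> g 0" "g t \<noteq> g 1" using inj[of t 0] inj[of t 1] t by auto
   ultimately show "g t \<in> e" using g(3,4) by (auto simp: pathstart_def pathfinish_def)
  qed
  show "e \<subseteq> g ` {0<..<1}"
  proof
   fix x assume "x \<in> e"
   then obtain t where t: "t \<in> {0..1}" "x = g t" "x \<notin> V" using g(4) by (auto simp: path_image_def)
   then have "t \<noteq> 0" "t \<noteq> 1" using g(3) by (auto simp: pathstart_def pathfinish_def)
   then show "x \<in> g ` {0<..<1}" using t by (auto simp: less_le)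
  qed
 qed
 moreover have "continuous_on {0..1} g" using g(1) by (simp add: simple_path_def path_def)
 moreover have "inj_on g {0<..<1}" 
 proof (rule inj_onI)
  fix x y :: real assume "x \<in> {0<..<1}" "y \<in> {0<..<1}" "g x = g y"
  then show "x = y" using inj[of x y] by auto
 qed
 moreover have "g 0 \<in> V" "g 1 \<in> V" using g(3) by (auto simp: pathstart_def pathfinish_def)
 moreover have "e \<inter> V = {}" "g ` {0..1} \<subseteq> S2" using g(2,4) by (auto simp: path_image_def)
 ultimately show ?thesis using that by blast
qed

text \<open>
  A boundary walk prescribes only the images of the open sides. Precomposition with a homeomorphism of the disc makes
  it follow given parametrisations of the edges.
\<close>

lemma normalised_boundary_walk:
 assumes bw: "boundary_walk P F es"
  and g: "\<And>e. e \<in> edges P ==> continuous_on {0..1} (g e) \<and> inj_on (g e) {0<..<1} \<and> g e ` {0<..<1} = e \<and> g e 0 \<notin> e \<and> g e 1 \<notin> e"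
  and V: "\<And>e. e \<in> edges P ==> e \<inter> verts P = {}"
 shows "\<exists>h d. continuous_on (cball 0 1) h \<and> inj_on h (ball 0 1) \<and> h ` ball 0 1 = F \<and>
  (\<forall>i<length es. \<forall>t\<in>{0..1}. h (pt (length es) (real i + t)) = g (es ! i) (if d i then t else 1 - t))"
proof -
 let ?n = "length es"
 obtain h0 h0' where h0: "continuous_on (cball 0 1) h0" "homeomorphism (ball 0 1) F h0 h0'"
  "\<And>i. i < ?n ==> h0 (pt ?n (real i)) \<in> verts P" "\<And>i. i < ?n ==> bij_betw h0 (side ?n i) (es ! i)"
  using bw unfolding boundary_walk_def pt_def by blast
 have n: "?n > 0" and esE: "\<And>i. i < ?n ==> es ! i \<in> edges P" using bw by (auto simp: boundary_walk_def)
 have "\<exists>\<sigma> d. continuous_on {0..1} \<sigma> \<and> inj_on \<sigma> {0..1} \<and> \<sigma> ` {0..1} = {0..1} \<and> \<sigma> 0 = 0 \<and> \<sigma> 1 = (1::real) \<and>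
   (\<forall>t\<in>{0..1}. h0 (pt ?n (real i + \<sigma> t)) = g (es ! i) (if d then t else 1 - t))" if i: "i < ?n" for i
 proof (rule arc_reparametrisation[of "\<lambda>t. h0 (pt ?n (real i + t))" "es ! i" "g (es ! i)"])
  show "continuous_on {0..1} (\<lambda>t. h0 (pt ?n (real i + t)))"
   by (rule continuous_on_compose2[OF h0(1)]) (auto intro!: continuous_intros)
  have b: "bij_betw h0 ((\<lambda>t. pt ?n (real i + t)) ` {0<..<1}) (es ! i)" using h0(4)[OF i] by (simp add: side_pt)
  have "inj_on (\<lambda>t. pt ?n (real i + t)) {0<..<1}" using pt_inj[OF i i] by (auto intro!: inj_onI)
  then show "inj_on (\<lambda>t. h0 (pt ?n (real i + t))) {0<..<1}"
   using b comp_inj_on[of "\<lambda>t. pt ?n (real i + t)" "{0<..<1}" h0] by (auto simp: bij_betw_def comp_def)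
  show "(\<lambda>t. h0 (pt ?n (real i + t))) ` {0<..<1} = es ! i" using b by (simp add: bij_betw_def image_image)
  have "h0 (pt ?n (real i + 0)) \<in> verts P" using h0(3)[OF i] by simp
  then show "h0 (pt ?n (real i + 0)) \<notin> es ! i" using V[OF esE[OF i]] by blast
  have "h0 (pt ?n (real i + 1)) \<in> verts P" using pt_corner[OF n i] h0(3)[of "(i + 1) mod ?n"] n by simp
  then show "h0 (pt ?n (real i + 1)) \<notin> es ! i" using V[OF esE[OF i]] by blast
 qed (use g[OF esE[OF i]] in auto)
 then have "\<forall>i\<in>{..<?n}. \<exists>s. continuous_on {0..1} (fst s) \<and> inj_on (fst s) {0..1} \<and> fst s ` {0..1} = {0..1} \<and> fst s 0 = 0 \<and> fst s 1 = (1::real) \<and>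
   (\<forall>t\<in>{0..1}. h0 (pt ?n (real i + fst s t)) = g (es ! i) (if snd s then t else 1 - t))" by fastforce
 then obtain f where f: "\<forall>i\<in>{..<?n}. continuous_on {0..1} (fst (f i)) \<and> inj_on (fst (f i)) {0..1} \<and> fst (f i) ` {0..1} = {0..1} \<and> fst (f i) 0 = 0 \<and> fst (f i) 1 = (1::real) \<and>
   (\<forall>t\<in>{0..1}. h0 (pt ?n (real i + fst (f i) t)) = g (es ! i) (if snd (f i) then t else 1 - t))" unfolding bchoice_iff by blast
 define \<sigma> d where "\<sigma> i = fst (f i)" and "d i = snd (f i)" for i
 have \<sigma>: "\<And>i. i < ?n ==> continuous_on {0..1} (\<sigma> i)" "\<And>i. i < ?n ==> inj_on (\<sigma> i) {0..1}"
  "\<And>i. i < ?n ==> \<sigma> i ` {0..1} = {0..1}" "\<And>i. i < ?n ==> \<sigma> i 0 = 0" "\<And>i. i < ?n ==> \<sigma> i 1 = (1::real)"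
  "\<And>i t. i < ?n ==> t \<in> {0..1} ==> h0 (pt ?n (real i + \<sigma> i t)) = g (es ! i) (if d i then t else 1 - t)"
  using f by (simp_all add: \<sigma>_def d_def)
 obtain \<rho> where \<rho>: "continuous_on (cball 0 1) \<rho>" "inj_on \<rho> (cball 0 1)" "\<rho> ` cball 0 1 = cball 0 1" "\<rho> ` ball 0 1 = ball 0 1"
  "\<And>i t. i < ?n ==> 0 \<le> t ==> t \<le> 1 ==> \<rho> (pt ?n (real i + t)) = pt ?n (real i + \<sigma> i t)"
  using disc_reparametrisation[OF n, of \<sigma>] \<sigma>(1-5) by blast
 have "continuous_on (cball 0 1) (h0 \<circ> \<rho>)" using \<rho>(1,3) h0(1) by (intro continuous_on_compose) auto
 moreover have "inj_on (h0 \<circ> \<rho>) (ball 0 1)"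
 proof (rule comp_inj_on)
  show "inj_on \<rho> (ball 0 1)" using \<rho>(2) by (rule inj_on_subset) auto
  show "inj_on h0 (\<rho> ` ball 0 1)" using h0(2) \<rho>(4) by (metis homeomorphism_def inj_on_inverseI)
 qed
 moreover have "(h0 \<circ> \<rho>) ` ball 0 1 = F" using \<rho>(4) h0(2) by (simp only: image_comp[symmetric] homeomorphism_def)
 moreover have "\<forall>i<?n. \<forall>t\<in>{0..1}. (h0 \<circ> \<rho>) (pt ?n (real i + t)) = g (es ! i) (if d i then t else 1 - t)"
  using \<rho>(5) \<sigma>(6) by simp
 ultimately show ?thesis by blast
qed

text \<open>
  Moving the starting point by one side brings the black neighbours of a white face to the even sides.
\<close>

lemma boundary_walk_rotate1:
 assumes "boundary_walk P F es" shows "boundary_walk P F (rotate1 es)"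
proof -
 let ?n = "length es"
 obtain h h' where h: "continuous_on (cball 0 1) h" "homeomorphism (ball 0 1) F h h'"
  "\<And>i. i < ?n ==> h (pt ?n (real i)) \<in> verts P" "\<And>i. i < ?n ==> bij_betw h (side ?n i) (es ! i)"
  using assms unfolding boundary_walk_def pt_def by blast
 have n: "?n > 0" using assms by (auto simp: boundary_walk_def)
 define \<rho> where "\<rho> z = pt ?n 1 * z" for z
 define \<rho>' where "\<rho>' z = cnj (pt ?n 1) * z" for z
 have i1: "cnj (pt ?n 1) * pt ?n 1 = 1" by (metis complex_norm_square mult.commute norm_pt of_real_1 one_power2)
 have nr: "norm (\<rho> z) = norm z" "norm (\<rho>' z) = norm z" for z by (simp_all add: \<rho>_def \<rho>'_def norm_mult)
 have inv: "\<rho>' (\<rho> z) = z" "\<rho> (\<rho>' z) = z" for z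
 proof -
  show "\<rho>' (\<rho> z) = z" using i1 by (metis \<rho>_def \<rho>'_def mult.assoc mult_1)
  have "pt ?n 1 * cnj (pt ?n 1) = 1" using i1 by (simp only: mult.commute)
  then show "\<rho> (\<rho>' z) = z" by (metis \<rho>_def \<rho>'_def mult.assoc mult_1)
 qed
 have hr: "homeomorphism (ball 0 1) (ball 0 1) \<rho> \<rho>'"
  unfolding homeomorphism_def
 proof (intro conjI)
  show "\<rho> ` ball 0 1 = ball 0 1"
  proof (intro set_eqI iffI)
   fix x :: complex assume "x \<in> ball 0 1"
   then show "x \<in> \<rho> ` ball 0 1" using nr inv by (intro image_eqI[of _ _ "\<rho>' x"]) auto
  qed (use nr in auto)
  show "\<rho>' ` ball 0 1 = ball 0 1"
  proof (intro set_eqI iffI)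
   fix x :: complex assume "x \<in> ball 0 1"
   then show "x \<in> \<rho>' ` ball 0 1" using nr inv by (intro image_eqI[of _ _ "\<rho> x"]) auto
  qed (use nr in auto)
 qed (auto simp: inv, auto simp: \<rho>_def \<rho>'_def intro!: continuous_intros)
 have rp: "\<rho> (pt ?n s) = pt ?n (s + 1)" for s
  by (simp add: \<rho>_def pt_def cis_mult add_divide_distrib[symmetric] ring_distribs add.commute)
 have rs: "\<rho> (pt ?n (real i + t)) = pt ?n (real ((i + 1) mod ?n) + t)" for i t
  using pt_mod[OF n, of "i + 1" t] by (simp add: rp ac_simps)
 have "continuous_on (cball 0 1) (h \<circ> \<rho>)"
  by (intro continuous_on_compose continuous_on_subset[OF h(1)]) (auto simp: nr, auto simp: \<rho>_def intro!: continuous_intros)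
 moreover have "homeomorphism (ball 0 1) F (h \<circ> \<rho>) (\<rho>' \<circ> h')" by (rule homeomorphism_compose[OF hr h(2)])
 moreover have "(h \<circ> \<rho>) (pt ?n (real i)) \<in> verts P" if "i < ?n" for i
  using rs[of i 0] h(3)[of "(i + 1) mod ?n"] n by simp
 moreover have "bij_betw (h \<circ> \<rho>) (side ?n i) (rotate1 es ! i)" if i: "i < ?n" for i
 proof -
  have "bij_betw \<rho> (side ?n i) (side ?n ((i + 1) mod ?n))"
   unfolding bij_betw_def
  proof
   show "inj_on \<rho> (side ?n i)" using inv by (metis inj_on_inverseI)
   show "\<rho> ` side ?n i = side ?n ((i + 1) mod ?n)" by (simp add: side_pt image_image rs)
  qed
  then have "bij_betw (h \<circ> \<rho>) (side ?n i) (es ! ((i + 1) mod ?n))"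
   using h(4)[of "(i + 1) mod ?n"] n by (intro bij_betw_trans) auto
  then show ?thesis using nth_rotate1[OF i] by simp
 qed
 ultimately show ?thesis using assms unfolding boundary_walk_def pt_def[symmetric] by (intro conjI exI[of _ "h \<circ> \<rho>"]) auto
qed

text \<open>
  The normal form of a pattern of type \<open>(k, 2m, 2)\<close>: the even sides of the white faces are those towards
  black faces.
\<close>

locale football_map = polygonal_map +
 fixes Bl Wh :: "(real^3) set set" and k m :: nat
 assumes Fs_BW: "Fs = Bl \<union> Wh" and BW: "Bl \<inter> Wh = {}"
  and n_Bl: "\<And>F. F \<in> Bl ==> n F = k" and n_Wh: "\<And>F. F \<in> Wh ==> n F = 2 * m"
  and k3: "3 \<le> k" and m2: "2 \<le> m"
  and across_Bl: "\<And>F i. F \<in> Bl ==> i < k ==> \<exists>G\<in>Wh. {F, G} = {H \<in> Fs. es F i \<subseteq> closure H}"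
  and across_Wh: "\<And>F i. F \<in> Wh ==> i < 2 * m ==>
    \<exists>G. {F, G} = {H \<in> Fs. es F i \<subseteq> closure H} \<and> (if even i then G \<in> Bl else G \<in> Wh)"

theorem football_pattern_normalised:
 assumes fp: "football_pattern k l 2 P"
 shows "\<exists>g n h es dr. football_map (verts P) (edges P) (faces P) g n h es dr (black P) (white P) k (l div 2)"
proof -
 let ?V = "verts P" and ?E = "edges P" and ?F = "faces P"
 have kl: "3 \<le> k" "3 \<le> l" "even l" using fp by (auto simp: football_pattern_def)
 have gr: "finite ?V" "?V \<subseteq> S2" "finite ?E" "\<And>e. e \<in> ?E ==> edge_on ?V e" "pairwise disjnt ?E" "connected (?V \<union> \<Union>?E)"
  using fp by (auto simp: football_pattern_def map_on_S2_def graph_on_S2_def)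
 have col: "black P \<union> white P = ?F" "black P \<inter> white P = {}" using fp by (auto simp: football_pattern_def)
 have acB: "\<exists>G\<in>white P. across P F e G" if "F \<in> black P" "e \<in> ?E" "e \<subseteq> closure F" for F e
  using fp that by (simp add: football_pattern_def)
 have "\<exists>g::real => real^3. continuous_on {0..1} g \<and> inj_on g {0<..<1} \<and> g ` {0<..<1} = e \<and> g 0 \<in> ?V \<and> g 1 \<in> ?V \<and> e \<inter> ?V = {} \<and> g ` {0..1} \<subseteq> S2"
  if "e \<in> ?E" for e using edge_on_path[OF gr(4)[OF that]] by metis
 then have "\<forall>e\<in>?E. \<exists>g::real => real^3. continuous_on {0..1} g \<and> inj_on g {0<..<1} \<and> g ` {0<..<1} = e \<and> g 0 \<in> ?V \<and> g 1 \<in> ?V \<and> e \<inter> ?V = {} \<and> g ` {0..1} \<subseteq> S2" by blast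
 from bchoice[OF this] obtain g :: "(real^3) set => real => real^3" where g0: "\<forall>e\<in>?E. continuous_on {0..1} (g e) \<and> inj_on (g e) {0<..<1} \<and> g e ` {0<..<1} = e \<and> g e 0 \<in> ?V \<and> g e 1 \<in> ?V \<and> e \<inter> ?V = {} \<and> g e ` {0..1} \<subseteq> S2"
  ..
 have g: "\<And>e. e \<in> ?E ==> continuous_on {0..1} (g e) \<and> inj_on (g e) {0<..<1} \<and> g e ` {0<..<1} = e \<and> g e 0 \<in> ?V \<and> g e 1 \<in> ?V \<and> e \<inter> ?V = {} \<and> g e ` {0..1} \<subseteq> S2"
  using g0 by blast
 have ES: "e \<subseteq> S2" if "e \<in> ?E" for e
 proof -
  have "g e ` {0<..<1} \<subseteq> g e ` {0..1}" by (intro image_mono) (auto intro: less_imp_le)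
  then show ?thesis using g[OF that] by blast
 qed
 have cov: "?V \<union> \<Union>?E \<union> \<Union>?F = S2" using gr(2) ES unfolding faces_def by (auto simp: Union_components[symmetric])
 have bwB: "\<exists>es. boundary_walk P F es \<and> length es = k" if "F \<in> black P" for F
  using fp that by (auto simp: football_pattern_def is_gon_def)
 have bwW: "\<exists>es. boundary_walk P F es \<and> length es = l \<and> (\<forall>i<l. \<exists>G. across P F (es ! i) G \<and> (if even i then G \<in> black P else G \<in> white P))"
  if "F \<in> white P" for F
 proof -
  obtain es r where e: "boundary_walk P F es" "length es = l" "r < 2"
   "\<And>i. i < l ==> \<exists>G. across P F (es ! i) G \<and> (if i mod 2 = r then G \<in> black P else G \<in> white P)"
   using fp \<open>F \<in> white P\<close> unfolding football_pattern_def by blast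
  show ?thesis
  proof (cases "r = 0")
   case True
   then show ?thesis using e by (intro exI[of _ es]) (auto simp: even_iff_mod_2_eq_zero)
  next
   case False
   then have r: "r = 1" using e(3) by simp
   have "\<exists>G. across P F (rotate1 es ! i) G \<and> (if even i then G \<in> black P else G \<in> white P)" if i: "i < l" for i
   proof -
    have "(i + 1) mod l < l" using kl by simp
    moreover have "even ((i + 1) mod l) \<longleftrightarrow> even (i + 1)" using kl(3) by (simp add: dvd_mod_iff)
    ultimately show ?thesis using e(4)[of "(i + 1) mod l"] nth_rotate1[of i es] i e(2) r by (auto simp: mod_2_eq_odd split: if_splits)
   qed
   then show ?thesis using boundary_walk_rotate1[OF e(1)] e(2) by (intro exI[of _ "rotate1 es"]) auto
  qed
 qed
 have "\<exists>es. boundary_walk P F es \<and> length es = (if F \<in> black P then k else l) \<and>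
   (F \<in> white P \<longrightarrow> (\<forall>i<l. \<exists>G. across P F (es ! i) G \<and> (if even i then G \<in> black P else G \<in> white P)))" if "F \<in> ?F" for F
 proof (cases "F \<in> black P")
  case True
  then have "F \<notin> white P" using col by blast
  then show ?thesis using bwB[OF True] True by simp
 next
  case False
  then have "F \<in> white P" using col that by blast
  then show ?thesis using bwW[of F] False by (simp only: if_False) blast
 qed
 then obtain es where es: "\<And>F. F \<in> ?F ==> boundary_walk P F (es F)" "\<And>F. F \<in> ?F ==> length (es F) = (if F \<in> black P then k else l)"
  "\<And>F i. F \<in> white P ==> i < l ==> \<exists>G. across P F (es F ! i) G \<and> (if even i then G \<in> black P else G \<in> white P)"
  using col by (metis UnCI)
 have "\<exists>h d. continuous_on (cball 0 1) h \<and> inj_on h (ball 0 1) \<and> h ` ball 0 1 = F \<and>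
  (\<forall>i<length (es F). \<forall>t\<in>{0..1}. h (pt (length (es F)) (real i + t)) = g (es F ! i) (if d i then t else 1 - t))" if "F \<in> ?F" for F
  by (rule normalised_boundary_walk[OF es(1)[OF that]]) (use g in blast)+
 then obtain h d where h: "\<And>F. F \<in> ?F ==> continuous_on (cball 0 1) (h F)" "\<And>F. F \<in> ?F ==> inj_on (h F) (ball 0 1)"
  "\<And>F. F \<in> ?F ==> h F ` ball 0 1 = F"
  "\<And>F i t. F \<in> ?F ==> i < length (es F) ==> t \<in> {0..1} ==> h F (pt (length (es F)) (real i + t)) = g (es F ! i) (if d F i then t else 1 - t)"
  by metis
 have esE: "es F ! i \<in> ?E" if "F \<in> ?F" "i < length (es F)" for F i
  using es(1)[OF that(1)] that(2) by (auto simp: boundary_walk_def)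
 have pos: "0 < length (es F)" if "F \<in> ?F" for F using es(1)[OF that] by (simp add: boundary_walk_def)
 have ecl: "es F ! i \<subseteq> closure F" if F: "F \<in> ?F" "i < length (es F)" for F i
 proof -
  have "h F ` closure (ball 0 1) \<subseteq> closure (h F ` ball 0 1)"
   by (rule image_closure_subset[OF _ closed_closure closure_subset]) (use h(1)[OF F(1)] in simp)
  then have sub: "h F ` cball 0 1 \<subseteq> closure F" using h(3)[OF F(1)] by simp
  show ?thesis
  proof
   fix x assume "x \<in> es F ! i"
   then obtain u where u: "0 < u" "u < 1" "x = g (es F ! i) u" using g[OF esE[OF F]] by (metis greaterThanLessThan_iff imageE)
   then have "x = h F (pt (length (es F)) (real i + (if d F i then u else 1 - u)))" using h(4)[OF F, of "if d F i then u else 1 - u"] by auto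
   then show "x \<in> closure F" using sub by auto
  qed
 qed
 have acr: "\<exists>G. across P F (es F ! i) G" if F: "F \<in> ?F" "i < length (es F)" for F i
 proof (cases "F \<in> black P")
  case True
  then show ?thesis using acB[OF _ esE[OF F] ecl[OF F]] by blast
 next
  case False
  then have "F \<in> white P" using F col by blast
  then show ?thesis using es(3)[of F i] es(2)[OF F(1)] F False by auto
 qed
 have finF: "finite ?F"
 proof (rule finite_subset)
  show "?F \<subseteq> (\<Union>e\<in>?E. {F \<in> ?F. es F ! 0 = e})" using esE pos by blast
  have "finite {F \<in> ?F. es F ! 0 = e}" for e
  proof (cases "{F \<in> ?F. es F ! 0 = e} = {}")
   case False
   then obtain F where F: "F \<in> ?F" "es F ! 0 = e" by blast
   then obtain G where "across P F e G" using acr[of F 0] pos[of F] by blast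
   then have "{H \<in> ?F. e \<subseteq> closure H} = {F, G}" by (simp add: across_def)
   then have "finite {H \<in> ?F. e \<subseteq> closure H}" by simp
   moreover have "{F \<in> ?F. es F ! 0 = e} \<subseteq> {H \<in> ?F. e \<subseteq> closure H}" using ecl pos by blast
   ultimately show ?thesis by (rule rev_finite_subset)
  qed (simp del: Collect_empty_eq)
  then show "finite (\<Union>e\<in>?E. {F \<in> ?F. es F ! 0 = e})" using gr(3) by blast
 qed
 have Fne: "?F \<noteq> {}"
 proof
  assume "?F = {}"
  then have S: "S2 = ?V \<union> \<Union>?E" using cov by simp
  have "infinite S2"
  proof
   assume "finite S2"
   moreover have "connected S2" by (simp add: connected_sphere)
   ultimately have "S2 = {} \<or> (\<exists>x. S2 = {x})" using connected_finite_iff_sing by blast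
   moreover have "axis 1 1 \<in> S2" "- axis 1 1 \<in> S2" by (simp_all add: norm_axis_1)
   moreover have "axis 1 1 \<noteq> (- axis 1 1 :: real^3)" by (simp add: vec_eq_iff axis_def)
   ultimately show False by (metis empty_iff singletonD)
  qed
  then obtain e where e: "e \<in> ?E" using S gr(1) by (metis Union_empty equals0I finite_Un finite.emptyI)
  have "closed (?V \<union> \<Union>(?E - {e}))"
  proof -
   have "compact (g d ` {0..1})" if "d \<in> ?E" for d using g[OF that] by (intro compact_continuous_image) auto
   then have "compact (?V \<union> (\<Union>d\<in>?E - {e}. g d ` {0..1}))" using gr(1,3) by (intro compact_Un compact_UN) (auto intro: finite_imp_compact)
   moreover have "?V \<union> (\<Union>d\<in>?E - {e}. g d ` {0..1}) = ?V \<union> \<Union>(?E - {e})"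
   proof -
    have "?V \<union> g d ` {0..1} = ?V \<union> d" if "d \<in> ?E" for d
    proof -
     have "{0..1} = insert 0 (insert 1 {0<..<1::real})" by auto
     then have "g d ` {0..1} = insert (g d 0) (insert (g d 1) d)" using g[OF that] by (metis image_insert)
     then show ?thesis using g[OF that] by auto
    qed
    then show ?thesis by blast
   qed
   ultimately show ?thesis by (metis compact_imp_closed)
  qed
  moreover have "e = S2 - (?V \<union> \<Union>(?E - {e}))"
   using S e g[OF e] gr(5) ES[OF e] by (auto simp: pairwise_def disjnt_iff)
  ultimately have "openin (top_of_set S2) e" by (metis Diff_eq openin_open open_Compl)
  then show False using open_arc_not_openin_S2[of "g e" e] g[OF e] by blast
 qed
 have "football_map ?V ?E ?F g (\<lambda>F. length (es F)) h (\<lambda>F i. es F ! i) d (black P) (white P) k (l div 2)"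
 proof
  show "?V \<inter> \<Union>?E = {}" using g by blast
  show "?V \<inter> \<Union>?F = {}" "\<Union>?E \<inter> \<Union>?F = {}" by (auto simp: faces_def Union_components[symmetric] dest!: in_components_subset)
  show "pairwise disjnt ?F" unfolding faces_def pairwise_def disjnt_def using components_nonoverlap by blast
  show "\<exists>G\<in>white P. {F, G} = {H \<in> faces P. es F ! i \<subseteq> closure H}" if "F \<in> black P" "i < k" for F i
  proof -
   have F: "F \<in> ?F" "i < length (es F)" using that col es(2)[of F] by auto
   then show ?thesis using acB[OF that(1) esE[OF F] ecl[OF F]] by (simp add: across_def)
  qed
  show "\<exists>G. {F, G} = {H \<in> faces P. es F ! i \<subseteq> closure H} \<and> (if even i then G \<in> black P else G \<in> white P)"
   if "F \<in> white P" "i < 2 * (l div 2)" for F i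
   using es(3)[of F i] that kl(3) by (simp add: across_def)
  show "length (es F) = k" if "F \<in> black P" for F
  proof -
   have "F \<in> ?F" using that col by blast
   then show ?thesis using es(2)[of F] that by simp
  qed
  show "length (es F) = 2 * (l div 2)" if "F \<in> white P" for F
  proof -
   have "F \<in> ?F" "F \<notin> black P" using that col by blast+
   then show ?thesis using es(2)[of F] kl(3) by simp
  qed
  show "2 \<le> l div 2" using kl by presburger
 qed (use gr cov g pos h esE finF Fne col kl in auto)
 then show ?thesis by blast
qed

section \<open>Flags and the number of vertices\<close>

context polygonal_map
begin

definition opp :: "(real^3) set => nat => (real^3) set \<times> nat"
 where "opp F i = (SOME s. s \<in> sides_of (es F i) \<and> s \<noteq> (F, i))"

lemma opp:
 assumes "F \<in> Fs" "i < n F"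
 shows "opp F i \<in> sides_of (es F i)" "opp F i \<noteq> (F, i)" "sides_of (es F i) = {(F, i), opp F i}"
proof -
 have s: "(F, i) \<in> sides_of (es F i)" using assms by (simp add: sides_of_def)
 obtain a b where ab: "a \<noteq> b" "sides_of (es F i) = {a, b}" using sides_of_card2[OF es_E[OF assms]] by blast
 then have "\<exists>t. t \<in> sides_of (es F i) \<and> t \<noteq> (F, i)" by blast
 then have *: "opp F i \<in> sides_of (es F i) \<and> opp F i \<noteq> (F, i)" unfolding opp_def by (rule someI_ex)
 then show "opp F i \<in> sides_of (es F i)" "opp F i \<noteq> (F, i)" by auto
 have "(F, i) \<in> {a, b}" "opp F i \<in> {a, b}" using * s ab(2) by auto
 then show "sides_of (es F i) = {(F, i), opp F i}" unfolding ab(2) using * by auto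
qed

lemma opp_es:
 assumes "F \<in> Fs" "i < n F" "opp F i = (G, j)"
 shows "G \<in> Fs" "j < n G" "es G j = es F i" "opp G j = (F, i)"
proof -
 show 1: "G \<in> Fs" "j < n G" "es G j = es F i" using opp(1)[OF assms(1,2)] assms(3) by (auto simp: sides_of_def)
 show "opp G j = (F, i)" using opp[OF 1(1,2)] opp[OF assms(1,2)] 1(3) assms(3) by auto
qed

definition flags :: "((real^3) set \<times> nat \<times> bool) set"
 where "flags = {(F, i, b). F \<in> Fs \<and> i < n F}"

text \<open>
  The three involutions \<open>rv\<close>, \<open>cr\<close> and \<open>ac\<close> pass from a flag to the other end
  of its side, to the other side at its corner, and across its edge. So \<open>ac \<circ> cr\<close> turns around the
  vertex \<open>vx\<close> by one corner.
\<close>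

fun rv :: "(real^3) set \<times> nat \<times> bool => (real^3) set \<times> nat \<times> bool"
 where "rv (F, i, b) = (F, i, \<not> b)"

fun cr :: "(real^3) set \<times> nat \<times> bool => (real^3) set \<times> nat \<times> bool"
 where "cr (F, i, b) = (if b then (F, (i + 1) mod n F, False) else (F, (i + n F - 1) mod n F, True))"

fun ac :: "(real^3) set \<times> nat \<times> bool => (real^3) set \<times> nat \<times> bool"
 where "ac (F, i, b) = (case opp F i of (G, j) => (G, j, b = (dr F i = dr G j)))"

fun ed :: "(real^3) set \<times> nat \<times> bool => (real^3) set"
 where "ed (F, i, b) = es F i"

fun vx :: "(real^3) set \<times> nat \<times> bool => real^3"
 where "vx (F, i, b) = g (es F i) (if b = dr F i then 1 else 0)"

lemma finite_flags: "finite flags"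
proof (rule finite_subset)
 show "flags \<subseteq> (SIGMA F:Fs. {..<n F} \<times> UNIV)" by (auto simp: flags_def)
qed (use finF in auto)

lemma mod_less_double: "(x::nat) < 2 * N ==> x mod N = (if x < N then x else x - N)"
 by (simp add: mod_if)

lemma rv_flags [simp]: "rv x \<in> flags \<longleftrightarrow> x \<in> flags" by (cases x) (auto simp: flags_def)
lemma rv_rv [simp]: "rv (rv x) = x" by (cases x) auto

lemma cr_flags [simp]: "x \<in> flags ==> cr x \<in> flags"
 by (cases x) (auto simp: flags_def n_pos)

lemma cr_cr [simp]: "x \<in> flags ==> cr (cr x) = x"
 by (cases x) (auto simp: flags_def mod_less_double)

lemma cr_neq: "cr x \<noteq> x" by (cases x) auto

lemma ac_cases:
 assumes "x \<in> flags"
 obtains F i b G j where "x = (F, i, b)" "F \<in> Fs" "i < n F" "opp F i = (G, j)" "G \<in> Fs" "j < n G" "es G j = es F i"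
  "opp G j = (F, i)" "ac x = (G, j, b = (dr F i = dr G j))"
proof -
 obtain F i b where x: "x = (F, i, b)" by (metis prod_cases3)
 obtain G j where o: "opp F i = (G, j)" by (cases "opp F i")
 have F: "F \<in> Fs" "i < n F" using assms x by (auto simp: flags_def)
 have "ac x = (G, j, b = (dr F i = dr G j))" using o x by simp
 then show ?thesis using that[OF x F o] opp_es[OF F o] by blast
qed

lemma ac_flags [simp]: "x \<in> flags ==> ac x \<in> flags"
 by (erule ac_cases) (simp add: flags_def)

lemma ac_ac [simp]: "x \<in> flags ==> ac (ac x) = x"
 by (erule ac_cases) (simp, blast)

lemma ac_neq: "x \<in> flags ==> ac x \<noteq> x"
 using opp(2) by (cases x) (fastforce simp: flags_def split: prod.splits)

lemma ac_rv: "ac (rv x) = rv (ac x)" by (cases x) (auto split: prod.splits)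

lemma ed_rv [simp]: "ed (rv x) = ed x" by (cases x) auto
lemma ed_ac [simp]: "x \<in> flags ==> ed (ac x) = ed x"
 by (erule ac_cases) simp

lemma ed_E: "x \<in> flags ==> ed x \<in> E" using es_E by (cases x) (auto simp: flags_def)

lemma vx_ac [simp]: "x \<in> flags ==> vx (ac x) = vx x"
 by (erule ac_cases) auto

lemma vx_h: "(F, i, b) \<in> flags ==> vx (F, i, b) = h F (pt (n F) (real i + of_bool b))"
 using h_side[of F i "of_bool b"] by (auto simp: flags_def)

lemma vx_cr [simp]: assumes "x \<in> flags" shows "vx (cr x) = vx x"
proof (cases x)
 case (fields F i b)
 then have F: "F \<in> Fs" "i < n F" using assms by (auto simp: flags_def)
 show ?thesis
 proof (cases b)
  case True
  have "((F, (i + 1) mod n F, False)) \<in> flags" using F n_pos by (simp add: flags_def)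
  then show ?thesis using vx_h[of F "(i + 1) mod n F" False] vx_h[of F i b] assms True pt_corner[of "n F" i] F n_pos
   by (simp add: fields)
 next
  case False
  let ?j = "(i + n F - 1) mod n F"
  have j: "(F, ?j, True) \<in> flags" using F n_pos by (simp add: flags_def)
  have "pt (n F) (real ?j + 1) = pt (n F) (real ((?j + 1) mod n F) + 0)" using pt_corner[of "n F" ?j] F n_pos by simp
  moreover have "(?j + 1) mod n F = i" using F by (auto simp: mod_less_double)
  ultimately show ?thesis using vx_h[of F ?j True] vx_h[of F i b] assms False j by (simp add: fields)
 qed
qed

lemma vx_V: "x \<in> flags ==> vx x \<in> V"
 using g_ends es_E by (cases x) (auto simp: flags_def)

lemma vx_ends: "x \<in> flags ==> {vx x, vx (rv x)} = {g (ed x) 0, g (ed x) 1}"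
 by (cases x) auto

lemma flags_of_edge:
 assumes x: "x \<in> flags" and y: "y \<in> flags" and e: "ed y = ed x"
 shows "y \<in> {x, rv x, ac x, ac (rv x)}"
proof -
 obtain F i b G j c where xy: "x = (F, i, b)" "y = (G, j, c)" by (metis prod_cases3)
 have "F \<in> Fs" "i < n F" "(G, j) \<in> sides_of (es F i)" using x y e xy by (auto simp: flags_def sides_of_def)
 then have "(G, j) \<in> {(F, i), opp F i}" using opp(3) by blast
 then show ?thesis using xy by (cases "opp F i") auto
qed

lemma tree_end:
 assumes "tree W T" "v \<in> W" "W \<noteq> {v}" shows "\<exists>e\<in>T. v \<in> {g e 0, g e 1}"
 using assms
proof induction
 case (step W T e a b)
 then show ?case by (cases "v \<in> {a, b}") auto
qed simp

lemma vertex_has_flag: assumes v: "v \<in> V" shows "\<exists>x\<in>flags. vx x = v"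
proof -
 obtain T where T: "tree V T" using spanning_tree by blast
 have "\<exists>e\<in>E. v \<in> {g e 0, g e 1}"
 proof (cases "V = {v}")
  case True
  obtain F where "F \<in> Fs" using Fs_ne by blast
  then have "es F 0 \<in> E" using es_E n_pos by simp
  then show ?thesis using g_ends True by (metis insertI1 singletonD)
 next
  case False
  then show ?thesis using tree_end[OF T v] tree_props[OF T] by blast
 qed
 then obtain e where e: "e \<in> E" "v \<in> {g e 0, g e 1}" by blast
 obtain F i where s: "(F, i) \<in> sides_of e" using side_exists[OF e(1)] by auto
 then have fl: "(F, i, True) \<in> flags" "ed (F, i, True) = e" by (auto simp: sides_of_def flags_def)
 then have "v \<in> {vx (F, i, True), vx (rv (F, i, True))}" using vx_ends[OF fl(1)] e(2) by simp
 then show ?thesis using fl(1) rv_flags by blast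
qed

lemma orbit_Suc: "((ac \<circ> cr) ^^ Suc j) x = ac (cr (((ac \<circ> cr) ^^ j) x))" by (simp add: comp_def)

lemma reflection_neq: "x \<in> flags ==> cr (((ac \<circ> cr) ^^ j) x) \<noteq> x"
proof (induction j arbitrary: x rule: nat_less_induct)
 case (1 j)
 have fl: "((ac \<circ> cr) ^^ i) y \<in> flags" if "y \<in> flags" for i y using that by (induction i) auto
 consider "j = 0" | "j = 1" | j' where "j = Suc (Suc j')" by (metis One_nat_def not0_implies_Suc)
 then show ?case
 proof cases
  case 1 then show ?thesis using cr_neq by simp
 next
  case 2
  show ?thesis
  proof
   assume "cr (((ac \<circ> cr) ^^ j) x) = x"
   then have "ac (cr x) = cr x" using 2 \<open>x \<in> flags\<close> by (metis One_nat_def ac_flags comp_apply cr_cr cr_flags funpow_0 funpow_simps_right(2))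
   then show False using ac_neq \<open>x \<in> flags\<close> by simp
  qed
 next
  case 3
  show ?thesis
  proof
   assume a: "cr (((ac \<circ> cr) ^^ j) x) = x"
   let ?w = "ac (cr x)"
   have w: "?w \<in> flags" "ac ?w = cr x" using \<open>x \<in> flags\<close> by auto
   have "((ac \<circ> cr) ^^ j) x = cr x" using a fl[OF \<open>x \<in> flags\<close>] by (metis cr_cr)
   moreover have "((ac \<circ> cr) ^^ j) x = ac (cr (((ac \<circ> cr) ^^ j') ?w))"
    unfolding 3 by (metis comp_apply funpow.simps(2) funpow_swap1)
   ultimately have "cr (((ac \<circ> cr) ^^ j') ?w) = ?w" using w fl[OF w(1)] by (metis ac_ac cr_flags)
   then show False using "1.IH" 3 w(1) by auto
  qed
 qed
qed

end

context football_map
begin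

text \<open>The three kinds of flags: black faces, and white faces at edges to black and to white faces.\<close>

fun ty :: "(real^3) set \<times> nat \<times> bool => nat"
 where "ty (F, i, b) = (if F \<in> Bl then 0 else if even i then 1 else 2)"

lemma ty_less: "ty x < 3" by (cases x) auto

lemma ty_rv [simp]: "ty (rv x) = ty x" by (cases x) auto

lemma in_Fs: "F \<in> Fs \<longleftrightarrow> F \<in> Bl \<or> F \<in> Wh" using Fs_BW by blast
lemma not_both: "F \<in> Wh ==> F \<notin> Bl" using BW by blast

lemma opp_face_in:
 assumes "F \<in> Fs" "i < n F" "opp F i = (G, j)" shows "{H \<in> Fs. es F i \<subseteq> closure H} = {F, G}"
proof -
 have "{H \<in> Fs. es F i \<subseteq> closure H} = {H \<in> Fs. \<exists>j. (H, j) \<in> sides_of (es F i)}"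
  using edge_in_closure_iff es_E[OF assms(1,2)] by blast
 also have "\<dots> = {F, G}" using opp(3)[OF assms(1,2)] assms opp_es(1)[OF assms] by auto
 finally show ?thesis .
qed

lemma opp_ty:
 assumes "F \<in> Fs" "i < n F" "opp F i = (G, j)"
 shows "ty (G, j, c) = (if ty (F, i, b) = 0 then 1 else if ty (F, i, b) = 1 then 0 else 2)"
proof -
 note G = opp_es[OF assms]
 have disj: "X \<in> Bl ==> X \<notin> Wh" for X using BW by blast
 have white: "G' \<in> Wh" if "opp F' i' = (G', j')" "F' \<in> Bl" "i' < n F'" for F' i' G' j'
 proof -
  have "F' \<in> Fs" using Fs_BW that by blast
  then have "{H \<in> Fs. es F' i' \<subseteq> closure H} = {F', G'}" using opp_face_in that by blast
  moreover obtain H where "H \<in> Wh" "{F', H} = {H \<in> Fs. es F' i' \<subseteq> closure H}" using across_Bl[of F' i'] \<open>F' \<in> Bl\<close> \<open>i' < n F'\<close> n_Bl[of F'] by auto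
  ultimately show ?thesis using that(2) disj by (metis doubleton_eq_iff)
 qed
 have Wh: "if even i' then G' \<in> Bl else G' \<in> Wh" if "opp F' i' = (G', j')" "F' \<in> Wh" "i' < n F'" for F' i' G' j'
 proof -
  have "F' \<in> Fs" using Fs_BW that by blast
  then have "{H \<in> Fs. es F' i' \<subseteq> closure H} = {F', G'}" using opp_face_in that by blast
  moreover obtain H where "{F', H} = {H \<in> Fs. es F' i' \<subseteq> closure H}" "if even i' then H \<in> Bl else H \<in> Wh"
   using across_Wh[of F' i'] \<open>F' \<in> Wh\<close> \<open>i' < n F'\<close> n_Wh[of F'] by auto
  ultimately have "{F', H} = {F', G'}" by simp
  then have "H = G'" by (auto simp: doubleton_eq_iff)
  then show ?thesis using \<open>if even i' then H \<in> Bl else H \<in> Wh\<close> by (simp only:)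
 qed
 consider "F \<in> Bl" | "F \<in> Wh" "even i" | "F \<in> Wh" "odd i" using assms Fs_BW by blast
 then show ?thesis
 proof cases
  case 1
  then have GW: "G \<in> Wh" using white assms by blast
  then have "even j" using Wh[OF G(4) GW G(2)] disj 1 by (metis (full_types))
  then show ?thesis using 1 GW disj by auto
 next
  case 2
  then have "G \<in> Bl" using Wh[OF assms(3) 2(1) assms(2)] by simp
  then show ?thesis using 2 disj by auto
 next
  case 3
  then have GW: "G \<in> Wh" using Wh[OF assms(3) 3(1) assms(2)] by simp
  then have "odd j" using Wh[OF G(4) GW G(2)] disj 3 by (metis (full_types))
  then show ?thesis using 3 GW disj by auto
 qed
qed

lemma ty_ac: "x \<in> flags ==> ty (ac x) = (if ty x = 0 then 1 else if ty x = 1 then 0 else 2)"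
 by (erule ac_cases) (simp only: opp_ty)

lemma ty_cr: assumes "x \<in> flags" shows "ty (cr x) = (if ty x = 0 then 0 else if ty x = 1 then 2 else 1)"
proof (cases x)
 case (fields F i b)
 then have F: "F \<in> Fs" "i < n F" using assms by (auto simp: flags_def)
 show ?thesis
 proof (cases "F \<in> Bl")
  case False
  then have "n F = 2 * m" using F Fs_BW n_Wh by blast
  then have "even (n F)" by simp
  moreover have "0 < n F" using F by simp
  ultimately have "even (i + n F - 1) \<longleftrightarrow> odd i" by presburger
  moreover have "even (x mod n F) \<longleftrightarrow> even x" for x using \<open>even (n F)\<close> by (rule dvd_mod_iff)
  ultimately have "even ((i + 1) mod n F) \<longleftrightarrow> odd i" "even ((i + n F - 1) mod n F) \<longleftrightarrow> odd i"
   by simp_all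
  then show ?thesis using False by (simp add: fields)
 qed (simp add: fields)
qed

lemma ty_step: "x \<in> flags ==> ty (ac (cr x)) = (ty x + 1) mod 3"
proof -
 assume x: "x \<in> flags"
 have "ty x = 0 \<or> ty x = 1 \<or> ty x = 2" using ty_less[of x] by linarith
 then show ?thesis using ty_cr[OF x] ty_ac[OF cr_flags[OF x]] by (auto simp del: ac.simps cr.simps ty.simps)
qed

lemma orbit_flags: "x \<in> flags ==> ((ac \<circ> cr) ^^ j) x \<in> flags"
 by (induction j) auto

lemma orbit_vx: "x \<in> flags ==> vx (((ac \<circ> cr) ^^ j) x) = vx x"
 by (induction j) (simp_all add: orbit_flags)

lemma orbit_ty: "x \<in> flags ==> ty (((ac \<circ> cr) ^^ j) x) = (ty x + j) mod 3"
proof (induction j)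
 case 0 then show ?case using ty_less[of x] by simp
next
 case (Suc j)
 have "ty (((ac \<circ> cr) ^^ Suc j) x) = (ty (((ac \<circ> cr) ^^ j) x) + 1) mod 3" 
  using ty_step[OF orbit_flags[OF Suc.prems, of j]] by (simp only: funpow.simps comp_apply)
 also have "\<dots> = ((ty x + j) mod 3 + 1) mod 3" by (simp only: Suc.IH[OF Suc.prems])
 also have "\<dots> = (ty x + Suc j) mod 3" by (simp add: mod_simps)
 finally show ?case .
qed

lemma orbit_reaches: assumes "x \<in> flags" "c < 3" obtains j where "ty (((ac \<circ> cr) ^^ j) x) = c"
proof -
 have "(ty x + (c + 3 - ty x)) mod 3 = c" using assms ty_less[of x] by simp
 then show ?thesis using that[of "c + 3 - ty x"] orbit_ty[OF assms(1)] by simp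
qed

lemma type_exists: assumes "c < 3" obtains x where "x \<in> flags" "ty x = c"
proof -
 obtain v where "v \<in> V" using V_nonempty by blast
 then obtain x where "x \<in> flags" using vertex_has_flag by blast
 then show ?thesis using orbit_reaches[OF _ assms] orbit_flags that by metis
qed

lemma finB: "finite Bl" and finW: "finite Wh" using finF Fs_BW by auto

definition black_flags where "black_flags = {x \<in> flags. ty x = 0}"

lemma card_black_flags: "card black_flags = 2 * (k * card Bl)"
proof -
 have "black_flags = Bl \<times> ({..<k} \<times> UNIV)"
  using n_Bl by (auto simp: black_flags_def flags_def in_Fs split: if_splits)
 then show ?thesis using finB by (simp add: card_cartesian_product)
qed

text \<open>
  Turning around a vertex leads through all types, so there is a black corner, and it has two flags.
\<close>

lemma black_fibre:
 assumes "v \<in> V" obtains x where "x \<in> black_flags" "vx x = v" "cr x \<in> black_flags" "vx (cr x) = v" "cr x \<noteq> x"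
proof -
 obtain y where y: "y \<in> flags" "vx y = v" using vertex_has_flag[OF assms] by blast
 obtain j where j: "ty (((ac \<circ> cr) ^^ j) y) = 0" using orbit_reaches[OF y(1), of 0] by auto
 let ?x = "((ac \<circ> cr) ^^ j) y"
 have "?x \<in> flags" "vx ?x = v" using orbit_flags y orbit_vx by auto
 then show ?thesis using that[of ?x] j ty_cr[of ?x] cr_neq by (simp add: black_flags_def)
qed

lemma card_black_flags_fibres: "(\<Sum>v\<in>V. card {x \<in> black_flags. vx x = v}) = 2 * (k * card Bl)"
proof -
 have "finite black_flags" by (simp add: black_flags_def finite_flags)
 moreover have "vx ` black_flags \<subseteq> V" using vx_V by (auto simp: black_flags_def)
 ultimately show ?thesis using sum.group[of black_flags V vx "\<lambda>_. 1::nat"] finV card_black_flags by simp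
qed

lemma fibre_ge2: assumes "v \<in> V" shows "2 \<le> card {x \<in> black_flags. vx x = v}"
proof -
 obtain x where x: "x \<in> black_flags" "vx x = v" "cr x \<in> black_flags" "vx (cr x) = v" "cr x \<noteq> x" using black_fibre[OF assms] .
 have "card {x, cr x} \<le> card {x \<in> black_flags. vx x = v}"
  by (rule card_mono) (use x finite_flags in \<open>auto simp: black_flags_def\<close>)
 then show ?thesis using x(5) by simp
qed

lemma card_V_le: "card V \<le> k * card Bl"
proof -
 have "(\<Sum>v\<in>V. 2) \<le> (\<Sum>v\<in>V. card {x \<in> black_flags. vx x = v})" by (rule sum_mono) (rule fibre_ge2)
 then show ?thesis using card_black_flags_fibres by simp
qed

text \<open>
  Every vertex then has exactly two black flags. A turn around the vertex meets a black flag at every third step, and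
  since turning never leads from a flag to the other flag of its corner, it closes after three steps.
\<close>

lemma cubic_if_card_V_eq:
 assumes eq: "card V = k * card Bl" and x: "x \<in> flags"
 shows "((ac \<circ> cr) ^^ 3) x = x"
proof -
 have two: "card {x \<in> black_flags. vx x = v} = 2" if v: "v \<in> V" for v
 proof (rule ccontr)
  assume "card {x \<in> black_flags. vx x = v} \<noteq> 2"
  then have "2 < card {x \<in> black_flags. vx x = v}" using fibre_ge2[OF v] by simp
  then have "(\<Sum>v\<in>V. 2) < (\<Sum>v\<in>V. card {x \<in> black_flags. vx x = v})"
   using v fibre_ge2 finV by (intro sum_strict_mono_ex1) auto
  then show False using card_black_flags_fibres eq by simp
 qed
 have black: "((ac \<circ> cr) ^^ 3) y = y" if y: "y \<in> black_flags" for y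
 proof -
  have yf: "y \<in> flags" using y by (simp add: black_flags_def)
  let ?z = "((ac \<circ> cr) ^^ 3) y"
  let ?S = "{x \<in> black_flags. vx x = vx y}"
  have "?z \<in> ?S" using orbit_flags[OF yf] orbit_ty[OF yf, of 3] orbit_vx[OF yf] y by (simp add: black_flags_def)
  moreover have "cr y \<in> ?S" "y \<in> ?S" using y ty_cr[OF yf] yf by (auto simp: black_flags_def)
  moreover have "{y, cr y} = ?S"
   by (rule card_subset_eq) (use two[OF vx_V[OF yf]] finite_flags cr_neq[of y] \<open>cr y \<in> ?S\<close> y in \<open>auto simp: black_flags_def\<close>)
  ultimately have "?z = y \<or> ?z = cr y" by blast
  moreover have "?z \<noteq> cr y"
  proof
   assume "?z = cr y"
   then have "cr ?z = y" using yf by simp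
   then show False using reflection_neq[OF yf] by blast
  qed
  ultimately show ?thesis by blast
 qed
 obtain j where j: "ty (((ac \<circ> cr) ^^ j) x) = 0" using orbit_reaches[OF x, of 0] by auto
 let ?y = "((ac \<circ> cr) ^^ j) x"
 have "((ac \<circ> cr) ^^ 3) ?y = ?y" using black orbit_flags[OF x] j by (simp add: black_flags_def)
 then have "((ac \<circ> cr) ^^ j) (((ac \<circ> cr) ^^ 3) x) = ((ac \<circ> cr) ^^ j) x"
 proof -
  have "(((ac \<circ> cr) ^^ j) \<circ> ((ac \<circ> cr) ^^ 3)) x = (((ac \<circ> cr) ^^ 3) \<circ> ((ac \<circ> cr) ^^ j)) x"
   by (simp only: funpow_add[symmetric] add.commute)
  then show ?thesis using \<open>((ac \<circ> cr) ^^ 3) ?y = ?y\<close> by (simp only: comp_apply)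
 qed
 moreover have inj: "a = b" if "a \<in> flags" "b \<in> flags" "((ac \<circ> cr) ^^ j) a = ((ac \<circ> cr) ^^ j) b" for a b j
  using that(3)
 proof (induction j)
  case (Suc j)
  have "ac (cr (((ac \<circ> cr) ^^ j) a)) = ac (cr (((ac \<circ> cr) ^^ j) b))" using Suc.prems by (simp only: orbit_Suc)
  then have "ac (ac (cr (((ac \<circ> cr) ^^ j) a))) = ac (ac (cr (((ac \<circ> cr) ^^ j) b)))" by (simp only:)
  then have "cr (cr (((ac \<circ> cr) ^^ j) a)) = cr (cr (((ac \<circ> cr) ^^ j) b))"
   using orbit_flags that(1,2) by (simp only: ac_ac cr_flags)
  then have "((ac \<circ> cr) ^^ j) a = ((ac \<circ> cr) ^^ j) b"
   using orbit_flags that(1,2) by (simp only: cr_cr)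
  then show ?case using Suc.IH by blast
 qed simp
 ultimately show ?thesis using orbit_flags[OF x] x by blast
qed

lemma card_sides: "2 * card E = k * card Bl + 2 * m * card Wh"
proof -
 let ?S = "SIGMA F:Fs. {..<n F}"
 have fin: "finite ?S" using finF by auto
 have sub: "(\<lambda>(F, i). es F i) ` ?S \<subseteq> E" using es_E by auto
 have "card {s \<in> ?S. (\<lambda>(F, i). es F i) s = e} = 2" if e: "e \<in> E" for e
 proof -
  have "{s \<in> ?S. (\<lambda>(F, i). es F i) s = e} = sides_of e" by (auto simp: sides_of_def)
  moreover obtain a b where "a \<noteq> b" "sides_of e = {a, b}" using sides_of_card2[OF e] by blast
  ultimately show ?thesis by simp
 qed
 then have "(\<Sum>e\<in>E. card {s \<in> ?S. (\<lambda>(F, i). es F i) s = e}) = 2 * card E" by simp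
 then have "card ?S = 2 * card E"
  using sum.group[OF fin finE sub, of "\<lambda>_. 1::nat"] by simp
 moreover have "card ?S = (\<Sum>F\<in>Fs. n F)" using finF by simp
 moreover have "(\<Sum>F\<in>Fs. n F) = (\<Sum>F\<in>Bl. n F) + (\<Sum>F\<in>Wh. n F)"
  unfolding Fs_BW by (rule sum.union_disjoint[OF finB finW BW])
 moreover have "(\<Sum>F\<in>Bl. n F) = k * card Bl" "(\<Sum>F\<in>Wh. n F) = 2 * m * card Wh" using n_Bl n_Wh by simp_all
 ultimately show ?thesis by simp
qed

lemma card_black_white: "k * card Bl = m * card Wh"
proof -
 let ?A = "{x \<in> flags. ty x = 0}" and ?B = "{x \<in> flags. ty x = 1}"
 have "bij_betw ac ?A ?B"
  by (rule bij_betw_byWitness[where f'=ac]) (use ty_ac in \<open>auto simp del: ac.simps ty.simps\<close>)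
 then have "card ?A = card ?B" by (rule bij_betw_same_card)
 moreover have "card ?B = 2 * (m * card Wh)"
 proof -
  have "?B = Wh \<times> ((\<lambda>j. 2 * j) ` {..<m} \<times> UNIV)"
  proof (intro set_eqI iffI)
   fix x assume "x \<in> ?B"
   then obtain F i b where x: "x = (F, i, b)" "F \<in> Wh" "i < 2 * m" "even i"
    using n_Wh by (cases x) (auto simp: flags_def in_Fs split: if_splits)
   then obtain j where "i = 2 * j" "j < m" by auto
   then show "x \<in> Wh \<times> ((\<lambda>j. 2 * j) ` {..<m} \<times> UNIV)" using x by auto
  next
   fix x assume "x \<in> Wh \<times> ((\<lambda>j. 2 * j) ` {..<m} \<times> (UNIV :: bool set))"
   then show "x \<in> ?B" using n_Wh not_both by (auto simp: flags_def in_Fs)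
  qed
  moreover have "card ((\<lambda>j. 2 * j) ` {..<m}) = m" by (simp add: card_image inj_on_def)
  ultimately show ?thesis using finW by (simp add: card_cartesian_product)
 qed
 ultimately show ?thesis using card_black_flags by (simp add: black_flags_def)
qed

lemma card_edges: "2 * card E = 3 * (k * card Bl)"
 using card_sides card_black_white by simp

lemma card_Fs: "card Fs = card Bl + card Wh"
 unfolding Fs_BW by (rule card_Un_disjoint[OF finB finW BW])

theorem black_count_bound: "k * card Bl + 4 \<le> 2 * (card Bl + card Wh)"
proof -
 define b where "b = k * card Bl"
 show ?thesis using Euler_inequality card_edges card_V_le card_Fs unfolding b_def[symmetric] by presburger
qed

theorem card_V_eq:
 assumes "2 * (card Bl + card Wh) \<le> k * card Bl + 4" shows "card V = k * card Bl"
proof -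
 define b where "b = k * card Bl"
 show ?thesis using Euler_inequality card_edges card_V_le card_Fs assms unfolding b_def[symmetric] by presburger
qed

end

section \<open>Placing one pattern over another\<close>

text \<open>
  The map \<open>P\<close> is to be spread over the map \<open>Q\<close>, all vertices of which have three corners.
\<close>

locale two_football_maps =
 P: football_map V E Fs g n h es dr Bl Wh k m + Q: football_map V' E' Fs' g' n' h' es' dr' Bl' Wh' k m
 for V E Fs g n h es dr Bl Wh V' E' Fs' g' n' h' es' dr' Bl' Wh' k m +
 assumes cubic: "\<And>y. y \<in> Q.flags ==> ((Q.ac \<circ> Q.cr) ^^ 3) y = y"
begin

text \<open>
  A triple \<open>(F', \<epsilon>, a)\<close> describes a placement of a face \<open>F\<close> on the face
  \<open>F'\<close>: its orientation \<open>\<epsilon>\<close> and the side \<open>a\<close> that receives side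
  \<open>0\<close>. For white faces \<open>a\<close> has to be even, so that sides towards black faces go to such
  sides. The function \<open>gm\<close> below is the effect of the placement on flags.
\<close>

definition ok :: "(real^3) set \<times> bool \<times> nat => (real^3) set => bool"
 where "ok q F \<longleftrightarrow> (case q of (F', \<epsilon>, a) => F' \<in> Fs' \<and> a < n F \<and> (F \<in> Bl \<longleftrightarrow> F' \<in> Bl') \<and> (F \<in> Wh \<longrightarrow> even a))"

fun gm :: "(real^3) set \<times> bool \<times> nat => (real^3) set \<times> nat \<times> bool => (real^3) set \<times> nat \<times> bool"
 where "gm (F', \<epsilon>, a) (F, i, b) = (if \<epsilon> then (F', (i + a) mod n F, b) else (F', (a + n F - i) mod n F, \<not> b))"

lemma white_P: "F \<in> Fs ==> F \<in> Wh \<longleftrightarrow> F \<notin> Bl" using P.Fs_BW P.BW by blast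
lemma white_Q: "F \<in> Fs' ==> F \<in> Wh' \<longleftrightarrow> F \<notin> Bl'" using Q.Fs_BW Q.BW by blast

lemma n_eq: "F \<in> Fs ==> F' \<in> Fs' ==> (F \<in> Bl \<longleftrightarrow> F' \<in> Bl') ==> n' F' = n F"
 using P.n_Bl P.n_Wh Q.n_Bl Q.n_Wh white_P white_Q by metis

lemma even_n: "F \<in> Fs ==> F \<notin> Bl ==> even (n F)" using P.n_Wh white_P by simp

lemma gm_props:
 assumes q: "ok q F" and x: "(F, i, b) \<in> P.flags"
 shows "gm q (F, i, b) \<in> Q.flags" "Q.ty (gm q (F, i, b)) = P.ty (F, i, b)"
  "gm q (P.rv (F, i, b)) = Q.rv (gm q (F, i, b))" "gm q (P.cr (F, i, b)) = Q.cr (gm q (F, i, b))"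
proof -
 obtain F' \<epsilon> a where q': "q = (F', \<epsilon>, a)" by (metis prod_cases3)
 have F: "F \<in> Fs" "i < n F" using x by (auto simp: P.flags_def)
 have F': "F' \<in> Fs'" "a < n F" "F \<in> Bl \<longleftrightarrow> F' \<in> Bl'" "F \<notin> Bl ==> even a"
  using q q' F white_P by (auto simp: ok_def)
 have n': "n' F' = n F" using n_eq F F' by blast
 have pos: "0 < n F" using F by simp
 show "gm q (F, i, b) \<in> Q.flags" using F' n' pos by (simp add: q' Q.flags_def)
 show "gm q (P.rv (F, i, b)) = Q.rv (gm q (F, i, b))" by (simp add: q')
 show "Q.ty (gm q (F, i, b)) = P.ty (F, i, b)"
 proof (cases "F \<in> Bl")
  case True then show ?thesis using F' by (simp add: q')
 next
  case False
  then have "even ((i + a) mod n F) \<longleftrightarrow> even i" "even ((a + n F - i) mod n F) \<longleftrightarrow> even i"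
   using even_n[OF F(1)] F F'(4) by (auto simp: dvd_mod_iff)
  then show ?thesis using False F'(3) by (simp add: q')
 qed
 show "gm q (P.cr (F, i, b)) = Q.cr (gm q (F, i, b))"
 proof -
  let ?N = "n F"
  have md: "x mod ?N = (if x < ?N then x else x - ?N)" if "x < 2 * ?N" for x using that by (simp add: mod_if)
  have A: "((i + 1) mod ?N + a) mod ?N = ((i + a) mod ?N + 1) mod ?N" by (simp add: mod_simps)
  have B: "((i + ?N - 1) mod ?N + a) mod ?N = ((i + a) mod ?N + ?N - 1) mod ?N"
  proof -
   have "((i + ?N - 1) mod ?N + a) mod ?N = (i + a + (?N - 1)) mod ?N" using pos by (simp add: mod_simps algebra_simps)
   moreover have "((i + a) mod ?N + ?N - 1) mod ?N = (i + a + (?N - 1)) mod ?N"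
    using pos by (metis Nat.add_diff_assoc One_nat_def Suc_leI mod_add_left_eq)
   ultimately show ?thesis by simp
  qed
  have C: "(a + ?N - (i + 1) mod ?N) mod ?N = ((a + ?N - i) mod ?N + ?N - 1) mod ?N"
  proof (cases "i + 1 < ?N")
   case True
   then have e: "(i + 1) mod ?N = i + 1" by simp
   show ?thesis unfolding e using True F F'(2) by (cases "a + ?N - i < ?N") (auto simp: md)
  next
   case False
   then have e: "i + 1 = ?N" using F by simp
   then have "(i + 1) mod ?N = 0" "a + ?N - i = a + 1" by auto
   then show ?thesis using F'(2) e by (cases "a + 1 < ?N") (auto simp: md)
  qed
  have D: "(a + ?N - (i + ?N - 1) mod ?N) mod ?N = ((a + ?N - i) mod ?N + 1) mod ?N"
  proof (cases "i = 0")
   case True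
   then have "(i + ?N - 1) mod ?N = ?N - 1" "(a + ?N - i) mod ?N = a" "a + ?N - (?N - 1) = a + 1" using pos F'(2) by auto
   then show ?thesis by simp
  next
   case False
   then have e: "(i + ?N - 1) mod ?N = i - 1" using F by (simp add: md)
   have "a + ?N - (i - 1) = (a + ?N - i) + 1" using False F by simp
   then show ?thesis unfolding e by (metis mod_add_left_eq)
  qed
  show ?thesis 
   by (cases b; cases \<epsilon>) (simp_all only: q' gm.simps P.cr.simps Q.cr.simps if_True if_False n' A B C D not_True_eq_False not_False_eq_True)
 qed
qed

text \<open>
  A placement may be prescribed by the image of one flag, provided its type is respected.
\<close>

lemma gm_exists:
 assumes x: "(F, i, b) \<in> P.flags" and y: "y \<in> Q.flags" and t: "Q.ty y = P.ty (F, i, b)"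
 shows "\<exists>q. ok q F \<and> gm q (F, i, b) = y"
proof -
 obtain F' j c where y': "y = (F', j, c)" by (metis prod_cases3)
 have F: "F \<in> Fs" "i < n F" using x by (auto simp: P.flags_def)
 have F': "F' \<in> Fs'" "j < n' F'" using y y' by (auto simp: Q.flags_def)
 have col: "F \<in> Bl \<longleftrightarrow> F' \<in> Bl'" using t by (auto simp: y' split: if_splits)
 have n': "n' F' = n F" using n_eq F F' col by blast
 let ?N = "n F"
 have par: "even i \<longleftrightarrow> even j" if "F \<notin> Bl" using t col that by (auto simp: y' split: if_splits)
 show ?thesis
 proof (cases "b = c")
  case True
  let ?a = "(j + ?N - i) mod ?N"
  have "(i + ?a) mod ?N = (i + (j + ?N - i)) mod ?N" by (simp add: mod_simps)
  also have "\<dots> = j" using F F' n' by simp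
  finally have "gm (F', True, ?a) (F, i, b) = y" using True by (simp add: y')
  moreover have "ok (F', True, ?a) F"
  proof -
   have "even ?a" if "F \<in> Wh"
   proof -
    have "F \<notin> Bl" using that white_P F by blast
    then show ?thesis using par even_n[OF F(1)] F by (auto simp: dvd_mod_iff)
   qed
   then show ?thesis using F F' col by (simp add: ok_def)
  qed
  ultimately show ?thesis by blast
 next
  case False
  let ?a = "(j + i) mod ?N"
  have "(?a + ?N - i) mod ?N = j"
  proof (cases "j + i < ?N")
   case True then show ?thesis using F' n' by simp
  next
   case False
   then have "?a = j + i - ?N" using F F' n' by (simp add: mod_if)
   then show ?thesis using False F' n' by simp
  qed
  then have "gm (F', False, ?a) (F, i, b) = y" using False by (auto simp: y')
  moreover have "ok (F', False, ?a) F"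
  proof -
   have "even ?a" if "F \<in> Wh"
   proof -
    have "F \<notin> Bl" using that white_P F by blast
    then show ?thesis using par even_n[OF F(1)] F by (auto simp: dvd_mod_iff)
   qed
   then show ?thesis using F F' col by (simp add: ok_def)
  qed
  ultimately show ?thesis by blast
 qed
qed

definition ga :: "((real^3) set => (real^3) set \<times> bool \<times> nat) => (real^3) set \<times> nat \<times> bool => (real^3) set \<times> nat \<times> bool"
 where "ga A x = gm (A (fst x)) x"

lemma ga_props:
 assumes "ok (A (fst x)) (fst x)" "x \<in> P.flags"
 shows "ga A x \<in> Q.flags" "Q.ty (ga A x) = P.ty x" "ga A (P.rv x) = Q.rv (ga A x)" "ga A (P.cr x) = Q.cr (ga A x)"
 using gm_props[of "A (fst x)" "fst x" "fst (snd x)" "snd (snd x)"] assms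
 by (cases x; auto simp: ga_def)+

definition consistent :: "((real^3) set => (real^3) set \<times> bool \<times> nat) => (real^3) set => bool"
 where "consistent A e \<longleftrightarrow> (\<forall>x\<in>P.flags. P.ed x = e \<longrightarrow> ga A (P.ac x) = Q.ac (ga A x))"

lemma consistentI:
 assumes x: "x \<in> P.flags" and ok: "ok (A (fst x)) (fst x)" "ok (A (fst (P.ac x))) (fst (P.ac x))"
  and eq: "ga A (P.ac x) = Q.ac (ga A x)"
 shows "consistent A (P.ed x)"
 unfolding consistent_def
proof (intro ballI impI)
 fix y assume y: "y \<in> P.flags" "P.ed y = P.ed x"
 have f: "fst (P.rv z) = fst z" for z by (cases z) auto
 have ax: "P.ac x \<in> P.flags" using x by simp
 have rx: "ga A (P.ac (P.rv x)) = Q.ac (ga A (P.rv x))"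
  using ga_props(3)[of A, OF ok(1) x] ga_props(3)[of A, OF ok(2) ax] eq by (simp add: P.ac_rv Q.ac_rv)
 have bk: "ga A (P.ac (P.ac z)) = Q.ac (ga A (P.ac z))" if "ga A (P.ac z) = Q.ac (ga A z)" "z \<in> P.flags" "ok (A (fst z)) (fst z)" for z
  using that ga_props(1)[of A, OF that(3,2)] by simp
 have "ok (A (fst (P.rv x))) (fst (P.rv x))" using ok(1) f by simp
 then show "ga A (P.ac y) = Q.ac (ga A y)"
  using P.flags_of_edge[OF x y] eq rx bk[OF eq x ok(1)] bk[OF rx] x by auto
qed

text \<open>
  Peel off a leaf of the cotree, place the other faces by induction, and then the leaf across the single edge that
  ties it to them.
\<close>

lemma consistent_off_tree:
 assumes K: "connected (V \<union> \<Union>T)" "T \<subseteq> E"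
 shows "\<exists>A. (\<forall>F\<in>Fs. ok (A F) F) \<and> (\<forall>e\<in>E - T. consistent A e)"
proof -
 have "\<exists>A. (\<forall>F\<in>X. ok (A F) F) \<and> (\<forall>e\<in>B. consistent A e)"
  if "X \<subseteq> Fs" "B \<subseteq> E - T" "\<And>e F i. e \<in> B ==> (F, i) \<in> P.sides_of e ==> F \<in> X" for X B
  using that
 proof (induction "card B" arbitrary: X B)
  case 0
  have "\<exists>q. ok q F" if "F \<in> X" for F
  proof -
   have fl: "(F, 0, True) \<in> P.flags" using that 0 P.n_pos by (auto simp: P.flags_def)
   obtain y where "y \<in> Q.flags" "Q.ty y = P.ty (F, 0, True)" using Q.type_exists P.ty_less by metis
   then show ?thesis using gm_exists[OF fl] by blast
  qed
  then have "\<exists>A. \<forall>F\<in>X. ok (A F) F" by (intro bchoice) blast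
  moreover have "B = {}" using 0 P.finE by (metis Diff_subset card_0_eq finite_subset)
  ultimately show ?case by simp
 next
  case (Suc c)
  have "B \<noteq> {}" using Suc(2) by force
  then obtain e G j where e: "e \<in> B" "(G, j) \<in> P.sides_of e" and leaf: "\<And>e' j'. e' \<in> B ==> (G, j') \<in> P.sides_of e' ==> e' = e \<and> j' = j"
   using P.cotree_leaf[OF K Suc.prems(2)] by metis
  have eE: "e \<in> E" using e Suc.prems by blast
  have fB: "finite B" using Suc.prems(2) P.finE by (meson Diff_subset finite_subset)
  have G: "G \<in> Fs" "j < n G" "es G j = e" using e(2) by (auto simp: P.sides_of_def)
  obtain A where A: "\<forall>F\<in>X - {G}. ok (A F) F" "\<forall>d\<in>B - {e}. consistent A d"
  proof -
   have "\<exists>A. (\<forall>F\<in>X - {G}. ok (A F) F) \<and> (\<forall>d\<in>B - {e}. consistent A d)"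
   proof (rule Suc.hyps(1))
    show "c = card (B - {e})" using Suc.hyps(2) e fB by simp
    show "F \<in> X - {G}" if "d \<in> B - {e}" "(F, i) \<in> P.sides_of d" for d F i using that leaf Suc.prems(3) by blast
   qed (use Suc.prems in auto)
   then show ?thesis using that by blast
  qed
  let ?y = "(G, j, True)"
  have y: "?y \<in> P.flags" "P.ed ?y = e" using G by (auto simp: P.flags_def)
  define x where "x = P.ac ?y"
  have x: "x \<in> P.flags" "P.ac x = ?y" "P.ed x = e" using y by (simp_all add: x_def del: P.ac.simps)
  have fx: "fst x \<noteq> G" "fst x \<in> X"
  proof -
   obtain H k' b where xx: "x = (H, k', b)" by (metis prod_cases3)
   have s: "(H, k') \<in> P.sides_of e" using x xx by (auto simp: P.flags_def P.sides_of_def)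
   then show "fst x \<in> X" using Suc.prems(3) e xx by auto
   have "P.opp G j = (H, k')" using x_def xx by (auto split: prod.splits)
   then have "(H, k') \<noteq> (G, j)" using P.opp(2)[OF G(1,2)] by simp
   then show "fst x \<noteq> G" using leaf[OF e(1)] s xx by auto
  qed
  have okx: "ok (A (fst x)) (fst x)" using A fx by blast
  have "Q.ty (Q.ac (ga A x)) = P.ty ?y"
   using Q.ty_ac[of "ga A x"] P.ty_ac[of x] x ga_props(1,2)[of A, OF okx x(1)] by (simp del: P.ty.simps Q.ty.simps P.ac.simps)
  moreover have "Q.ac (ga A x) \<in> Q.flags" using ga_props(1)[of A, OF okx x(1)] by simp
  ultimately obtain q where q: "ok q G" "gm q ?y = Q.ac (ga A x)" using gm_exists[OF y(1)] by metis
  define A' where "A' = A(G := q)"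
  have okA': "\<forall>F\<in>X. ok (A' F) F" using A(1) q(1) by (simp add: A'_def)
  have same: "ga A' z = ga A z" if "fst z \<noteq> G" for z using that by (simp add: ga_def A'_def)
  have "consistent A' d" if d: "d \<in> B" for d
  proof (cases "d = e")
   case True
   have "consistent A' (P.ed x)"
   proof (rule consistentI[OF x(1)])
    show "ga A' (P.ac x) = Q.ac (ga A' x)" using q(2) same[OF fx(1)] x(2) by (simp add: ga_def A'_def)
    show "ok (A' (fst (P.ac x))) (fst (P.ac x))" using q(1) x(2) by (simp add: A'_def)
   qed (use okA' fx in blast)
   then show ?thesis using x(3) True by simp
  next
   case False
   have off: "fst z \<noteq> G" if "z \<in> P.flags" "P.ed z = d" for z
   proof
    assume "fst z = G"
    then have "(G, fst (snd z)) \<in> P.sides_of d" using that by (cases z) (auto simp: P.flags_def P.sides_of_def)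
    then show False using leaf d False by blast
   qed
   have "consistent A d" using A d False by blast
   then show ?thesis unfolding consistent_def using same off by (metis P.ac_flags P.ed_ac)
  qed
  then show ?case using okA' by blast
 qed
 from this[of Fs "E - T"] show ?thesis by (auto simp: P.sides_of_def)
qed

lemma orbit_period:
 assumes x: "x \<in> P.flags"
 obtains p where "0 < p" "((P.ac \<circ> P.cr) ^^ p) x = x" "\<And>j. 0 < j ==> j < p ==> ((P.ac \<circ> P.cr) ^^ j) x \<noteq> x"
proof -
 let ?f = "P.ac \<circ> P.cr"
 have "\<not> inj_on (\<lambda>j. (?f ^^ j) x) UNIV"
 proof
  assume "inj_on (\<lambda>j. (?f ^^ j) x) UNIV"
  moreover have "finite (range (\<lambda>j. (?f ^^ j) x))"
   by (rule finite_subset[OF _ P.finite_flags]) (use P.orbit_flags[OF x] in auto)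
  ultimately show False using finite_imageD infinite_UNIV_nat by blast
 qed
 then obtain a b where ab: "a < b" "(?f ^^ a) x = (?f ^^ b) x"
  unfolding inj_on_def by (metis linorder_neqE_nat)
 have canc: "y = z" if "y \<in> P.flags" "z \<in> P.flags" "(?f ^^ j) y = (?f ^^ j) z" for y z j
  using that(3)
 proof (induction j)
  case (Suc j)
  have "P.ac (P.cr ((?f ^^ j) y)) = P.ac (P.cr ((?f ^^ j) z))" using Suc.prems by (simp only: P.orbit_Suc)
  then have "P.ac (P.ac (P.cr ((?f ^^ j) y))) = P.ac (P.ac (P.cr ((?f ^^ j) z)))" by (simp only:)
  then have "P.cr (P.cr ((?f ^^ j) y)) = P.cr (P.cr ((?f ^^ j) z))"
   using P.orbit_flags that(1,2) by (simp only: P.ac_ac P.cr_flags)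
  then have "(?f ^^ j) y = (?f ^^ j) z" using P.orbit_flags that(1,2) by (simp only: P.cr_cr)
  then show ?case using Suc.IH by blast
 qed simp
 have "(?f ^^ a) ((?f ^^ (b - a)) x) = (?f ^^ a) x"
 proof -
  have "(?f ^^ (a + (b - a))) x = (?f ^^ a) ((?f ^^ (b - a)) x)" by (simp add: funpow_add)
  then show ?thesis using ab by simp
 qed
 then have ex: "0 < b - a \<and> (?f ^^ (b - a)) x = x" using canc P.orbit_flags[OF x] x ab(1) by auto
 define p where "p = (LEAST j. 0 < j \<and> (?f ^^ j) x = x)"
 have "0 < p \<and> (?f ^^ p) x = x" unfolding p_def by (rule LeastI[of _ "b - a"]) (rule ex)
 moreover have "(?f ^^ j) x \<noteq> x" if "0 < j" "j < p" for j using not_less_Least[of j "\<lambda>j. 0 < j \<and> (?f ^^ j) x = x"] that by (auto simp: p_def)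
 ultimately show ?thesis using that by blast
qed

text \<open>
  Inconsistent edges can only lie in the spanning tree. If there are any, some vertex \<open>v\<close> lies on exactly
  one of them, \<open>e\<close>. Turn around \<open>v\<close>, from one side of \<open>e\<close> to the other: all
  edges crossed are consistent, so the images turn around a vertex of \<open>Q\<close>. The number of steps of a full
  turn is a multiple of three, because of the types, and three steps around a vertex of \<open>Q\<close> lead back; so
  \<open>e\<close> is consistent after all.
\<close>

theorem flag_morphism:
 "\<exists>A. (\<forall>F\<in>Fs. ok (A F) F) \<and> (\<forall>x\<in>P.flags. ga A (P.ac x) = Q.ac (ga A x))"
proof -
 obtain T where T: "P.tree V T" using P.spanning_tree by blast
 note tp = P.tree_props[OF T]
 obtain A where A: "\<forall>F\<in>Fs. ok (A F) F" "\<forall>e\<in>E - T. consistent A e"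
  using consistent_off_tree[of T] tp by blast
 have ok: "ok (A (fst x)) (fst x)" if "x \<in> P.flags" for x using A that by (auto simp: P.flags_def)
 have gp: "ga A y \<in> Q.flags" "Q.ty (ga A y) = P.ty y" "ga A (P.rv y) = Q.rv (ga A y)" "ga A (P.cr y) = Q.cr (ga A y)"
  if "y \<in> P.flags" for y using ga_props[of A y, OF ok[OF that] that] by auto
 let ?B = "{e \<in> E. \<not> consistent A e}"
 have "?B = {}"
 proof (rule ccontr)
  assume ne: "?B \<noteq> {}"
  have BT: "?B \<subseteq> T" using A(2) by blast
  from P.tree_leaf[OF T BT ne] obtain v e where e: "e \<in> ?B" "v \<in> {g e 0, g e 1}" "g e 0 \<noteq> g e 1"
   and leaf: "\<forall>e'\<in>?B. v \<in> {g e' 0, g e' 1} \<longrightarrow> e' = e"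
   by (elim exE conjE)
  have eE: "e \<in> E" using e by simp
  obtain F i where s: "(F, i) \<in> P.sides_of e" using P.side_exists[OF eE] by auto
  have w: "(F, i, True) \<in> P.flags" "P.ed (F, i, True) = e" using s by (auto simp: P.flags_def P.sides_of_def)
  have "v \<in> {P.vx (F, i, True), P.vx (P.rv (F, i, True))}" using P.vx_ends[OF w(1)] w(2) e(2) by simp
  then obtain x where x: "x \<in> P.flags" "P.ed x = e" "P.vx x = v"
   using w P.ed_rv P.rv_flags by (metis insertE singletonD)
  have vr: "P.vx (P.rv x) \<noteq> v" using P.vx_ends[OF x(1)] x e(3) by (metis doubleton_eq_iff insert_absorb2 singleton_insert_inj_eq)
  obtain p where p: "0 < p" "((P.ac \<circ> P.cr) ^^ p) x = x" "\<And>j. 0 < j ==> j < p ==> ((P.ac \<circ> P.cr) ^^ j) x \<noteq> x"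
   using orbit_period[OF x(1)] by blast
  define z where "z j = ((P.ac \<circ> P.cr) ^^ j) x" for j
  have z: "z j \<in> P.flags" "P.vx (z j) = v" for j using P.orbit_flags[OF x(1)] P.orbit_vx[OF x(1)] x(3) by (auto simp: z_def)
  have zS: "z (Suc j) = P.ac (P.cr (z j))" for j by (simp add: z_def)
  have cons: "ga A (z (Suc j)) = Q.ac (ga A (P.cr (z j)))" if j: "Suc j < p" for j
  proof -
   let ?c = "P.cr (z j)"
   have c: "?c \<in> P.flags" "P.vx ?c = v" using z by auto
   have "consistent A (P.ed ?c)"
   proof (rule ccontr)
    assume nc: "\<not> consistent A (P.ed ?c)"
    have "v \<in> {g (P.ed ?c) 0, g (P.ed ?c) 1}" using P.vx_ends[OF c(1)] c(2) by blast
    then have "P.ed ?c = P.ed x" using leaf nc P.ed_E[OF c(1)] x(2) by blast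
    then have "?c \<in> {x, P.rv x, P.ac x, P.ac (P.rv x)}" by (rule P.flags_of_edge[OF x(1) c(1)])
    moreover have "?c \<noteq> P.rv x" "?c \<noteq> P.ac (P.rv x)" using c(2) vr x(1) by auto
    moreover have "?c \<noteq> x" using P.reflection_neq[OF x(1)] by (simp add: z_def)
    moreover have "?c \<noteq> P.ac x"
    proof
     assume "?c = P.ac x"
     then have "z (Suc j) = x" using zS x(1) by simp
     then show False using p(3)[of "Suc j"] j by (simp add: z_def)
    qed
    ultimately show False by blast
   qed
   then show ?thesis unfolding zS consistent_def using c by blast
  qed
  have orb: "ga A (z j) = ((Q.ac \<circ> Q.cr) ^^ j) (ga A x)" if "j < p" for j
   using that
  proof (induction j)
   case (Suc j)
   then show ?case using cons[OF Suc.prems] gp(4)[OF z(1)[of j]] by simp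
  qed (simp add: z_def)
  have "(P.ty x + p) mod 3 = P.ty x mod 3" using P.orbit_ty[OF x(1), of p] p(2) P.ty_less[of x] by simp
  then have "3 dvd p" by presburger
  then obtain c where c: "p = 3 * c" by blast
  have cyc: "((Q.ac \<circ> Q.cr) ^^ p) (ga A x) = ga A x"
  proof -
   define u where "u = (Q.ac \<circ> Q.cr) ^^ 3"
   have "u (ga A x) = ga A x" unfolding u_def by (rule cubic[OF gp(1)[OF x(1)]])
   then have "(u ^^ c) (ga A x) = ga A x" by (induction c) simp_all
   then have "(((Q.ac \<circ> Q.cr) ^^ 3) ^^ c) (ga A x) = ga A x" unfolding u_def .
   then show ?thesis by (simp add: c funpow_mult mult.commute)
  qed
  obtain p' where p': "p = Suc p'" using p(1) by (cases p) auto
  have ax: "P.cr (z p') = P.ac x"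
  proof -
   have "P.ac (P.cr (z p')) = x" using p(2) zS[of p'] by (simp add: z_def p')
   then show ?thesis using z(1)[of p'] by (metis P.ac_ac P.cr_flags)
  qed
  have "ga A (P.ac x) = Q.cr (((Q.ac \<circ> Q.cr) ^^ p') (ga A x))"
   using orb[of p'] gp(4)[OF z(1)[of p']] ax p' by simp
  moreover have "Q.ac (Q.cr (((Q.ac \<circ> Q.cr) ^^ p') (ga A x))) = ga A x" using cyc p' by simp
  moreover have "Q.cr (((Q.ac \<circ> Q.cr) ^^ p') (ga A x)) \<in> Q.flags" using Q.orbit_flags gp(1)[OF x(1)] by simp
  ultimately have "ga A (P.ac x) = Q.ac (ga A x)" by (metis Q.ac_ac)
  then have "consistent A (P.ed x)" using consistentI[OF x(1) ok[OF x(1)] ok] x(1) by simp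
  then show False using e x by simp
 qed
 then have "consistent A (P.ed x)" if "x \<in> P.flags" for x using P.ed_E[OF that] by blast
 then show ?thesis using A(1) unfolding consistent_def by blast
qed

end

section \<open>The branched covering\<close>

lemma pt_mult: "pt n s * pt n t = pt n (s + t)"
 by (simp add: pt_def cis_mult add_divide_distrib ring_distribs)

lemma cnj_pt: "cnj (pt n s) = pt n (- s)"
 by (simp add: pt_def cis_cnj)

context polygonal_map
begin

text \<open>A neighbourhood of an edge.\<close>

definition nb :: "(real^3) set => (real^3) set"
 where "nb e = {strip F i t y |F i t y. (F, i) \<in> sides_of e \<and> 0 < t \<and> t < 1 \<and> 0 \<le> y \<and> y < 1}"

lemma nb_collar:
 assumes e: "e \<in> E" and s: "sides_of e = {(F, i), (G, j)}"
 shows "nb e = collar F i G j ` collar_dom"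
proof
 have m: "(F, i) \<in> sides_of e" "(G, j) \<in> sides_of e" using s by auto
 show "nb e \<subseteq> collar F i G j ` collar_dom"
 proof
  fix x assume "x \<in> nb e"
  then obtain H k t y where x: "x = strip H k t y" "(H, k) \<in> sides_of e" "0 < t" "t < 1" "0 \<le> y" "y < 1" by (auto simp: nb_def)
  then consider "(H, k) = (F, i)" | "(H, k) = (G, j)" "y > 0" | "(H, k) = (G, j)" "y = 0" using s by fastforce
  then show "x \<in> collar F i G j ` collar_dom"
  proof cases
   case 1
   then have "x = collar F i G j (Complex t y)" using x by (simp add: collar_def)
   moreover have "Complex t y \<in> collar_dom" using x by (simp add: collar_dom_def)
   ultimately show ?thesis by blast
  next
   case 2
   let ?w = "Complex (if dr F i = dr G j then t else 1 - t) (- y)"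
   have "x = collar F i G j ?w" using x 2 by (simp add: collar_def)
   moreover have "?w \<in> collar_dom" using x by (simp add: collar_dom_def)
   ultimately show ?thesis by blast
  next
   case 3
   let ?w = "Complex (if dr F i = dr G j then t else 1 - t) 0"
   have "x = strip G j t 0" using x 3 by simp
   also have "\<dots> = strip F i (if dr F i = dr G j then t else 1 - t) 0"
    using collar_at_edge[OF m(2,1), of t] x by (simp only: eq_commute[of "dr G j"])
   finally have "x = collar F i G j ?w" by (simp add: collar_def)
   moreover have "?w \<in> collar_dom" using x by (simp add: collar_dom_def)
   ultimately show ?thesis by blast
  qed
 qed
 show "collar F i G j ` collar_dom \<subseteq> nb e"
 proof clarify
  fix w assume w: "w \<in> collar_dom"
  then have b: "0 < Re w" "Re w < 1" "-1 < Im w" "Im w < 1" by (auto simp: collar_dom_def)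
  show "collar F i G j w \<in> nb e"
  proof (cases "0 \<le> Im w")
   case True then show ?thesis using b m unfolding nb_def collar_def by auto
  next
   case False
   let ?t = "if dr F i = dr G j then Re w else 1 - Re w"
   have "collar F i G j w = strip G j ?t (- Im w)" using False by (simp add: collar_def)
   moreover have "0 < ?t" "?t < 1" "0 \<le> - Im w" "- Im w < 1" using b False by auto
   ultimately show ?thesis using m(2) unfolding nb_def by blast
  qed
 qed
qed

lemma edge_sub_nb: assumes e: "e \<in> E" shows "e \<subseteq> nb e"
proof
 fix x assume "x \<in> e"
 then obtain u where u: "0 < u" "u < 1" "x = g e u" using g_im[OF e] by (metis greaterThanLessThan_iff imageE)
 obtain F i where s: "(F, i) \<in> sides_of e" using side_exists[OF e] by auto
 let ?t = "if dr F i then u else 1 - u"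
 have "x = strip F i ?t 0" using strip_0[of F i ?t] s u by (auto simp: sides_of_def)
 moreover have "0 < ?t" "?t < 1" using u by auto
 ultimately show "x \<in> nb e" using s unfolding nb_def by fastforce
qed

lemma nb_cases:
 assumes e: "e \<in> E" and x: "x \<in> nb e"
 obtains "x \<in> e" | F i t y where "(F, i) \<in> sides_of e" "0 < t" "t < 1" "0 < y" "y < 1" "x = strip F i t y" "x \<in> F"
proof -
 obtain F i t y where x: "x = strip F i t y" "(F, i) \<in> sides_of e" "0 < t" "t < 1" "0 \<le> y" "y < 1" using x by (auto simp: nb_def)
 then have F: "F \<in> Fs" "i < n F" "es F i = e" by (auto simp: sides_of_def)
 show ?thesis
 proof (cases "y = 0")
  case True then show ?thesis using that(1) strip_edge[OF F(1,2) x(3,4)] F(3) x(1) by simp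
 next
  case False then show ?thesis using that(2)[OF x(2,3,4) _ x(6) x(1)] strip_face[OF F(1), of y i t] x by simp
 qed
qed

lemma nb_edge: assumes "e \<in> E" "d \<in> E" "x \<in> nb e" "x \<in> d" shows "d = e"
 using assms(1,3)
proof (cases rule: nb_cases)
 case 1 then show ?thesis using E_eq assms by blast
next
 case (2 F i t y)
 then have "F \<in> Fs" by (simp add: sides_of_def)
 then show ?thesis using x_EF[OF assms(4,2)] 2 by blast
qed

lemma nb_notV: assumes "e \<in> E" "x \<in> nb e" shows "x \<notin> V"
 using assms
proof (cases rule: nb_cases)
 case 1 then show ?thesis using x_VE assms by blast
next
 case (2 F i t y)
 then have "F \<in> Fs" by (simp add: sides_of_def)
 then show ?thesis using x_VF 2 by blast
qed

lemma nb_disjoint: assumes "e \<in> E" "d \<in> E" "x \<in> nb e" "x \<in> nb d" shows "e = d"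
 using assms(1,3)
proof (cases rule: nb_cases)
 case 1 then show ?thesis using nb_edge assms by blast
next
 case (2 F i t y)
 then have F: "F \<in> Fs" "i < n F" "es F i = e" by (auto simp: sides_of_def)
 note two = 2
 show ?thesis using assms(2,4)
 proof (cases rule: nb_cases)
  case 1 then show ?thesis using nb_edge assms by blast
 next
  case (2 G j u z)
  then have G: "G \<in> Fs" "j < n G" "es G j = d" by (auto simp: sides_of_def)
  then show ?thesis using strip_inj[of F G i j t u y z] F two 2 by simp
 qed
qed

lemma nb_open: assumes "e \<in> E" shows "openin (top_of_set S2) (nb e)"
proof -
 obtain a b where ab: "a \<noteq> b" "sides_of e = {a, b}" using sides_of_card2[OF assms] by blast
 obtain F i G j where FG: "a = (F, i)" "b = (G, j)" by (cases a, cases b)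
 then show ?thesis using nb_collar[OF assms, of F i G j] collar_open[of F i e G j collar_dom] ab open_collar_dom by simp
qed

lemma point_side:
 assumes "e \<in> E" "(F, i) \<in> sides_of e" "0 \<le> s" "s \<le> 1"
 shows "g e s = h F (pt (n F) (real i + (if dr F i then s else 1 - s)))"
 using h_side[of F i "if dr F i then s else 1 - s"] assms by (auto simp: sides_of_def)

lemma S2_closed_faces: assumes "x \<in> S2" shows "\<exists>F\<in>Fs. x \<in> h F ` cball 0 1"
 using assms
proof (cases rule: S2_cases)
 case V
 then obtain y where y: "y \<in> flags" "vx y = x" using vertex_has_flag by blast
 obtain F i b where fi: "y = (F, i, b)" by (metis prod_cases3)
 have "x = h F (pt (n F) (real i + of_bool b))" using vx_h y fi by blast
 moreover have "F \<in> Fs" using y fi by (simp add: flags_def)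
 moreover have "pt (n F) (real i + of_bool b) \<in> cball 0 1" by simp
 ultimately show ?thesis by blast
next
 case (E e)
 obtain F i where s: "(F, i) \<in> sides_of e" using side_exists[OF E(1)] by auto
 obtain u where "0 < u" "u < 1" "x = g e u" using g_im[OF E(1)] E(2) by (metis greaterThanLessThan_iff imageE)
 then have "x = h F (pt (n F) (real i + (if dr F i then u else 1 - u)))" using point_side[OF E(1) s] by simp
 moreover have "F \<in> Fs" using s by (simp add: sides_of_def)
 moreover have "pt (n F) (real i + (if dr F i then u else 1 - u)) \<in> cball 0 1" by simp
 ultimately show ?thesis by blast
next
 case (F F) then show ?thesis using h_im[of F] by force
qed

end

locale developed = two_football_maps +
 fixes A
 assumes okA: "\<And>F. F \<in> Fs ==> ok (A F) F"
  and acA: "\<And>x. x \<in> P.flags ==> ga A (P.ac x) = Q.ac (ga A x)"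
begin

text \<open>
  The map of discs \<open>dm F\<close> is the rotation or reflection that belongs to the placement of
  \<open>F\<close>, and \<open>ph F\<close> is the resulting map into the target, in terms of the disc of
  \<open>F\<close>.
\<close>

definition tf where "tf F = fst (A F)"
definition dm :: "(real^3) set => complex => complex"
 where "dm F z = (if fst (snd (A F)) then pt (n F) (real (snd (snd (A F)))) * z
          else pt (n F) (real (snd (snd (A F))) + 1) * cnj z)"
definition ph where "ph F z = h' (tf F) (dm F z)"

lemma tf: "F \<in> Fs ==> tf F \<in> Fs'" "F \<in> Fs ==> F \<in> Bl \<longleftrightarrow> tf F \<in> Bl'"
 using okA[of F] by (auto simp: ok_def tf_def split: prod.splits)

lemma n'_tf: "F \<in> Fs ==> n' (tf F) = n F" using n_eq tf by blast

lemma norm_dm [simp]: "norm (dm F z) = norm z" by (simp add: dm_def norm_mult)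

lemma dm_inj: "inj (dm F)"
 by (rule injI) (auto simp: dm_def split: if_splits)

lemma dm_cont: "continuous_on S (dm F)"
 unfolding dm_def by (cases "fst (snd (A F))") (auto intro!: continuous_intros)

lemma dm_surj: obtains z where "dm F z = w"
proof (cases "fst (snd (A F))")
 case True
 then show ?thesis using that[of "w / pt (n F) (real (snd (snd (A F))))"] by (simp add: dm_def)
next
 case False
 then show ?thesis using that[of "cnj (w / pt (n F) (real (snd (snd (A F))) + 1))"] by (simp add: dm_def)
qed

lemma ga_flags: "x \<in> P.flags ==> ga A x \<in> Q.flags" "x \<in> P.flags ==> Q.ty (ga A x) = P.ty x"
 "x \<in> P.flags ==> ga A (P.rv x) = Q.rv (ga A x)" "x \<in> P.flags ==> ga A (P.cr x) = Q.cr (ga A x)"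
 using ga_props[of A x] okA by (auto simp: P.flags_def)

text \<open>The side of the target face onto which a side is carried, and whether its direction is kept.\<close>

definition sd where "sd F i = fst (snd (ga A (F, i, True)))"
definition kp where "kp F i = snd (snd (ga A (F, i, True)))"

lemma ga_sd: assumes "F \<in> Fs" "i < n F" shows "ga A (F, i, b) = (tf F, sd F i, b = kp F i)"
 by (cases "A F") (auto simp: ga_def tf_def sd_def kp_def)

lemma sd_less: assumes "F \<in> Fs" "i < n F" shows "sd F i < n F"
 using ga_flags(1)[of "(F, i, True)"] ga_sd[OF assms] assms n'_tf by (auto simp: P.flags_def Q.flags_def)

lemma dm_side:
 assumes "F \<in> Fs" "i < n F"
 shows "dm F (r *\<^sub>R pt (n F) (real i + t)) = r *\<^sub>R pt (n F) (real (sd F i) + (if kp F i then t else 1 - t))"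
proof -
 obtain F' \<epsilon> a where q: "A F = (F', \<epsilon>, a)" by (metis prod_cases3)
 have a: "a < n F" using okA[OF assms(1)] q by (simp add: ok_def)
 have np: "0 < n F" using assms by simp
 show ?thesis
 proof (cases \<epsilon>)
  case True
  then have "sd F i = (i + a) mod n F" "kp F i" by (auto simp: sd_def kp_def ga_def q)
  then show ?thesis using pt_mod[OF np, of "i + a" t] True
   by (simp add: dm_def q pt_mult add_ac)
 next
  case False
  then have s: "sd F i = (a + n F - i) mod n F" "\<not> kp F i" by (auto simp: sd_def kp_def ga_def q)
  have "pt (n F) (real a + 1 + - (real i + t)) = pt (n F) (real (a + n F - i) + (1 - t))"
   using pt_eq_iff[OF np] assms(2) by (intro iffD2[OF pt_eq_iff[OF np]] exI[of _ "-1"]) (simp add: of_nat_diff)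
  then show ?thesis using pt_mod[OF np, of "a + n F - i" "1 - t"] s False
   by (simp add: dm_def q pt_mult cnj_pt)
 qed
qed

lemma ph_strip:
 assumes "F \<in> Fs" "i < n F"
 shows "ph F ((1 - y) *\<^sub>R pt (n F) (real i + t)) = Q.strip (tf F) (sd F i) (if kp F i then t else 1 - t) y"
 using dm_side[OF assms] n'_tf[OF assms(1)] by (simp add: ph_def Q.strip_def)

lemma opp_sd:
 assumes "F \<in> Fs" "i < n F" "P.opp F i = (G, j)"
 shows "Q.opp (tf F) (sd F i) = (tf G, sd G j)"
  "(dr F i = dr G j) = (kp F i = (kp G j = (dr' (tf F) (sd F i) = dr' (tf G) (sd G j))))"
proof -
 have G: "G \<in> Fs" "j < n G" using P.opp_es[OF assms] by auto
 have "ga A (P.ac (F, i, True)) = Q.ac (ga A (F, i, True))" using acA[of "(F, i, True)"] assms by (simp add: P.flags_def)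
 then have e: "(tf G, sd G j, (True = (dr F i = dr G j)) = kp G j) = Q.ac (tf F, sd F i, kp F i)"
  using ga_sd[OF G] ga_sd[OF assms(1,2)] assms(3) by simp
 then show "Q.opp (tf F) (sd F i) = (tf G, sd G j)" by (auto split: prod.splits)
 then show "(dr F i = dr G j) = (kp F i = (kp G j = (dr' (tf F) (sd F i) = dr' (tf G) (sd G j))))"
  using e by auto
qed

text \<open>The value on the side, in terms of the parameter of the edge.\<close>

definition val where "val F i s = g' (es' (tf F) (sd F i)) (if dr F i = (kp F i = dr' (tf F) (sd F i)) then s else 1 - s)"

lemma ph_side:
 assumes "F \<in> Fs" "i < n F" "0 \<le> t" "t \<le> 1"
 shows "ph F (pt (n F) (real i + t)) = val F i (if dr F i then t else 1 - t)"
proof -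
 have "ph F (pt (n F) (real i + t)) = Q.strip (tf F) (sd F i) (if kp F i then t else 1 - t) 0"
  using ph_strip[OF assms(1,2), of 0 t] by simp
 also have "\<dots> = val F i (if dr F i then t else 1 - t)"
  using Q.strip_0[OF tf(1)[OF assms(1)], of "sd F i" "if kp F i then t else 1 - t"] sd_less[OF assms(1,2)] n'_tf[OF assms(1)] assms(3,4)
  by (auto simp: val_def)
 finally show ?thesis .
qed

lemma val_opp:
 assumes "F \<in> Fs" "i < n F" "P.opp F i = (G, j)"
 shows "val G j = val F i"
proof -
 have e: "es' (tf G) (sd G j) = es' (tf F) (sd F i)"
  using Q.opp_es[OF tf(1)[OF assms(1)] _ opp_sd(1)[OF assms]] sd_less[OF assms(1,2)] n'_tf[OF assms(1)] by simp
 have "(dr G j = (kp G j = dr' (tf G) (sd G j))) = (dr F i = (kp F i = dr' (tf F) (sd F i)))"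
  using opp_sd(2)[OF assms] by blast
 then show ?thesis unfolding val_def e by (intro ext) simp
qed

lemma val_same:
 assumes "(F, i) \<in> P.sides_of e" "(G, j) \<in> P.sides_of e" shows "val F i = val G j"
proof -
 have F: "F \<in> Fs" "i < n F" "es F i = e" using assms by (auto simp: P.sides_of_def)
 then have "(G, j) = (F, i) \<or> P.opp F i = (G, j)" using P.opp(3)[OF F(1,2)] assms(2) by auto
 then show ?thesis using val_opp[OF F(1,2)] by auto
qed

lemma ph_well_defined:
 assumes "F \<in> Fs" "z \<in> cball 0 1" "G \<in> Fs" "w \<in> cball 0 1" "h F z = h G w" "h F z \<notin> V"
 shows "ph F z = ph G w"
 using assms(1,2)
proof (cases rule: P.cball_cases)
 case inside
 then have "norm w < 1 \<and> F = G" using P.h_in_face[OF assms(3,4,1)] assms(5) by simp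
 then show ?thesis using inside P.h_inj[OF assms(1)] assms(5) by (auto dest: inj_onD)
next
 case (side i t)
 have e: "es F i \<in> E" using P.es_E side assms by blast
 obtain j u where j: "j < n G" "0 < u" "u < 1" "w = pt (n G) (real j + u)" "es G j = es F i"
  using P.h_in_edge[OF assms(3,4) e] side assms(5) by metis
 have m: "(F, i) \<in> P.sides_of (es F i)" "(G, j) \<in> P.sides_of (es F i)" using assms side j by (auto simp: P.sides_of_def)
 have "g (es F i) (if dr F i then t else 1 - t) = g (es F i) (if dr G j then u else 1 - u)"
  using P.h_side[OF assms(1) side(1), of t] P.h_side[OF assms(3) j(1), of u] side j assms(5) by simp
 then have "(if dr F i then t else 1 - t) = (if dr G j then u else 1 - u)"
  by (rule inj_onD[OF P.g_inj[OF e]]) (use side j in auto)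
 then show ?thesis using ph_side[OF assms(1) side(1), of t] ph_side[OF assms(3) j(1), of u] val_same[OF m] side j by simp
next
 case corner then show ?thesis using assms by blast
qed

lemma ph_cont: "F \<in> Fs ==> continuous_on (cball 0 1) (ph F)"
 unfolding ph_def by (rule continuous_on_compose2[OF Q.h_cont dm_cont]) (auto simp: tf)

lemma ph_corner: assumes "(F, i, b) \<in> P.flags"
 shows "ph F (pt (n F) (real i + of_bool b)) = Q.vx (ga A (F, i, b))"
proof -
 have F: "F \<in> Fs" "i < n F" using assms by (auto simp: P.flags_def)
 have fl: "(tf F, sd F i, b = kp F i) \<in> Q.flags" using ga_flags(1)[OF assms] ga_sd[OF F] by simp
 have "ph F (1 *\<^sub>R pt (n F) (real i + of_bool b)) = h' (tf F) (1 *\<^sub>R pt (n F) (real (sd F i) + (if kp F i then of_bool b else 1 - of_bool b)))"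
  unfolding ph_def dm_side[OF F] ..
 then show ?thesis using Q.vx_h[OF fl] ga_sd[OF F] n'_tf[OF F(1)] by (auto split: if_splits)
qed

text \<open>
  By compactness of the discs, points close to \<open>v\<close> come from points close to corners at \<open>v\<close>.
\<close>

lemma near_vertex:
 assumes v: "v \<in> V" and r: "r > 0"
 obtains d where "d > 0" "\<And>F z. F \<in> Fs ==> z \<in> cball 0 1 ==> dist (h F z) v < d ==>
   \<exists>x\<in>P.flags. P.vx x = v \<and> dist (ph F z) (Q.vx (ga A x)) < r"
proof -
 define Z where "Z F = {z \<in> cball 0 1. \<forall>x\<in>P.flags. P.vx x = v \<longrightarrow> r \<le> dist (ph F z) (Q.vx (ga A x))}" for F
 have "\<exists>d>0. \<forall>z\<in>Z F. d \<le> dist (h F z) v" if F: "F \<in> Fs" for F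
 proof -
  have "closed (Z F)"
  proof -
   have "Z F = cball 0 1 \<inter> (\<Inter>x\<in>{x\<in>P.flags. P.vx x = v}. {z \<in> cball 0 1. r \<le> dist (ph F z) (Q.vx (ga A x))})" by (auto simp: Z_def)
   moreover have "closed {z \<in> cball 0 1. r \<le> dist (ph F z) c}" for c
    by (intro continuous_closed_preimage_constant continuous_on_closed_Collect_le) (auto intro!: continuous_intros ph_cont[OF F])
   ultimately show ?thesis by (auto intro!: closed_Int closed_INT)
  qed
  then have cp: "compact (h F ` Z F)"
  proof -
   assume cl: "closed (Z F)"
   have sub: "Z F \<subseteq> cball 0 1" by (auto simp: Z_def)
   have "compact (Z F)" using cl bounded_subset[OF bounded_cball sub] by (simp add: compact_eq_bounded_closed)
   then show ?thesis using continuous_on_subset[OF P.h_cont[OF F] sub] by (simp add: compact_continuous_image)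
  qed
  have "v \<notin> h F ` Z F"
  proof
   assume "v \<in> h F ` Z F"
   then obtain z where z: "z \<in> Z F" "v = h F z" by blast
   then have zc: "z \<in> cball 0 1" by (simp add: Z_def)
   obtain i where i: "i < n F" "z = pt (n F) (real i)" using P.h_in_V[OF F zc] z v by blast
   have fl: "(F, i, False) \<in> P.flags" using F i by (simp add: P.flags_def)
   have "P.vx (F, i, False) = v" using P.vx_h[OF fl] z i by simp
   moreover have "ph F z = Q.vx (ga A (F, i, False))" using ph_corner[OF fl] i by simp
   ultimately have "r \<le> 0" using z(1) fl by (auto simp: Z_def)
   then show False using r by simp
  qed
  then obtain d where "d > 0" "\<forall>x\<in>h F ` Z F. d \<le> dist v x" using separate_point_closed[OF compact_imp_closed[OF cp]] by metis
  then show ?thesis by (auto simp: dist_commute)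
 qed
 then have "\<forall>F\<in>Fs. \<exists>d>0. \<forall>z\<in>Z F. d \<le> dist (h F z) v" by blast
 from bchoice[OF this] obtain d where d: "\<forall>F\<in>Fs. d F > 0 \<and> (\<forall>z\<in>Z F. d F \<le> dist (h F z) v)" ..
 show ?thesis
 proof (rule that[of "Min (d ` Fs)"])
  show "0 < Min (d ` Fs)" using d P.finF P.Fs_ne by simp
  fix F z assume Fz: "F \<in> Fs" "z \<in> cball 0 1" "dist (h F z) v < Min (d ` Fs)"
  then have "dist (h F z) v < d F" using P.finF by (meson Min_le finite_imageI imageI less_le_trans)
  then have "z \<notin> Z F" using d Fz by fastforce
  then show "\<exists>x\<in>P.flags. P.vx x = v \<and> dist (ph F z) (Q.vx (ga A x)) < r" using Fz by (auto simp: Z_def not_le)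
 qed
qed

text \<open>The map away from the vertices.\<close>

definition f0 where "f0 x = (SOME y. \<exists>F\<in>Fs. \<exists>z\<in>cball 0 1. h F z = x \<and> y = ph F z)"

lemma f0_h: assumes "F \<in> Fs" "z \<in> cball 0 1" "h F z \<notin> V" shows "f0 (h F z) = ph F z"
proof -
 have "\<exists>y. \<exists>G\<in>Fs. \<exists>w\<in>cball 0 1. h G w = h F z \<and> y = ph G w" using assms by blast
 then have "\<exists>G\<in>Fs. \<exists>w\<in>cball 0 1. h G w = h F z \<and> f0 (h F z) = ph G w" unfolding f0_def by (rule someI_ex)
 then show ?thesis using ph_well_defined assms by metis
qed

lemma f0_cont: "continuous_on (S2 - V) f0"
proof (rule continuous_on_glue[OF P.finF, where K="\<lambda>_. cball 0 1" and q=h and F=ph])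
 show "S2 - V \<subseteq> (\<Union>j\<in>Fs. h j ` cball 0 1)" using P.S2_closed_faces by blast
 show "continuous_on (cball 0 1 \<inter> h F -` (S2 - V)) (ph F)" if "F \<in> Fs" for F
  using ph_cont[OF that] continuous_on_subset by blast
qed (use P.h_cont f0_h in auto)

text \<open>
  A small connected punctured neighbourhood of the vertex is mapped close to the images of its corners. If two of
  these images were different, the connected image of the neighbourhood would be split between disjoint balls around
  them.
\<close>

lemma vertex_consistent:
 assumes x: "x \<in> P.flags" and y: "y \<in> P.flags" and xy: "P.vx x = P.vx y"
 shows "Q.vx (ga A x) = Q.vx (ga A y)"
proof (rule ccontr)
 assume ne: "Q.vx (ga A x) \<noteq> Q.vx (ga A y)"
 let ?v = "P.vx x" and ?a = "Q.vx (ga A x)"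
 have v: "?v \<in> V" using P.vx_V x by blast
 have aV: "Q.vx (ga A z) \<in> V'" if "z \<in> P.flags" for z using Q.vx_V ga_flags(1)[OF that] by blast
 obtain r where r: "r > 0" "\<And>p q. p \<in> V' ==> q \<in> V' ==> p \<noteq> q ==> 2 * r \<le> dist p q"
 proof -
  have "\<exists>r>0. \<forall>p\<in>V'. \<forall>q\<in>V'. p \<noteq> q \<longrightarrow> r \<le> dist p q"
  proof -
   let ?D = "(\<lambda>(p, q). dist p q) ` {(p, q). p \<in> V' \<and> q \<in> V' \<and> p \<noteq> q}"
   have "finite {(p, q). p \<in> V' \<and> q \<in> V' \<and> p \<noteq> q}" by (rule finite_subset[of _ "V' \<times> V'"]) (use Q.finV in auto)
   then have fD: "finite ?D" by simp
   show ?thesis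
   proof (cases "?D = {}")
    case True then show ?thesis by (intro exI[of _ 1]) auto
   next
    case False
    have "0 < Min ?D" using fD False by (auto simp: Min_gr_iff)
    moreover have "Min ?D \<le> dist p q" if "p \<in> V'" "q \<in> V'" "p \<noteq> q" for p q
     by (rule Min_le[OF fD]) (use that in force)
    ultimately show ?thesis by blast
   qed
  qed
  then obtain r where "r > 0" "\<forall>p\<in>V'. \<forall>q\<in>V'. p \<noteq> q \<longrightarrow> r \<le> dist p q" by blast
  then show ?thesis using that[of "r / 2"] by simp
 qed
 obtain d where d: "d > 0" "\<And>F z. F \<in> Fs ==> z \<in> cball 0 1 ==> dist (h F z) ?v < d ==>
   \<exists>x\<in>P.flags. P.vx x = ?v \<and> dist (ph F z) (Q.vx (ga A x)) < r" using near_vertex[OF v r(1)] by blast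
 have "openin (top_of_set S2) (S2 \<inter> ball ?v d)" by (simp add: openin_open_Int)
 moreover have "?v \<in> S2 \<inter> ball ?v d" using v d(1) P.V_S2 by auto
 moreover have "locally connected S2" using locally_connected_sphere by blast
 ultimately obtain W where W: "openin (top_of_set S2) W" "connected W" "?v \<in> W" "W \<subseteq> S2 \<inter> ball ?v d"
  unfolding locally_connected by metis
 have con: "connected (W - V)" by (rule connected_S2_delete_finite[OF W(1,2) P.finV])
 have sub: "W - V \<subseteq> S2 - V" using W by blast
 have fcon: "connected (f0 ` (W - V))" by (rule connected_continuous_image[OF continuous_on_subset[OF f0_cont sub] con])
 let ?U = "ball ?a r" and ?W = "\<Union>q\<in>V' - {?a}. ball q r"
 have cov: "f0 ` (W - V) \<subseteq> ?U \<union> ?W"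
 proof clarify
  fix p assume p: "p \<in> W" "p \<notin> V" "f0 p \<notin> ?W"
  then obtain F z where Fz: "F \<in> Fs" "z \<in> cball 0 1" "p = h F z" using P.S2_closed_faces W(4) by blast
  then have "f0 p = ph F z" using f0_h p by simp
  moreover have "dist (h F z) ?v < d" using W(4) p(1) Fz(3) by (auto simp: dist_commute)
  from d(2)[OF Fz(1,2) this] obtain u where u: "u \<in> P.flags" "dist (ph F z) (Q.vx (ga A u)) < r" by blast
  ultimately have m: "f0 p \<in> ball (Q.vx (ga A u)) r" by (simp add: dist_commute)
  then have "Q.vx (ga A u) = ?a" using p(3) aV[OF u(1)] by blast
  then show "f0 p \<in> ?U" using m by simp
 qed
 have dis: "?U \<inter> ?W = {}"
 proof -
  have False if "q \<in> V'" "q \<noteq> ?a" "dist ?a c < r" "dist q c < r" for q c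
  proof -
   have "dist ?a q < 2 * r" using that dist_triangle2[of ?a q c] by simp
   then show False using r(2)[OF aV[OF x] that(1)] that(2) by simp
  qed
  then show ?thesis unfolding disjoint_iff UN_iff mem_ball by blast
 qed
 have hit: "f0 ` (W - V) \<inter> ball (Q.vx (ga A u)) r \<noteq> {}" if u: "u \<in> P.flags" "P.vx u = ?v" for u
 proof -
  obtain F i b where fi: "u = (F, i, b)" by (metis prod_cases3)
  have F: "F \<in> Fs" using u fi by (simp add: P.flags_def)
  let ?c = "pt (n F) (real i + of_bool b)"
  have hc: "h F ?c = ?v" "ph F ?c = Q.vx (ga A u)" using P.vx_h ph_corner u fi by auto
  obtain O1 where O1: "open O1" "W = S2 \<inter> O1" using W(1) by (auto simp: openin_open)
  have c1: "continuous_on {0..1} (\<lambda>t. h F ((1 - t) *\<^sub>R ?c))"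
   by (rule continuous_on_compose2[OF P.h_cont[OF F]]) (auto intro!: continuous_intros)
  then obtain B1 where B1: "open B1" "B1 \<inter> {0..1} = (\<lambda>t. h F ((1 - t) *\<^sub>R ?c)) -` O1 \<inter> {0..1}"
   using continuous_on_open_invariant[THEN iffD1, rule_format, OF c1 O1(1)] by blast
  have c2: "continuous_on {0..1} (\<lambda>t. ph F ((1 - t) *\<^sub>R ?c))"
   by (rule continuous_on_compose2[OF ph_cont[OF F]]) (auto intro!: continuous_intros)
  then obtain B2 where B2: "open B2" "B2 \<inter> {0..1} = (\<lambda>t. ph F ((1 - t) *\<^sub>R ?c)) -` ball (Q.vx (ga A u)) r \<inter> {0..1}"
   using continuous_on_open_invariant[THEN iffD1, rule_format, OF c2 open_ball] by blast
  have "0 \<in> (\<lambda>t. h F ((1 - t) *\<^sub>R ?c)) -` O1 \<inter> {0..1}" using hc O1(2) W(3) by simp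
  moreover have "0 \<in> (\<lambda>t. ph F ((1 - t) *\<^sub>R ?c)) -` ball (Q.vx (ga A u)) r \<inter> {0..1}" using hc r(1) by simp
  ultimately have "0 \<in> B1 \<inter> B2" unfolding B1(2)[symmetric] B2(2)[symmetric] by blast
  then obtain c where c: "c > 0" "ball 0 c \<subseteq> B1 \<inter> B2" using B1(1) B2(1) by (metis open_Int open_contains_ball)
  define t where "t = min (c / 2) (1 / 2)"
  have t: "0 < t" "t < 1" "t \<in> ball 0 c" using c by (auto simp: t_def)
  then have "t \<in> B1 \<inter> {0..1}" "t \<in> B2 \<inter> {0..1}" using c(2) by auto
  then have m: "h F ((1 - t) *\<^sub>R ?c) \<in> O1" "ph F ((1 - t) *\<^sub>R ?c) \<in> ball (Q.vx (ga A u)) r" unfolding B1(2) B2(2) by auto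
  have inF: "h F ((1 - t) *\<^sub>R ?c) \<in> F" using P.h_ball[OF F] t by simp
  then have notV: "h F ((1 - t) *\<^sub>R ?c) \<notin> V" using P.x_VF F by blast
  have "h F ((1 - t) *\<^sub>R ?c) \<in> S2" using subsetD[OF P.F_S2[OF F] inF] .
  then have inW: "h F ((1 - t) *\<^sub>R ?c) \<in> W - V" unfolding O1(2) using m(1) notV by (intro DiffI IntI)
  have "f0 (h F ((1 - t) *\<^sub>R ?c)) = ph F ((1 - t) *\<^sub>R ?c)" using f0_h[OF F _ notV] t by simp
  then have "ph F ((1 - t) *\<^sub>R ?c) \<in> f0 ` (W - V)" using imageI[OF inW, of f0] by simp
  then show ?thesis using m(2) by (metis IntI emptyE)
 qed
 have "?U \<inter> f0 ` (W - V) \<noteq> {}" using hit[OF x] by (simp add: Int_commute)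
 moreover have "?W \<inter> f0 ` (W - V) \<noteq> {}"
 proof -
  have "ball (Q.vx (ga A y)) r \<subseteq> ?W" by (rule UN_upper) (use ne aV[OF y] in auto)
  moreover have "f0 ` (W - V) \<inter> ball (Q.vx (ga A y)) r \<noteq> {}" by (rule hit[OF y]) (simp add: xy)
  ultimately show ?thesis by (metis Int_commute Int_mono order_refl subset_empty)
 qed
 moreover have "?U \<inter> ?W \<inter> f0 ` (W - V) = {}" unfolding dis by simp
 moreover have "open ?W" by (intro open_UN ballI open_ball)
 ultimately show False using connectedD[OF fcon open_ball \<open>open ?W\<close> _ cov] by metis
qed

lemma ph_glue:
 assumes "F \<in> Fs" "z \<in> cball 0 1" "G \<in> Fs" "w \<in> cball 0 1" "h F z = h G w"
 shows "ph F z = ph G w"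
proof (cases "h F z \<in> V")
 case True
 obtain i where i: "i < n F" "z = pt (n F) (real i)" using P.h_in_V assms True by metis
 obtain j where j: "j < n G" "w = pt (n G) (real j)" using P.h_in_V assms True by metis
 have fl: "(F, i, False) \<in> P.flags" "(G, j, False) \<in> P.flags" using i j assms by (auto simp: P.flags_def)
 have "P.vx (F, i, False) = P.vx (G, j, False)" using P.vx_h[OF fl(1)] P.vx_h[OF fl(2)] i j assms(5) by simp
 then show ?thesis using vertex_consistent[OF fl] ph_corner[OF fl(1)] ph_corner[OF fl(2)] i j by simp
qed (use ph_well_defined assms in blast)

definition f where "f x = (SOME y. \<exists>F\<in>Fs. \<exists>z\<in>cball 0 1. h F z = x \<and> y = ph F z)"

lemma f_h: assumes "F \<in> Fs" "z \<in> cball 0 1" shows "f (h F z) = ph F z"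
proof -
 have "\<exists>y. \<exists>G\<in>Fs. \<exists>w\<in>cball 0 1. h G w = h F z \<and> y = ph G w" using assms by blast
 then have "\<exists>G\<in>Fs. \<exists>w\<in>cball 0 1. h G w = h F z \<and> f (h F z) = ph G w" unfolding f_def by (rule someI_ex)
 then show ?thesis using ph_glue assms by metis
qed

lemma f_cont: "continuous_on S2 f"
proof (rule continuous_on_glue[OF P.finF, where K="\<lambda>_. cball 0 1" and q=h and F=ph])
 show "S2 \<subseteq> (\<Union>j\<in>Fs. h j ` cball 0 1)" using P.S2_closed_faces by blast
 show "continuous_on (cball 0 1 \<inter> h F -` S2) (ph F)" if "F \<in> Fs" for F
  using ph_cont[OF that] continuous_on_subset by blast
qed (use P.h_cont f_h in auto)

lemma f_vertex: assumes "v \<in> V" shows "f v \<in> V'"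
proof -
 obtain x where x: "x \<in> P.flags" "P.vx x = v" using P.vertex_has_flag[OF assms] by blast
 obtain F i b where fi: "x = (F, i, b)" by (metis prod_cases3)
 have "F \<in> Fs" using x fi by (simp add: P.flags_def)
 then have "f v = Q.vx (ga A x)" using f_h[of F "pt (n F) (real i + of_bool b)"] P.vx_h[of F i b] ph_corner[of F i b] x fi by auto
 then show ?thesis using Q.vx_V ga_flags(1)[OF x(1)] by simp
qed

definition em where "em e = (case (SOME s. s \<in> P.sides_of e) of (F, i) => es' (tf F) (sd F i))"

lemma em_side: assumes "(F, i) \<in> P.sides_of e" shows "em e = es' (tf F) (sd F i)" "em e \<in> E'"
proof -
 obtain G j where G: "(SOME s. s \<in> P.sides_of e) = (G, j)" by (cases "SOME s. s \<in> P.sides_of e")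
 have "(SOME s. s \<in> P.sides_of e) \<in> P.sides_of e" using assms by (rule someI)
 then have m: "(G, j) \<in> P.sides_of e" using G by simp
 have F: "F \<in> Fs" "i < n F" "es F i = e" using assms by (auto simp: P.sides_of_def)
 have "(G, j) = (F, i) \<or> P.opp F i = (G, j)" using P.opp(3)[OF F(1,2)] m F(3) by auto
 then have "es' (tf G) (sd G j) = es' (tf F) (sd F i)"
  using Q.opp_es(3)[OF tf(1)[OF F(1)] _ opp_sd(1)[OF F(1,2)]] sd_less[OF F(1,2)] n'_tf[OF F(1)] by auto
 then show e: "em e = es' (tf F) (sd F i)" by (simp add: em_def G)
 show "em e \<in> E'" unfolding e using Q.es_E tf(1)[OF F(1)] sd_less[OF F(1,2)] n'_tf[OF F(1)] by simp
qed

lemma f_edge: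
 assumes e: "e \<in> E"
 obtains c where "\<And>s. 0 \<le> s ==> s \<le> 1 ==> f (g e s) = g' (em e) (if c then s else 1 - s)"
proof -
 obtain F i where s: "(F, i) \<in> P.sides_of e" using P.side_exists[OF e] by auto
 have F: "F \<in> Fs" "i < n F" "es F i = e" using s by (auto simp: P.sides_of_def)
 have "f (g e u) = g' (em e) (if dr F i = (kp F i = dr' (tf F) (sd F i)) then u else 1 - u)" if u: "0 \<le> u" "u \<le> 1" for u
 proof -
  let ?t = "if dr F i then u else 1 - u"
  have "f (g e u) = ph F (pt (n F) (real i + ?t))" using P.point_side[OF e s u] f_h[OF F(1)] by simp
  also have "\<dots> = val F i (if dr F i then ?t else 1 - ?t)" by (rule ph_side[OF F(1,2)]) (use u in auto)
  finally show ?thesis using em_side(1)[OF s] by (simp add: val_def split: if_splits)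
 qed
 then show ?thesis using that by blast
qed

lemma em_E: "e \<in> E ==> em e \<in> E'" using em_side(2) P.side_exists[of e] by fastforce

lemma f_edge_image: assumes e: "e \<in> E" shows "f ` e = em e" "inj_on f e"
proof -
 obtain k where k: "\<And>s. 0 \<le> s ==> s \<le> 1 ==> f (g e s) = g' (em e) (if k then s else 1 - s)" using f_edge[OF e] by blast
 have "(\<lambda>s. if k then s else 1 - s) ` {0<..<1} = {0<..<1::real}"
 proof (intro set_eqI iffI)
  fix x :: real assume "x \<in> {0<..<1}"
  then show "x \<in> (\<lambda>s. if k then s else 1 - s) ` {0<..<1}" by (intro image_eqI[of _ _ "if k then x else 1 - x"]) auto
 qed (auto split: if_splits)
 then have "g' (em e) ` (\<lambda>s. if k then s else 1 - s) ` {0<..<1} = em e" using Q.g_im[OF em_E[OF e]] by simp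
 moreover have "f ` e = f ` g e ` {0<..<1}" using P.g_im[OF e] by simp
 moreover have "f ` g e ` {0<..<1} = g' (em e) ` (\<lambda>s. if k then s else 1 - s) ` {0<..<1}"
  unfolding image_image by (rule image_cong) (use k in auto)
 ultimately show "f ` e = em e" by simp
 show "inj_on f e"
 proof (rule inj_onI)
  fix x y assume xy: "x \<in> e" "y \<in> e" "f x = f y"
  have "x \<in> g e ` {0<..<1}" "y \<in> g e ` {0<..<1}" using xy P.g_im[OF e] by auto
  then obtain s t where st: "0 < s" "s < 1" "x = g e s" "0 < t" "t < 1" "y = g e t" by auto
  have "g' (em e) (if k then s else 1 - s) = g' (em e) (if k then t else 1 - t)" using k[of s] k[of t] st xy(3) by simp
  then have "(if k then s else 1 - s) = (if k then t else 1 - t)"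
   by (rule inj_onD[OF Q.g_inj[OF em_E[OF e]]]) (use st in auto)
  then have "s = t" by (cases k) auto
  then show "x = y" using st by simp
 qed
qed

lemma f_face: assumes F: "F \<in> Fs" shows "f ` F = tf F" "inj_on f F" "\<exists>k. homeomorphism F (tf F) f k"
proof -
 have fh: "f (h F z) = h' (tf F) (dm F z)" if "norm z < 1" for z using f_h[OF F, of z] that by (simp add: ph_def)
 have "dm F ` ball 0 1 = ball 0 1"
 proof (intro set_eqI iffI)
  fix w :: complex assume "w \<in> ball 0 1"
  moreover obtain z where "dm F z = w" using dm_surj by blast
  ultimately show "w \<in> dm F ` ball 0 1" using norm_dm[of F z] by (intro image_eqI[of _ _ z]) auto
 qed auto
 then have "h' (tf F) ` dm F ` ball 0 1 = tf F" using Q.h_im[OF tf(1)[OF F]] by simp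
 moreover have "f ` F = f ` h F ` ball 0 1" using P.h_im[OF F] by simp
 moreover have "f ` h F ` ball 0 1 = h' (tf F) ` dm F ` ball 0 1" unfolding image_image by (rule image_cong) (use fh in auto)
 ultimately show im: "f ` F = tf F" by simp
 show inj: "inj_on f F"
 proof (rule inj_onI)
  fix x y assume xy: "x \<in> F" "y \<in> F" "f x = f y"
  obtain z w where zw: "norm z < 1" "x = h F z" "norm w < 1" "y = h F w"
   using xy P.h_im[OF F] by (metis imageE mem_ball_0)
  then have "h' (tf F) (dm F z) = h' (tf F) (dm F w)" using fh xy(3) by simp
  then have "dm F z = dm F w" by (rule inj_onD[OF Q.h_inj[OF tf(1)[OF F]]]) (use zw in auto)
  then show "x = y" using dm_inj zw by (auto dest: injD)
 qed
 have "F = closure F \<inter> f -` tf F"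
 proof
  show "F \<subseteq> closure F \<inter> f -` tf F" using im closure_subset by blast
  show "closure F \<inter> f -` tf F \<subseteq> F"
  proof clarify
   fix x assume x: "x \<in> closure F" "f x \<in> tf F"
   then obtain z where z: "z \<in> cball 0 1" "x = h F z" using P.closure_face[OF F] by auto
   then have "h' (tf F) (dm F z) \<in> tf F" using x(2) f_h[OF F z(1)] by (simp add: ph_def)
   then have "norm (dm F z) < 1" using Q.h_in_face[OF tf(1)[OF F], of "dm F z" "tf F"] z(1) tf(1)[OF F] by simp
   then show "x \<in> F" using z P.h_ball[OF F] by simp
  qed
 qed
 moreover have "compact (closure F)" using P.closure_face[OF F] P.closed_face_compact[OF F] by simp
 moreover have "closure F \<subseteq> S2" using closure_minimal[OF P.F_S2[OF F]] by (simp add: closed_sphere)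
 ultimately show "\<exists>k. homeomorphism F (tf F) f k"
  using homeomorphism_saturated[of "closure F" f F "tf F"] inj im continuous_on_subset[OF f_cont] by blast
qed

lemma f_S2: "x \<in> S2 ==> f x \<in> S2"
 by (erule P.S2_cases) (metis f_vertex Q.V_S2 subsetD, metis f_edge_image(1) em_E Q.E_S2 subsetD imageI, metis f_face(1) tf(1) Q.F_S2 subsetD imageI)

lemma f_V_iff: "x \<in> S2 ==> f x \<in> V' \<longleftrightarrow> x \<in> V"
 by (erule P.S2_cases) (simp add: f_vertex, metis f_edge_image(1) em_E Q.x_VE P.x_VE imageI, metis f_face(1) tf(1) Q.x_VF P.x_VF imageI)

lemma f_in_edge: assumes "x \<in> S2" "f x \<in> e'" "e' \<in> E'" shows "\<exists>e\<in>E. x \<in> e \<and> em e = e'"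
 using assms(1)
proof (cases rule: P.S2_cases)
 case V then show ?thesis using f_vertex Q.x_VE assms by blast
next
 case (E e)
 then have "f x \<in> em e" using f_edge_image(1) by blast
 then show ?thesis using Q.E_eq[OF em_E[OF E(1)] assms(3)] assms(2) E by blast
next
 case (F F)
 then have "f x \<in> tf F" using f_face(1) by blast
 then show ?thesis using Q.x_EF[OF assms(2,3) tf(1)[OF F(1)]] by blast
qed

lemma f_in_face: assumes "x \<in> S2" "f x \<in> F'" "F' \<in> Fs'" shows "\<exists>F\<in>Fs. x \<in> F \<and> tf F = F'"
 using assms(1)
proof (cases rule: P.S2_cases)
 case V then show ?thesis using f_vertex Q.x_VF assms by blast
next
 case (E e)
 then have "f x \<in> em e" using f_edge_image(1) by blast
 then show ?thesis using Q.x_EF[OF _ em_E[OF E(1)] assms(3)] assms(2) by blast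
next
 case (F F)
 then have "f x \<in> tf F" using f_face(1) by blast
 then show ?thesis using Q.F_eq[OF tf(1)[OF F(1)] assms(3)] assms(2) F by blast
qed

lemma f_strip:
 assumes "F \<in> Fs" "i < n F" "0 \<le> y" "y \<le> 1"
 shows "f (P.strip F i t y) = Q.strip (tf F) (sd F i) (if kp F i then t else 1 - t) y"
 using f_h[OF assms(1), of "(1 - y) *\<^sub>R pt (n F) (real i + t)"] ph_strip[OF assms(1,2)] assms(3,4) by (simp add: P.strip_def)

lemma f_collar:
 assumes F: "F \<in> Fs" "i < n F" "P.opp F i = (G, j)" and w: "w \<in> P.collar_dom"
 shows "f (P.collar F i G j w) =
  Q.collar (tf F) (sd F i) (tf G) (sd G j) (if kp F i then w else Complex (1 - Re w) (Im w))"
proof (cases "0 \<le> Im w")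
 case True
 then show ?thesis using f_strip[OF F(1,2), of "Im w" "Re w"] w by (simp add: P.collar_def Q.collar_def P.collar_dom_def)
next
 case False
 let ?t = "if dr F i = dr G j then Re w else 1 - Re w"
 have G: "G \<in> Fs" "j < n G" using P.opp_es[OF F] by auto
 have "f (P.collar F i G j w) = Q.strip (tf G) (sd G j) (if kp G j then ?t else 1 - ?t) (- Im w)"
  using f_strip[OF G, of "- Im w" ?t] w False by (simp add: P.collar_def P.collar_dom_def)
 moreover have "(if kp G j then ?t else 1 - ?t) =
   (if dr' (tf F) (sd F i) = dr' (tf G) (sd G j) then (if kp F i then Re w else 1 - Re w) else 1 - (if kp F i then Re w else 1 - Re w))"
  using opp_sd(2)[OF F] by auto
 ultimately show ?thesis using False by (simp add: Q.collar_def)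
qed

lemma f_nb:
 assumes e: "e \<in> E"
 shows "\<exists>k. homeomorphism (P.nb e) (Q.nb (em e)) f k"
proof -
 obtain F i where s: "(F, i) \<in> P.sides_of e" using P.side_exists[OF e] by auto
 have F: "F \<in> Fs" "i < n F" "es F i = e" using s by (auto simp: P.sides_of_def)
 obtain G j where o: "P.opp F i = (G, j)" by (cases "P.opp F i")
 have sP: "P.sides_of e = {(F, i), (G, j)}" "(F, i) \<noteq> (G, j)" using P.opp[OF F(1,2)] o F(3) by auto
 have F': "tf F \<in> Fs'" "sd F i < n' (tf F)" using tf(1)[OF F(1)] sd_less[OF F(1,2)] n'_tf[OF F(1)] by auto
 note oQ = opp_sd(1)[OF F(1,2) o]
 have em: "em e = es' (tf F) (sd F i)" by (rule em_side(1)[OF s])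
 have sQ: "Q.sides_of (em e) = {(tf F, sd F i), (tf G, sd G j)}" "(tf F, sd F i) \<noteq> (tf G, sd G j)"
  using Q.opp[OF F'] oQ em by auto
 let ?C = "P.collar F i G j" and ?D = "Q.collar (tf F) (sd F i) (tf G) (sd G j)"
 let ?r = "\<lambda>w. if kp F i then w else Complex (1 - Re w) (Im w)"
 have nbP: "P.nb e = ?C ` P.collar_dom" by (rule P.nb_collar[OF e sP(1)])
 have nbQ: "Q.nb (em e) = ?D ` P.collar_dom"
  using Q.nb_collar[OF em_E[OF e] sQ(1)] by simp
 have rr: "?r (?r w) = w" for w by simp
 have rdom: "?r w \<in> P.collar_dom \<longleftrightarrow> w \<in> P.collar_dom" for w by (auto simp: P.collar_dom_def)
 have rc: "continuous_on UNIV ?r"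
 proof (cases "kp F i")
  case False
  have "(\<lambda>w. Complex (1 - Re w) (Im w)) = (\<lambda>w. 1 - cnj w)" by (auto simp: complex_eq_iff)
  then show ?thesis using False by (auto intro!: continuous_intros)
 qed auto
 have fC: "f (?C w) = ?D (?r w)" if "w \<in> P.collar_dom" for w using f_collar[OF F(1,2) o that] .
 have injD: "inj_on ?D P.collar_dom" using Q.collar_inj[of "tf F" "sd F i" "em e" "tf G" "sd G j"] sQ by auto
 have "f ` P.nb e = Q.nb (em e)"
 proof (intro set_eqI iffI)
  fix x assume "x \<in> Q.nb (em e)"
  then obtain w where w: "w \<in> P.collar_dom" "x = ?D w" unfolding nbQ by blast
  have rw: "?r w \<in> P.collar_dom" using rdom w(1) by blast
  have "f (?C (?r w)) = x" unfolding fC[OF rw] rr w(2) ..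
  then show "x \<in> f ` P.nb e" unfolding nbP using rw by blast
 qed (use fC rdom in \<open>auto simp: nbP nbQ\<close>)
 moreover have "inj_on f (P.nb e)"
 proof (rule inj_onI)
  fix x y assume "x \<in> P.nb e" "y \<in> P.nb e" "f x = f y"
  then obtain w u where wu: "w \<in> P.collar_dom" "u \<in> P.collar_dom" "x = ?C w" "y = ?C u" "?D (?r w) = ?D (?r u)"
   unfolding nbP using fC by auto
  then have "?r w = ?r u" using inj_onD[OF injD wu(5)] rdom by blast
  then have "?r (?r w) = ?r (?r u)" by (simp only:)
  then have "w = u" unfolding rr .
  then show "x = y" using wu by simp
 qed
 moreover have sub: "P.nb e \<subseteq> S2" using P.nb_open[OF e] openin_imp_subset by blast
 moreover have "openin (top_of_set (Q.nb (em e))) (f ` U)" if U: "openin (top_of_set (P.nb e)) U" for U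
 proof -
  obtain O1 where O1: "open O1" "U = P.nb e \<inter> O1" using U by (auto simp: openin_open)
  have mem: "(F, i) \<in> P.sides_of e" "(G, j) \<in> P.sides_of e" using sP(1) by auto
  have "openin (top_of_set P.collar_dom) (P.collar_dom \<inter> ?C -` O1)"
   by (rule continuous_openin_preimage_gen[OF P.collar_cont[OF mem] O1(1)])
  then have op: "open (P.collar_dom \<inter> ?C -` O1)" using P.open_collar_dom openin_open_trans by blast
  let ?X = "?r -` (P.collar_dom \<inter> ?C -` O1)"
  have opX: "open ?X" using continuous_open_preimage[OF rc open_UNIV op] by simp
  have Xd: "?X \<subseteq> P.collar_dom" using rdom by blast
  have "f ` U = ?D ` ?X"
  proof (intro set_eqI iffI)
   fix x assume "x \<in> f ` U"
   then obtain w where w: "w \<in> P.collar_dom" "?C w \<in> O1" "x = f (?C w)" using O1(2) nbP by auto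
   then have "x = ?D (?r w)" "?r w \<in> ?X" using fC rr by auto
   then show "x \<in> ?D ` ?X" by blast
  next
   fix x assume "x \<in> ?D ` ?X"
   then obtain w where w: "?r w \<in> P.collar_dom" "?C (?r w) \<in> O1" "x = ?D w" by blast
   have "f (?C (?r w)) = x" unfolding fC[OF w(1)] rr w(3) ..
   then show "x \<in> f ` U" using w O1(2) nbP by blast
  qed
  moreover have "openin (top_of_set S2) (?D ` ?X)"
   using Q.collar_open[of "tf F" "sd F i" "em e" "tf G" "sd G j" ?X] sQ opX Xd by auto
  moreover have "f ` U \<subseteq> Q.nb (em e)" using O1(2) \<open>f ` P.nb e = Q.nb (em e)\<close> by blast
  moreover have "Q.nb (em e) \<subseteq> S2" using Q.nb_open[OF em_E[OF e]] openin_imp_subset by blast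
  ultimately show ?thesis by (metis openin_subset_trans)
 qed
 ultimately obtain k where "homeomorphism (P.nb e) (Q.nb (em e)) f k"
  using homeomorphism_injective_open_map[of "P.nb e" f "Q.nb (em e)"] continuous_on_subset[OF f_cont sub] by metis
 then show ?thesis by blast
qed

lemma f_in_nb: assumes "x \<in> S2" "f x \<in> Q.nb e'" "e' \<in> E'" shows "\<exists>e\<in>E. x \<in> P.nb e \<and> em e = e'"
 using assms(1)
proof (cases rule: P.S2_cases)
 case V then show ?thesis using f_vertex Q.nb_notV assms by blast
next
 case (E e)
 then have "f x \<in> em e" using f_edge_image(1) by blast
 then have "em e = e'" using Q.nb_edge[OF assms(3) em_E[OF E(1)] assms(2)] by blast
 then show ?thesis using P.edge_sub_nb[OF E(1)] E by blast
next
 case (F F)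
 then have fx: "f x \<in> tf F" using f_face(1) by blast
 show ?thesis using assms(3,2)
 proof (cases rule: Q.nb_cases)
  case 1 then show ?thesis using Q.x_EF[OF _ assms(3) tf(1)[OF F(1)]] fx by blast
 next
  case (2 F' i' t' y)
  have F': "F' \<in> Fs'" "i' < n' F'" "es' F' i' = e'" using 2(1) by (auto simp: Q.sides_of_def)
  then have eq: "F' = tf F" using Q.F_eq 2 fx tf(1)[OF F(1)] by blast
  obtain z where z: "norm z < 1" "x = h F z" using F P.h_im by (metis imageE mem_ball_0)
  have np: "0 < n F" using P.n_pos F by blast
  have "h' F' (dm F z) = h' F' ((1 - y) *\<^sub>R pt (n F) (real i' + t'))"
   using 2(6) f_h[OF F(1), of z] z eq n'_tf[OF F(1)] by (simp add: ph_def Q.strip_def)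
  then have dz: "dm F z = (1 - y) *\<^sub>R pt (n F) (real i' + t')"
   by (rule inj_onD[OF Q.h_inj[OF F'(1)]]) (use z 2 in auto)
  have "norm (dm F z) = 1 - y" unfolding dz using 2 by simp
  then have nz: "norm z = 1 - y" by simp
  have z0: "z \<noteq> 0" using nz 2(5) by auto
  then have "norm (sgn z) = 1" by (simp add: norm_sgn)
  then obtain i t where it: "i < n F" "0 \<le> t" "t < 1" "sgn z = pt (n F) (real i + t)" using sphere_pt_cases[OF np] by metis
  have zz: "z = (1 - y) *\<^sub>R pt (n F) (real i + t)" 
   unfolding it(4)[symmetric] nz[symmetric] using z0 by (simp add: sgn_div_norm)
  then have "(1 - y) *\<^sub>R pt (n F) (real (sd F i) + (if kp F i then t else 1 - t)) = (1 - y) *\<^sub>R pt (n F) (real i' + t')"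
   using dm_side[OF F(1) it(1), of "1 - y" t] dz by simp
  then have pe: "pt (n F) (real (sd F i) + (if kp F i then t else 1 - t)) = pt (n F) (real i' + t')" using 2 by simp
  have i'n: "i' < n F" using F'(2) eq n'_tf[OF F(1)] by simp
  have "t \<noteq> 0"
  proof
   assume t0: "t = 0"
   have "\<exists>c<n F. pt (n F) (real (sd F i) + (if kp F i then t else 1 - t)) = pt (n F) (real c + 0)"
   proof (cases "kp F i")
    case True then show ?thesis using t0 sd_less[OF F(1) it(1)] by (intro exI[of _ "sd F i"]) simp
   next
    case False then show ?thesis using t0 pt_corner[OF np sd_less[OF F(1) it(1)]] np by (intro exI[of _ "(sd F i + 1) mod n F"]) simp
   qed
   then obtain c where "c < n F" "pt (n F) (real c + 0) = pt (n F) (real i' + t')" using pe by metis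
   then show False using pt_inj[of c "n F" i' 0 t'] i'n 2 by simp
  qed
  then have t: "0 < t" using it by simp
  then have "sd F i = i'" using pt_inj[OF sd_less[OF F(1) it(1)] i'n _ _ _ _ pe] it 2 by auto
  moreover have m: "(F, i) \<in> P.sides_of (es F i)" using F it by (simp add: P.sides_of_def)
  ultimately have "em (es F i) = e'" using em_side(1)[OF m] F'(3) eq by simp
  moreover have "x = P.strip F i t y" using z zz by (simp add: P.strip_def)
  then have "x \<in> P.nb (es F i)" unfolding P.nb_def using m t it 2 by fastforce
  moreover have "es F i \<in> E" using P.es_E F it by blast
  ultimately show ?thesis by blast
 qed
qed

lemma f_surj: "f ` S2 = S2"
proof
 show "f ` S2 \<subseteq> S2" using f_S2 by blast
 let ?M = "f ` (S2 - V)"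
 have cl: "closed (f ` S2)" using f_cont by (simp add: compact_continuous_image compact_imp_closed)
 have M: "?M = f ` S2 \<inter> (S2 - V')" using f_V_iff f_S2 by blast
 have fs: "f ` F \<subseteq> ?M" if "F \<in> Fs" for F using P.F_S2[OF that] P.x_VF that by blast
 have "openin (top_of_set S2) ?M"
 proof (subst openin_subopen, intro ballI)
  fix y assume "y \<in> ?M"
  then obtain x where x: "x \<in> S2" "x \<notin> V" "y = f x" by blast
  show "\<exists>T. openin (top_of_set S2) T \<and> y \<in> T \<and> T \<subseteq> ?M"
   using x(1)
  proof (cases rule: P.S2_cases)
   case V then show ?thesis using x by blast
  next
   case (E e)
   have sub: "P.nb e \<subseteq> S2 - V" using openin_imp_subset[OF P.nb_open[OF E(1)]] P.nb_notV[OF E(1)] by blast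
   have eq: "f ` P.nb e = Q.nb (em e)" using f_nb[OF E(1)] by (auto simp: homeomorphism_def)
   have "Q.nb (em e) \<subseteq> ?M" unfolding eq[symmetric] using sub by (rule image_mono)
   moreover have "y \<in> Q.nb (em e)" unfolding eq[symmetric] using P.edge_sub_nb[OF E(1)] E(2) x(3) by blast
   ultimately show ?thesis using Q.nb_open[OF em_E[OF E(1)]] by blast
  next
   case (F F)
   then show ?thesis using Q.F_open[OF tf(1)[OF F(1)]] f_face(1)[OF F(1)] fs[OF F(1)] x(3) by blast
  qed
 qed
 then have op: "openin (top_of_set (S2 - V')) ?M" using M by (metis Diff_subset Int_lower2 openin_subset_trans)
 have clo: "closedin (top_of_set (S2 - V')) ?M" unfolding M using cl by (simp add: closedin_closed_Int Int_commute)
 have "connected (S2 - V')" by (rule connected_S2_delete_finite) (auto simp: Q.finV connected_sphere)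
 moreover obtain F where F: "F \<in> Fs" using P.Fs_ne by blast
 then have "?M \<noteq> {}" using fs[OF F] P.F_nonempty[OF F] by blast
 ultimately have MM: "?M = S2 - V'" using op clo unfolding connected_clopen by blast
 show "S2 \<subseteq> f ` S2"
 proof
  fix y assume "y \<in> S2"
  show "y \<in> f ` S2"
  proof (cases "y \<in> V'")
   case False then show ?thesis using MM \<open>y \<in> S2\<close> by blast
  next
   case True
   then obtain z where z: "z \<in> Q.flags" "Q.vx z = y" using Q.vertex_has_flag by blast
   obtain F' i b where fi: "z = (F', i, b)" by (metis prod_cases3)
   have F': "F' \<in> Fs'" using z fi by (simp add: Q.flags_def)
   have "y = h' F' (pt (n' F') (real i + of_bool b))" using Q.vx_h[of F' i b] z fi by simp
   moreover have "pt (n' F') (real i + of_bool b) \<in> cball 0 1" by simp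
   ultimately have "y \<in> closure F'" using Q.closure_face[OF F'] by blast
   moreover have "F' \<subseteq> f ` S2" using MM Q.F_S2[OF F'] Q.x_VF F' by blast
   then have "closure F' \<subseteq> f ` S2" using cl closure_minimal by blast
   ultimately show ?thesis by blast
  qed
 qed
qed

lemma f_fibres_finite: assumes "y \<in> S2" shows "finite (S2 \<inter> f -` {y})"
proof -
 have one: "finite (c \<inter> f -` {y})" if "inj_on f c" for c
 proof (cases "c \<inter> f -` {y} = {}")
  case False
  then obtain x where "x \<in> c" "f x = y" by blast
  then have "c \<inter> f -` {y} = {x}" using that by (auto dest: inj_onD)
  then show ?thesis by simp
 qed simp
 have "S2 \<inter> f -` {y} \<subseteq> V \<union> (\<Union>e\<in>E. e \<inter> f -` {y}) \<union> (\<Union>F\<in>Fs. F \<inter> f -` {y})"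
 proof
  fix x assume "x \<in> S2 \<inter> f -` {y}"
  then have "x \<in> S2" "f x = y" by auto
  then show "x \<in> V \<union> (\<Union>e\<in>E. e \<inter> f -` {y}) \<union> (\<Union>F\<in>Fs. F \<inter> f -` {y})" by (cases rule: P.S2_cases) auto
 qed
 moreover have "finite (V \<union> (\<Union>e\<in>E. e \<inter> f -` {y}) \<union> (\<Union>F\<in>Fs. F \<inter> f -` {y}))"
  using P.finV P.finE P.finF one f_edge_image(2) f_face(2) by (intro finite_UnI finite_UN_I) auto
 ultimately show ?thesis by (rule finite_subset)
qed

text \<open>
  Open faces of the target, and the neighbourhoods \<open>nb\<close> of its edges, are evenly covered: their preimages
  are disjoint unions of faces and of such neighbourhoods, each mapped homeomorphically.
\<close>

lemma f_covering: "covering_space (S2 - f -` V') f (S2 - V')"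
proof -
 have dom: "S2 - f -` V' = S2 - V" using f_V_iff by blast
 have im: "f ` (S2 - V) = S2 - V'"
 proof
  show "f ` (S2 - V) \<subseteq> S2 - V'" using f_V_iff f_S2 by blast
  show "S2 - V' \<subseteq> f ` (S2 - V)"
  proof
   fix y assume y: "y \<in> S2 - V'"
   then have "y \<in> f ` S2" using f_surj by simp
   then obtain x where "x \<in> S2" "y = f x" by blast
   then show "y \<in> f ` (S2 - V)" using f_V_iff[of x] y by blast
  qed
 qed
 have opD: "openin (top_of_set (S2 - B)) X" if "openin (top_of_set S2) X" "X \<inter> B = {}" for X B
 proof -
  have "X \<subseteq> S2 - B" using openin_imp_subset[OF that(1)] that(2) by blast
  then show ?thesis using openin_subset_trans[OF that(1)] by blast
 qed
 have opV: "openin (top_of_set (S2 - V)) X" if "openin (top_of_set S2) X" "X \<inter> V = {}" for X using opD that .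
 have opV': "openin (top_of_set (S2 - V')) X" if "openin (top_of_set S2) X" "X \<inter> V' = {}" for X using opD that .
 have "\<exists>T. y \<in> T \<and> openin (top_of_set (S2 - V')) T \<and>
   (\<exists>v. \<Union>v = (S2 - V) \<inter> f -` T \<and> (\<forall>u\<in>v. openin (top_of_set (S2 - V)) u) \<and> pairwise disjnt v \<and> (\<forall>u\<in>v. \<exists>q. homeomorphism u T f q))"
  if y: "y \<in> S2 - V'" for y
 proof -
  from y have "y \<in> S2" by blast
  then show ?thesis
  proof (cases rule: Q.S2_cases)
   case V then show ?thesis using y by blast
  next
   case (E e')
   let ?v = "P.nb ` {e \<in> E. em e = e'}"
   have "\<Union>?v = (S2 - V) \<inter> f -` Q.nb e'"
   proof
    show "\<Union>?v \<subseteq> (S2 - V) \<inter> f -` Q.nb e'"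
    proof clarify
     fix x e assume e: "e \<in> E" "x \<in> P.nb e" "e' = em e"
     have "f ` P.nb e = Q.nb (em e)" using f_nb[OF e(1)] by (auto simp: homeomorphism_def)
     then show "x \<in> (S2 - V) \<inter> f -` Q.nb (em e)"
      using e P.nb_open[OF e(1)] openin_imp_subset P.nb_notV[OF e(1)] by blast
    qed
    show "(S2 - V) \<inter> f -` Q.nb e' \<subseteq> \<Union>?v" using f_in_nb[OF _ _ E(1)] by blast
   qed
   moreover have "\<forall>u\<in>?v. openin (top_of_set (S2 - V)) u" using opV P.nb_open P.nb_notV by blast
   moreover have "pairwise disjnt ?v" using P.nb_disjoint unfolding pairwise_def disjnt_iff by blast
   moreover have "\<forall>u\<in>?v. \<exists>q. homeomorphism u (Q.nb e') f q" using f_nb by blast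
   moreover have "openin (top_of_set (S2 - V')) (Q.nb e')" using opV' Q.nb_open[OF E(1)] Q.nb_notV[OF E(1)] by blast
   moreover have "y \<in> Q.nb e'" using Q.edge_sub_nb E by blast
   ultimately show ?thesis by (intro exI[of _ "Q.nb e'"] conjI exI[of _ ?v])
  next
   case (F F')
   let ?v = "{F \<in> Fs. tf F = F'}"
   have "\<Union>?v = (S2 - V) \<inter> f -` F'"
   proof
    show "\<Union>?v \<subseteq> (S2 - V) \<inter> f -` F'" using P.F_S2 P.x_VF f_face(1) by blast
    show "(S2 - V) \<inter> f -` F' \<subseteq> \<Union>?v" using f_in_face[OF _ _ F(1)] by blast
   qed
   moreover have "\<forall>u\<in>?v. openin (top_of_set (S2 - V)) u" using opV P.F_open P.x_VF by blast
   moreover have "pairwise disjnt ?v" using P.disjF by (auto simp: pairwise_def)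
   moreover have "\<forall>u\<in>?v. \<exists>q. homeomorphism u F' f q" using f_face(3) by blast
   moreover have "openin (top_of_set (S2 - V')) F'" using opV' Q.F_open[OF F(1)] Q.x_VF[OF _ F(1)] by blast
   ultimately show ?thesis using F(2) by (intro exI[of _ F'] conjI exI[of _ ?v])
  qed
 qed
 then show ?thesis unfolding dom covering_space_def using im continuous_on_subset[OF f_cont, of "S2 - V"] by blast
qed

lemma f_branched_covering: "branched_covering V' f"
 unfolding branched_covering_def
 using Q.finV Q.V_S2 f_cont f_surj f_fibres_finite f_covering by blast

lemma f_preimage_edge: assumes e': "e' \<in> E'" shows "components (S2 \<inter> f -` e') = {e \<in> E. f ` e = e'}"
proof -
 let ?C = "{e \<in> E. f ` e = e'}"
 have U: "S2 \<inter> f -` e' = \<Union>?C"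
 proof
  show "\<Union>?C \<subseteq> S2 \<inter> f -` e'" using P.E_S2 by blast
  show "S2 \<inter> f -` e' \<subseteq> \<Union>?C"
  proof
   fix x assume "x \<in> S2 \<inter> f -` e'"
   then obtain e where "e \<in> E" "x \<in> e" "em e = e'" using f_in_edge[OF _ _ e'] by blast
   then show "x \<in> \<Union>?C" using f_edge_image(1) by auto
  qed
 qed
 have "closedin (top_of_set (\<Union>?C)) e" if e: "e \<in> ?C" for e
 proof -
  have eE: "e \<in> E" using e by simp
  have "closure e \<subseteq> e \<union> V" using P.closure_edge[OF eE] P.closed_edge_eq[OF eE] P.g_ends[OF eE] by auto
  moreover have "V \<inter> \<Union>?C = {}" using P.x_VE by blast
  ultimately have "e = \<Union>?C \<inter> closure e" using e closure_subset[of e] by blast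
  then show ?thesis unfolding closedin_closed using closed_closure by blast
 qed
 moreover have "pairwise disjnt ?C" using P.disjE by (auto simp: pairwise_def)
 ultimately show ?thesis unfolding U
  by (intro components_finite_disjoint_closed) (use P.finE P.E_connected P.E_nonempty in auto)
qed

lemma f_preimage_face: assumes F': "F' \<in> Fs'" shows "components (S2 \<inter> f -` F') = {F \<in> Fs. f ` F = F'}"
proof -
 let ?C = "{F \<in> Fs. f ` F = F'}"
 have U: "S2 \<inter> f -` F' = \<Union>?C"
 proof
  show "\<Union>?C \<subseteq> S2 \<inter> f -` F'" using P.F_S2 by blast
  show "S2 \<inter> f -` F' \<subseteq> \<Union>?C"
  proof
   fix x assume "x \<in> S2 \<inter> f -` F'"
   then obtain F where "F \<in> Fs" "x \<in> F" "tf F = F'" using f_in_face[OF _ _ F'] by blast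
   then show "x \<in> \<Union>?C" using f_face(1) by auto
  qed
 qed
 have "closedin (top_of_set (\<Union>?C)) F" if F: "F \<in> ?C" for F
 proof -
  have FF: "F \<in> Fs" using F by simp
  have "x \<in> F" if "x \<in> closure F" "x \<in> G" "G \<in> Fs" for x G
   using that P.closure_face[OF FF] P.h_in_face[OF FF _ that(3)] P.h_ball[OF FF] by auto
  then have "F = \<Union>?C \<inter> closure F" using F closure_subset[of F] by blast
  then show ?thesis unfolding closedin_closed using closed_closure by blast
 qed
 moreover have "pairwise disjnt ?C" using P.disjF by (auto simp: pairwise_def)
 ultimately show ?thesis unfolding U
  by (intro components_finite_disjoint_closed) (use P.finF P.F_connected P.F_nonempty in auto)
qed

lemma f_cells: "e \<in> E ==> f ` e \<in> E'" "F \<in> Fs ==> f ` F \<in> Fs'" "F \<in> Fs ==> f ` F \<in> Bl' \<longleftrightarrow> F \<in> Bl"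
 using f_edge_image(1) em_E f_face(1) tf by auto

end

theorem (in two_football_maps) covering_map:
 "\<exists>f. branched_covering V' f \<and> V = S2 \<inter> f -` V' \<and>
  (\<forall>e'\<in>E'. components (S2 \<inter> f -` e') = {e \<in> E. f ` e = e'}) \<and>
  (\<forall>F'\<in>Fs'. components (S2 \<inter> f -` F') = {F \<in> Fs. f ` F = F'}) \<and>
  (\<forall>e\<in>E. f ` e \<in> E' \<and> inj_on f e) \<and> (\<forall>F\<in>Fs. f ` F \<in> Fs' \<and> inj_on f F \<and> (f ` F \<in> Bl' \<longleftrightarrow> F \<in> Bl))"
proof -
 obtain A where A: "\<forall>F\<in>Fs. ok (A F) F" "\<forall>x\<in>P.flags. ga A (P.ac x) = Q.ac (ga A x)" using flag_morphism by blast
 interpret developed V E Fs g n h es dr Bl Wh V' E' Fs' g' n' h' es' dr' Bl' Wh' k m A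
  by unfold_locales (use A in auto)
 have "V = S2 \<inter> f -` V'" using f_V_iff P.V_S2 by blast
 then show ?thesis
  using f_branched_covering f_preimage_edge f_preimage_face f_cells f_edge_image(2) f_face(2) by (intro exI[of _ f]) auto
qed

section \<open>Minimal realisations\<close>

lemma (in football_map) counts:
 shows "0 < card Bl" "k * card Bl = m * card Wh" "k * card Bl + 4 \<le> 2 * (card Bl + card Wh)" "card Fs = card Bl + card Wh"
proof -
 obtain x where "x \<in> flags" "ty x = 0" using type_exists[of 0] by auto
 then have "fst x \<in> Bl" by (cases x) (auto simp: flags_def split: if_splits)
 then show "0 < card Bl" using finB by (metis card_gt_0_iff empty_iff)
qed (rule card_black_white black_count_bound card_Fs)+

text \<open>
  Eliminating the numbers of faces leaves \<open>m k < 2 (m + k)\<close>, that is \<open>(m - 2) (k - 2) < 4\<close>.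
\<close>

lemma spherical_types:
 fixes k m b w :: nat
 assumes "3 \<le> k" "2 \<le> m" "k * b = m * w" "k * b + 4 \<le> 2 * (b + w)"
 shows "m = 2 \<or> (k, m) \<in> {(3,3), (4,3), (5,3), (3,4), (3,5)}"
proof -
 have "m * (k * b + 4) \<le> m * (2 * (b + w))" using assms(4) by simp
 then have "m * (k * b) + 4 * m \<le> 2 * (m * b) + 2 * (k * b)" unfolding assms(3) by (simp add: algebra_simps)
 then have "b * (m * k) < b * (2 * m + 2 * k)" using assms(2) by (simp add: algebra_simps)
 then have lt: "m * k < 2 * m + 2 * k" by simp
 consider "m = 2" | "m = 3" | "m = 4" | "m = 5" | "m \<ge> 6" using assms(2) by linarith
 then show ?thesis
 proof cases
  case 5
  obtain m' k' where mk: "m = 6 + m'" "k = 3 + k'" using 5 assms(1) by (metis le_add_diff_inverse)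
  have False using lt unfolding mk by (simp add: algebra_simps)
  then show ?thesis ..
 qed (use lt assms(1) in auto)
qed

text \<open>
  Here \<open>m\<close> is half the number of sides of the white faces, and equality holds in
  \<open>black_count_bound\<close>.
\<close>

definition optimal :: "nat => nat => pattern => bool"
 where "optimal k m P \<longleftrightarrow> football_pattern k (2 * m) 2 P \<and> k * card (black P) + 4 = 2 * card (faces P)"

lemma pattern_map:
 assumes "football_pattern k l 2 P"
 obtains g n h es dr where "football_map (verts P) (edges P) (faces P) g n h es dr (black P) (white P) k (l div 2)"
 using football_pattern_normalised[OF assms] by blast

text \<open>
  By \<open>k b = m w\<close> the number of faces grows with the number of black faces, and the Euler bound is a lower
  bound for the latter. So if equality is attained at all, the minimal patterns are those with equality.
\<close>

lemma minimal_optimal: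
 assumes opt: "optimal k (l div 2) R" and l: "even l" and Q: "minimal_realisation k l 2 Q"
 shows "football_pattern k l 2 Q" "2 * card (faces Q) \<le> k * card (black Q) + 4" "card (faces Q) = card (faces R)"
proof -
 have ll: "2 * (l div 2) = l" using l by simp
 have R: "football_pattern k l 2 R" "k * card (black R) + 4 = 2 * card (faces R)" using opt ll by (auto simp: optimal_def)
 show fQ: "football_pattern k l 2 Q" using Q by (simp add: minimal_realisation_def is_arg_min_def)
 have le: "card (faces Q) \<le> card (faces R)" using Q R(1) by (auto simp: minimal_realisation_def is_arg_min_def not_less)
 obtain g n h es dr where "football_map (verts Q) (edges Q) (faces Q) g n h es dr (black Q) (white Q) k (l div 2)"
  using pattern_map[OF fQ] .
 then interpret Q: football_map "verts Q" "edges Q" "faces Q" g n h es dr "black Q" "white Q" k "l div 2" .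
 obtain g' n' h' es' dr' where "football_map (verts R) (edges R) (faces R) g' n' h' es' dr' (black R) (white R) k (l div 2)"
  using pattern_map[OF R(1)] .
 then interpret R: football_map "verts R" "edges R" "faces R" g' n' h' es' dr' "black R" "white R" k "l div 2" .
 let ?m = "l div 2"
 define q where "q = card (black Q)"
 define r where "r = card (black R)"
 define wq where "wq = card (white Q)"
 define wr where "wr = card (white R)"
 have c: "k * q = ?m * wq" "k * r = ?m * wr" "q + wq \<le> r + wr" "k * r + 4 = 2 * (r + wr)" "k * q + 4 \<le> 2 * (q + wq)"
  using Q.counts R.counts le R(2) by (auto simp: q_def r_def wq_def wr_def)
 have m0: "0 < ?m" using Q.m2 by simp
 have "?m * (q + wq) \<le> ?m * (r + wr)" using c(3) by simp
 then have "(?m + k) * q \<le> (?m + k) * r" using c(1,2) by (simp add: algebra_simps)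
 then have qr: "q \<le> r" using m0 by simp
 have e: "?m * (k * r) + 4 * ?m = 2 * (?m + k) * r"
 proof -
  have "?m * (k * r + 4) = ?m * (2 * (r + wr))" using c(4) by simp
  then show ?thesis using c(2) by (simp add: algebra_simps)
 qed
 have lq: "?m * (k * q) + 4 * ?m \<le> 2 * (?m + k) * q"
 proof -
  have "?m * (k * q + 4) \<le> ?m * (2 * (q + wq))" using c(5) by simp
  then show ?thesis using c(1) by (simp add: algebra_simps)
 qed
 have "q = r"
 proof (rule ccontr)
  assume "q \<noteq> r"
  then obtain d where d: "r = q + d" "0 < d" using qr by (metis le_add_diff_inverse le_neq_implies_less zero_less_diff)
  have "?m * (k * q) + ?m * k * d + 4 * ?m = 2 * (?m + k) * q + 2 * (?m + k) * d"
   using e unfolding d(1) by (simp add: algebra_simps)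
  then have "2 * (?m + k) * d \<le> ?m * k * d" using lq by linarith
  then have "2 * (?m + k) \<le> ?m * k" using d(2) by simp
  then have "2 * (?m + k) * r \<le> ?m * (k * r)" by (metis mult.assoc mult_le_mono1)
  then show False using e m0 by linarith
 qed
 then have "wq = wr" using c m0 by simp
 then show "card (faces Q) = card (faces R)" "2 * card (faces Q) \<le> k * card (black Q) + 4"
  using \<open>q = r\<close> c Q.counts R.counts by (auto simp: q_def r_def wq_def wr_def)
qed

lemma covers_minimal:
 assumes P: "football_pattern k l 2 P" and Q: "football_pattern k l 2 Q" "2 * card (faces Q) \<le> k * card (black Q) + 4"
 shows "\<exists>f. branched_covering (verts Q) f \<and> verts P = S2 \<inter> f -` verts Q \<and>
  (\<forall>e'\<in>edges Q. components (S2 \<inter> f -` e') = {e \<in> edges P. f ` e = e'}) \<and>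
  (\<forall>F'\<in>faces Q. components (S2 \<inter> f -` F') = {F \<in> faces P. f ` F = F'}) \<and>
  (\<forall>e\<in>edges P. f ` e \<in> edges Q \<and> inj_on f e) \<and>
  (\<forall>F\<in>faces P. f ` F \<in> faces Q \<and> inj_on f F \<and> (f ` F \<in> black Q \<longleftrightarrow> F \<in> black P))"
proof -
 obtain g n h es dr where "football_map (verts P) (edges P) (faces P) g n h es dr (black P) (white P) k (l div 2)"
  using pattern_map[OF P] .
 then interpret P: football_map "verts P" "edges P" "faces P" g n h es dr "black P" "white P" k "l div 2" .
 obtain g' n' h' es' dr' where "football_map (verts Q) (edges Q) (faces Q) g' n' h' es' dr' (black Q) (white Q) k (l div 2)"
  using pattern_map[OF Q(1)] .
 then interpret Q: football_map "verts Q" "edges Q" "faces Q" g' n' h' es' dr' "black Q" "white Q" k "l div 2" .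
 have eq: "card (verts Q) = k * card (black Q)" using Q.card_V_eq Q(2) Q.card_Fs by simp
 interpret two_football_maps "verts P" "edges P" "faces P" g n h es dr "black P" "white P"
  "verts Q" "edges Q" "faces Q" g' n' h' es' dr' "black Q" "white Q" k "l div 2"
  by unfold_locales (rule Q.cubic_if_card_V_eq[OF eq])
 show ?thesis by (rule covering_map)
qed

lemma lift_of_cells:
 assumes col: "black P \<union> white P = faces P" "black P \<inter> white P = {}" "black Q \<union> white Q = faces Q" "black Q \<inter> white Q = {}"
  and f: "verts P = S2 \<inter> f -` verts Q"
   "\<forall>e'\<in>edges Q. components (S2 \<inter> f -` e') = {e \<in> edges P. f ` e = e'}"
   "\<forall>F'\<in>faces Q. components (S2 \<inter> f -` F') = {F \<in> faces P. f ` F = F'}"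
   "\<forall>e\<in>edges P. f ` e \<in> edges Q \<and> inj_on f e"
   "\<forall>F\<in>faces P. f ` F \<in> faces Q \<and> inj_on f F \<and> (f ` F \<in> black Q \<longleftrightarrow> F \<in> black P)"
 shows "is_lift f Q P"
 unfolding is_lift_def
proof (intro conjI)
 show "edges P = (\<Union>e\<in>edges Q. components (S2 \<inter> f -` e))" using f(2,4) by auto
 have B: "F \<in> black Q ==> F \<in> faces Q" "F \<in> white Q ==> F \<in> faces Q" "F \<in> black P ==> F \<in> faces P" "F \<in> white P ==> F \<in> faces P" for F
  using col by auto
 have W: "F \<in> white P \<longleftrightarrow> F \<in> faces P \<and> F \<notin> black P" "F \<in> white Q \<longleftrightarrow> F \<in> faces Q \<and> F \<notin> black Q" for F using col by auto
 have "(\<Union>F\<in>black Q. components (S2 \<inter> f -` F)) = (\<Union>F'\<in>black Q. {F \<in> faces P. f ` F = F'})" using f(3) B by simp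
 then show "black P = (\<Union>F\<in>black Q. components (S2 \<inter> f -` F))" using f(5) B by auto
 have "(\<Union>F\<in>white Q. components (S2 \<inter> f -` F)) = (\<Union>F'\<in>white Q. {F \<in> faces P. f ` F = F'})" using f(3) B by simp
 then show "white P = (\<Union>F\<in>white Q. components (S2 \<inter> f -` F))" using f(5) W by auto
qed (rule f(1))

lemma inj_on_of_surj_card:
 assumes "finite A" "f ` A = B" "card A = card B" shows "inj_on f A"
 by (rule eq_card_imp_inj_on) (use assms in simp_all)

text \<open>
  Both patterns have the same numbers of vertices, edges and faces, so the covering is injective on cells and hence a
  homeomorphism.
\<close>

lemma optimal_isomorphic:
 assumes P: "football_pattern k l 2 P" "2 * card (faces P) \<le> k * card (black P) + 4"
  and Q: "football_pattern k l 2 Q" "2 * card (faces Q) \<le> k * card (black Q) + 4"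
  and eq: "card (faces P) = card (faces Q)"
 shows "isomorphic_patterns P Q"
proof -
 obtain g n h es dr where "football_map (verts P) (edges P) (faces P) g n h es dr (black P) (white P) k (l div 2)"
  using pattern_map[OF P(1)] .
 then interpret P: football_map "verts P" "edges P" "faces P" g n h es dr "black P" "white P" k "l div 2" .
 obtain g' n' h' es' dr' where "football_map (verts Q) (edges Q) (faces Q) g' n' h' es' dr' (black Q) (white Q) k (l div 2)"
  using pattern_map[OF Q(1)] .
 then interpret Q: football_map "verts Q" "edges Q" "faces Q" g' n' h' es' dr' "black Q" "white Q" k "l div 2" .
 from covers_minimal[OF P(1) Q] obtain f where f: "branched_covering (verts Q) f" "verts P = S2 \<inter> f -` verts Q"
  "\<forall>e'\<in>edges Q. components (S2 \<inter> f -` e') = {e \<in> edges P. f ` e = e'}"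
  "\<forall>F'\<in>faces Q. components (S2 \<inter> f -` F') = {F \<in> faces P. f ` F = F'}"
  "\<forall>e\<in>edges P. f ` e \<in> edges Q \<and> inj_on f e"
  "\<forall>F\<in>faces P. f ` F \<in> faces Q \<and> inj_on f F \<and> (f ` F \<in> black Q \<longleftrightarrow> F \<in> black P)"
  by (elim exE conjE)
 have cont: "continuous_on S2 f" and sur: "f ` S2 = S2" using f(1) by (auto simp: branched_covering_def)
 have hit: "\<exists>y\<in>S2. f y \<in> c" if "c \<subseteq> S2" "c \<noteq> {}" for c
 proof -
  obtain z where "z \<in> c" using \<open>c \<noteq> {}\<close> by blast
  then have "z \<in> f ` S2" using sur that by blast
  then show ?thesis using \<open>z \<in> c\<close> by blast
 qed
 have k0: "0 < k" using P.k3 by simp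
 have cB: "card (black P) = card (black Q)"
 proof -
  have "k * card (black P) + 4 = 2 * card (faces P)" "k * card (black Q) + 4 = 2 * card (faces Q)"
   using P Q P.counts Q.counts by auto
  then have "k * card (black P) = k * card (black Q)" using eq by linarith
  then show ?thesis using k0 by simp
 qed
 have cV: "card (verts P) = card (verts Q)" using P.card_V_eq Q.card_V_eq P(2) Q(2) P.card_Fs Q.card_Fs cB by simp
 have cE: "card (edges P) = card (edges Q)" using P.card_edges Q.card_edges cB by simp
 have imV: "f ` verts P = verts Q"
 proof -
  have "v \<in> f ` verts P" if v: "v \<in> verts Q" for v
  proof -
   obtain y where "y \<in> S2" "f y = v" using hit[of "{v}"] v Q.V_S2 by blast
   then show ?thesis using f(2) v by blast
  qed
  then show ?thesis using f(2) by blast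
 qed
 have imE: "(`) f ` edges P = edges Q"
 proof -
  have "e' \<in> (`) f ` edges P" if e': "e' \<in> edges Q" for e'
  proof -
   have "S2 \<inter> f -` e' \<noteq> {}" using hit[OF Q.E_S2[OF e'] Q.E_nonempty[OF e']] by blast
   then have "{e \<in> edges P. f ` e = e'} \<noteq> {}" using bspec[OF f(3) e'] components_eq_empty[of "S2 \<inter> f -` e'"] by metis
   then show ?thesis by blast
  qed
  then show ?thesis using f(5) by blast
 qed
 have imF: "(`) f ` faces P = faces Q"
 proof -
  have "F' \<in> (`) f ` faces P" if F': "F' \<in> faces Q" for F'
  proof -
   have "S2 \<inter> f -` F' \<noteq> {}" using hit[OF Q.F_S2[OF F'] Q.F_nonempty[OF F']] by blast
   then have "{F \<in> faces P. f ` F = F'} \<noteq> {}" using bspec[OF f(4) F'] components_eq_empty[of "S2 \<inter> f -` F'"] by metis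
   then show ?thesis by blast
  qed
  then show ?thesis using f(6) by blast
 qed
 have iV: "inj_on f (verts P)" by (rule inj_on_of_surj_card[OF P.finV imV cV])
 have iE: "inj_on ((`) f) (edges P)" by (rule inj_on_of_surj_card[OF P.finE imE cE])
 have iF: "inj_on ((`) f) (faces P)" by (rule inj_on_of_surj_card[OF P.finF imF eq])
 have inj: "inj_on f S2"
 proof (rule inj_onI)
  fix x y assume xy: "x \<in> S2" "y \<in> S2" "f x = f y"
  show "x = y" using xy(1)
  proof (cases rule: P.S2_cases)
   case V
   then have "y \<in> verts P" using f(2) xy by auto
   then show ?thesis using iV V xy by (auto dest: inj_onD)
  next
   case (E e)
   then have fy: "f y \<in> f ` e" "f ` e \<in> edges Q" using imageI[OF E(2), of f] xy(3) f(5) by auto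
   show ?thesis using xy(2)
   proof (cases rule: P.S2_cases)
    case V then show ?thesis using f(2) fy Q.x_VE by blast
   next
    case (E d)
    then have "f ` d = f ` e" using Q.E_eq[of "f ` d" "f ` e" "f y"] fy f(5) by blast
    then have "d = e" using iE E \<open>e \<in> edges P\<close> by (auto dest: inj_onD)
    then show ?thesis using f(5) E \<open>x \<in> e\<close> xy(3) by (meson inj_onD)
   next
    case (F F)
    then have "f ` F \<in> faces Q" "f y \<in> f ` F" using f(6) by auto
    then show ?thesis using Q.x_EF fy by blast
   qed
  next
   case (F F)
   then have fy: "f y \<in> f ` F" "f ` F \<in> faces Q" using imageI[OF F(2), of f] xy(3) f(6) by auto
   show ?thesis using xy(2)
   proof (cases rule: P.S2_cases)
    case V then show ?thesis using f(2) fy Q.x_VF by blast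
   next
    case (E d)
    then have "f ` d \<in> edges Q" "f y \<in> f ` d" using f(5) by auto
    then show ?thesis using Q.x_EF fy by blast
   next
    case (F G)
    then have "f ` G = f ` F" using Q.F_eq[of "f ` G" "f ` F" "f y"] fy f(6) by blast
    then have "G = F" using iF F \<open>F \<in> faces P\<close> by (auto dest: inj_onD)
    then show ?thesis using f(6) F \<open>x \<in> F\<close> xy(3) by (meson inj_onD)
   qed
  qed
 qed
 obtain f' where hm: "homeomorphism S2 S2 f f'"
  using homeomorphism_compact[OF _ cont sur inj] compact_sphere by blast
 have "(`) f ` black P = black Q"
 proof
  show "(`) f ` black P \<subseteq> black Q" using f(6) P.in_Fs by blast
  show "black Q \<subseteq> (`) f ` black P"
  proof
   fix F' assume F': "F' \<in> black Q"
   then obtain F where "F \<in> faces P" "F' = f ` F" using imF Q.in_Fs by blast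
   then show "F' \<in> (`) f ` black P" using f(6) F' by blast
  qed
 qed
 moreover have "(`) f ` white P = white Q"
 proof
  have W: "F \<in> white P \<longleftrightarrow> F \<in> faces P \<and> F \<notin> black P" "F \<in> white Q \<longleftrightarrow> F \<in> faces Q \<and> F \<notin> black Q" for F
   using P.in_Fs P.not_both Q.in_Fs Q.not_both by blast+
  show "(`) f ` white P \<subseteq> white Q"
  proof clarify
   fix F assume "F \<in> white P"
   then show "f ` F \<in> white Q" using f(6) W by simp
  qed
  show "white Q \<subseteq> (`) f ` white P"
  proof
   fix F' assume F': "F' \<in> white Q"
   then obtain F where F: "F \<in> faces P" "F' = f ` F" using imF W(2) by blast
   then have "F \<in> white P" using f(6) F' W by simp
   then show "F' \<in> (`) f ` white P" using F(2) by blast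
  qed
 qed
 ultimately show ?thesis unfolding isomorphic_patterns_def using hm imV imE by blast
qed

lemma conclusion_from_optimal:
 fixes k l :: nat
 assumes ex: "\<exists>P. football_pattern k l 2 P"
  and opt: "\<exists>R. optimal k (l div 2) R"
 shows "(\<exists>Q. minimal_realisation k l 2 Q) \<and>
  (\<forall>P Q. football_pattern k l 2 P \<longrightarrow> minimal_realisation k l 2 Q \<longrightarrow> branched_cover_of P Q) \<and>
  (\<forall>Q Q'. minimal_realisation k l 2 Q \<longrightarrow> minimal_realisation k l 2 Q' \<longrightarrow> isomorphic_patterns Q Q')"
proof (intro conjI allI impI)
 obtain P where P: "football_pattern k l 2 P" using ex by blast
 then have l: "even l" by (simp add: football_pattern_def)
 obtain R where R: "optimal k (l div 2) R" using opt by blast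
 show "\<exists>Q. minimal_realisation k l 2 Q"
  unfolding minimal_realisation_def is_arg_min_linorder using ex_has_least_nat[of "football_pattern k l 2" P "\<lambda>P. card (faces P)"] P by blast
 fix P Q assume PQ: "football_pattern k l 2 P" "minimal_realisation k l 2 Q"
 note mQ = minimal_optimal[OF R l PQ(2)]
 have "black P \<union> white P = faces P" "black P \<inter> white P = {}" "black Q \<union> white Q = faces Q" "black Q \<inter> white Q = {}"
  using PQ(1) mQ(1) by (auto simp: football_pattern_def)
 note col = this
 from covers_minimal[OF PQ(1) mQ(1,2)] show "branched_cover_of P Q"
  unfolding branched_cover_of_def by (elim exE conjE) (intro exI conjI lift_of_cells[OF col], assumption+)
next
 obtain P where P: "football_pattern k l 2 P" using ex by blast
 then have l: "even l" by (simp add: football_pattern_def)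
 obtain R where R: "optimal k (l div 2) R" using opt by blast
 fix Q Q' assume "minimal_realisation k l 2 Q" "minimal_realisation k l 2 Q'"
 then show "isomorphic_patterns Q Q'" using minimal_optimal[OF R l] optimal_isomorphic[of k l Q Q'] by metis
qed

section \<open>Cutting a disc along a chord\<close>

text \<open>
  A positive multiple of the signed distance from the chord that joins the corners \<open>0\<close> and
  \<open>j\<close> of the \<open>n\<close>-gon.
\<close>

definition cut :: "nat => nat => complex => real"
 where "cut n j z = Im ((z - 1) * cnj (pt n (real j) - 1))"

lemma pt_0 [simp]: "pt n 0 = 1" by (simp add: pt_def)

lemma cut_pt: "cut n j (pt n s) = 4 * sin (pi * s / n) * sin (pi * j / n) * sin (pi * (s - j) / n)"
proof -
 define x y where "x = pi * s / n" and "y = pi * real j / n"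
 have e: "2 * pi * s / n = 2 * x" "2 * pi * real j / n = 2 * y" by (simp_all add: x_def y_def)
 have "cut n j (pt n s) = sin (2 * x) * (cos (2 * y) - 1) - (cos (2 * x) - 1) * sin (2 * y)"
  unfolding cut_def pt_def e by (simp add: algebra_simps)
 also have "\<dots> = 4 * sin x * sin y * sin (x - y)"
 proof -
  have c: "cos (2 * x) - 1 = - 2 * (sin x)\<^sup>2" "cos (2 * y) - 1 = - 2 * (sin y)\<^sup>2" by (simp_all add: cos_double_sin)
  show ?thesis unfolding c sin_double sin_diff by (simp add: power2_eq_square algebra_simps)
 qed
 also have "x - y = pi * (s - j) / n" by (simp add: x_def y_def algebra_simps diff_divide_distrib)
 finally show ?thesis by (simp add: x_def y_def)
qed

lemma sin_frac_pos: "0 < s ==> s < real n ==> 0 < sin (pi * s / n)"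
 by (rule sin_gt_zero) (auto simp: field_simps)

lemma cut_sign:
 fixes s :: real
 assumes "0 < j" "j < n"
 shows "0 < s ==> s < j ==> cut n j (pt n s) < 0" "j < s ==> s < n ==> 0 < cut n j (pt n s)"
  "cut n j 1 = 0" "cut n j (pt n j) = 0"
proof -
 have y: "0 < sin (pi * j / n)" using sin_frac_pos[of "real j" n] assms by simp
 show "cut n j (pt n s) < 0" if "0 < s" "s < j"
 proof -
  have "0 < sin (pi * (j - s) / n)" using sin_frac_pos[of "j - s" n] assms that by simp
  moreover have "pi * (s - j) / n = - (pi * (j - s) / n)" by (simp add: algebra_simps diff_divide_distrib)
  ultimately have "sin (pi * (s - j) / n) < 0" by simp
  moreover have "0 < sin (pi * s / n)" using sin_frac_pos[of s n] assms that by simp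
  ultimately show ?thesis using y unfolding cut_pt by (simp add: mult_less_0_iff zero_less_mult_iff)
 qed
 show "0 < cut n j (pt n s)" if "j < s" "s < n"
  using y sin_frac_pos[of "s - j" n] sin_frac_pos[of s n] assms that unfolding cut_pt by simp
 show "cut n j 1 = 0" by (simp add: cut_def)
 show "cut n j (pt n j) = 0" by (simp add: cut_pt)
qed

lemma pt_neq_1: "0 < j ==> j < n ==> pt n (real j) \<noteq> 1"
 using pt_inj[of j n 0 0 0] by auto

lemma chord_inside:
 assumes "0 < j" "j < n" "0 < \<tau>" "\<tau> < 1"
 shows "norm (1 + \<tau> *\<^sub>R (pt n (real j) - 1)) < 1"
proof -
 let ?P = "pt n (real j)"
 have "1 + \<tau> *\<^sub>R (?P - 1) = (1 - \<tau>) *\<^sub>R 1 + \<tau> *\<^sub>R ?P" by (simp add: algebra_simps)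
 then have "1 + \<tau> *\<^sub>R (?P - 1) \<in> open_segment 1 ?P" using pt_neq_1[OF assms(1,2)] assms(3,4) by (auto simp: in_segment)
 then show ?thesis using dist_decreases_open_segment[of "1 + \<tau> *\<^sub>R (?P - 1)" 1 ?P 0] by auto
qed

lemma chord_cut: "cut n j (1 + \<tau> *\<^sub>R (pt n (real j) - 1)) = 0"
 by (simp add: cut_def scaleR_conv_of_real complex_eq_iff algebra_simps)

lemma on_chord:
 assumes j: "0 < j" "j < n" and z: "cut n j z = 0" "norm z \<le> 1"
 obtains \<tau> where "0 \<le> \<tau>" "\<tau> \<le> 1" "z = 1 + \<tau> *\<^sub>R (pt n (real j) - 1)"
proof -
 let ?P = "pt n (real j)"
 define d where "d = ?P - 1"
 have d0: "d \<noteq> 0" using pt_neq_1[OF j] by (simp add: d_def)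
 define r where "r = Re ((z - 1) * cnj d) / (norm d)\<^sup>2"
 have "(z - 1) * cnj d = complex_of_real (Re ((z - 1) * cnj d))" using z(1) by (simp add: cut_def d_def complex_eq_iff)
 then have "(z - 1) * (cnj d * d) = complex_of_real (Re ((z - 1) * cnj d)) * d" by (metis mult.assoc)
 moreover have "cnj d * d = complex_of_real ((norm d)\<^sup>2)" by (simp only: complex_norm_square mult.commute)
 ultimately have "(z - 1) * complex_of_real ((norm d)\<^sup>2) = complex_of_real (Re ((z - 1) * cnj d)) * d" by (simp only:)
 then have "z - 1 = complex_of_real (Re ((z - 1) * cnj d)) * d / complex_of_real ((norm d)\<^sup>2)"
  by (subst nonzero_eq_divide_eq) (use d0 in auto)
 then have "z - 1 = complex_of_real r * d" unfolding r_def of_real_divide by (simp only: times_divide_eq_left)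
 then have zr: "z = 1 + r *\<^sub>R d" by (simp add: scaleR_conv_of_real algebra_simps)
 have nd: "2 * Re d + (norm d)\<^sup>2 = 0"
 proof -
  have "(norm (1 + d))\<^sup>2 = 1" by (simp add: d_def)
  then show ?thesis unfolding cmod_power2 by (simp add: power2_eq_square algebra_simps)
 qed
 have "(norm (1 + r *\<^sub>R d))\<^sup>2 \<le> 1" using z(2) unfolding zr[symmetric] by (simp add: power_le_one)
 then have "2 * r * Re d + r\<^sup>2 * (norm d)\<^sup>2 \<le> 0" unfolding cmod_power2 by (simp add: power2_eq_square algebra_simps)
 moreover have "2 * Re d = - (norm d)\<^sup>2" using nd by simp
 ultimately have "r * (- (norm d)\<^sup>2) + r\<^sup>2 * (norm d)\<^sup>2 \<le> 0" by (metis mult.assoc mult.commute)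
 then have "(norm d)\<^sup>2 * (r\<^sup>2 - r) \<le> 0" by (simp add: algebra_simps)
 then have "r\<^sup>2 - r \<le> 0" using d0 by (simp add: mult_le_0_iff)
 then have "r * (r - 1) \<le> 0" by (simp add: power2_eq_square algebra_simps)
 then have "0 \<le> r \<and> r \<le> 1" by (auto simp: mult_le_0_iff)
 then show ?thesis using that zr d_def by blast
qed

text \<open>
  A disc is mapped onto a circular segment, by a cone over a parametrisation of its boundary: first the sides
  \<open>0, \<dots>, j - 1\<close>, then the chord, traversed backwards in \<open>N\<close> equal pieces.
\<close>

lemma half_disc:
 assumes j: "0 < j" "j < n" and N: "0 < N"
 obtains \<eta> where "continuous_on (cball 0 1) \<eta>" "inj_on \<eta> (cball 0 1)" "\<eta> ` cball 0 1 \<subseteq> cball 0 1"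
  "\<eta> ` ball 0 1 = {z. norm z < 1 \<and> cut n j z < 0}"
  "\<And>i t. i < j ==> 0 \<le> t ==> t \<le> 1 ==> \<eta> (pt (j + N) (real i + t)) = pt n (real i + t)"
  "\<And>i t. i < N ==> 0 \<le> t ==> t \<le> 1 ==> \<eta> (pt (j + N) (real (j + i) + t)) = 1 + (1 - (real i + t) / real N) *\<^sub>R (pt n (real j) - 1)"
proof -
 let ?P = "pt n (real j)"
 define d where "d = ?P - 1"
 define a where "a = Complex (- Im d) (Re d)"
 define b where "b = inner a 1"
 have np: "0 < n" using j by simp
 have cut: "cut n j z = inner a z - b" for z
  by (simp add: cut_def a_def b_def d_def inner_complex_def algebra_simps)
 have a0: "a \<noteq> 0" using pt_neq_1[OF j] by (auto simp: a_def d_def complex_eq_iff)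
 define A where "A = cball 0 1 \<inter> {z. inner a z \<le> b}"
 have A: "convex A" "compact A" unfolding A_def by (auto intro!: convex_Int convex_halfspace_le compact_Int_closed closed_halfspace_le)
 have intA: "interior A = {z. norm z < 1 \<and> cut n j z < 0}"
  unfolding A_def interior_Int interior_cball interior_halfspace_le[OF a0] cut by (simp add: set_eq_iff)
 have memA: "z \<in> A \<longleftrightarrow> norm z \<le> 1 \<and> cut n j z \<le> 0" for z by (auto simp: A_def cut)
 have frA: "z \<in> frontier A \<longleftrightarrow> norm z \<le> 1 \<and> cut n j z \<le> 0 \<and> (norm z = 1 \<or> cut n j z = 0)" for z
 proof -
  have "frontier A = A - interior A" using A(2) by (simp add: frontier_def compact_imp_closed)
  then have "z \<in> frontier A \<longleftrightarrow> z \<in> A \<and> z \<notin> interior A" by blast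
  then show ?thesis unfolding memA intA mem_Collect_eq by linarith
 qed
 define ch where "ch \<tau> = 1 + \<tau> *\<^sub>R (?P - 1)" for \<tau>
 have ch01: "ch 0 = 1" "ch 1 = ?P" by (simp_all add: ch_def)
 have chn: "norm (ch \<tau>) \<le> 1" if "0 \<le> \<tau>" "\<tau> \<le> 1" for \<tau>
  using chord_inside[OF j, of \<tau>] that ch01 by (cases "\<tau> = 0 \<or> \<tau> = 1") (auto simp: ch_def[symmetric] less_imp_le)
 have chc: "cut n j (ch \<tau>) = 0" for \<tau> unfolding ch_def by (rule chord_cut)
 have ch_inj: "\<tau> = \<tau>'" if "ch \<tau> = ch \<tau>'" for \<tau> \<tau>' using that pt_neq_1[OF j] by (simp add: ch_def)
 obtain c where c: "c \<in> interior A"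
 proof -
  let ?w = "pt n (real j / 2)" and ?m = "ch (1/2)"
  have w: "cut n j ?w < 0" using cut_sign(1)[OF j, of "real j / 2"] j by simp
  have m: "norm ?m < 1" unfolding ch_def using chord_inside[OF j, of "1/2"] by simp
  let ?c = "(1/2) *\<^sub>R ?w + (1/2) *\<^sub>R ?m"
  have "norm ?c \<le> 1/2 + 1/2 * norm ?m" by (rule order_trans[OF norm_triangle_ineq]) simp
  then have "norm ?c < 1" using m by simp
  moreover have "cut n j ?c = 1/2 * cut n j ?w + 1/2 * cut n j ?m" unfolding cut by (simp add: inner_add_right field_simps)
  then have "cut n j ?c < 0" using w chc by simp
  ultimately show ?thesis using that[of ?c] intA by simp
 qed
 define p where "p i t = (if i < j then pt n (real i + t) else ch (1 - (real (i - j) + t) / real N))" for i t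
 have p_hi: "p i t = ch (1 - (real (i - j) + t) / real N)" if "j \<le> i" for i t using that by (simp add: p_def)
 have JN: "0 < j + N" using j by simp
 obtain \<beta> where \<beta>: "continuous_on (sphere 0 1) \<beta>" "\<And>i t. i < j + N ==> 0 \<le> t ==> t \<le> 1 ==> \<beta> (pt (j + N) (real i + t)) = p i t"
 proof (rule circle_map[OF JN, of p])
  show "continuous_on {0..1} (p i)" for i
   unfolding p_def ch_def using N by (cases "i < j") (auto intro!: continuous_intros)
  show "p i 1 = p ((i + 1) mod (j + N)) 0" if "i < j + N" for i
  proof -
   consider "i + 1 < j" | "i + 1 = j" | "j \<le> i" "i + 1 < j + N" | "i + 1 = j + N" using \<open>i < j + N\<close> by linarith
   then show ?thesis
   proof cases
    case 1 then show ?thesis by (simp add: p_def add.commute)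
   next
    case 2
    have "real i + 1 = real j" using 2 by linarith
    then have "p i 1 = ?P" unfolding p_def using 2 by (simp only:) simp
    moreover have "(i + 1) mod (j + N) = j" using 2 N by simp
    moreover have "p j 0 = ?P" using ch01 by (simp add: p_def)
    ultimately show ?thesis by (simp only:)
   next
    case 3
    have "p i 1 = ch (1 - (real (i - j) + 1) / real N)" using 3 by (intro p_hi)
    moreover have "p (i + 1) 0 = ch (1 - (real (i + 1 - j) + 0) / real N)" using 3 by (intro p_hi) simp
    moreover have "real (i + 1 - j) + 0 = real (i - j) + 1" using 3 by (simp add: of_nat_diff)
    moreover have "(i + 1) mod (j + N) = i + 1" using 3 by simp
    ultimately show ?thesis by (simp only:)
   next
    case 4
    have ij: "j \<le> i" using 4 N by linarith
    have "p i 1 = ch (1 - (real (i - j) + 1) / real N)" using ij by (rule p_hi)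
    moreover have "real (i - j) + 1 = real N" using 4 ij by (simp add: of_nat_diff)
    moreover have "(i + 1) mod (j + N) = 0" using 4 by simp
    moreover have "p 0 0 = ch 0" using j ch01 by (simp add: p_def)
    ultimately show ?thesis using N by simp
   qed
  qed
 qed auto
 have inj: "inj_on \<beta> (sphere 0 1)"
 proof (rule inj_onI)
  have arc: "p i t = pt n (real i + t)" "cut n j (p i t) < 0 \<or> i = 0 \<and> t = 0" if "i < j" "0 \<le> t" "t < 1" for i t
  proof -
   show 1: "p i t = pt n (real i + t)" using that by (simp add: p_def)
   have "real i + t < real j" using that by linarith
   moreover have "real i + t = 0 \<longleftrightarrow> i = 0 \<and> t = 0" using that by (simp add: add_nonneg_eq_0_iff)
   ultimately show "cut n j (p i t) < 0 \<or> i = 0 \<and> t = 0"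
    unfolding 1 using cut_sign(1)[OF j, of "real i + t"] that by (cases "real i + t = 0") auto
  qed
  have chd: "p i t = ch (1 - (real (i - j) + t) / real N)" "0 < 1 - (real (i - j) + t) / real N" if "j \<le> i" "i < j + N" "0 \<le> t" "t < 1" for i t
  proof -
   show "p i t = ch (1 - (real (i - j) + t) / real N)" using that by (simp add: p_def)
   have "i - j + 1 \<le> N" using that by simp
   then have "real (i - j) + 1 \<le> real N" by (metis of_nat_Suc of_nat_le_iff Suc_eq_plus1 add.commute)
   then show "0 < 1 - (real (i - j) + t) / real N" using that N by (simp add: field_simps)
  qed
  have mixed: "p i t \<noteq> p i' t'" if "i < j" "0 \<le> t" "t < 1" "j \<le> i'" "i' < j + N" "0 \<le> t'" "t' < 1" for i t i' t'
  proof
   assume eq: "p i t = p i' t'"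
   then have "cut n j (p i t) = 0" using chd(1)[OF that(4-7)] chc by simp
   then have "i = 0" "t = 0" using arc(2)[OF that(1-3)] by auto
   then have "p i t = ch 0" using ch01 j by (simp add: p_def)
   then show False using eq chd[OF that(4-7)] ch_inj by fastforce
  qed
  fix z w :: complex assume zw: "z \<in> sphere 0 1" "w \<in> sphere 0 1" "\<beta> z = \<beta> w"
  obtain i t where i: "i < j + N" "0 \<le> t" "t < 1" "z = pt (j + N) (real i + t)" using sphere_pt_cases[OF JN] zw(1) by (metis mem_sphere_0)
  obtain i' t' where i': "i' < j + N" "0 \<le> t'" "t' < 1" "w = pt (j + N) (real i' + t')" using sphere_pt_cases[OF JN] zw(2) by (metis mem_sphere_0)
  have eq: "p i t = p i' t'" using zw(3) \<beta>(2)[of i t] \<beta>(2)[of i' t'] i i' by simp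
  show "z = w"
  proof (cases "i < j"; cases "i' < j")
   assume a: "i < j" "i' < j"
   then have "pt n (real i + t) = pt n (real i' + t')" using eq by (simp add: p_def)
   then have "i = i' \<and> t = t'" using pt_inj[of i n i' t t'] a j i i' by simp
   then show ?thesis using i i' by simp
  next
   assume a: "\<not> i < j" "\<not> i' < j"
   then have "ch (1 - (real (i - j) + t) / real N) = ch (1 - (real (i' - j) + t') / real N)" using eq by (simp add: p_def)
   then have "real (i - j) + t = real (i' - j) + t'" using ch_inj N by fastforce
   moreover have "i - j = nat \<lfloor>real (i - j) + t\<rfloor>" "i' - j = nat \<lfloor>real (i' - j) + t'\<rfloor>" using i i' by linarith+
   ultimately have "i - j = i' - j \<and> t = t'" by simp
   moreover have "i = i'" if "i - j = i' - j" using that a by linarith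
   ultimately show ?thesis using i i' by simp
  qed (use mixed[of i t i' t'] mixed[of i' t' i t] eq i i' in auto)
 qed
 have im: "\<beta> ` sphere 0 1 = frontier A"
 proof
  show "\<beta> ` sphere 0 1 \<subseteq> frontier A"
  proof clarify
   fix z :: complex assume z: "z \<in> sphere 0 1"
   obtain i t where i: "i < j + N" "0 \<le> t" "t < 1" "z = pt (j + N) (real i + t)" using sphere_pt_cases[OF JN] z by (metis mem_sphere_0)
   have bz: "\<beta> z = p i t" using \<beta>(2) i by simp
   show "\<beta> z \<in> frontier A"
   proof (cases "i < j")
    case True
    then have "real i + t < real j" using i(3) by linarith
    then have "cut n j (pt n (real i + t)) \<le> 0"
     using cut_sign(1)[OF j, of "real i + t"] cut_sign(3)[OF j] i(2) by (cases "real i + t = 0") (auto simp: less_imp_le)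
    then show ?thesis using True by (simp add: frA bz p_def)
   next
    case False
    then have "i - j + 1 \<le> N" using i by simp
    then have "real (i - j) + 1 \<le> real N" by (metis of_nat_Suc of_nat_le_iff Suc_eq_plus1 add.commute)
    then have "0 \<le> 1 - (real (i - j) + t) / real N" "1 - (real (i - j) + t) / real N \<le> 1" using i N by (simp_all add: field_simps)
    then show ?thesis using False chc chn by (simp add: frA bz p_def)
   qed
  qed
  show "frontier A \<subseteq> \<beta> ` sphere 0 1"
  proof
   fix z assume "z \<in> frontier A"
   then have z: "norm z \<le> 1" "cut n j z \<le> 0" "norm z = 1 \<or> cut n j z = 0" by (auto simp: frA)
   have "\<exists>i t. i < j + N \<and> 0 \<le> t \<and> t \<le> 1 \<and> z = p i t"
   proof (cases "cut n j z = 0")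
    case True
    obtain \<tau> where \<tau>: "0 \<le> \<tau>" "\<tau> \<le> 1" "z = ch \<tau>" using on_chord[OF j True z(1)] unfolding ch_def by blast
    show ?thesis
    proof (cases "\<tau> = 0")
     case True
     then have "z = p 0 0" using \<tau>(3) ch01 j by (simp add: p_def)
     then show ?thesis using JN by (intro exI[of _ 0]) auto
    next
     case False
     define u where "u = (1 - \<tau>) * real N"
     have u: "0 \<le> u" "u < real N" using \<tau> False N by (auto simp: u_def)
     let ?i = "nat \<lfloor>u\<rfloor>"
     have iN: "?i < N" using u by linarith
     have "real ?i = of_int \<lfloor>u\<rfloor>" using u by simp
     then have t: "0 \<le> u - real ?i" "u - real ?i \<le> 1" by linarith+
     have "1 - (real ?i + (u - real ?i)) / real N = \<tau>" using N by (simp add: u_def)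
     then have "z = p (j + ?i) (u - real ?i)" using \<tau>(3) by (simp add: p_def)
     then show ?thesis using iN t by (intro exI[of _ "j + ?i"] exI[of _ "u - real ?i"]) auto
    qed
   next
    case False
    then have "norm z = 1" using z by blast
    then obtain i t where i: "i < n" "0 \<le> t" "t < 1" "z = pt n (real i + t)" using sphere_pt_cases[OF np] by blast
    have "i < j"
    proof (rule ccontr)
     assume "\<not> i < j"
     then have "real j \<le> real i + t" using i by simp
     moreover have "real i + t < real n" using i by linarith
     ultimately show False using cut_sign(2)[OF j, of "real i + t"] cut_sign(4)[OF j] False z(2) i(4) by (cases "real j = real i + t") auto
    qed
    then show ?thesis using i by (intro exI[of _ i] exI[of _ t]) (auto simp: p_def)
   qed
   then obtain i t where "i < j + N" "0 \<le> t" "t \<le> 1" "z = p i t" by blast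
   then have "z = \<beta> (pt (j + N) (real i + t))" using \<beta>(2) by simp
   then show "z \<in> \<beta> ` sphere 0 1" by (rule image_eqI) simp
  qed
 qed
 obtain \<eta> where \<eta>: "continuous_on (cball 0 1) \<eta>" "inj_on \<eta> (cball 0 1)" "\<eta> ` cball 0 1 = A"
  "\<eta> ` ball 0 1 = interior A" "\<And>z. norm z = 1 ==> \<eta> z = \<beta> z"
  using cone_homeomorphism[OF A c \<beta>(1) inj im] by metis
 show ?thesis
 proof (rule that[OF \<eta>(1,2)])
  show "\<eta> ` cball 0 1 \<subseteq> cball 0 1" unfolding \<eta>(3) by (auto simp: A_def)
  show "\<eta> ` ball 0 1 = {z. norm z < 1 \<and> cut n j z < 0}" unfolding \<eta>(4) intA ..
  show "\<eta> (pt (j + N) (real i + t)) = pt n (real i + t)" if "i < j" "0 \<le> t" "t \<le> 1" for i t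
   using \<eta>(5) \<beta>(2)[of i t] that by (simp add: p_def)
  show "\<eta> (pt (j + N) (real (j + i) + t)) = 1 + (1 - (real i + t) / real N) *\<^sub>R (pt n (real j) - 1)" if "i < N" "0 \<le> t" "t \<le> 1" for i t
   using \<eta>(5) \<beta>(2)[of "j + i" t] that by (simp add: p_def ch_def)
 qed
qed

text \<open>
  A rotation carries one side of a chord to the other side of the complementary chord; this reduces the second half of
  the disc to the first.
\<close>

lemma cut_rotate:
 assumes "0 < j" "j < n"
 shows "cut n j (pt n (real j) * z) = - cut n (n - j) z"
proof -
 let ?P = "pt n (real j)"
 have "real (n - j) = - real j + real n * of_int 1" using assms by (simp add: of_nat_diff)
 then have P': "pt n (real (n - j)) = cnj ?P" unfolding cnj_pt using pt_eq_iff[of n] assms by blast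
 have PP: "?P * cnj ?P = 1" by (simp add: complex_norm_square[symmetric])
 have "cut n (n - j) z = Im ((z - 1) * (?P - 1))" unfolding cut_def P' by simp
 moreover have "cut n j (?P * z) = Im ((z - cnj ?P) - (?P * z - 1))"
 proof -
  have "(?P * z - 1) * cnj (?P - 1) = (?P * cnj ?P) * z - ?P * z - cnj ?P + 1" by (simp add: algebra_simps)
  also have "\<dots> = (z - cnj ?P) - (?P * z - 1)" unfolding PP by simp
  finally show ?thesis by (simp only: cut_def)
 qed
 moreover have "Im ((z - cnj ?P) - (?P * z - 1)) = - Im ((z - 1) * (?P - 1))" by (simp add: algebra_simps)
 ultimately show ?thesis by (simp only:)
qed

section \<open>Drawings on the sphere\<close>

text \<open>
  A face is recorded by the cyclic sequence of its vertices, and an edge of it by the pair of successive vertices.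
\<close>

definition arcs :: "nat list => (nat \<times> nat) set"
 where "arcs L = set (zip L (rotate1 L))"

definition all_arcs where "all_arcs Ls = \<Union> (arcs ` set Ls)"
definition all_verts where "all_verts Ls = \<Union> (set ` set (Ls :: nat list list))"

datatype cell = Vertex nat | Edge "nat set" | Face "nat list"

text \<open>
  The function \<open>loc\<close> assigns to every point the cell that contains it; \<open>p\<close>, \<open>c\<close>
  and \<open>H\<close> parametrise the vertices, edges and faces. Faces are oriented coherently: every directed edge
  lies on exactly one face, its reverse on the neighbouring one.
\<close>

definition drawing ::
 "(real^3 => cell) => (nat => real^3) => (nat => nat => real => real^3) => (nat list => complex => real^3) => nat list list => bool"
 where "drawing loc p c H Ls \<longleftrightarrow>
  (\<forall>L\<in>set Ls. distinct L \<and> 3 \<le> length L \<and> continuous_on (cball 0 1) (H L) \<and> inj_on (H L) (ball 0 1) \<and>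
    H L ` cball 0 1 \<subseteq> S2 \<and> H L ` ball 0 1 = {q \<in> S2. loc q = Face L} \<and>
    (\<forall>i<length L. \<forall>t\<in>{0..1}. H L (pt (length L) (real i + t)) = c (L ! i) (rotate1 L ! i) t)) \<and>
  (\<forall>a b. (a, b) \<in> all_arcs Ls \<longrightarrow> (b, a) \<in> all_arcs Ls \<and> continuous_on {0..1} (c a b) \<and> inj_on (c a b) {0<..<1} \<and>
    c a b ` {0<..<1} = {q \<in> S2. loc q = Edge {a, b}} \<and> c a b 0 = p a \<and> (\<forall>t. c b a t = c a b (1 - t))) \<and>
  (\<forall>a\<in>all_verts Ls. {q \<in> S2. loc q = Vertex a} = {p a}) \<and>
  (\<forall>q\<in>S2. loc q \<in> Vertex ` all_verts Ls \<union> (\<lambda>(a, b). Edge {a, b}) ` all_arcs Ls \<union> Face ` set Ls) \<and>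
  connected {q \<in> S2. loc q \<notin> range Face} \<and>
  distinct Ls \<and> (\<forall>L\<in>set Ls. \<forall>M\<in>set Ls. L \<noteq> M \<longrightarrow> arcs L \<inter> arcs M = {})"

definition drawable where "drawable Ls \<longleftrightarrow> (\<exists>loc p c H. drawing loc p c H Ls)"

lemma arcs_split: "arcs (x # as @ y # bs) = set (zip (x # as) (as @ [y])) \<union> set (zip (y # bs) (bs @ [x]))"
proof -
 have "zip (x # as @ y # bs) (as @ y # bs @ [x]) = zip ((x # as) @ (y # bs)) ((as @ [y]) @ (bs @ [x]))" by simp
 also have "\<dots> = zip (x # as) (as @ [y]) @ zip (y # bs) (bs @ [x])" by (rule zip_append) simp
 finally show ?thesis by (simp add: arcs_def)
qed

lemma arcs_verts: "(a, b) \<in> arcs L ==> a \<in> set L \<and> b \<in> set L"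
 by (auto simp: arcs_def dest: set_zip_leftD set_zip_rightD)

lemma arcs_nth: "(a, b) \<in> arcs L \<longleftrightarrow> (\<exists>i<length L. a = L ! i \<and> b = rotate1 L ! i)"
 by (auto simp: arcs_def set_zip)

lemma path_rev: "set (zip (y # rev (ns :: nat list)) (rev ns @ [x])) = prod.swap ` set (zip (x # ns) (ns @ [y]))"
proof -
 have "zip (y # rev ns) (rev ns @ [x]) = rev (zip (ns @ [y]) (x # ns))"
  by (subst zip_rev[symmetric]) simp_all
 also have "set \<dots> = prod.swap ` set (zip (x # ns) (ns @ [y]))"
 proof -
  have zs: "set (zip A B) = prod.swap ` set (zip B A)" for A B :: "nat list"
   by (induction A B rule: list_induct2') auto
  show ?thesis unfolding set_rev by (rule zs)
 qed
 finally show ?thesis .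
qed

lemma all_arcs_verts: "(a, b) \<in> all_arcs X ==> a \<in> all_verts X \<and> b \<in> all_verts X"
 using arcs_verts by (fastforce simp: all_arcs_def all_verts_def)

locale drawn =
 fixes loc p c H and Ls :: "nat list list"
 assumes D: "drawing loc p c H Ls"
begin

lemmas D_conj =
 D[unfolded drawing_def, THEN conjunct1]
 D[unfolded drawing_def, THEN conjunct2, THEN conjunct1]
 D[unfolded drawing_def, THEN conjunct2, THEN conjunct2, THEN conjunct1]
 D[unfolded drawing_def, THEN conjunct2, THEN conjunct2, THEN conjunct2, THEN conjunct1]
 D[unfolded drawing_def, THEN conjunct2, THEN conjunct2, THEN conjunct2, THEN conjunct2, THEN conjunct1]
 D[unfolded drawing_def, THEN conjunct2, THEN conjunct2, THEN conjunct2, THEN conjunct2, THEN conjunct2, THEN conjunct1]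
 D[unfolded drawing_def, THEN conjunct2, THEN conjunct2, THEN conjunct2, THEN conjunct2, THEN conjunct2, THEN conjunct2]

lemma faceD: assumes "L \<in> set Ls"
 shows "distinct L" "3 \<le> length L" "continuous_on (cball 0 1) (H L)" "inj_on (H L) (ball 0 1)"
  "H L ` cball 0 1 \<subseteq> S2" "H L ` ball 0 1 = {q \<in> S2. loc q = Face L}"
  "\<And>i t. i < length L ==> 0 \<le> t ==> t \<le> 1 ==> H L (pt (length L) (real i + t)) = c (L ! i) (rotate1 L ! i) t"
 using bspec[OF D_conj(1) assms] by simp_all

lemma arcD: assumes "(a, b) \<in> all_arcs Ls"
 shows "(b, a) \<in> all_arcs Ls" "continuous_on {0..1} (c a b)" "inj_on (c a b) {0<..<1}"
    "c a b ` {0<..<1} = {q \<in> S2. loc q = Edge {a, b}}" "c a b 0 = p a" "\<And>t. c b a t = c a b (1 - t)"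
 using D_conj(2)[rule_format, OF assms] by simp_all

lemmas vertD = D_conj(3)[rule_format] and locD = D_conj(4)[rule_format] and connD = D_conj(5) and distD = D_conj(6) D_conj(7)[rule_format]

end

text \<open>
  The face \<open>R\<close> is cut in two by a path from \<open>x\<close> to \<open>y\<close> with new inner vertices
  \<open>ns\<close>, drawn along a chord of the disc of \<open>R\<close>. The chord is divided into \<open>N\<close>
  equal pieces, and \<open>lab\<close> names the cell at each of its points.
\<close>

locale chord_step = drawn loc p c H "(x # as @ y # bs) # Ls"
 for loc p c H and x y :: nat and as bs ns :: "nat list" and Ls +
 assumes ns: "distinct ns" "set ns \<inter> all_verts ((x # as @ y # bs) # Ls) = {}"
  and ns0: "ns = [] ==> as \<noteq> [] \<and> bs \<noteq> [] \<and> (x, y) \<notin> all_arcs ((x # as @ y # bs) # Ls)"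
begin

abbreviation "R \<equiv> x # as @ y # bs"
abbreviation "F1 \<equiv> x # as @ y # rev ns"
abbreviation "F2 \<equiv> y # bs @ x # ns"
abbreviation "W \<equiv> x # ns @ [y]"
definition N where "N = length ns + 1"
definition j where "j = length as + 1"
definition n where "n = length R"
definition K where "K \<tau> = H R (1 + \<tau> *\<^sub>R (pt n (real j) - 1))"
definition newp where "newp = set (zip (x # ns) (ns @ [y]))"

lemma jn: "0 < j" "j < n" and N0: "0 < N" by (auto simp: j_def n_def N_def)

lemma Rin: "R \<in> set (R # Ls)" by simp

lemma xy: "x \<noteq> y" "x \<notin> set as" "x \<notin> set bs" "y \<notin> set as" "y \<notin> set bs" "distinct as" "distinct bs" "set as \<inter> set bs = {}"
 using faceD(1)[OF Rin] by auto

lemma in_verts: "set R \<subseteq> all_verts (R # Ls)" by (auto simp: all_verts_def)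

lemma ns_fresh: "v \<in> set ns ==> v \<notin> set R" using ns(2) in_verts by blast

lemma distW: "distinct W" using ns(1) xy(1) ns_fresh by auto

lemma lenW: "length W = N + 1" by (simp add: N_def)

lemma W_inj: "i \<le> N ==> i' \<le> N ==> W ! i = W ! i' ==> i = i'"
 using nth_eq_iff_index_eq[OF distW] lenW by simp

lemma W_ends: "W ! 0 = x" "W ! N = y" by (auto simp: N_def nth_append)

lemma W_mid: assumes "0 < i" "i < N" shows "W ! i \<in> set ns"
proof -
 obtain i' where "i = Suc i'" using assms(1) by (cases i) auto
 then show ?thesis using assms(2) by (simp add: N_def nth_append)
qed

lemma ns_W: assumes "v \<in> set ns" obtains i where "0 < i" "i < N" "v = W ! i"
proof -
 obtain i where i: "i < length ns" "ns ! i = v" using assms by (auto simp: in_set_conv_nth)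
 then have "v = W ! Suc i" by (simp add: nth_append)
 then show ?thesis using that[of "Suc i"] i by (simp add: N_def)
qed

lemma newp_W: "(a, b) \<in> newp \<longleftrightarrow> (\<exists>i<N. a = W ! i \<and> b = W ! (i + 1))"
proof -
 have h: "(x # ns) ! i = W ! i \<and> (ns @ [y]) ! i = W ! (i + 1)" if "i < N" for i
  using that by (cases i) (auto simp: N_def nth_append)
 have "(a, b) \<in> newp \<longleftrightarrow> (\<exists>i<N. a = (x # ns) ! i \<and> b = (ns @ [y]) ! i)"
  by (auto simp: newp_def set_zip N_def simp del: nth_Cons_Suc)
 also have "\<dots> \<longleftrightarrow> (\<exists>i<N. a = W ! i \<and> b = W ! (i + 1))" using h by (metis (no_types))
 finally show ?thesis .
qed

lemma newp_new: assumes "(a, b) \<in> newp" shows "(a, b) \<notin> all_arcs (R # Ls)" "(b, a) \<notin> all_arcs (R # Ls)" "a \<noteq> b"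
proof -
 obtain i where i: "i < N" "a = W ! i" "b = W ! (i + 1)" using assms newp_W by blast
 show "a \<noteq> b" using W_inj[of i "i + 1"] i by auto
 have "(a, b) \<notin> all_arcs (R # Ls) \<and> (b, a) \<notin> all_arcs (R # Ls)"
 proof (cases "ns = []")
  case True
  then have "length ns = 0" by (simp only: list.size)
  then have "N = 1" unfolding N_def by linarith
  then have ab: "a = x" "b = y" using i W_ends by auto
  then show ?thesis using ns0[OF True] arcD(1) by blast
 next
  case False
  then have "0 < length ns" by simp
  then have "2 \<le> N" unfolding N_def by linarith
  then have "a \<in> set ns \<or> b \<in> set ns" using W_mid[of i] W_mid[of "i + 1"] i by (cases "i = 0") auto
  then show ?thesis using all_arcs_verts ns(2) by blast
 qed
 then show "(a, b) \<notin> all_arcs (R # Ls)" "(b, a) \<notin> all_arcs (R # Ls)" by auto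
qed

lemma newp_ne: "newp \<noteq> {}" by (simp add: newp_def)

lemma newp_irrefl: "(a, b) \<in> newp ==> (b, a) \<notin> newp"
proof
 assume "(a, b) \<in> newp" "(b, a) \<in> newp"
 then obtain i i' where "i < N" "a = W ! i" "b = W ! (i + 1)" "i' < N" "b = W ! i'" "a = W ! (i' + 1)" unfolding newp_W by blast
 then have "i + 1 = i'" "i' + 1 = i" using W_inj[of "i + 1" i'] W_inj[of i "i' + 1"] by auto
 then show False by simp
qed

lemma arcs_R: "arcs R = set (zip (x # as) (as @ [y])) \<union> set (zip (y # bs) (bs @ [x]))" by (rule arcs_split)
lemma arcs_F1: "arcs F1 = set (zip (x # as) (as @ [y])) \<union> prod.swap ` newp"
 unfolding newp_def path_rev[symmetric] by (rule arcs_split)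
lemma arcs_F2: "arcs F2 = set (zip (y # bs) (bs @ [x])) \<union> newp"
 unfolding newp_def by (rule arcs_split)

lemma all_arcs_new: "all_arcs (F2 # F1 # Ls) = all_arcs (R # Ls) \<union> newp \<union> prod.swap ` newp"
 unfolding all_arcs_def by (simp only: list.set image_insert Union_insert arcs_R arcs_F1 arcs_F2) blast

lemma all_verts_new: "all_verts (F2 # F1 # Ls) = all_verts (R # Ls) \<union> set ns"
 by (auto simp: all_verts_def)

lemma F_new: "F1 \<notin> set (R # Ls)" "F2 \<notin> set (R # Ls)" "F1 \<noteq> F2"
proof -
 obtain a b where ab: "(a, b) \<in> newp" using newp_ne by (metis equals0I surj_pair)
 have "(b, a) \<in> arcs F1" "(a, b) \<in> arcs F2" 
  unfolding arcs_F1 arcs_F2 using ab image_eqI[of "(b, a)" prod.swap "(a, b)" newp] by auto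
 then show "F1 \<notin> set (R # Ls)" "F2 \<notin> set (R # Ls)" using newp_new[OF ab] unfolding all_arcs_def by blast+
 show "F1 \<noteq> F2" using xy(1) by simp
qed

lemma HR_n: "i < n ==> 0 \<le> t ==> t \<le> 1 ==> H R (pt n (real i + t)) = c (R ! i) (rotate1 R ! i) t"
 using faceD(7)[OF Rin] by (simp add: n_def)

lemma R_arc: "i < n ==> (R ! i, rotate1 R ! i) \<in> all_arcs (R # Ls)"
 using arcs_nth[of "R ! i" "rotate1 R ! i" R] by (auto simp: all_arcs_def n_def)

lemma R_corner: assumes "i < n" shows "H R (pt n (real i)) = p (R ! i)"
 using HR_n[OF assms, of 0] arcD(5)[OF R_arc[OF assms]] by simp

lemma K_ends: "K 0 = p x" "K 1 = p y"
proof -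
 show "K 0 = p x" using R_corner[of 0] by (simp add: K_def n_def)
 have "R ! j = y" by (simp add: j_def nth_append)
 then show "K 1 = p y" using R_corner[OF jn(2)] by (simp add: K_def)
qed

lemma K_cont: "continuous_on {0..1} K"
 unfolding K_def
proof (rule continuous_on_compose2[OF faceD(3)[OF Rin]])
 have "norm (1 + \<tau> *\<^sub>R (pt n (real j) - 1)) \<le> 1" if "0 \<le> \<tau>" "\<tau> \<le> 1" for \<tau>
  using chord_inside[OF jn, of \<tau>] that by (cases "\<tau> = 0 \<or> \<tau> = 1") (auto simp: less_imp_le)
 then show "(\<lambda>\<tau>. 1 + \<tau> *\<^sub>R (pt n (real j) - 1)) ` {0..1} \<subseteq> cball 0 1" by auto
qed (auto intro!: continuous_intros)

lemma chord_inj: "1 + \<tau> *\<^sub>R (pt n (real j) - 1) = 1 + \<tau>' *\<^sub>R (pt n (real j) - 1) \<longleftrightarrow> \<tau> = \<tau>'"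
 using pt_neq_1[OF jn] by simp

lemma K_inj: "inj_on K {0<..<1}"
proof (rule inj_onI)
 fix \<tau> \<tau>' :: real assume t: "\<tau> \<in> {0<..<1}" "\<tau>' \<in> {0<..<1}" "K \<tau> = K \<tau>'"
 then have "1 + \<tau> *\<^sub>R (pt n (real j) - 1) = 1 + \<tau>' *\<^sub>R (pt n (real j) - 1)"
  by (intro inj_onD[OF faceD(4)[OF Rin]]) (use chord_inside[OF jn] in \<open>auto simp: K_def\<close>)
 then show "\<tau> = \<tau>'" using chord_inj by simp
qed

definition neg where "neg = H R ` {z. norm z < 1 \<and> cut n j z < 0}"
definition pos where "pos = H R ` {z. norm z < 1 \<and> 0 < cut n j z}"

definition lab :: "real => cell"
 where "lab \<tau> = (let i = nat \<lfloor>\<tau> * real N\<rfloor> in if \<tau> * real N = real i then Vertex (W ! i) else Edge {W ! i, W ! (i + 1)})"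

definition loc' where "loc' q = (if q \<in> S2 \<and> loc q = Face R then
  (let z = inv_into (ball 0 1) (H R) q in if cut n j z < 0 then Face F1 else if 0 < cut n j z then Face F2
   else lab (THE \<tau>. z = 1 + \<tau> *\<^sub>R (pt n (real j) - 1))) else loc q)"

lemma ball_R: "norm z < 1 ==> H R z \<in> S2 \<and> loc (H R z) = Face R"
proof -
 assume "norm z < 1"
 then have "H R z \<in> H R ` ball 0 1" by (intro imageI) simp
 then show ?thesis unfolding faceD(6)[OF Rin] by simp
qed

lemma inv_R: "norm z < 1 ==> inv_into (ball 0 1) (H R) (H R z) = z"
 using inv_into_f_f[OF faceD(4)[OF Rin], of z] by simp

lemma loc'_neg: "q \<in> neg ==> q \<in> S2 \<and> loc' q = Face F1"
 using ball_R inv_R by (auto simp: neg_def loc'_def)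

lemma loc'_pos: "q \<in> pos ==> q \<in> S2 \<and> loc' q = Face F2"
 using ball_R inv_R by (auto simp: pos_def loc'_def)

lemma loc'_K: assumes "0 < \<tau>" "\<tau> < 1" shows "K \<tau> \<in> S2 \<and> loc' (K \<tau>) = lab \<tau>"
proof -
 let ?z = "1 + \<tau> *\<^sub>R (pt n (real j) - 1)"
 have z: "norm ?z < 1" by (rule chord_inside[OF jn assms])
 have "(THE \<tau>'. ?z = 1 + \<tau>' *\<^sub>R (pt n (real j) - 1)) = \<tau>" using chord_inj by (intro the_equality) auto
 then show ?thesis using ball_R[OF z] inv_R[OF z] chord_cut[of n j \<tau>] by (simp add: loc'_def K_def)
qed

lemma loc'_old: "loc q \<noteq> Face R ==> loc' q = loc q" by (simp add: loc'_def)

lemma S2_split: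
 assumes "q \<in> S2"
 obtains (old) "loc q \<noteq> Face R" "loc' q = loc q" | (neg) "q \<in> neg" | (pos) "q \<in> pos" | (chord) \<tau> where "0 < \<tau>" "\<tau> < 1" "q = K \<tau>"
proof (cases "loc q = Face R")
 case False then show ?thesis using old loc'_old by blast
next
 case True
 then have "q \<in> H R ` ball 0 1" using faceD(6)[OF Rin] assms by simp
 then obtain z where z: "norm z < 1" "q = H R z" by auto
 consider "cut n j z < 0" | "0 < cut n j z" | "cut n j z = 0" by linarith
 then show ?thesis
 proof cases
  case 1 then show ?thesis using neg z by (auto simp: neg_def)
 next
  case 2 then show ?thesis using pos z by (auto simp: pos_def)
 next
  case 3
  then obtain \<tau> where \<tau>: "0 \<le> \<tau>" "\<tau> \<le> 1" "z = 1 + \<tau> *\<^sub>R (pt n (real j) - 1)" using on_chord[OF jn] z by (metis less_imp_le)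
  have "\<tau> \<noteq> 0" "\<tau> \<noteq> 1" using z(1) \<tau>(3) by auto
  then show ?thesis using chord[of \<tau>] \<tau> z by (simp add: K_def less_le)
 qed
qed

lemma lab_vertex: assumes "0 < i" "i < N" shows "lab (real i / real N) = Vertex (W ! i)"
 using N0 by (simp add: lab_def)

lemma lab_edge: assumes "i < N" "0 < t" "t < 1" shows "lab ((real i + t) / real N) = Edge {W ! i, W ! (i + 1)}"
proof -
 have "(real i + t) / real N * real N = real i + t" using N0 by simp
 moreover have "nat \<lfloor>real i + t\<rfloor> = i" 
 proof -
  have "\<lfloor>real i + t\<rfloor> = int i" using assms by linarith
  then show ?thesis by simp
 qed
 ultimately show ?thesis using assms by (simp add: lab_def)
qed

lemma lab_cases:
 assumes "0 < \<tau>" "\<tau> < 1"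
 obtains (v) i where "0 < i" "i < N" "\<tau> = real i / real N" | (e) i t where "i < N" "0 < t" "t < 1" "\<tau> = (real i + t) / real N"
proof -
 define u where "u = \<tau> * real N"
 have u: "0 < u" "u < real N" "\<tau> = u / real N" using assms N0 by (auto simp: u_def)
 let ?i = "nat \<lfloor>u\<rfloor>"
 have ri: "real ?i = of_int \<lfloor>u\<rfloor>" using u by simp
 have iN: "?i < N" using u by linarith
 show ?thesis
 proof (cases "u = real ?i")
  case True
  then have "0 < ?i" using u(1) by linarith
  then show ?thesis using v[of ?i] iN u(3) True by simp
 next
  case False
  have "0 < u - real ?i" "u - real ?i < 1" using False ri by linarith+
  then show ?thesis using e[of ?i "u - real ?i"] iN u(3) by simp
 qed
qed

definition ix where "ix v = (SOME i. i \<le> N \<and> W ! i = v)"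

lemma ix: assumes "i \<le> N" shows "ix (W ! i) = i"
 unfolding ix_def by (rule some_equality) (use assms W_inj in auto)

definition p' where "p' v = (if v \<in> set ns then K (real (ix v) / real N) else p v)"
definition c' where "c' a b = (if (a, b) \<in> newp \<or> (b, a) \<in> newp then (\<lambda>t. K ((real (ix a) + t * (real (ix b) - real (ix a))) / real N)) else c a b)"

lemma p'_W: assumes "i \<le> N" shows "p' (W ! i) = K (real i / real N)"
proof -
 consider "i = 0" | "i = N" | "0 < i" "i < N" using assms by linarith
 then show ?thesis
 proof cases
  case 1 then show ?thesis using K_ends ns_fresh[of x] by (auto simp: p'_def)
 next
  case 2 then show ?thesis using K_ends ns_fresh[of y] W_ends(2) N0 by (auto simp: p'_def)
 next
  case 3 then show ?thesis using W_mid[OF 3] ix[OF assms] by (simp add: p'_def)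
 qed
qed

lemma c'_new: assumes "i < N" shows "c' (W ! i) (W ! (i + 1)) t = K ((real i + t) / real N)"
 "c' (W ! (i + 1)) (W ! i) t = K ((real i + 1 - t) / real N)"
proof -
 have m: "(W ! i, W ! (i + 1)) \<in> newp" using newp_W assms by blast
 have "ix (W ! i) = i" "ix (W ! (i + 1)) = i + 1" using ix[of i] ix[of "i + 1"] assms by simp_all
 then show "c' (W ! i) (W ! (i + 1)) t = K ((real i + t) / real N)" "c' (W ! (i + 1)) (W ! i) t = K ((real i + 1 - t) / real N)"
  using m by (simp_all add: c'_def algebra_simps del: nth_Cons_Suc)
qed

lemma c'_old: "(a, b) \<in> all_arcs (R # Ls) ==> c' a b = c a b"
 using newp_new by (auto simp: c'_def)

lemma c'_sym: assumes "(a, b) \<in> all_arcs (R # Ls) \<union> newp \<union> prod.swap ` newp" shows "c' b a t = c' a b (1 - t)"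
proof -
 consider "(a, b) \<in> all_arcs (R # Ls)" | "(a, b) \<in> newp" | "(b, a) \<in> newp" using assms by auto
 then show ?thesis
 proof cases
  case 1 then show ?thesis using c'_old arcD(1,6) by metis
 qed (auto simp: c'_def algebra_simps)
qed

lemma old_labels: assumes "q \<in> S2" "loc q \<noteq> Face R"
 shows "loc q \<in> Vertex ` all_verts (R # Ls) \<union> (\<lambda>(a, b). Edge {a, b}) ` all_arcs (R # Ls) \<union> Face ` set Ls"
 using locD[OF assms(1)] assms(2) by auto

lemma edge_set_new: assumes "(a, b) \<in> newp" "(a', b') \<in> all_arcs (R # Ls)" shows "{a, b} \<noteq> {a', b'}"
 using newp_new[OF assms(1)] assms(2) by (auto simp: doubleton_eq_iff)

lemma K_arc: assumes "i < N" shows "(\<lambda>t. K ((real i + t) / real N)) ` {0<..<1} = {q \<in> S2. loc' q = Edge {W ! i, W ! (i + 1)}}"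
proof (intro set_eqI iffI)
 have rng: "0 < (real i' + t) / real N" "(real i' + t) / real N < 1" if "i' < N" "0 < t" "t < 1" for i' t
 proof -
  show "0 < (real i' + t) / real N" using that N0 by (intro divide_pos_pos) auto
  have "real i' + 1 \<le> real N" using that(1) by simp
  then show "(real i' + t) / real N < 1" using that N0 by (simp add: divide_less_eq)
 qed
 fix q
 { assume "q \<in> (\<lambda>t. K ((real i + t) / real N)) ` {0<..<1}"
  then obtain t where t: "0 < t" "t < 1" "q = K ((real i + t) / real N)" by auto
  then show "q \<in> {q \<in> S2. loc' q = Edge {W ! i, W ! (i + 1)}}"
   using loc'_K[OF rng[OF assms t(1,2)]] lab_edge[OF assms t(1,2)] by (simp del: nth_Cons_Suc) }
 { assume "q \<in> {q \<in> S2. loc' q = Edge {W ! i, W ! (i + 1)}}"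
  then have q: "q \<in> S2" "loc' q = Edge {W ! i, W ! (i + 1)}" by auto
  have m: "(W ! i, W ! (i + 1)) \<in> newp" using newp_W assms by blast
  show "q \<in> (\<lambda>t. K ((real i + t) / real N)) ` {0<..<1}" using q(1)
  proof (cases rule: S2_split)
   case old
   then have "Edge {W ! i, W ! (i + 1)} \<in> Vertex ` all_verts (R # Ls) \<union> (\<lambda>(a, b). Edge {a, b}) ` all_arcs (R # Ls) \<union> Face ` set Ls"
    using old_labels[OF q(1) old(1)] q(2) by (simp del: nth_Cons_Suc)
   then have "Edge {W ! i, W ! (i + 1)} \<in> (\<lambda>(a, b). Edge {a, b}) ` all_arcs (R # Ls)" by blast
   then obtain ab where "ab \<in> all_arcs (R # Ls)" "Edge {W ! i, W ! (i + 1)} = (case ab of (a, b) => Edge {a, b})" by (rule imageE)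
   then obtain a b where "(a, b) \<in> all_arcs (R # Ls)" "{W ! i, W ! (i + 1)} = {a, b}" by (cases ab) (simp del: nth_Cons_Suc)
   then show ?thesis using edge_set_new[OF m] by metis
  next
   case neg then show ?thesis using loc'_neg q by simp
  next
   case pos then show ?thesis using loc'_pos q by simp
  next
   case (chord \<tau>)
   then have l: "lab \<tau> = Edge {W ! i, W ! (i + 1)}" using loc'_K q by simp
   show ?thesis using chord(1,2)
   proof (cases rule: lab_cases)
    case (v i') then show ?thesis using lab_vertex l by simp
   next
    case (e i' t)
    then have "{W ! i', W ! (i' + 1)} = {W ! i, W ! (i + 1)}" using lab_edge l by (simp del: nth_Cons_Suc)
    then have "i' = i" using W_inj[of i' i] W_inj[of i' "i + 1"] W_inj[of "i' + 1" i] assms e(1) by (auto simp: doubleton_eq_iff simp del: nth_Cons_Suc)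
    then show ?thesis using e chord(3) by auto
   qed
  qed }
qed


lemma lab_new: assumes "0 < \<tau>" "\<tau> < 1" shows "lab \<tau> \<in> Vertex ` set ns \<union> (\<lambda>(a, b). Edge {a, b}) ` newp"
 using assms
proof (cases rule: lab_cases)
 case (v i) then show ?thesis using lab_vertex W_mid by auto
next
 case (e i t)
 have "(W ! i, W ! (i + 1)) \<in> newp" using newp_W e(1) by blast
 then show ?thesis using lab_edge[OF e(1-3)] e(4) by (intro UnI2 image_eqI[of _ _ "(W ! i, W ! (i + 1))"]) (simp_all del: nth_Cons_Suc)
qed

lemma loc'_same:
 assumes "l \<noteq> Face R" "l \<noteq> Face F1" "l \<noteq> Face F2" "l \<notin> Vertex ` set ns" "l \<notin> (\<lambda>(a, b). Edge {a, b}) ` newp"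
 shows "{q \<in> S2. loc' q = l} = {q \<in> S2. loc q = l}"
proof -
 have "loc' q = l \<longleftrightarrow> loc q = l" if q: "q \<in> S2" for q
  using q
 proof (cases rule: S2_split)
  case neg
  then have "loc q = Face R" using ball_R by (auto simp: neg_def)
  then show ?thesis using loc'_neg[OF neg] assms by auto
 next
  case pos
  then have "loc q = Face R" using ball_R by (auto simp: pos_def)
  then show ?thesis using loc'_pos[OF pos] assms by auto
 next
  case (chord \<tau>)
  then have "loc q = Face R" using ball_R[OF chord_inside[OF jn]] by (simp add: K_def)
  then show ?thesis using loc'_K[OF chord(1,2)] lab_new[OF chord(1,2)] chord(3) assms by auto
 qed simp
 then show ?thesis by blast
qed

lemma neg_eq: "{q \<in> S2. loc' q = Face F1} = neg"
proof
 show "neg \<subseteq> {q \<in> S2. loc' q = Face F1}" using loc'_neg by blast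
 show "{q \<in> S2. loc' q = Face F1} \<subseteq> neg"
 proof
  fix q assume "q \<in> {q \<in> S2. loc' q = Face F1}"
  then have q: "q \<in> S2" "loc' q = Face F1" by auto
  show "q \<in> neg" using q(1)
  proof (cases rule: S2_split)
   case old
   have "F1 \<in> set Ls" using old_labels[OF q(1) old(1)] old(2) q(2) by auto
   then show ?thesis using F_new(1) by simp
  next
   case pos then show ?thesis using loc'_pos[OF pos] q(2) F_new(3) by (metis cell.inject(3))
  next
   case (chord \<tau>) then show ?thesis using loc'_K[OF chord(1,2)] lab_new[OF chord(1,2)] q(2) by auto
  qed
 qed
qed

lemma pos_eq: "{q \<in> S2. loc' q = Face F2} = pos"
proof
 show "pos \<subseteq> {q \<in> S2. loc' q = Face F2}" using loc'_pos by blast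
 show "{q \<in> S2. loc' q = Face F2} \<subseteq> pos"
 proof
  fix q assume "q \<in> {q \<in> S2. loc' q = Face F2}"
  then have q: "q \<in> S2" "loc' q = Face F2" by auto
  show "q \<in> pos" using q(1)
  proof (cases rule: S2_split)
   case old
   have "F2 \<in> set Ls" using old_labels[OF q(1) old(1)] old(2) q(2) by auto
   then show ?thesis using F_new(2) by simp
  next
   case neg then show ?thesis using loc'_neg[OF neg] q(2) F_new(3) by (metis cell.inject(3))
  next
   case (chord \<tau>) then show ?thesis using loc'_K[OF chord(1,2)] lab_new[OF chord(1,2)] q(2) by auto
  qed
 qed
qed

lemma frac_01: "0 < i ==> i < N ==> 0 < real i / real N \<and> real i / real N < 1"
 by simp

lemma vertex_new: assumes "0 < i" "i < N" shows "{q \<in> S2. loc' q = Vertex (W ! i)} = {K (real i / real N)}"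
proof
 show "{K (real i / real N)} \<subseteq> {q \<in> S2. loc' q = Vertex (W ! i)}"
  using loc'_K[of "real i / real N"] frac_01[OF assms] lab_vertex[OF assms] by simp
 show "{q \<in> S2. loc' q = Vertex (W ! i)} \<subseteq> {K (real i / real N)}"
 proof
  fix q assume "q \<in> {q \<in> S2. loc' q = Vertex (W ! i)}"
  then have q: "q \<in> S2" "loc' q = Vertex (W ! i)" by auto
  show "q \<in> {K (real i / real N)}" using q(1)
  proof (cases rule: S2_split)
   case old
   have "W ! i \<in> all_verts (R # Ls)" using old_labels[OF q(1) old(1)] old(2) q(2) by auto
   then show ?thesis using W_mid[OF assms] ns(2) by blast
  next
   case neg then show ?thesis using loc'_neg[OF neg] q(2) by simp
  next
   case pos then show ?thesis using loc'_pos[OF pos] q(2) by simp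
  next
   case (chord \<tau>)
   then have l: "lab \<tau> = Vertex (W ! i)" using loc'_K q by simp
   show ?thesis using chord(1,2)
   proof (cases rule: lab_cases)
    case (v i')
    then have "W ! i' = W ! i" using lab_vertex[OF v(1,2)] l by simp
    then have "i' = i" using W_inj[of i' i] v assms by simp
    then show ?thesis using v chord(3) by simp
   next
    case (e i' t) then show ?thesis using lab_edge[OF e(1-3)] l by simp
   qed
  qed
 qed
qed

lemma arcs_cover: "(a, b) \<in> all_arcs (F2 # F1 # Ls) \<longleftrightarrow> (a, b) \<in> all_arcs (R # Ls) \<or> (a, b) \<in> newp \<or> (b, a) \<in> newp"
proof -
 have "(a, b) \<in> prod.swap ` newp \<longleftrightarrow> (b, a) \<in> newp" using image_eqI[of "(a, b)" prod.swap "(b, a)" newp] by auto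
 then show ?thesis unfolding all_arcs_new by blast
qed

lemma K_seg_cont: assumes "i < N" shows "continuous_on {0..1} (\<lambda>t. K ((real i + t) / real N))"
proof (rule continuous_on_compose2[OF K_cont])
 have "real i + 1 \<le> real N" using assms by simp
 then have "0 \<le> (real i + t) / real N \<and> (real i + t) / real N \<le> 1" if "0 \<le> t" "t \<le> 1" for t
  using that N0 by (simp add: divide_le_eq)
 then show "(\<lambda>t. (real i + t) / real N) ` {0..1} \<subseteq> {0..1}" by auto
qed (use N0 in \<open>auto intro!: continuous_intros\<close>)

lemma K_seg_inj: assumes "i < N" shows "inj_on (\<lambda>t. K ((real i + t) / real N)) {0<..<1}"
proof (rule inj_onI)
 have "real i + 1 \<le> real N" using assms by simp
 then have r: "0 < (real i + t) / real N \<and> (real i + t) / real N < 1" if "0 < t" "t < 1" for t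
  using that N0 by (simp add: divide_less_eq)
 fix s t :: real assume st: "s \<in> {0<..<1}" "t \<in> {0<..<1}" "K ((real i + s) / real N) = K ((real i + t) / real N)"
 then have "(real i + s) / real N = (real i + t) / real N" by (intro inj_onD[OF K_inj]) (use r in auto)
 then show "s = t" using N0 by simp
qed

lemma new_arcD:
 assumes "(a, b) \<in> all_arcs (F2 # F1 # Ls)"
 shows "(b, a) \<in> all_arcs (F2 # F1 # Ls) \<and> continuous_on {0..1} (c' a b) \<and> inj_on (c' a b) {0<..<1} \<and>
    c' a b ` {0<..<1} = {q \<in> S2. loc' q = Edge {a, b}} \<and> c' a b 0 = p' a \<and> (\<forall>t. c' b a t = c' a b (1 - t))"
proof -
 have sym: "\<forall>t. c' b a t = c' a b (1 - t)" using c'_sym[of a b] assms unfolding all_arcs_new by blast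
 have sw: "(b, a) \<in> all_arcs (F2 # F1 # Ls)" using assms arcD(1)[of a b] unfolding arcs_cover by blast
 consider "(a, b) \<in> all_arcs (R # Ls)" | "(a, b) \<in> newp" | "(b, a) \<in> newp" using assms unfolding arcs_cover by blast
 then show ?thesis
 proof cases
  case 1
  have "Edge {a, b} \<notin> (\<lambda>(a, b). Edge {a, b}) ` newp" using edge_set_new[OF _ 1] by fastforce
  then have "{q \<in> S2. loc' q = Edge {a, b}} = {q \<in> S2. loc q = Edge {a, b}}" by (intro loc'_same) auto
  moreover have "a \<notin> set ns" using all_arcs_verts[OF 1] ns(2) by blast
  ultimately show ?thesis using arcD[OF 1] c'_old[OF 1] sym sw by (simp add: p'_def)
 next
  case 2
  then obtain i where i: "i < N" "a = W ! i" "b = W ! (i + 1)" using newp_W by blast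
  have e: "c' a b = (\<lambda>t. K ((real i + t) / real N))" using c'_new(1)[OF i(1)] i by (intro ext) (simp only:)
  have "c' a b 0 = p' a" unfolding e using p'_W[of i] i by (simp only: less_imp_le add_0_right)
  moreover have "c' a b ` {0<..<1} = {q \<in> S2. loc' q = Edge {a, b}}" unfolding e unfolding i(2,3) by (rule K_arc[OF i(1)])
  ultimately show ?thesis using K_seg_cont[OF i(1)] K_seg_inj[OF i(1)] sym sw unfolding e by blast
 next
  case 3
  then obtain i where i: "i < N" "b = W ! i" "a = W ! (i + 1)" using newp_W by blast
  have e: "c' a b = (\<lambda>t. K ((real i + (1 - t)) / real N))"
  proof
   fix t
   have "real i + 1 - t = real i + (1 - t)" by simp
   then show "c' a b t = K ((real i + (1 - t)) / real N)" using c'_new(2)[OF i(1)] i by (simp only:)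
  qed
  have im: "(\<lambda>t. 1 - t) ` {0<..<1} = {0<..<1::real}"
  proof (intro set_eqI iffI)
   fix x :: real assume "x \<in> {0<..<1}"
   then show "x \<in> (\<lambda>t. 1 - t) ` {0<..<1}" by (intro image_eqI[of _ _ "1 - x"]) auto
  qed auto
  have "c' a b 0 = p' a"
  proof -
   have "real i + (1 - 0) = real (i + 1)" by simp
   then show ?thesis unfolding e using p'_W[of "i + 1"] i by (simp only: Suc_eq_plus1[symmetric] Suc_leI)
  qed
  moreover have "c' a b ` {0<..<1} = {q \<in> S2. loc' q = Edge {a, b}}"
  proof -
   have "c' a b ` {0<..<1} = (\<lambda>t. K ((real i + t) / real N)) ` (\<lambda>t. 1 - t) ` {0<..<1}" unfolding e image_image ..
   also have "\<dots> = {q \<in> S2. loc' q = Edge {W ! i, W ! (i + 1)}}" unfolding im by (rule K_arc[OF i(1)])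
   finally show ?thesis unfolding i(2,3) by (simp only: insert_commute)
  qed
  moreover have "continuous_on {0..1} (c' a b)" unfolding e
   by (rule continuous_on_compose2[OF K_seg_cont[OF i(1)]]) (auto intro!: continuous_intros)
  moreover have "inj_on (c' a b) {0<..<1}"
  proof -
   have "inj_on ((\<lambda>t. K ((real i + t) / real N)) \<circ> (\<lambda>t. 1 - t)) {0<..<1}"
    by (rule comp_inj_on) (auto simp: inj_on_def im K_seg_inj[OF i(1), unfolded inj_on_def, simplified])
   then show ?thesis unfolding e comp_def .
  qed
  ultimately show ?thesis using sym sw by blast
 qed
qed

lemma new_vertD: assumes "a \<in> all_verts (F2 # F1 # Ls)" shows "{q \<in> S2. loc' q = Vertex a} = {p' a}"
proof (cases "a \<in> set ns")
 case True
 then obtain i where "0 < i" "i < N" "a = W ! i" using ns_W by blast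
 then show ?thesis using vertex_new[of i] p'_W[of i] by simp
next
 case False
 then have a: "a \<in> all_verts (R # Ls)" using assms all_verts_new by blast
 have "{q \<in> S2. loc' q = Vertex a} = {q \<in> S2. loc q = Vertex a}" using False by (intro loc'_same) auto
 then show ?thesis using vertD[OF a] False by (simp add: p'_def)
qed

lemma new_locD: assumes q: "q \<in> S2"
 shows "loc' q \<in> Vertex ` all_verts (F2 # F1 # Ls) \<union> (\<lambda>(a, b). Edge {a, b}) ` all_arcs (F2 # F1 # Ls) \<union> Face ` set (F2 # F1 # Ls)"
 using q
proof (cases rule: S2_split)
 case old
 then show ?thesis using old_labels[OF q old(1)] unfolding all_verts_new all_arcs_new by auto
next
 case neg then show ?thesis using loc'_neg by auto
next
 case pos then show ?thesis using loc'_pos by auto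
next
 case (chord \<tau>)
 then show ?thesis using loc'_K[OF chord(1,2)] lab_new[OF chord(1,2)] unfolding all_verts_new all_arcs_new by auto
qed

lemma new_connD: "connected {q \<in> S2. loc' q \<notin> range Face}"
proof -
 have px: "p x \<in> S2 \<and> loc (p x) = Vertex x" "p y \<in> S2 \<and> loc (p y) = Vertex y"
  using vertD[of x] vertD[of y] in_verts by auto
 have "{q \<in> S2. loc' q \<notin> range Face} = {q \<in> S2. loc q \<notin> range Face} \<union> K ` {0..1}"
 proof (intro set_eqI iffI)
  fix q assume "q \<in> {q \<in> S2. loc' q \<notin> range Face}"
  then have q: "q \<in> S2" "loc' q \<notin> range Face" by auto
  show "q \<in> {q \<in> S2. loc q \<notin> range Face} \<union> K ` {0..1}"
   using q(1) by (cases rule: S2_split) (use q loc'_neg loc'_pos in auto)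
 next
  fix q assume "q \<in> {q \<in> S2. loc q \<notin> range Face} \<union> K ` {0..1}"
  then show "q \<in> {q \<in> S2. loc' q \<notin> range Face}"
  proof
   assume q: "q \<in> {q \<in> S2. loc q \<notin> range Face}"
   then have "loc q \<noteq> Face R" by blast
   then have "loc' q = loc q" by (rule loc'_old)
   then show ?thesis using q by simp
  next
   assume "q \<in> K ` {0..1}"
   then obtain \<tau> where \<tau>: "0 \<le> \<tau>" "\<tau> \<le> 1" "q = K \<tau>" by auto
   consider "\<tau> = 0" | "\<tau> = 1" | "0 < \<tau>" "\<tau> < 1" using \<tau> by linarith
   then show ?thesis
   proof cases
    case 1 then show ?thesis using \<tau> K_ends px loc'_old[of q] by auto
   next
    case 2 then show ?thesis using \<tau> K_ends px loc'_old[of q] by auto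
   next
    case 3 then show ?thesis using \<tau>(3) loc'_K[OF 3] lab_new[OF 3] by auto
   qed
  qed
 qed
 moreover have "connected ({q \<in> S2. loc q \<notin> range Face} \<union> K ` {0..1})"
 proof (rule connected_Un[OF connD])
  show "connected (K ` {0..1})" by (rule connected_continuous_image[OF K_cont]) simp
  have "p x \<in> K ` {0..1}" using K_ends(1) by (metis atLeastAtMost_iff image_eqI order_refl zero_le_one)
  then show "{q \<in> S2. loc q \<notin> range Face} \<inter> K ` {0..1} \<noteq> {}" using px by auto
 qed
 ultimately show ?thesis by simp
qed

lemma new_distD: "distinct (F2 # F1 # Ls)"
 "\<And>L M. L \<in> set (F2 # F1 # Ls) ==> M \<in> set (F2 # F1 # Ls) ==> L \<noteq> M ==> arcs L \<inter> arcs M = {}"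
proof -
 show "distinct (F2 # F1 # Ls)" using F_new distD(1) by auto
 let ?A = "set (zip (x # as) (as @ [y]))" and ?B = "set (zip (y # bs) (bs @ [x]))"
 have R_L: "arcs R \<inter> arcs L = {}" if "L \<in> set Ls" for L using distD(2)[of R L] distD(1) that by auto
 have AB: "?A \<inter> ?B = {}"
 proof -
  have "fst ` ?A \<subseteq> set (x # as)" "fst ` ?B \<subseteq> set (y # bs)" by (auto dest: set_zip_leftD)
  moreover have "set (x # as) \<inter> set (y # bs) = {}" using xy by auto
  ultimately show ?thesis by blast
 qed
 have ABR: "?A \<subseteq> all_arcs (R # Ls)" "?B \<subseteq> all_arcs (R # Ls)" using arcs_R by (auto simp: all_arcs_def)
 have nw: "newp \<inter> all_arcs (R # Ls) = {}" "prod.swap ` newp \<inter> all_arcs (R # Ls) = {}" "newp \<inter> prod.swap ` newp = {}"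
  using newp_new newp_irrefl by auto
 have LL: "arcs L \<subseteq> all_arcs (R # Ls)" if "L \<in> set Ls" for L using that by (auto simp: all_arcs_def)
 have e1: "arcs F1 \<inter> arcs F2 = {}" unfolding arcs_F1 arcs_F2 using AB ABR nw by blast
 have e2: "arcs F1 \<inter> arcs L = {}" "arcs F2 \<inter> arcs L = {}" if "L \<in> set Ls" for L
  using R_L[OF that] LL[OF that] nw unfolding arcs_F1 arcs_F2 arcs_R by blast+
 fix L M assume LM: "L \<in> set (F2 # F1 # Ls)" "M \<in> set (F2 # F1 # Ls)" "L \<noteq> M"
 have e3: "arcs L \<inter> arcs M = {}" if "L \<in> set Ls" "M \<in> set Ls" using distD(2)[of L M] that LM(3) by auto
 from LM(1,2) consider "L = F2" "M = F2" | "L = F2" "M = F1" | "L = F1" "M = F2" | "L = F1" "M = F1"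
  | "L = F2" "M \<in> set Ls" | "L = F1" "M \<in> set Ls" | "L \<in> set Ls" "M = F2" | "L \<in> set Ls" "M = F1" | "L \<in> set Ls" "M \<in> set Ls"
  by (simp only: list.set insert_iff) blast
 then show "arcs L \<inter> arcs M = {}"
 proof cases
  case 1 then show ?thesis using LM(3) by (simp only: refl not_True_eq_False)
 next
  case 2 show ?thesis unfolding 2 Int_commute[of "arcs F2"] by (rule e1)
 next
  case 3 show ?thesis unfolding 3 by (rule e1)
 next
  case 4 then show ?thesis using LM(3) by (simp only: refl not_True_eq_False)
 next
  case 5 show ?thesis unfolding 5(1) by (rule e2(2)[OF 5(2)])
 next
  case 6 show ?thesis unfolding 6(1) by (rule e2(1)[OF 6(2)])
 next
  case 7 show ?thesis unfolding 7(2) Int_commute[of "arcs L"] by (rule e2(2)[OF 7(1)])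
 next
  case 8 show ?thesis unfolding 8(2) Int_commute[of "arcs L"] by (rule e2(1)[OF 8(1)])
 next
  case 9 show ?thesis by (rule e3[OF 9])
 qed
qed

lemma nth_join: "i < length A ==> (A @ B) ! i = A ! i" "(A @ B) ! (length A + i) = B ! i"
 by (simp_all add: nth_append)

theorem step: "\<exists>loc p c H. drawing loc p c H (F2 # F1 # Ls)"
proof -
 obtain \<eta>1 where \<eta>1: "continuous_on (cball 0 1) \<eta>1" "inj_on \<eta>1 (cball 0 1)" "\<eta>1 ` cball 0 1 \<subseteq> cball 0 1"
  "\<eta>1 ` ball 0 1 = {z. norm z < 1 \<and> cut n j z < 0}"
  "\<And>i t. i < j ==> 0 \<le> t ==> t \<le> 1 ==> \<eta>1 (pt (j + N) (real i + t)) = pt n (real i + t)"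
  "\<And>i t. i < N ==> 0 \<le> t ==> t \<le> 1 ==> \<eta>1 (pt (j + N) (real (j + i) + t)) = 1 + (1 - (real i + t) / real N) *\<^sub>R (pt n (real j) - 1)"
  by (rule half_disc[OF jn N0]) blast
 have nj: "0 < n - j" "n - j < n" using jn by auto
 obtain \<eta>2 where \<eta>2: "continuous_on (cball 0 1) \<eta>2" "inj_on \<eta>2 (cball 0 1)" "\<eta>2 ` cball 0 1 \<subseteq> cball 0 1"
  "\<eta>2 ` ball 0 1 = {z. norm z < 1 \<and> cut n (n - j) z < 0}"
  "\<And>i t. i < n - j ==> 0 \<le> t ==> t \<le> 1 ==> \<eta>2 (pt (n - j + N) (real i + t)) = pt n (real i + t)"
  "\<And>i t. i < N ==> 0 \<le> t ==> t \<le> 1 ==> \<eta>2 (pt (n - j + N) (real (n - j + i) + t)) = 1 + (1 - (real i + t) / real N) *\<^sub>R (pt n (real (n - j)) - 1)"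
  by (rule half_disc[OF nj N0]) blast
 define \<rho> where "\<rho> z = pt n (real j) * z" for z
 have \<rho>n: "norm (\<rho> z) = norm z" for z by (simp add: \<rho>_def norm_mult)
 have \<rho>i: "inj \<rho>" by (rule injI) (simp add: \<rho>_def)
 have np: "0 < n" using jn by simp
 have lenF: "length F1 = j + N" "length F2 = n - j + N" by (simp_all add: j_def N_def n_def)
 define H1 where "H1 = H R \<circ> \<eta>1"
 define H2 where "H2 = H R \<circ> (\<rho> \<circ> \<eta>2)"
 define H' where "H' = H(F1 := H1, F2 := H2)"
 have hF: "H' F1 = H1" "H' F2 = H2" by (simp_all only: H'_def fun_upd_apply F_new(3) if_True if_False refl)
 have hL: "H' L = H L" if "L \<in> set Ls" for L
 proof -
  have "L \<noteq> F1" "L \<noteq> F2" using that F_new(1,2) by (metis list.set_intros(2))+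
  then show ?thesis unfolding H'_def by (simp only: fun_upd_apply if_False)
 qed
 have \<rho>2: "(\<rho> \<circ> \<eta>2) ` cball 0 1 \<subseteq> cball 0 1" using \<eta>2(3) \<rho>n by fastforce
 have face1: "distinct F1 \<and> 3 \<le> length F1 \<and> continuous_on (cball 0 1) H1 \<and> inj_on H1 (ball 0 1) \<and> H1 ` cball 0 1 \<subseteq> S2 \<and>
   H1 ` ball 0 1 = {q \<in> S2. loc' q = Face F1} \<and>
   (\<forall>i<length F1. \<forall>t\<in>{0..1}. H1 (pt (length F1) (real i + t)) = c' (F1 ! i) (rotate1 F1 ! i) t)"
 proof (intro conjI allI ballI impI)
  show "distinct F1" using xy ns(1) ns_fresh by auto
  show "3 \<le> length F1" using ns0 by (cases ns; cases as) auto
  show "continuous_on (cball 0 1) H1" unfolding H1_def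
   by (intro continuous_on_compose \<eta>1(1) continuous_on_subset[OF faceD(3)[OF Rin]] \<eta>1(3))
  show "inj_on H1 (ball 0 1)" unfolding H1_def
  proof (rule comp_inj_on)
   show "inj_on \<eta>1 (ball 0 1)" using \<eta>1(2) by (rule inj_on_subset) auto
   show "inj_on (H R) (\<eta>1 ` ball 0 1)" unfolding \<eta>1(4) by (rule inj_on_subset[OF faceD(4)[OF Rin]]) auto
  qed
  show "H1 ` cball 0 1 \<subseteq> S2" unfolding H1_def using \<eta>1(3) faceD(5)[OF Rin] by (auto simp: image_subset_iff)
  show "H1 ` ball 0 1 = {q \<in> S2. loc' q = Face F1}" unfolding neg_eq neg_def H1_def image_comp[symmetric] \<eta>1(4) ..
  fix i t assume it: "i < length F1" "t \<in> {0..1::real}"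
  then have t: "0 \<le> t" "t \<le> 1" by auto
  have rot: "rotate1 F1 = (as @ [y]) @ (rev ns @ [x])" "F1 = (x # as) @ (y # rev ns)" by simp_all
  have rotR: "rotate1 R = (as @ [y]) @ (bs @ [x])" "R = (x # as) @ (y # bs)" by simp_all
  show "H1 (pt (length F1) (real i + t)) = c' (F1 ! i) (rotate1 F1 ! i) t"
  proof (cases "i < j")
   case True
   then have ia: "i < length (x # as)" "i < length (as @ [y])" by (simp_all add: j_def)
   have "F1 ! i = R ! i" unfolding rot(2) rotR(2) by (simp only: nth_join(1)[OF ia(1)])
   moreover have "rotate1 F1 ! i = rotate1 R ! i" unfolding rot(1) rotR(1) by (simp only: nth_join(1)[OF ia(2)])
   moreover have "i < n" using True jn by simp
   ultimately show ?thesis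
    using HR_n[OF \<open>i < n\<close> t] \<eta>1(5)[OF True t] c'_old[OF R_arc[OF \<open>i < n\<close>]] unfolding lenF H1_def comp_apply by (simp only:)
  next
   case False
   then obtain k where k: "i = j + k" "k < N" using that[of "i - j"] it(1) lenF(1) by simp
   have la: "j = length (x # as)" "j = length (as @ [y])" by (simp_all add: j_def)
   have rW: "rev W = y # rev ns @ [x]" by simp
   have "F1 ! i = (y # rev ns) ! k" unfolding rot(2) k(1) la(1) by (rule nth_join(2))
   moreover have "rotate1 F1 ! i = (rev ns @ [x]) ! k" unfolding rot(1) k(1) la(2) by (rule nth_join(2))
   moreover have "(y # rev ns) ! k = rev W ! k" "(rev ns @ [x]) ! k = rev W ! (k + 1)"
    unfolding rW using k(2) by (cases k; simp add: nth_append N_def)+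
   moreover have "rev W ! k = W ! (N - k)" "rev W ! (k + 1) = W ! (N - k - 1)"
   proof -
    have l: "k < length W" "k + 1 < length W" "length W - Suc k = N - k" "length W - Suc (k + 1) = N - k - 1" using k(2) unfolding lenW by auto
    show "rev W ! k = W ! (N - k)" "rev W ! (k + 1) = W ! (N - k - 1)" using rev_nth[OF l(1)] rev_nth[OF l(2)] unfolding l(3,4) .
   qed
   moreover have "N - k = (N - k - 1) + 1" using k(2) by simp
   ultimately have F: "F1 ! i = W ! ((N - k - 1) + 1)" "rotate1 F1 ! i = W ! (N - k - 1)" by metis+
   have "N - k - 1 < N" using k(2) by simp
   then have "c' (F1 ! i) (rotate1 F1 ! i) t = K ((real (N - k - 1) + 1 - t) / real N)" unfolding F by (rule c'_new(2))
   also have "(real (N - k - 1) + 1 - t) / real N = 1 - (real k + t) / real N"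
    using k(2) N0 by (simp add: of_nat_diff field_simps)
   finally show ?thesis using \<eta>1(6)[OF k(2) t] unfolding lenF H1_def comp_apply k(1) by (simp only: K_def)
  qed
 qed
 have face2: "distinct F2 \<and> 3 \<le> length F2 \<and> continuous_on (cball 0 1) H2 \<and> inj_on H2 (ball 0 1) \<and> H2 ` cball 0 1 \<subseteq> S2 \<and>
   H2 ` ball 0 1 = {q \<in> S2. loc' q = Face F2} \<and>
   (\<forall>i<length F2. \<forall>t\<in>{0..1}. H2 (pt (length F2) (real i + t)) = c' (F2 ! i) (rotate1 F2 ! i) t)"
 proof (intro conjI allI ballI impI)
  show "distinct F2" using xy ns(1) ns_fresh by auto
  show "3 \<le> length F2" using ns0 by (cases ns; cases bs) auto
  have rc: "continuous_on (cball 0 1) (\<rho> \<circ> \<eta>2)"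
   by (intro continuous_on_compose \<eta>2(1)) (auto simp: \<rho>_def intro!: continuous_intros)
  show "continuous_on (cball 0 1) H2" unfolding H2_def
   by (intro continuous_on_compose[OF rc] continuous_on_subset[OF faceD(3)[OF Rin]] \<rho>2)
  have im: "(\<rho> \<circ> \<eta>2) ` ball 0 1 = {z. norm z < 1 \<and> 0 < cut n j z}"
  proof (intro set_eqI iffI)
   fix z assume "z \<in> (\<rho> \<circ> \<eta>2) ` ball 0 1"
   then obtain w where "w \<in> {z. norm z < 1 \<and> cut n (n - j) z < 0}" "z = \<rho> w" unfolding image_comp[symmetric] \<eta>2(4) by blast
   then show "z \<in> {z. norm z < 1 \<and> 0 < cut n j z}" using cut_rotate[OF jn, of w] \<rho>n by (simp add: \<rho>_def)
  next
   fix z assume z: "z \<in> {z. norm z < 1 \<and> 0 < cut n j z}"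
   define w where "w = z / pt n (real j)"
   have zw: "z = \<rho> w" by (simp add: w_def \<rho>_def)
   then have "w \<in> {z. norm z < 1 \<and> cut n (n - j) z < 0}" using z cut_rotate[OF jn, of w] \<rho>n[of w] by (simp add: \<rho>_def)
   then show "z \<in> (\<rho> \<circ> \<eta>2) ` ball 0 1" unfolding image_comp[symmetric] \<eta>2(4) zw by blast
  qed
  show "inj_on H2 (ball 0 1)" unfolding H2_def
  proof (rule comp_inj_on)
   have "inj_on \<eta>2 (ball 0 1)" using \<eta>2(2) by (rule inj_on_subset) auto
   then show "inj_on (\<rho> \<circ> \<eta>2) (ball 0 1)" by (rule comp_inj_on) (rule inj_on_subset[OF \<rho>i], simp)
   show "inj_on (H R) ((\<rho> \<circ> \<eta>2) ` ball 0 1)" unfolding im by (rule inj_on_subset[OF faceD(4)[OF Rin]]) auto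
  qed
  show "H2 ` cball 0 1 \<subseteq> S2" unfolding H2_def image_comp[of "H R", symmetric]
   by (rule order_trans[OF image_mono[OF \<rho>2] faceD(5)[OF Rin]])
  show "H2 ` ball 0 1 = {q \<in> S2. loc' q = Face F2}" unfolding pos_eq pos_def H2_def im[symmetric] by (simp only: image_comp)
  fix i t assume it: "i < length F2" "t \<in> {0..1::real}"
  then have t: "0 \<le> t" "t \<le> 1" by auto
  have rot: "rotate1 F2 = (bs @ [x]) @ (ns @ [y])" "F2 = (y # bs) @ (x # ns)" by simp_all
  have rotR: "rotate1 R = (as @ [y]) @ (bs @ [x])" "R = (x # as) @ (y # bs)" by simp_all
  have lb: "n - j = length bs + 1" by (simp add: n_def j_def)
  show "H2 (pt (length F2) (real i + t)) = c' (F2 ! i) (rotate1 F2 ! i) t"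
  proof (cases "i < n - j")
   case True
   have jin: "j + i < n" using True by simp
   have la: "j = length (x # as)" "j = length (as @ [y])" by (simp_all add: j_def)
   have ia: "i < length (y # bs)" "i < length (bs @ [x])" using True lb by simp_all
   have "F2 ! i = R ! (j + i)" unfolding rot(2) rotR(2) la(1) nth_join(2) by (rule nth_join(1)[OF ia(1)])
   moreover have "rotate1 F2 ! i = rotate1 R ! (j + i)" unfolding rot(1) rotR(1) la(2) nth_join(2) by (rule nth_join(1)[OF ia(2)])
   moreover have "\<rho> (pt n (real i + t)) = pt n (real (j + i) + t)" by (simp add: \<rho>_def pt_mult add.assoc)
   ultimately show ?thesis
    using HR_n[OF jin t] \<eta>2(5)[OF True t] c'_old[OF R_arc[OF jin]] unfolding lenF H2_def comp_apply by (simp only:)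
  next
   case False
   then obtain k where k: "i = n - j + k" "k < N" using that[of "i - (n - j)"] it(1) lenF(2) by simp
   have la: "n - j = length (y # bs)" "n - j = length (bs @ [x])" using lb by simp_all
   have "F2 ! i = (x # ns) ! k" unfolding rot(2) k(1) la(1) by (rule nth_join(2))
   moreover have "rotate1 F2 ! i = (ns @ [y]) ! k" unfolding rot(1) k(1) la(2) by (rule nth_join(2))
   moreover have "(x # ns) ! k = W ! k" "(ns @ [y]) ! k = W ! (k + 1)"
    using k(2) by (cases k; simp add: nth_append N_def)+
   ultimately have F: "F2 ! i = W ! k" "rotate1 F2 ! i = W ! (k + 1)" by metis+
   have "c' (F2 ! i) (rotate1 F2 ! i) t = K ((real k + t) / real N)" unfolding F by (rule c'_new(1)[OF k(2)])
   moreover have "\<rho> (1 + (1 - (real k + t) / real N) *\<^sub>R (pt n (real (n - j)) - 1)) = 1 + ((real k + t) / real N) *\<^sub>R (pt n (real j) - 1)"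
   proof -
    have "real j + real (n - j) = 0 + real n * of_int 1" using jn by simp
    then have "pt n (real j + real (n - j)) = pt n 0" using pt_eq_iff[OF np] by blast
    then have "pt n (real j) * pt n (real (n - j)) = 1" by (simp add: pt_mult)
    then show ?thesis by (simp add: \<rho>_def algebra_simps scaleR_conv_of_real)
   qed
   ultimately show ?thesis using \<eta>2(6)[OF k(2) t] unfolding lenF H2_def comp_apply k(1) by (simp only: K_def)
  qed
 qed
 have faceL: "{q \<in> S2. loc' q = Face L} = {q \<in> S2. loc q = Face L}" if "L \<in> set Ls" for L
  using that F_new distD(1) by (intro loc'_same) auto
 have cL: "c' (L ! i) (rotate1 L ! i) = c (L ! i) (rotate1 L ! i)" if "L \<in> set Ls" "i < length L" for L i
 proof (rule c'_old)
  have "(L ! i, rotate1 L ! i) \<in> arcs L" using arcs_nth that by blast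
  then show "(L ! i, rotate1 L ! i) \<in> all_arcs (R # Ls)" using that by (auto simp: all_arcs_def)
 qed
 have "drawing loc' p' c' H' (F2 # F1 # Ls)"
  unfolding drawing_def
 proof (intro conjI ballI)
  fix L assume L: "L \<in> set (F2 # F1 # Ls)"
  then consider "L = F2" | "L = F1" | "L \<in> set Ls" by auto
  then show "distinct L" "3 \<le> length L" "continuous_on (cball 0 1) (H' L)" "inj_on (H' L) (ball 0 1)" "H' L ` cball 0 1 \<subseteq> S2"
   "H' L ` ball 0 1 = {q \<in> S2. loc' q = Face L}"
   "\<forall>i<length L. \<forall>t\<in>{0..1}. H' L (pt (length L) (real i + t)) = c' (L ! i) (rotate1 L ! i) t"
   by (cases; use face1 face2 hF hL faceD[of L] faceL cL in simp)+
 next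
  show "\<forall>a b. (a, b) \<in> all_arcs (F2 # F1 # Ls) \<longrightarrow> (b, a) \<in> all_arcs (F2 # F1 # Ls) \<and> continuous_on {0..1} (c' a b) \<and> inj_on (c' a b) {0<..<1} \<and>
    c' a b ` {0<..<1} = {q \<in> S2. loc' q = Edge {a, b}} \<and> c' a b 0 = p' a \<and> (\<forall>t. c' b a t = c' a b (1 - t))"
   using new_arcD by blast
 qed (use new_vertD new_locD new_connD new_distD in blast)+
 then show ?thesis by blast
qed

end

lemma drawable_step:
 assumes "drawable ((x # as @ y # bs) # Ls)" "distinct ns" "set ns \<inter> all_verts ((x # as @ y # bs) # Ls) = {}"
  "ns = [] ==> as \<noteq> [] \<and> bs \<noteq> [] \<and> (x, y) \<notin> all_arcs ((x # as @ y # bs) # Ls)"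
 shows "drawable ((y # bs @ x # ns) # (x # as @ y # rev ns) # Ls)"
proof -
 obtain loc p c H where "drawing loc p c H ((x # as @ y # bs) # Ls)" using assms(1) unfolding drawable_def by blast
 then interpret chord_step loc p c H x y as bs ns Ls using assms(2-4) by unfold_locales
 show ?thesis unfolding drawable_def by (rule step)
qed

section \<open>From drawings to patterns\<close>

context drawn begin

definition "vertex_set = p ` all_verts Ls"
definition "edge a b = c a b ` {0<..<1}"
definition "edge_set = (\<lambda>(a, b). edge a b) ` all_arcs Ls"
definition "face L = H L ` ball 0 1"

lemma arc_nth: assumes "L \<in> set Ls" "i < length L"
 shows "(L ! i, rotate1 L ! i) \<in> arcs L" "(L ! i, rotate1 L ! i) \<in> all_arcs Ls"
 using assms arcs_nth[of "L ! i" "rotate1 L ! i" L] by (auto simp: all_arcs_def)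

lemma edge_loc: "(a, b) \<in> all_arcs Ls ==> edge a b = {q \<in> S2. loc q = Edge {a, b}}"
 unfolding edge_def by (rule arcD(4))

lemma edge_sym: "(a, b) \<in> all_arcs Ls ==> edge b a = edge a b"
 using edge_loc[of a b] edge_loc[of b a] arcD(1)[of a b] by (simp add: insert_commute)

lemma face_loc: "L \<in> set Ls ==> face L = {q \<in> S2. loc q = Face L}"
 unfolding face_def by (rule faceD(6))

lemma vertex_loc: "vertex_set = {q \<in> S2. loc q \<in> Vertex ` all_verts Ls}"
 unfolding vertex_set_def using vertD by fast

lemma p_loc: "a \<in> all_verts Ls ==> p a \<in> S2 \<and> loc (p a) = Vertex a"
 using vertD[of a] by blast

lemma skeleton: "vertex_set \<union> \<Union>edge_set = {q \<in> S2. loc q \<notin> range Face}"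
proof
 have "\<Union>edge_set \<subseteq> {q \<in> S2. loc q \<notin> range Face}"
 proof
  fix q assume "q \<in> \<Union>edge_set"
  then obtain a b where ab: "(a, b) \<in> all_arcs Ls" "q \<in> edge a b" unfolding edge_set_def by auto
  then show "q \<in> {q \<in> S2. loc q \<notin> range Face}" using edge_loc[OF ab(1)] by auto
 qed
 then show "vertex_set \<union> \<Union>edge_set \<subseteq> {q \<in> S2. loc q \<notin> range Face}" unfolding vertex_loc by auto
 show "{q \<in> S2. loc q \<notin> range Face} \<subseteq> vertex_set \<union> \<Union>edge_set"
 proof
  fix q assume "q \<in> {q \<in> S2. loc q \<notin> range Face}"
  then have q: "q \<in> S2" "loc q \<notin> range Face" by auto
  then consider "loc q \<in> Vertex ` all_verts Ls" | "loc q \<in> (\<lambda>(a, b). Edge {a, b}) ` all_arcs Ls" using locD[OF q(1)] by blast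
  then show "q \<in> vertex_set \<union> \<Union>edge_set"
  proof cases
   case 1 then show ?thesis using q unfolding vertex_loc by blast
  next
   case 2
   then obtain a b where ab: "(a, b) \<in> all_arcs Ls" "loc q = Edge {a, b}" by auto
   then have "q \<in> edge a b" using edge_loc[OF ab(1)] q by simp
   then show ?thesis using ab(1) unfolding edge_set_def by blast
  qed
 qed
qed

lemma complement: "S2 - (vertex_set \<union> \<Union>edge_set) = \<Union>(face ` set Ls)"
proof -
 have "\<Union>(face ` set Ls) = {q \<in> S2. loc q \<in> Face ` set Ls}" using face_loc by auto
 moreover have "S2 - {q \<in> S2. loc q \<notin> range Face} = {q \<in> S2. loc q \<in> range Face}" by blast
 moreover have "{q \<in> S2. loc q \<in> range Face} = {q \<in> S2. loc q \<in> Face ` set Ls}"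
 proof (intro Collect_cong conj_cong refl)
  fix q assume "q \<in> S2"
  then show "loc q \<in> range Face \<longleftrightarrow> loc q \<in> Face ` set Ls" using locD[of q] by auto
 qed
 ultimately show ?thesis unfolding skeleton by (simp only:)
qed

lemma finite_arcs: "finite (all_arcs Ls)" by (simp add: all_arcs_def arcs_def)

lemma no_both: assumes L: "L \<in> set Ls" and "(a, b) \<in> arcs L" shows "(b, a) \<notin> arcs L" "a \<noteq> b"
proof -
 let ?n = "length L"
 have n: "3 \<le> ?n" "distinct L" using faceD(1,2)[OF L] by auto
 obtain i where i: "i < ?n" "a = L ! i" "b = rotate1 L ! i" using assms(2) arcs_nth by blast
 have b: "b = L ! (Suc i mod ?n)" using i nth_rotate1[OF i(1)] by simp
 have n0: "0 < ?n" using n(1) by linarith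
 have lt: "Suc i mod ?n < ?n" using n0 by (rule mod_less_divisor)
 show "a \<noteq> b" using i(2) b nth_eq_iff_index_eq[OF n(2) i(1) lt] i(1) n(1) by (auto simp: mod_Suc split: if_splits)
 show "(b, a) \<notin> arcs L"
 proof
  assume "(b, a) \<in> arcs L"
  then obtain j where j: "j < ?n" "b = L ! j" "a = rotate1 L ! j" using arcs_nth by blast
  have a: "a = L ! (Suc j mod ?n)" using j nth_rotate1[OF j(1)] by simp
  have lt': "Suc j mod ?n < ?n" using n0 by (rule mod_less_divisor)
  have e1: "j = Suc i mod ?n" using nth_eq_iff_index_eq[OF n(2) j(1) lt] j(2) b by simp
  have e2: "i = Suc j mod ?n" using nth_eq_iff_index_eq[OF n(2) i(1) lt'] i(2) a by simp
  show False using e1 e2 i(1) j(1) n(1) by (auto simp: mod_Suc split: if_splits)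
 qed
qed

lemma arc_face: assumes "(a, b) \<in> all_arcs Ls" obtains L where "L \<in> set Ls" "(a, b) \<in> arcs L"
 using assms unfolding all_arcs_def by blast

lemma boundary_loc: assumes L: "L \<in> set Ls" and z: "norm z = 1"
 shows "\<exists>i<length L. loc (H L z) = Vertex (L ! i) \<or> loc (H L z) = Edge {L ! i, rotate1 L ! i}"
proof -
 let ?n = "length L"
 have n0: "?n > 0" using faceD(2)[OF L] by linarith
 obtain i t where it: "i < ?n" "0 \<le> t" "t < 1" "z = pt ?n (real i + t)" using sphere_pt_cases[OF n0 z] .
 have e: "H L z = c (L ! i) (rotate1 L ! i) t" unfolding it(4) using faceD(7)[OF L it(1)] it by simp
 have m: "(L ! i, rotate1 L ! i) \<in> all_arcs Ls" using arc_nth(2)[OF L it(1)] .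
 show ?thesis
 proof (cases "t = 0")
  case True
  have "L ! i \<in> all_verts Ls" using all_arcs_verts[OF m] by blast
  then have "loc (H L z) = Vertex (L ! i)" using e True arcD(5)[OF m] p_loc by simp
  then show ?thesis using it(1) by blast
 next
  case False
  then have "t \<in> {0<..<1}" using it by simp
  then have "H L z \<in> edge (L ! i) (rotate1 L ! i)" unfolding e edge_def by (rule imageI)
  then have "loc (H L z) = Edge {L ! i, rotate1 L ! i}" using edge_loc[OF m] by simp
  then show ?thesis using it(1) by blast
 qed
qed

lemma closure_face: assumes L: "L \<in> set Ls" shows "closure (face L) = H L ` cball 0 1"
proof
 have "compact (H L ` cball 0 1)" using compact_continuous_image[OF faceD(3)[OF L]] by simp
 then show "closure (face L) \<subseteq> H L ` cball 0 1" unfolding face_def by (intro closure_minimal compact_imp_closed) auto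
 have "H L ` closure (ball 0 1) \<subseteq> closure (face L)"
 proof (rule image_closure_subset)
  show "continuous_on (closure (ball 0 1)) (H L)" using faceD(3)[OF L] by simp
  show "H L ` ball 0 1 \<subseteq> closure (face L)" unfolding face_def by (rule closure_subset)
 qed simp
 then show "H L ` cball 0 1 \<subseteq> closure (face L)" by simp
qed

text \<open>
  The middle of an edge lies on the boundary circle of the disc of \<open>L\<close>, in a side that runs along the
  same edge.
\<close>

lemma edge_closure_face: assumes L: "L \<in> set Ls" and ab: "(a, b) \<in> all_arcs Ls"
 shows "edge a b \<subseteq> closure (face L) \<longleftrightarrow> (a, b) \<in> arcs L \<or> (b, a) \<in> arcs L"
proof
 assume "edge a b \<subseteq> closure (face L)"
 moreover have "c a b (1/2) \<in> edge a b" unfolding edge_def by (intro imageI) simp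
 ultimately have q: "c a b (1/2) \<in> H L ` cball 0 1" "loc (c a b (1/2)) = Edge {a, b}"
  using closure_face[OF L] edge_loc[OF ab] by blast+
 then obtain z where z: "norm z \<le> 1" "c a b (1/2) = H L z" by auto
 have "norm z = 1"
 proof (rule ccontr)
  assume "norm z \<noteq> 1"
  then have "H L z \<in> face L" unfolding face_def using z(1) by (intro imageI) simp
  then show False using face_loc[OF L] q(2) z(2) by simp
 qed
 then obtain i where i: "i < length L" "loc (H L z) = Vertex (L ! i) \<or> loc (H L z) = Edge {L ! i, rotate1 L ! i}"
  using boundary_loc[OF L] by blast
 then have "{a, b} = {L ! i, rotate1 L ! i}" using q(2) z(2) by simp
 then show "(a, b) \<in> arcs L \<or> (b, a) \<in> arcs L" using arc_nth(1)[OF L i(1)] by (auto simp: doubleton_eq_iff)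
next
 have *: "edge a b \<subseteq> closure (face L)" if m: "(a, b) \<in> arcs L" for a b
 proof -
  obtain i where i: "i < length L" "a = L ! i" "b = rotate1 L ! i" using m arcs_nth by blast
  show ?thesis unfolding edge_def closure_face[OF L]
  proof (rule image_subsetI)
   fix t :: real assume t: "t \<in> {0<..<1}"
   then have "c a b t = H L (pt (length L) (real i + t))" using faceD(7)[OF L i(1), of t] i by simp
   then show "c a b t \<in> H L ` cball 0 1" by simp
  qed
 qed
 assume "(a, b) \<in> arcs L \<or> (b, a) \<in> arcs L"
 then show "edge a b \<subseteq> closure (face L)" using *[of a b] *[of b a] edge_sym[OF ab] by auto
qed

lemma face_inj: "inj_on face (set Ls)"
proof (rule inj_onI)
 fix L M assume LM: "L \<in> set Ls" "M \<in> set Ls" "face L = face M"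
 have "H L 0 \<in> face L" unfolding face_def by (intro imageI) simp
 then have "loc (H L 0) = Face L" "loc (H L 0) = Face M" using LM(3) face_loc[OF LM(1)] face_loc[OF LM(2)] by blast+
 then show "L = M" by (metis cell.inject(3))
qed

lemma face_homeomorphism: assumes L: "L \<in> set Ls" shows "\<exists>h'. homeomorphism (ball 0 1) (face L) (H L) h'"
proof -
 have cont: "continuous_on (ball 0 1) (H L)" using faceD(3)[OF L] ball_subset_cball by (rule continuous_on_subset)
 have S: "face L \<subseteq> S2" using face_loc[OF L] by blast
 have "openin (top_of_set (face L)) (H L ` U)" if "openin (top_of_set (ball 0 1)) U" for U
 proof -
  have U: "open U" "U \<subseteq> ball 0 1" using that openin_open_eq[of "ball 0 1" U] by auto
  have "openin (top_of_set S2) (H L ` U)"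
   by (rule invariance_of_domain_S2[OF U(1)])
    (use U(2) cont faceD(4)[OF L] S in \<open>auto intro: continuous_on_subset inj_on_subset simp: face_def image_subset_iff\<close>)
  moreover have "H L ` U \<subseteq> face L" unfolding face_def by (rule image_mono[OF U(2)])
  ultimately show ?thesis by (rule openin_subset_trans) (rule S)
 qed
 then obtain g where "homeomorphism (ball 0 1) (face L) (H L) g"
  using homeomorphism_injective_open_map[OF cont _ faceD(4)[OF L], of "face L"] unfolding face_def by blast
 then show ?thesis by blast
qed

lemma face_components: "components (S2 - (vertex_set \<union> \<Union>edge_set)) = face ` set Ls"
 unfolding complement
proof (rule components_finite_disjoint_closed)
 show "pairwise disjnt (face ` set Ls)"
  unfolding pairwise_def disjnt_def using face_loc by (auto simp: disjoint_iff)
 fix F assume "F \<in> face ` set Ls"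
 then obtain L where L: "L \<in> set Ls" "F = face L" by blast
 have "continuous_on (ball 0 1) (H L)" using faceD(3)[OF L(1)] ball_subset_cball by (rule continuous_on_subset)
 then show "connected F \<and> F \<noteq> {}" unfolding L(2) face_def using connected_continuous_image[OF _ connected_ball] by auto
 have "F = \<Union>(face ` set Ls) \<inter> closure F"
 proof
  show "F \<subseteq> \<Union>(face ` set Ls) \<inter> closure F" using L closure_subset by blast
  show "\<Union>(face ` set Ls) \<inter> closure F \<subseteq> F"
  proof
   fix q assume q: "q \<in> \<Union>(face ` set Ls) \<inter> closure F"
   then obtain M where M: "M \<in> set Ls" "loc q = Face M" using face_loc by auto
   obtain z where z: "norm z \<le> 1" "q = H L z" using q closure_face[OF L(1)] L(2) by auto
   show "q \<in> F"
   proof (cases "norm z = 1")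
    case True then show ?thesis using boundary_loc[OF L(1) True] M(2) z(2) by auto
   next
    case False then show ?thesis unfolding L(2) face_def z(2) using z(1) by (intro imageI) simp
   qed
  qed
 qed
 then show "closedin (top_of_set (\<Union>(face ` set Ls))) F" using closedin_closed_Int[of "closure F" "\<Union>(face ` set Ls)"] by simp
qed simp

lemma arc_path: assumes ab: "(a, b) \<in> all_arcs Ls"
 shows "c a b ` {0..1} = edge a b \<union> {p a, p b}" "c a b 1 = p b" "p a \<noteq> p b" "inj_on (c a b) {0..1}"
proof -
 have e1: "c a b 1 = p b" using arcD(6)[OF ab, of 0] arcD(5)[OF arcD(1)[OF ab]] by simp
 then show "c a b 1 = p b" .
 have "{0..1::real} = {0<..<1} \<union> {0, 1}" by auto
 then show "c a b ` {0..1} = edge a b \<union> {p a, p b}" using arcD(5)[OF ab] e1 by (simp add: edge_def image_Un)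
 have v: "loc (p a) = Vertex a" "loc (p b) = Vertex b" using p_loc all_arcs_verts[OF ab] by auto
 obtain L where "L \<in> set Ls" "(a, b) \<in> arcs L" using arc_face[OF ab] .
 then have "a \<noteq> b" by (rule no_both(2))
 then show ne: "p a \<noteq> p b" using v by auto
 have mid: "c a b t \<noteq> p a \<and> c a b t \<noteq> p b" if "0 < t" "t < 1" for t
 proof -
  have "c a b t \<in> edge a b" unfolding edge_def using that by (intro imageI) simp
  then show ?thesis using edge_loc[OF ab] v by auto
 qed
 show "inj_on (c a b) {0..1}"
 proof (rule inj_onI)
  fix s t :: real assume st: "s \<in> {0..1}" "t \<in> {0..1}" "c a b s = c a b t"
  have inner: "s = t" if "0 < s" "s < 1" "0 < t" "t < 1"
   by (rule inj_onD[OF arcD(3)[OF ab] st(3)]) (use that in simp_all)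
  have "s = 0 \<or> s = 1 \<or> (0 < s \<and> s < 1)" "t = 0 \<or> t = 1 \<or> (0 < t \<and> t < 1)" using st(1,2) by auto
  then show "s = t"
   by (elim disjE conjE; use inner st(3) mid[of s] mid[of t] arcD(5)[OF ab] e1 ne in auto)
 qed
qed

lemma edge_on_arc: assumes ab: "(a, b) \<in> all_arcs Ls" shows "edge_on vertex_set (edge a b)"
 unfolding edge_on_def
proof (intro exI[of _ "c a b"] conjI)
 note v = all_arcs_verts[OF ab]
 have dis: "edge a b \<inter> vertex_set = {}" using edge_loc[OF ab] vertex_loc by auto
 have pV: "p a \<in> vertex_set" "p b \<in> vertex_set" using v by (auto simp: vertex_set_def)
 have im: "path_image (c a b) = edge a b \<union> {p a, p b}" unfolding path_image_def by (rule arc_path(1)[OF ab])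
 have "arc (c a b)" unfolding arc_def path_def using arcD(2)[OF ab] arc_path(4)[OF ab] by simp
 then show "simple_path (c a b)" by (rule arc_imp_simple_path)
 show "path_image (c a b) \<subseteq> S2" unfolding im using edge_loc[OF ab] p_loc v by auto
 have pe: "pathstart (c a b) = p a" "pathfinish (c a b) = p b" unfolding pathstart_def pathfinish_def using arcD(5)[OF ab] arc_path(2)[OF ab] by auto
 show "path_image (c a b) \<inter> vertex_set = {pathstart (c a b), pathfinish (c a b)}" unfolding im pe using dis pV by blast
 show "edge a b = path_image (c a b) - vertex_set" unfolding im using dis pV by blast
qed

lemma p_closure: assumes ab: "(a, b) \<in> all_arcs Ls" shows "p a \<in> closure (edge a b)"
proof -
 have "c a b ` closure {0<..<1} \<subseteq> closure (edge a b)"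
 proof (rule image_closure_subset)
  show "continuous_on (closure {0<..<1}) (c a b)" using arcD(2)[OF ab] by simp
  show "c a b ` {0<..<1} \<subseteq> closure (edge a b)" unfolding edge_def by (rule closure_subset)
 qed simp
 moreover have "c a b 0 \<in> c a b ` closure {0<..<1}" by (rule imageI) simp
 ultimately show ?thesis using arcD(5)[OF ab] by auto
qed

definition pattern_of where "pattern_of B = \<lparr>verts = vertex_set, edges = edge_set, black = face ` B, white = face ` (set Ls - B)\<rparr>"

lemma faces_pattern_of: "faces (pattern_of B) = face ` set Ls"
 unfolding faces_def pattern_of_def by (simp add: face_components)

lemma map_pattern_of: "map_on_S2 (pattern_of B)"
 unfolding map_on_S2_def faces_pattern_of
proof
 have fin: "finite vertex_set" "finite edge_set" using finite_arcs by (auto simp: vertex_set_def edge_set_def all_verts_def)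
 have "pairwise disjnt edge_set"
 proof (rule pairwiseI)
  fix e f assume ef: "e \<in> edge_set" "f \<in> edge_set" "e \<noteq> f"
  then obtain a b a' b' where ab: "(a, b) \<in> all_arcs Ls" "e = edge a b" "(a', b') \<in> all_arcs Ls" "f = edge a' b'"
   unfolding edge_set_def by auto
  then have l: "e = {q \<in> S2. loc q = Edge {a, b}}" "f = {q \<in> S2. loc q = Edge {a', b'}}" using edge_loc by simp_all
  then have "{a, b} \<noteq> {a', b'}" using ef(3) by auto
  then show "disjnt e f" unfolding l disjnt_def by auto
 qed
 moreover have "\<forall>e\<in>edge_set. edge_on vertex_set e" using edge_on_arc by (auto simp: edge_set_def)
 moreover have "connected (vertex_set \<union> \<Union>edge_set)" unfolding skeleton by (rule connD)
 moreover have "vertex_set \<subseteq> S2" unfolding vertex_loc by blast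
 ultimately show "graph_on_S2 (pattern_of B)" unfolding graph_on_S2_def pattern_of_def using fin by simp
 show "\<forall>F\<in>face ` set Ls. F homeomorphic (ball 0 1 :: complex set)"
  using face_homeomorphism homeomorphic_sym unfolding homeomorphic_def by (metis imageE homeomorphism_symD)
qed

lemma walk_pattern_of: assumes L: "L \<in> set Ls"
 shows "boundary_walk (pattern_of B) (face L) (map (\<lambda>i. edge (L ! i) (rotate1 L ! i)) [0..<length L])"
 unfolding boundary_walk_def
proof (intro conjI exI[of _ "H L"] allI impI)
 let ?es = "map (\<lambda>i. edge (L ! i) (rotate1 L ! i)) [0..<length L]"
 show "?es \<noteq> []" using faceD(2)[OF L] by (cases L) auto
 show "set ?es \<subseteq> edges (pattern_of B)" using arc_nth(2)[OF L] by (auto simp: pattern_of_def edge_set_def)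
 show "continuous_on (cball 0 1) (H L)" by (rule faceD(3)[OF L])
 show "\<exists>h'. homeomorphism (ball 0 1) (face L) (H L) h'" by (rule face_homeomorphism[OF L])
 fix i assume "i < length ?es"
 then have i: "i < length L" by simp
 note m = arc_nth(2)[OF L i]
 have h: "H L (pt (length L) (real i + t)) = c (L ! i) (rotate1 L ! i) t" if "0 \<le> t" "t \<le> 1" for t
  by (rule faceD(7)[OF L i that])
 have "H L (pt (length L) (real i)) = p (L ! i)" using h[of 0] arcD(5)[OF m] by simp
 then show "H L (cis (2 * pi * real i / real (length ?es))) \<in> verts (pattern_of B)"
  using all_arcs_verts[OF m] by (simp add: pattern_of_def vertex_set_def pt_def[symmetric])
 have "bij_betw (H L) (side (length L) i) (edge (L ! i) (rotate1 L ! i))"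
 proof (rule bij_betw_imageI)
  show "inj_on (H L) (side (length L) i)" unfolding side_pt
  proof (rule inj_onI)
   fix z w assume "z \<in> (\<lambda>t. pt (length L) (real i + t)) ` {0<..<1}" "w \<in> (\<lambda>t. pt (length L) (real i + t)) ` {0<..<1}" "H L z = H L w"
   then obtain s t where st: "s \<in> {0<..<1}" "t \<in> {0<..<1}" "z = pt (length L) (real i + s)" "w = pt (length L) (real i + t)" "H L z = H L w" by blast
   then have "c (L ! i) (rotate1 L ! i) s = c (L ! i) (rotate1 L ! i) t" using h[of s] h[of t] by simp
   then have "s = t" using inj_onD[OF arcD(3)[OF m]] st by blast
   then show "z = w" using st by simp
  qed
  have "H L ` side (length L) i = (\<lambda>t. H L (pt (length L) (real i + t))) ` {0<..<1}" unfolding side_pt image_image ..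
  also have "\<dots> = edge (L ! i) (rotate1 L ! i)" unfolding edge_def by (rule image_cong) (use h in auto)
  finally show "H L ` side (length L) i = edge (L ! i) (rotate1 L ! i)" .
 qed
 then show "bij_betw (H L) (side (length ?es) i) (?es ! i)" using i by simp
qed

lemma across_pattern_of: assumes L: "L \<in> set Ls" "M \<in> set Ls" and ab: "(a, b) \<in> arcs L" "(b, a) \<in> arcs M"
 shows "across (pattern_of B) (face L) (edge a b) (face M)"
proof -
 have m: "(a, b) \<in> all_arcs Ls" using L(1) ab(1) by (auto simp: all_arcs_def)
 have "N = L \<or> N = M" if "N \<in> set Ls" "(a, b) \<in> arcs N \<or> (b, a) \<in> arcs N" for N
  using distD(2)[OF that(1) L(1)] distD(2)[OF that(1) L(2)] that(2) ab by blast
 then have "{N \<in> set Ls. (a, b) \<in> arcs N \<or> (b, a) \<in> arcs N} = {L, M}" using L ab by blast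
 then have "{N \<in> set Ls. edge a b \<subseteq> closure (face N)} = {L, M}" using edge_closure_face[OF _ m] by auto
 moreover have "{F \<in> face ` set Ls. edge a b \<subseteq> closure F} = face ` {N \<in> set Ls. edge a b \<subseteq> closure (face N)}" by blast
 ultimately show ?thesis unfolding across_def faces_pattern_of by simp
qed

lemma degree_pattern_of:
 assumes "(a, b1) \<in> all_arcs Ls" "(a, b2) \<in> all_arcs Ls" "(a, b3) \<in> all_arcs Ls" "b1 \<noteq> b2" "b1 \<noteq> b3" "b2 \<noteq> b3"
 shows "3 \<le> degree_at (pattern_of B) (p a)"
proof -
 have ne: "edge a b \<noteq> edge a b'" if "(a, b) \<in> all_arcs Ls" "(a, b') \<in> all_arcs Ls" "b \<noteq> b'" for b b'
 proof
  assume e: "edge a b = edge a b'"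
  have "c a b (1/2) \<in> edge a b" unfolding edge_def by (intro imageI) simp
  then have "loc (c a b (1/2)) = Edge {a, b}" "loc (c a b (1/2)) = Edge {a, b'}" 
   using edge_loc[OF that(1)] edge_loc[OF that(2)] e by blast+
  then have "{a, b} = {a, b'}" by (metis cell.inject(2))
  then show False using that(3) by (auto simp: doubleton_eq_iff)
 qed
 let ?S = "{edge a b1, edge a b2, edge a b3}"
 have "card ?S = 3" using ne[OF assms(1,2,4)] ne[OF assms(1,3,5)] ne[OF assms(2,3,6)] by simp
 moreover have "edge a b \<in> edge_set" if "(a, b) \<in> all_arcs Ls" for b using that unfolding edge_set_def by force
 then have "?S \<subseteq> {e \<in> edge_set. p a \<in> closure e}" using assms(1-3) p_closure by auto
 moreover have "finite {e \<in> edge_set. p a \<in> closure e}" using finite_arcs by (simp add: edge_set_def)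
 ultimately have "3 \<le> card {e \<in> edge_set. p a \<in> closure e}" using card_mono[of "{e \<in> edge_set. p a \<in> closure e}" ?S] by linarith
 then show ?thesis unfolding degree_at_def pattern_of_def by simp
qed

text \<open>
  The length of a white face is even, so the types of its two sides at a corner differ, even at the corner where the
  list starts.
\<close>

lemma alternating_vertex:
 assumes L: "L \<in> set Ls" "length L = 2 * m" and a: "a \<in> set L"
  and alt: "\<forall>i<2 * m. (rotate1 L ! i, L ! i) \<in> A \<longleftrightarrow> i mod 2 = (r :: nat)" and r: "r < 2"
 obtains w z where "(w, a) \<in> arcs L" "(a, z) \<in> arcs L" "(a, w) \<in> A \<longleftrightarrow> (z, a) \<notin> A"
proof -
 obtain i where i: "i < length L" "L ! i = a" using a by (auto simp: in_set_conv_nth)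
 have n: "3 \<le> length L" using faceD(2)[OF L(1)] .
 define i' where "i' = (if i = 0 then length L - 1 else i - 1)"
 have i': "i' < length L" "Suc i' mod length L = i" using i n by (auto simp: i'_def)
 have r': "rotate1 L ! i' = a" using nth_rotate1[OF i'(1)] i'(2) i(2) by simp
 have par: "i' mod 2 \<noteq> i mod 2"
 proof (cases "i = 0")
  case True
  then have "i' = 2 * m - 1" "0 < m" using L(2) n by (auto simp: i'_def)
  then have "odd i'" by simp
  then show ?thesis using True by (simp add: odd_iff_mod_2_eq_one)
 next
  case False
  then have "i = Suc i'" by (simp add: i'_def)
  then show ?thesis by (simp add: mod_Suc)
 qed
 have "(L ! i', a) \<in> arcs L" "(a, rotate1 L ! i) \<in> arcs L" using arc_nth(1)[OF L(1) i'(1)] arc_nth(1)[OF L(1) i(1)] r' i by auto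
 moreover have "(a, L ! i') \<in> A \<longleftrightarrow> i' mod 2 = r" "(rotate1 L ! i, a) \<in> A \<longleftrightarrow> i mod 2 = r"
  using alt[rule_format, of i'] alt[rule_format, of i] i i'(1) L(2) r' by auto
 moreover have "i' mod 2 = r \<longleftrightarrow> i mod 2 \<noteq> r"
 proof -
  have "u = r \<longleftrightarrow> v \<noteq> r" if "u < 2" "v < 2" "u \<noteq> v" for u v :: nat using that r by linarith
  then show ?thesis using par by simp
 qed
 ultimately show ?thesis using that by blast
qed

text \<open>
  That three edges meet at a vertex follows from the colours: the vertex lies on a black face, with two neighbours
  there; at the white face next to one of these two edges there is a further edge at the vertex, which does not lie on
  a black face on that side.
\<close>

lemma football_pattern_of:
 assumes km: "3 \<le> k" "2 \<le> m" and B: "B \<subseteq> set Ls"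
  and lenB: "\<And>L. L \<in> B ==> length L = k" and lenW: "\<And>L. L \<in> set Ls - B ==> length L = 2 * m"
  and bl: "\<And>a b. (a, b) \<in> \<Union>(arcs ` B) ==> (b, a) \<notin> \<Union>(arcs ` B)"
  and wh: "\<And>L. L \<in> set Ls - B ==> \<exists>r<2. \<forall>i<2 * m. (rotate1 L ! i, L ! i) \<in> \<Union>(arcs ` B) \<longleftrightarrow> i mod 2 = r"
 shows "football_pattern k (2 * m) 2 (pattern_of B)"
proof -
 let ?A = "\<Union>(arcs ` B)"
 have A: "?A \<subseteq> all_arcs Ls" using B by (auto simp: all_arcs_def)
 have dis: "M \<notin> B" if "M \<in> set Ls" "(a, b) \<in> arcs M" "(a, b) \<notin> ?A" for M a b using that by blast
 have alt: "\<exists>w z. (w, a) \<in> arcs L \<and> (a, z) \<in> arcs L \<and> ((a, w) \<in> ?A \<longleftrightarrow> (z, a) \<notin> ?A)" if LB: "L \<in> set Ls - B" and aL: "a \<in> set L" for L a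
 proof -
  obtain r :: nat where r: "r < 2" "\<forall>i<2 * m. (rotate1 L ! i, L ! i) \<in> ?A \<longleftrightarrow> i mod 2 = r" using wh[OF LB] by blast
  have L: "L \<in> set Ls" using LB by blast
  show ?thesis by (rule alternating_vertex[OF L lenW[OF LB] aL r(2,1)]) blast
 qed
 have black_vertex: "\<exists>L\<in>B. a \<in> set L" if a: "a \<in> all_verts Ls" for a
 proof -
  obtain L where L: "L \<in> set Ls" "a \<in> set L" using a by (auto simp: all_verts_def)
  show ?thesis
  proof (cases "L \<in> B")
   case False
   then obtain w z where "(w, a) \<in> arcs L" "(a, z) \<in> arcs L" "(a, w) \<in> ?A \<longleftrightarrow> (z, a) \<notin> ?A" using alt[of L a] L by blast
   then have "(a, w) \<in> ?A \<or> (z, a) \<in> ?A" by blast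
   then show ?thesis using arcs_verts by blast
  qed (use L in blast)
 qed
 have deg: "3 \<le> degree_at (pattern_of B) v" if v: "v \<in> vertex_set" for v
 proof -
  obtain a where a: "a \<in> all_verts Ls" "v = p a" using v unfolding vertex_set_def by blast
  obtain L where L: "L \<in> B" "a \<in> set L" using black_vertex[OF a(1)] by blast
  have LLs: "L \<in> set Ls" using L B by blast
  obtain i where i: "i < length L" "L ! i = a" using L(2) by (auto simp: in_set_conv_nth)
  obtain i' where i': "i' < length L" "rotate1 L ! i' = a"
   using L(2) by (metis in_set_conv_nth length_rotate1 set_rotate1)
  define b where "b = rotate1 L ! i"
  define z where "z = L ! i'"
  have b: "(a, b) \<in> arcs L" and z: "(z, a) \<in> arcs L"
   using arc_nth(1)[OF LLs i(1)] arc_nth(1)[OF LLs i'(1)] i i' by (auto simp: b_def z_def)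
  have zA: "(z, a) \<in> ?A" "(a, b) \<in> ?A" using z b L(1) by blast+
  have "(a, z) \<in> all_arcs Ls" using arcD(1) A zA(1) by blast
  then obtain M where M: "M \<in> set Ls" "(a, z) \<in> arcs M" using arc_face by blast
  have MW: "M \<in> set Ls - B" using dis[OF M] bl[OF zA(1)] M(1) by blast
  have aM: "a \<in> set M" using arcs_verts[OF M(2)] by blast
  from alt[OF MW aM] obtain w z' where w: "(w, a) \<in> arcs M" "(a, z') \<in> arcs M" "(a, w) \<in> ?A \<longleftrightarrow> (z', a) \<notin> ?A" by (elim exE conjE)
  have "z' = z"
  proof -
   obtain s where s: "s < length M" "a = M ! s" "z' = rotate1 M ! s" using w(2) arcs_nth by blast
   obtain t where t: "t < length M" "a = M ! t" "z = rotate1 M ! t" using M(2) arcs_nth by blast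
   have "s = t" using nth_eq_iff_index_eq[OF faceD(1)[OF M(1)] s(1) t(1)] s t by simp
   then show ?thesis using s t by simp
  qed
  then have wA: "(a, w) \<notin> ?A" using w(3) zA(1) by blast
  have ne: "b \<noteq> w" "b \<noteq> z" "z \<noteq> w" using wA zA(2) no_both(1)[OF LLs b] z no_both(1)[OF M] w(1) by auto
  have "(w, a) \<in> all_arcs Ls" using w(1) M(1) by (auto simp: all_arcs_def)
  then have "(a, w) \<in> all_arcs Ls" by (rule arcD(1))
  then show ?thesis unfolding a(2)
   using degree_pattern_of[OF _ \<open>(a, z) \<in> all_arcs Ls\<close> _ ne(2,1,3)] zA(2) A by blast
 qed
 have other: "\<exists>M\<in>set Ls. (b, a) \<in> arcs M" if "(a, b) \<in> all_arcs Ls" for a b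
  using arcD(1)[OF that] arc_face by metis
 have bw: "\<exists>G\<in>face ` (set Ls - B). across (pattern_of B) F e G" if F: "F \<in> face ` B" and e: "e \<in> edge_set" "e \<subseteq> closure F" for F e
 proof -
  obtain L where L: "L \<in> B" "F = face L" using F by blast
  have LLs: "L \<in> set Ls" using L B by blast
  obtain a0 b0 where ab0: "(a0, b0) \<in> all_arcs Ls" "e = edge a0 b0" using e(1) unfolding edge_set_def by auto
  then have "(a0, b0) \<in> arcs L \<or> (b0, a0) \<in> arcs L" using edge_closure_face[OF LLs ab0(1)] e(2) L(2) by simp
  then obtain a b where ab: "(a, b) \<in> arcs L" "e = edge a b" using ab0 edge_sym by metis
  have abA: "(a, b) \<in> ?A" using ab(1) L(1) by blast
  then obtain M where M: "M \<in> set Ls" "(b, a) \<in> arcs M" using other A by blast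
  have "M \<in> set Ls - B" using dis[OF M] bl[OF abA] M(1) by blast
  then show ?thesis using across_pattern_of[OF LLs M(1) ab(1) M(2)] L(2) ab(2) by blast
 qed
 have ww: "\<exists>es. boundary_walk (pattern_of B) F es \<and> length es = 2 * m \<and>
    (\<exists>r<2. \<forall>i<2 * m. \<exists>G. across (pattern_of B) F (es ! i) G \<and> (if i mod 2 = r then G \<in> face ` B else G \<in> face ` (set Ls - B)))"
  if "F \<in> face ` (set Ls - B)" for F
 proof -
  obtain L where L: "L \<in> set Ls - B" "F = face L" using \<open>F \<in> face ` (set Ls - B)\<close> by blast
  then have LLs: "L \<in> set Ls" by blast
  note len = lenW[OF L(1)]
  obtain r :: nat where r: "r < 2" "\<forall>i<2 * m. (rotate1 L ! i, L ! i) \<in> ?A \<longleftrightarrow> i mod 2 = r" using wh[OF L(1)] by blast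
  let ?es = "map (\<lambda>i. edge (L ! i) (rotate1 L ! i)) [0..<length L]"
  have "\<exists>G. across (pattern_of B) F (?es ! i) G \<and> (if i mod 2 = r then G \<in> face ` B else G \<in> face ` (set Ls - B))" if i: "i < 2 * m" for i
  proof -
   have il: "i < length L" using i len by simp
   note arc = arc_nth[OF LLs il]
   obtain M where M: "M \<in> set Ls" "(rotate1 L ! i, L ! i) \<in> arcs M" using other[OF arc(2)] by blast
   have "across (pattern_of B) F (?es ! i) (face M)" using across_pattern_of[OF LLs M(1) arc(1) M(2)] L(2) il by simp
   moreover have "M \<in> B \<longleftrightarrow> i mod 2 = r"
   proof -
    have "M \<in> B \<longleftrightarrow> (rotate1 L ! i, L ! i) \<in> ?A"
    proof
     assume "(rotate1 L ! i, L ! i) \<in> ?A"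
     then obtain N where N: "N \<in> B" "(rotate1 L ! i, L ! i) \<in> arcs N" by blast
     then have "N = M" using distD(2)[of N M] M B by blast
     then show "M \<in> B" using N by simp
    qed (use M(2) in blast)
    then show ?thesis using r(2) i by blast
   qed
   ultimately show ?thesis using M(1) by auto
  qed
  note sides = this
  show ?thesis
  proof (intro exI[of _ ?es] conjI)
   show "boundary_walk (pattern_of B) F ?es" unfolding L(2) by (rule walk_pattern_of[OF LLs])
   show "length ?es = 2 * m" using len by simp
   show "\<exists>r<2. \<forall>i<2 * m. \<exists>G. across (pattern_of B) F (?es ! i) G \<and> (if i mod 2 = r then G \<in> face ` B else G \<in> face ` (set Ls - B))"
    by (rule exI[of _ r]) (intro conjI allI impI r(1) sides)
  qed
 qed
 show ?thesis unfolding football_pattern_def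
 proof (intro conjI)
  show "black (pattern_of B) \<union> white (pattern_of B) = faces (pattern_of B)" unfolding faces_pattern_of unfolding pattern_of_def using B by auto
  show "black (pattern_of B) \<inter> white (pattern_of B) = {}" unfolding pattern_of_def using face_inj B by (auto simp: inj_on_def)
  show "\<forall>F\<in>black (pattern_of B). is_gon (pattern_of B) k F"
  proof
   fix F assume "F \<in> black (pattern_of B)"
   then obtain L where L: "L \<in> B" "F = face L" unfolding pattern_of_def by auto
   have "boundary_walk (pattern_of B) (face L) (map (\<lambda>i. edge (L ! i) (rotate1 L ! i)) [0..<length L])"
    by (rule walk_pattern_of) (use L B in blast)
   then show "is_gon (pattern_of B) k F" unfolding is_gon_def L(2) using lenB[OF L(1)] by (metis diff_zero length_map length_upt)
  qed
  show "\<forall>F\<in>black (pattern_of B). \<forall>e\<in>edges (pattern_of B). e \<subseteq> closure F \<longrightarrow> (\<exists>G\<in>white (pattern_of B). across (pattern_of B) F e G)"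
   using bw by (simp add: pattern_of_def[of B] del: bex_simps ball_simps) 
  show "\<forall>F\<in>white (pattern_of B). \<exists>es. boundary_walk (pattern_of B) F es \<and> length es = 2 * m \<and>
    (\<exists>r<2. \<forall>i<2 * m. \<exists>G. across (pattern_of B) F (es ! i) G \<and> (if i mod 2 = r then G \<in> black (pattern_of B) else G \<in> white (pattern_of B)))"
  proof
   fix F assume F: "F \<in> white (pattern_of B)"
   have sel: "black (pattern_of B) = face ` B" "white (pattern_of B) = face ` (set Ls - B)" by (simp_all add: pattern_of_def)
   show "\<exists>es. boundary_walk (pattern_of B) F es \<and> length es = 2 * m \<and>
    (\<exists>r<2. \<forall>i<2 * m. \<exists>G. across (pattern_of B) F (es ! i) G \<and> (if i mod 2 = r then G \<in> black (pattern_of B) else G \<in> white (pattern_of B)))"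
    using F unfolding sel by (rule ww)
  qed
  show "\<forall>v\<in>verts (pattern_of B). 3 \<le> degree_at (pattern_of B) v" using deg by (simp add: pattern_of_def[of B])
  show "map_on_S2 (pattern_of B)" by (rule map_pattern_of)
 qed (use km in auto)
qed

end

theorem drawable_optimal:
 assumes dr: "drawable Ls" and km: "3 \<le> k" "2 \<le> m" and B: "B \<subseteq> set Ls"
  and lenB: "\<And>L. L \<in> B ==> length L = k" and lenW: "\<And>L. L \<in> set Ls - B ==> length L = 2 * m"
  and bl: "\<And>a b. (a, b) \<in> \<Union>(arcs ` B) ==> (b, a) \<notin> \<Union>(arcs ` B)"
  and wh: "\<And>L. L \<in> set Ls - B ==> \<exists>r<2. \<forall>i<2 * m. (rotate1 L ! i, L ! i) \<in> \<Union>(arcs ` B) \<longleftrightarrow> i mod 2 = r"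
  and count: "k * card B + 4 = 2 * length Ls"
 shows "\<exists>P. optimal k m P"
proof -
 obtain loc p c H where "drawing loc p c H Ls" using dr unfolding drawable_def by blast
 then interpret drawn loc p c H Ls by unfold_locales
 have "card (face ` B) = card B" using card_image inj_on_subset[OF face_inj B] by blast
 moreover have "card (face ` set Ls) = length Ls" using card_image[OF face_inj] distinct_card[OF distD(1)] by simp
 ultimately have "k * card (black (pattern_of B)) + 4 = 2 * card (faces (pattern_of B))"
  unfolding faces_pattern_of using count by (simp add: pattern_of_def)
 moreover have "football_pattern k (2 * m) 2 (pattern_of B)" by (rule football_pattern_of[OF km B lenB lenW bl wh])
 ultimately show ?thesis unfolding optimal_def by blast
qed

section \<open>Sequences of cuts\<close>

lemma zip_rotate1: "length A = length B ==> zip (rotate1 A) (rotate1 B) = rotate1 (zip A B)"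
 by (cases A; cases B) auto

lemma arcs_rotate1: "arcs (rotate1 L) = arcs L"
 unfolding arcs_def by (subst zip_rotate1) simp_all

text \<open>
  Turning the disc of the face by one side changes only its name.
\<close>

lemma drawable_rotate1: assumes "drawable (R # Ls)" shows "drawable (rotate1 R # Ls)"
proof (cases "rotate1 R = R")
 case True then show ?thesis using assms by simp
next
 case False
 obtain loc p c H where "drawing loc p c H (R # Ls)" using assms unfolding drawable_def by blast
 then interpret drawn loc p c H "R # Ls" by unfold_locales
 define R' where "R' = rotate1 R"
 have ne: "R' \<noteq> R" using False by (simp add: R'_def)
 have Rin: "R \<in> set (R # Ls)" by simp
 have n3: "3 \<le> length R" by (rule faceD(2)[OF Rin])
 have R0: "R \<notin> set Ls" using distD(1) by simp
 have arcs': "arcs R' = arcs R" unfolding R'_def by (rule arcs_rotate1)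
 have "arcs R \<noteq> {}" using n3 by (cases R) (auto simp: arcs_def)
 then have new: "R' \<notin> set Ls" using distD(2)[of R R'] ne arcs' by auto
 have aa: "all_arcs (R' # Ls) = all_arcs (R # Ls)" by (simp add: all_arcs_def arcs')
 have av: "all_verts (R' # Ls) = all_verts (R # Ls)" by (simp add: all_verts_def R'_def)
 define loc' where "loc' q = (if loc q = Face R then Face R' else loc q)" for q
 define H' where "H' = H(R' := \<lambda>z. H R (pt (length R) 1 * z))"
 have HR': "H' R' = (\<lambda>z. H R (pt (length R) 1 * z))" by (simp add: H'_def)
 have HL: "H' L = H L" if "L \<in> set Ls" for L using that new by (auto simp: H'_def)
 have noR': "loc q \<noteq> Face R'" if "q \<in> S2" for q using locD[OF that] new ne by auto
 have l1: "{q \<in> S2. loc' q = Face R'} = {q \<in> S2. loc q = Face R}" using noR' by (auto simp: loc'_def)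
 have l2: "{q \<in> S2. loc' q = Face L} = {q \<in> S2. loc q = Face L}" if "L \<in> set Ls" for L
 proof -
  have "L \<noteq> R" "L \<noteq> R'" using that R0 new by auto
  then show ?thesis by (auto simp: loc'_def)
 qed
 have l3: "{q \<in> S2. loc' q = Vertex a} = {q \<in> S2. loc q = Vertex a}" for a by (auto simp: loc'_def)
 have l4: "{q \<in> S2. loc' q = Edge e} = {q \<in> S2. loc q = Edge e}" for e by (auto simp: loc'_def)
 have l5: "{q \<in> S2. loc' q \<notin> range Face} = {q \<in> S2. loc q \<notin> range Face}" by (auto simp: loc'_def)
 let ?\<rho> = "\<lambda>z. pt (length R) 1 * z"
 have \<rho>b: "?\<rho> ` ball 0 1 = ball 0 1"
 proof (intro set_eqI iffI)
  fix z :: complex assume "z \<in> ball 0 1"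
  then show "z \<in> ?\<rho> ` ball 0 1" by (intro image_eqI[of _ _ "z / pt (length R) 1"]) (simp_all add: norm_divide)
 qed (auto simp: norm_mult)
 have \<rho>c: "?\<rho> ` cball 0 1 \<subseteq> cball 0 1" by (auto simp: norm_mult)
 have walk: "H R (?\<rho> (pt (length R') (real i + t))) = c (R' ! i) (rotate1 R' ! i) t" if i: "i < length R'" and t: "0 \<le> t" "t \<le> 1" for i t
 proof -
  let ?n = "length R"
  let ?j = "Suc i mod ?n"
  have n0: "0 < ?n" using n3 by linarith
  have len: "length R' = ?n" by (simp add: R'_def)
  have j: "?j < ?n" using n0 by (rule mod_less_divisor)
  have i': "i < ?n" using i len by simp
  have e: "R' ! i = R ! ?j" unfolding R'_def by (rule nth_rotate1[OF i'])
  have e': "rotate1 R' ! i = rotate1 R ! ?j" using nth_rotate1[OF i] len by (simp add: R'_def)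
  have "?\<rho> (pt (length R') (real i + t)) = pt ?n (real (Suc i) + t)" unfolding len by (simp add: pt_mult add.assoc)
  also have "\<dots> = pt ?n (real ?j + t)" by (rule pt_mod[OF n0, symmetric])
  finally show ?thesis unfolding e e' using faceD(7)[OF Rin j t] by simp
 qed
 have "drawing loc' p c H' (R' # Ls)"
  unfolding drawing_def aa av
 proof (intro conjI ballI)
  fix L assume "L \<in> set (R' # Ls)"
  then consider "L = R'" | "L \<in> set Ls" by auto
  then have "distinct L \<and> 3 \<le> length L \<and> continuous_on (cball 0 1) (H' L) \<and> inj_on (H' L) (ball 0 1) \<and> H' L ` cball 0 1 \<subseteq> S2 \<and>
   H' L ` ball 0 1 = {q \<in> S2. loc' q = Face L} \<and> (\<forall>i<length L. \<forall>t\<in>{0..1}. H' L (pt (length L) (real i + t)) = c (L ! i) (rotate1 L ! i) t)"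
  proof cases
   case 1
   have "inj_on (H R \<circ> ?\<rho>) (ball 0 1)"
    by (rule comp_inj_on) (use faceD(4)[OF Rin] in \<open>simp_all add: \<rho>b inj_on_def\<close>)
   moreover have "continuous_on (cball 0 1) (H R \<circ> ?\<rho>)"
    by (intro continuous_on_compose continuous_intros continuous_on_subset[OF faceD(3)[OF Rin]] \<rho>c)
   moreover have "(H R \<circ> ?\<rho>) ` cball 0 1 \<subseteq> S2" unfolding image_comp[symmetric]
    by (rule order_trans[OF image_mono[OF \<rho>c] faceD(5)[OF Rin]])
   moreover have "(H R \<circ> ?\<rho>) ` ball 0 1 = {q \<in> S2. loc q = Face R}" unfolding image_comp[symmetric] \<rho>b by (rule faceD(6)[OF Rin])
   moreover have "H' R' = H R \<circ> ?\<rho>" unfolding HR' by (simp add: comp_def)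
   moreover have "distinct R'" "3 \<le> length R'" using faceD(1)[OF Rin] n3 by (simp_all add: R'_def)
   ultimately show ?thesis unfolding 1 l1 using walk HR' by simp
  next
   case 2
   have "L \<in> set (R # Ls)" using 2 by simp
   from faceD[OF this] show ?thesis unfolding HL[OF 2] l2[OF 2] by auto
  qed
  then show "distinct L" "3 \<le> length L" "continuous_on (cball 0 1) (H' L)" "inj_on (H' L) (ball 0 1)" "H' L ` cball 0 1 \<subseteq> S2"
   "H' L ` ball 0 1 = {q \<in> S2. loc' q = Face L}" "\<forall>i<length L. \<forall>t\<in>{0..1}. H' L (pt (length L) (real i + t)) = c (L ! i) (rotate1 L ! i) t"
   by - (elim conjE, assumption)+
 next
  show "\<forall>a b. (a, b) \<in> all_arcs (R # Ls) \<longrightarrow> (b, a) \<in> all_arcs (R # Ls) \<and> continuous_on {0..1} (c a b) \<and> inj_on (c a b) {0<..<1} \<and>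
    c a b ` {0<..<1} = {q \<in> S2. loc' q = Edge {a, b}} \<and> c a b 0 = p a \<and> (\<forall>t. c b a t = c a b (1 - t))"
   unfolding l4 using arcD by blast
  show "{q \<in> S2. loc' q = Vertex a} = {p a}" if "a \<in> all_verts (R # Ls)" for a unfolding l3 by (rule vertD[OF that])
  show "connected {q \<in> S2. loc' q \<notin> range Face}" unfolding l5 by (rule connD)
  show "distinct (R' # Ls)" using distD(1) new by simp
  show "L \<noteq> M \<longrightarrow> arcs L \<inter> arcs M = {}" if LM: "L \<in> set (R' # Ls)" "M \<in> set (R' # Ls)" for L M
  proof
   assume "L \<noteq> M"
   then consider "L = R'" "M \<in> set Ls" | "M = R'" "L \<in> set Ls" | "L \<in> set Ls" "M \<in> set Ls" using LM by auto
   then show "arcs L \<inter> arcs M = {}"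
    by cases (use distD(2)[of R M] distD(2)[of L R] distD(2)[of L M] \<open>L \<noteq> M\<close> R0 arcs' in auto)
  qed
  show "loc' q \<in> Vertex ` all_verts (R # Ls) \<union> (\<lambda>(a, b). Edge {a, b}) ` all_arcs (R # Ls) \<union> Face ` set (R' # Ls)" if q: "q \<in> S2" for q
  proof (cases "loc q = Face R")
   case False
   then show ?thesis using locD[OF q] unfolding loc'_def by auto
  qed (simp add: loc'_def)
 qed
 then show ?thesis unfolding drawable_def R'_def by blast
qed

lemma drawable_rotate: "drawable (R # Ls) ==> drawable (rotate r R # Ls)"
 by (induction r) (auto simp: rotate_Suc dest: drawable_rotate1)

text \<open>
  The half spheres \<open>s = 1\<close> and \<open>s = -1\<close> as graphs over the unit disc; \<open>shadow\<close>
  is the vertical projection.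
\<close>

definition hemisphere :: "real => complex => real^3"
 where "hemisphere s z = Re z *\<^sub>R axis 1 1 + Im z *\<^sub>R axis 2 1 + (s * sqrt (1 - (norm z)\<^sup>2)) *\<^sub>R axis 3 1"
definition shadow :: "real^3 => complex" where "shadow q = Complex (q $ 1) (q $ 2)"

lemma hemisphere_nth: "hemisphere s z $ 1 = Re z" "hemisphere s z $ 2 = Im z" "hemisphere s z $ 3 = s * sqrt (1 - (norm z)\<^sup>2)"
 by (simp_all add: hemisphere_def axis_def)

lemma shadow_hemisphere: "shadow (hemisphere s z) = z"
 by (simp add: shadow_def hemisphere_nth)

lemma S2_coordinates: "q \<in> S2 \<longleftrightarrow> (q $ 1)\<^sup>2 + (q $ 2)\<^sup>2 + (q $ 3)\<^sup>2 = 1"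
 by (simp add: norm_vec_def L2_set_def sum_3)

lemma hemisphere_S2: assumes "s = 1 \<or> s = -1" "norm z \<le> 1" shows "hemisphere s z \<in> S2"
proof -
 have "(norm z)\<^sup>2 \<le> 1" using assms(2) by (simp add: power_le_one)
 then have "(s * sqrt (1 - (norm z)\<^sup>2))\<^sup>2 = 1 - (norm z)\<^sup>2" using assms(1) by (auto simp: power_mult_distrib)
 then show ?thesis unfolding S2_coordinates hemisphere_nth by (simp add: cmod_power2)
qed

lemma hemisphere_shadow: assumes "q \<in> S2" "s = 1 \<or> s = -1" "0 \<le> s * q $ 3" shows "hemisphere s (shadow q) = q" "norm (shadow q) \<le> 1" "q $ 3 \<noteq> 0 \<longrightarrow> norm (shadow q) < 1"
proof -
 have n: "(norm (shadow q))\<^sup>2 = 1 - (q $ 3)\<^sup>2" using assms(1) unfolding S2_coordinates shadow_def by (simp add: cmod_power2)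
 have "s * sqrt ((q $ 3)\<^sup>2) = q $ 3" using assms(2,3) by auto
 then show "hemisphere s (shadow q) = q" using n by (simp add: vec_eq_iff forall_3 hemisphere_nth shadow_def)
 have "(norm (shadow q))\<^sup>2 \<le> 1\<^sup>2" using n by simp
 then show "norm (shadow q) \<le> 1" by (rule power2_le_imp_le) simp
 show "q $ 3 \<noteq> 0 \<longrightarrow> norm (shadow q) < 1"
 proof
  assume "q $ 3 \<noteq> 0"
  then have "(norm (shadow q))\<^sup>2 < 1\<^sup>2" using n by simp
  then show "norm (shadow q) < 1" by (rule power2_less_imp_less) simp
 qed
qed

lemma hemisphere_sign: assumes "s = 1 \<or> s = -1" "norm z < 1" shows "0 < s * hemisphere s z $ 3"
proof -
 have "(norm z)\<^sup>2 < 1" using assms(2) by (simp add: power_less_one_iff abs_square_less_1)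
 then show ?thesis using assms(1) by (auto simp: hemisphere_nth)
qed

lemma hemisphere_cont: "continuous_on S (hemisphere s)"
 unfolding hemisphere_def by (intro continuous_intros)

lemma hemisphere_equator: "norm z = 1 ==> hemisphere s z = hemisphere 1 z \<and> hemisphere s z $ 3 = 0"
 by (simp add: hemisphere_def axis_def)

text \<open>
  The equator carries a \<open>k\<close>-gon, and the hemispheres are its two faces, the lower one seen from below.
\<close>

lemma drawable_initial: assumes k: "3 \<le> k" shows "drawable [0 # rev [1..<k], [0..<k]]"
proof -
 define T B :: "nat list" where "T = [0..<k]" and "B = 0 # rev [1..<k]"
 have k0: "0 < k" using k by linarith
 define sc where "sc i = Suc i mod k" for i
 have sc: "i < k ==> sc i < k" for i unfolding sc_def using k0 by simp
 have sc2: "sc (sc i) \<noteq> i" "sc i \<noteq> i" if "i < k" for i using that k by (auto simp: sc_def mod_Suc split: if_splits)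
 have len: "length T = k" "length B = k" using k0 by (simp_all add: T_def B_def)
 have T_nth: "T ! i = i" "rotate1 T ! i = sc i" if "i < k" for i
  using that k0 nth_rotate1[of i T] by (simp_all add: T_def sc_def)
 define rf where "rf i = k - 1 - i" for i
 have rf: "i < k ==> rf i < k \<and> rf (rf i) = i" for i by (auto simp: rf_def)
 have B_nth: "B ! i = sc (rf i)" if "i < k" for i
 proof (cases i)
  case 0 then show ?thesis using k0 by (simp add: B_def sc_def rf_def)
 next
  case (Suc i')
  then have "B ! i = k - i" using that by (simp add: B_def rev_nth)
  moreover have "Suc (rf i) = k - i" "k - i < k" using that Suc by (simp_all add: rf_def)
  ultimately show ?thesis by (simp add: sc_def)
 qed
 have B_nth': "rotate1 B ! i = rf i" if "i < k" for i
 proof (cases "Suc i < k")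
  case True
  then have "rotate1 B ! i = B ! Suc i" using nth_rotate1[of i B] that by (simp add: len)
  moreover have "Suc (rf (Suc i)) = rf i" "rf i < k" using True by (auto simp: rf_def)
  ultimately show ?thesis using B_nth[OF True] by (simp add: sc_def)
 next
  case False
  then have "Suc i = k" using that by simp
  then have "rotate1 B ! i = B ! 0" using nth_rotate1[of i B] that by (simp add: len)
  then show ?thesis using \<open>Suc i = k\<close> by (auto simp: B_def rf_def)
 qed
 have arcs_T: "(a, b) \<in> arcs T \<longleftrightarrow> a < k \<and> b = sc a" for a b unfolding arcs_nth len using T_nth by auto
 have arcs_B: "(a, b) \<in> arcs B \<longleftrightarrow> b < k \<and> a = sc b" for a b
 proof
  assume "(a, b) \<in> arcs B"
  then show "b < k \<and> a = sc b" unfolding arcs_nth len using B_nth B_nth' rf by auto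
 next
  assume ab: "b < k \<and> a = sc b"
  then show "(a, b) \<in> arcs B" unfolding arcs_nth len using B_nth[of "rf b"] B_nth'[of "rf b"] rf[of b] by (intro exI[of _ "rf b"]) simp
 qed
 have aa: "(a, b) \<in> all_arcs [B, T] \<longleftrightarrow> (a < k \<and> b = sc a) \<or> (b < k \<and> a = sc b)" for a b
  unfolding all_arcs_def using arcs_T arcs_B by auto
 have av: "all_verts [B, T] = {..<k}" using k0 by (auto simp: all_verts_def B_def T_def)
 have TB: "T \<noteq> B" using T_nth(1)[of 1] B_nth[of 1] k by (auto simp: sc_def rf_def)
 define eq where "eq s = hemisphere 1 (pt k s)" for s
 define lb where "lb z = (if \<exists>i<k. z = pt k (real i) then Vertex (THE i. i < k \<and> z = pt k (real i))
   else Edge (let i = THE i. i < k \<and> (\<exists>t. 0 < t \<and> t < 1 \<and> z = pt k (real i + t)) in {i, sc i}))" for z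
 have lb_v: "lb (pt k (real i)) = Vertex i" if "i < k" for i
 proof -
  have "(THE j. j < k \<and> pt k (real i) = pt k (real j)) = i"
  proof (rule the_equality)
   fix j assume j: "j < k \<and> pt k (real i) = pt k (real j)"
   then have "pt k (real i + 0) = pt k (real j + 0)" by simp
   then show "j = i" using pt_inj[of i k j 0 0] j that by simp
  qed (use that in simp)
  then show ?thesis unfolding lb_def using that by auto
 qed
 have lb_e: "lb (pt k (real i + t)) = Edge {i, sc i}" if it: "i < k" "0 < t" "t < 1" for i t
 proof -
  have "(THE j. j < k \<and> (\<exists>u. 0 < u \<and> u < 1 \<and> pt k (real i + t) = pt k (real j + u))) = i"
  proof (rule the_equality)
   fix j assume "j < k \<and> (\<exists>u. 0 < u \<and> u < 1 \<and> pt k (real i + t) = pt k (real j + u))"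
   then obtain u where "j < k" "0 < u" "u < 1" "pt k (real i + t) = pt k (real j + u)" by blast
   then show "j = i" using pt_inj[of i k j t u] it by simp
  qed (use it in blast)
  moreover have "\<not> (\<exists>j<k. pt k (real i + t) = pt k (real j))" using pt_inj[of i k _ t 0] it by auto
  ultimately show ?thesis unfolding lb_def by (simp add: Let_def)
 qed
 define loc where "loc q = (if 0 < q $ 3 then Face T else if q $ 3 < 0 then Face B else lb (shadow q))" for q :: "real^3"
 define p where "p i = eq (real i)" for i
 define c where "c a b t = (if b = sc a then eq (real a + t) else eq (real b + 1 - t))" for a b and t :: real
 define H where "H L = (if L = T then hemisphere 1 else (\<lambda>z. hemisphere (-1) (cnj z)))" for L
 have eq3: "eq s $ 3 = 0" and eqS: "eq s \<in> S2" and sh: "shadow (eq s) = pt k s" for s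
  using hemisphere_equator[of "pt k s" 1] hemisphere_S2[of 1 "pt k s"] by (simp_all add: eq_def shadow_hemisphere)
 have loc_eq: "loc (eq s) = lb (pt k s)" for s by (simp add: loc_def eq3 sh)
 have onS: "\<exists>i t. i < k \<and> 0 \<le> t \<and> t < 1 \<and> q = eq (real i + t)" if q: "q \<in> S2" "q $ 3 = 0" for q
 proof -
  have h: "hemisphere 1 (shadow q) = q" using hemisphere_shadow(1)[of q 1] q by simp
  have "(norm (shadow q))\<^sup>2 = 1" using q unfolding S2_coordinates shadow_def by (simp add: cmod_power2)
  then have "norm (shadow q) = 1" using power2_eq_imp_eq[of "norm (shadow q)" 1] by simp
  then obtain i t where "i < k" "0 \<le> t" "t < 1" "shadow q = pt k (real i + t)" using sphere_pt_cases[OF k0] by blast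
  then show ?thesis using h by (auto simp: eq_def)
 qed
 have lb_cases: "lb (pt k (real i + t)) = (if t = 0 then Vertex i else Edge {i, sc i})" if "i < k" "0 \<le> t" "t < 1" for i t
  using lb_v[of i] lb_e[of i t] that by auto
 have loc_face: "loc q \<in> range Face \<longleftrightarrow> q $ 3 \<noteq> 0" if q: "q \<in> S2" for q
 proof (cases "q $ 3 = 0")
  case True
  then obtain i t where "i < k" "0 \<le> t" "t < 1" "q = eq (real i + t)" using onS[OF q] by blast
  then show ?thesis using lb_cases[of i t] True by (auto simp: loc_eq)
 qed (auto simp: loc_def)
 have vert: "{q \<in> S2. loc q = Vertex a} = {p a}" if a: "a < k" for a
 proof
  show "{p a} \<subseteq> {q \<in> S2. loc q = Vertex a}" using eqS lb_v[OF a] by (simp add: p_def loc_eq)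
  show "{q \<in> S2. loc q = Vertex a} \<subseteq> {p a}"
  proof
   fix q assume "q \<in> {q \<in> S2. loc q = Vertex a}"
   then have q: "q \<in> S2" "loc q = Vertex a" by auto
   then have "q $ 3 = 0" using loc_face[OF q(1)] by auto
   then obtain i t where it: "i < k" "0 \<le> t" "t < 1" "q = eq (real i + t)" using onS[OF q(1)] by blast
   then have "i = a" "t = 0" using lb_cases[of i t] q(2) by (auto simp: loc_eq split: if_splits)
   then show "q \<in> {p a}" using it by (simp add: p_def)
  qed
 qed
 have edge: "(\<lambda>t. eq (real a + t)) ` {0<..<1} = {q \<in> S2. loc q = Edge {a, sc a}}" if a: "a < k" for a
 proof
  show "(\<lambda>t. eq (real a + t)) ` {0<..<1} \<subseteq> {q \<in> S2. loc q = Edge {a, sc a}}" using eqS lb_e[OF a] by (auto simp: loc_eq)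
  show "{q \<in> S2. loc q = Edge {a, sc a}} \<subseteq> (\<lambda>t. eq (real a + t)) ` {0<..<1}"
  proof
   fix q assume "q \<in> {q \<in> S2. loc q = Edge {a, sc a}}"
   then have q: "q \<in> S2" "loc q = Edge {a, sc a}" by auto
   then have "q $ 3 = 0" using loc_face[OF q(1)] by auto
   then obtain i t where it: "i < k" "0 \<le> t" "t < 1" "q = eq (real i + t)" using onS[OF q(1)] by blast
   then have e: "t \<noteq> 0" "{i, sc i} = {a, sc a}" using lb_cases[of i t] q(2) by (auto simp: loc_eq split: if_splits)
   have "i = a"
   proof (rule ccontr)
    assume "i \<noteq> a"
    then have "i = sc a" "sc i = a" using e(2) by (auto simp: doubleton_eq_iff)
    then show False using sc2(1)[OF a] by simp
   qed
   then show "q \<in> (\<lambda>t. eq (real a + t)) ` {0<..<1}" using it e(1) by (intro image_eqI[of _ _ t]) auto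
  qed
 qed
 have eq_cont: "continuous_on S eq" for S unfolding eq_def by (rule continuous_on_compose2[OF hemisphere_cont]) (auto intro!: continuous_intros)
 have eq_inj: "t = u" if "a < k" "0 < t" "t < 1" "0 < u" "u < 1" "eq (real a + t) = eq (real a + u)" for a t u
 proof -
  have "shadow (eq (real a + t)) = shadow (eq (real a + u))" by (rule arg_cong[OF that(6)])
  then have "pt k (real a + t) = pt k (real a + u)" unfolding sh .
  then show ?thesis using pt_inj[of a k a t u] that(1-5) by simp
 qed
 have eq_wrap: "eq (real (sc a)) = eq (real a + 1)" if "a < k" for a
  using pt_corner[OF k0 that] by (simp add: eq_def sc_def)
 have face_T: "hemisphere 1 ` ball 0 1 = {q \<in> S2. loc q = Face T}"
 proof (intro set_eqI iffI)
  fix q assume "q \<in> hemisphere 1 ` ball 0 1"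
  then obtain z where z: "norm z < 1" "q = hemisphere 1 z" by auto
  then show "q \<in> {q \<in> S2. loc q = Face T}" using hemisphere_sign[of 1 z] hemisphere_S2[of 1 z] by (simp add: loc_def)
 next
  fix q assume "q \<in> {q \<in> S2. loc q = Face T}"
  then have q: "q \<in> S2" "loc q = Face T" by auto
  have "q $ 3 \<noteq> 0" using loc_face[OF q(1)] q(2) by auto
  then have "0 < q $ 3" using q(2) TB by (auto simp: loc_def split: if_splits)
  then show "q \<in> hemisphere 1 ` ball 0 1" using hemisphere_shadow[OF q(1), of 1] by (intro image_eqI[of _ _ "shadow q"]) auto
 qed
 have face_B: "(\<lambda>z. hemisphere (-1) (cnj z)) ` ball 0 1 = {q \<in> S2. loc q = Face B}"
 proof (intro set_eqI iffI)
  fix q assume "q \<in> (\<lambda>z. hemisphere (-1) (cnj z)) ` ball 0 1"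
  then obtain z where z: "norm z < 1" "q = hemisphere (-1) (cnj z)" by auto
  then show "q \<in> {q \<in> S2. loc q = Face B}" using hemisphere_sign[of "-1" "cnj z"] hemisphere_S2[of "-1" "cnj z"] by (simp add: loc_def)
 next
  fix q assume "q \<in> {q \<in> S2. loc q = Face B}"
  then have q: "q \<in> S2" "loc q = Face B" by auto
  have "q $ 3 \<noteq> 0" using loc_face[OF q(1)] q(2) by auto
  then have "q $ 3 < 0" using q(2) TB by (auto simp: loc_def split: if_splits)
  then show "q \<in> (\<lambda>z. hemisphere (-1) (cnj z)) ` ball 0 1" using hemisphere_shadow[OF q(1), of "-1"] by (intro image_eqI[of _ _ "cnj (shadow q)"]) auto
 qed
 have inj_h: "inj (hemisphere s)" for s by (metis injI shadow_hemisphere)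
 have c_T: "c i (sc i) t = eq (real i + t)" and c_B: "c (sc i) i t = eq (real i + 1 - t)" if "i < k" for i t
  using sc2(1)[OF that] by (simp_all add: c_def)
 have "drawing loc p c H [B, T]"
  unfolding drawing_def av
 proof (intro conjI ballI)
  fix L assume "L \<in> set [B, T]"
  then consider "L = T" | "L = B" by auto
  then have "distinct L \<and> 3 \<le> length L \<and> continuous_on (cball 0 1) (H L) \<and> inj_on (H L) (ball 0 1) \<and> H L ` cball 0 1 \<subseteq> S2 \<and>
   H L ` ball 0 1 = {q \<in> S2. loc q = Face L} \<and> (\<forall>i<length L. \<forall>t\<in>{0..1}. H L (pt (length L) (real i + t)) = c (L ! i) (rotate1 L ! i) t)"
  proof cases
   case 1
   have "H L = hemisphere 1" by (simp add: H_def 1)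
   moreover have "distinct T" by (simp add: T_def)
   moreover have "hemisphere 1 (pt k (real i + t)) = c (T ! i) (rotate1 T ! i) t" if "i < k" for i t
    using c_T[OF that] T_nth[OF that] by (simp add: eq_def)
   moreover have "hemisphere 1 ` cball 0 1 \<subseteq> S2"
   proof (rule image_subsetI)
    fix z :: complex assume "z \<in> cball 0 1"
    then show "hemisphere 1 z \<in> S2" by (intro hemisphere_S2) simp_all
   qed
   ultimately show ?thesis unfolding 1 using len k hemisphere_cont inj_on_subset[OF inj_h subset_UNIV] face_T by metis
  next
   case 2
   have h: "H L = (\<lambda>z. hemisphere (-1) (cnj z))" using TB by (simp add: H_def 2)
   have "distinct B" by (auto simp: B_def)
   moreover have "hemisphere (-1) (cnj (pt k (real i + t))) = c (B ! i) (rotate1 B ! i) t" if i: "i < k" for i t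
   proof -
    have "real (rf i) = real k - 1 - real i" using i by (simp add: rf_def of_nat_diff)
    then have "real (rf i) + 1 - t = - (real i + t) + real k * of_int 1" by simp
    then have "pt k (real (rf i) + 1 - t) = pt k (- (real i + t))" unfolding pt_eq_iff[OF k0] by blast
    then show ?thesis using B_nth[OF i] B_nth'[OF i] c_B[of "rf i"] rf[OF i] hemisphere_equator[of "pt k (- (real i + t))" "-1"]
     by (simp add: cnj_pt eq_def)
   qed
   moreover have "(\<lambda>z. hemisphere (-1) (cnj z)) ` cball 0 1 \<subseteq> S2"
   proof (rule image_subsetI)
    fix z :: complex assume "z \<in> cball 0 1"
    then show "hemisphere (-1) (cnj z) \<in> S2" by (intro hemisphere_S2) simp_all
   qed
   moreover have "continuous_on (cball 0 1) (\<lambda>z. hemisphere (-1) (cnj z))"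
    by (rule continuous_on_compose2[OF hemisphere_cont]) (auto intro!: continuous_intros)
   moreover have "inj_on (\<lambda>z. hemisphere (-1) (cnj z)) (ball 0 1)" using injD[OF inj_h[of "-1"]] by (intro inj_onI) (metis complex_cnj_cancel_iff)
   ultimately show ?thesis unfolding h unfolding 2 using len k face_B by metis
  qed
  then show "distinct L" "3 \<le> length L" "continuous_on (cball 0 1) (H L)" "inj_on (H L) (ball 0 1)" "H L ` cball 0 1 \<subseteq> S2"
   "H L ` ball 0 1 = {q \<in> S2. loc q = Face L}" "\<forall>i<length L. \<forall>t\<in>{0..1}. H L (pt (length L) (real i + t)) = c (L ! i) (rotate1 L ! i) t"
   by - (elim conjE, assumption)+
 next
  show "\<forall>a b. (a, b) \<in> all_arcs [B, T] \<longrightarrow> (b, a) \<in> all_arcs [B, T] \<and> continuous_on {0..1} (c a b) \<and> inj_on (c a b) {0<..<1} \<and>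
    c a b ` {0<..<1} = {q \<in> S2. loc q = Edge {a, b}} \<and> c a b 0 = p a \<and> (\<forall>t. c b a t = c a b (1 - t))"
  proof (intro allI impI)
   fix a b assume ab: "(a, b) \<in> all_arcs [B, T]"
   have swap: "(b, a) \<in> all_arcs [B, T]" using ab unfolding aa by blast
   have fwd: "continuous_on {0..1} (\<lambda>t. eq (real i + t)) \<and> inj_on (\<lambda>t. eq (real i + t)) {0<..<1}"
    "continuous_on {0..1} (\<lambda>t. eq (real i + 1 - t)) \<and> inj_on (\<lambda>t. eq (real i + 1 - t)) {0<..<1}" if i: "i < k" for i
   proof -
    show "continuous_on {0..1} (\<lambda>t. eq (real i + t)) \<and> inj_on (\<lambda>t. eq (real i + t)) {0<..<1}"
     using eq_inj[OF i] by (intro conjI continuous_on_compose2[OF eq_cont] continuous_intros inj_onI) auto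
    have "inj_on (\<lambda>t. eq (real i + 1 - t)) {0<..<1}"
    proof (rule inj_onI)
     fix s t :: real assume st: "s \<in> {0<..<1}" "t \<in> {0<..<1}" "eq (real i + 1 - s) = eq (real i + 1 - t)"
     have "1 - s = 1 - t" using st by (intro eq_inj[OF i]) (simp_all add: add_diff_eq)
     then show "s = t" by simp
    qed
    then show "continuous_on {0..1} (\<lambda>t. eq (real i + 1 - t)) \<and> inj_on (\<lambda>t. eq (real i + 1 - t)) {0<..<1}"
     by (intro conjI continuous_on_compose2[OF eq_cont] continuous_intros) auto
   qed
   from ab consider "a < k" "b = sc a" | "b < k" "a = sc b" unfolding aa by blast
   then show "(b, a) \<in> all_arcs [B, T] \<and> continuous_on {0..1} (c a b) \<and> inj_on (c a b) {0<..<1} \<and>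
    c a b ` {0<..<1} = {q \<in> S2. loc q = Edge {a, b}} \<and> c a b 0 = p a \<and> (\<forall>t. c b a t = c a b (1 - t))"
   proof cases
    case 1
    have e: "c a b = (\<lambda>t. eq (real a + t))" unfolding 1(2) using c_T[OF 1(1)] by blast
    have s: "c b a t = c a b (1 - t)" for t unfolding e unfolding 1(2) using c_B[OF 1(1), of t] by (simp add: add_diff_eq)
    show ?thesis using swap fwd(1)[OF 1(1)] edge[OF 1(1)] s unfolding e by (simp add: p_def 1(2))
   next
    case 2
    have e: "c a b = (\<lambda>t. eq (real b + 1 - t))" unfolding 2(2) using c_B[OF 2(1)] by blast
    have s: "c b a t = c a b (1 - t)" for t unfolding e unfolding 2(2) using c_T[OF 2(1), of t] by simp
    have "c a b ` {0<..<1} = (\<lambda>t. eq (real b + t)) ` {0<..<1}"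
    proof (intro set_eqI iffI)
     fix q assume "q \<in> c a b ` {0<..<1}"
     then obtain t where "0 < t" "t < 1" "q = eq (real b + 1 - t)" unfolding e by auto
     then show "q \<in> (\<lambda>t. eq (real b + t)) ` {0<..<1}" by (intro image_eqI[of _ _ "1 - t"]) (simp_all add: add_diff_eq)
    next
     fix q assume "q \<in> (\<lambda>t. eq (real b + t)) ` {0<..<1}"
     then obtain t where "0 < t" "t < 1" "q = eq (real b + t)" by auto
     then show "q \<in> c a b ` {0<..<1}" unfolding e by (intro image_eqI[of _ _ "1 - t"]) simp_all
    qed
    then have im: "c a b ` {0<..<1} = {q \<in> S2. loc q = Edge {a, b}}" using edge[OF 2(1)] unfolding 2(2) by (simp add: insert_commute)
    have p0: "c a b 0 = p a" unfolding e unfolding p_def 2(2) using eq_wrap[OF 2(1)] by simp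
    have "continuous_on {0..1} (c a b) \<and> inj_on (c a b) {0<..<1}" unfolding e by (rule fwd(2)[OF 2(1)])
    then show ?thesis using swap im p0 s by blast
   qed
  qed
  show "{q \<in> S2. loc q = Vertex a} = {p a}" if "a \<in> {..<k}" for a using vert that by simp
  show "connected {q \<in> S2. loc q \<notin> range Face}"
  proof -
   have "{q \<in> S2. loc q \<notin> range Face} = hemisphere 1 ` sphere 0 1"
   proof (intro set_eqI iffI)
    fix q assume "q \<in> {q \<in> S2. loc q \<notin> range Face}"
    then obtain i t where "q = eq (real i + t)" using loc_face onS by blast
    then show "q \<in> hemisphere 1 ` sphere 0 1" unfolding eq_def by (intro image_eqI[of _ _ "pt k (real i + t)"]) simp_all
   next
    fix q assume "q \<in> hemisphere 1 ` sphere 0 1"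
    then obtain z where z: "norm z = 1" "q = hemisphere 1 z" by auto
    have "q \<in> S2" "q $ 3 = 0" using hemisphere_S2[of 1 z] hemisphere_equator[of z 1] z by simp_all
    then show "q \<in> {q \<in> S2. loc q \<notin> range Face}" using loc_face by simp
   qed
   moreover have "connected (sphere (0::complex) 1)" by (rule connected_sphere) simp
   ultimately show ?thesis using connected_continuous_image[OF hemisphere_cont] by metis
  qed
  show "distinct [B, T]" using TB by auto
  have "arcs T \<inter> arcs B = {}"
  proof -
   have False if "(a, b) \<in> arcs T" "(a, b) \<in> arcs B" for a b using that sc2(1)[of b] unfolding arcs_T arcs_B by auto
   then show ?thesis by auto
  qed
  then show "L \<noteq> M \<longrightarrow> arcs L \<inter> arcs M = {}" if "L \<in> set [B, T]" "M \<in> set [B, T]" for L M using that by auto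
  show "loc q \<in> Vertex ` {..<k} \<union> (\<lambda>(a, b). Edge {a, b}) ` all_arcs [B, T] \<union> Face ` set [B, T]" if q: "q \<in> S2" for q
  proof (cases "q $ 3 = 0")
   case True
   then obtain i t where it: "i < k" "0 \<le> t" "t < 1" "q = eq (real i + t)" using onS[OF q] by blast
   have "(i, sc i) \<in> all_arcs [B, T]" using aa it(1) by blast
   then have "Edge {i, sc i} \<in> (\<lambda>(a, b). Edge {a, b}) ` all_arcs [B, T]" by (intro image_eqI[of _ _ "(i, sc i)"]) simp_all
   then show ?thesis using lb_cases[OF it(1-3)] it unfolding it(4) loc_eq by auto
  qed (auto simp: loc_def)
 qed
 then show ?thesis unfolding drawable_def B_def T_def by blast
qed

text \<open>
  A step \<open>(r, t, d)\<close> turns the current face (the head of the list) by \<open>r\<close> places and cuts it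
  from its first vertex to vertex \<open>t\<close> by a path with \<open>d\<close> new inner vertices, numbered from
  \<open>n\<close> on. The part that contains the vertices between the first one and vertex \<open>t\<close> is
  finished, the other one is the new current face.
\<close>

fun shell :: "nat => (nat \<times> nat \<times> nat) list => nat list list => nat list list option" where
 "shell n [] Ls = Some Ls"
| "shell n ((r, t, d) # st) [] = None"
| "shell n ((r, t, d) # st) (R # Ls) =
  (case drop r R @ take r R of [] => None | x # R' =>
   (case drop (t - 1) R' of [] => None | y # bs =>
    if d = 0 \<longrightarrow> (t \<noteq> 1 \<and> bs \<noteq> [] \<and> list_all (\<lambda>L. (x, y) \<notin> set (zip L (rotate1 L))) (R # Ls))
    then shell (n + d) st ((y # bs @ x # [n..<n + d]) # (x # take (t - 1) R' @ y # rev [n..<n + d]) # Ls)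
    else None))"

lemma drawable_shell: "drawable Ls ==> all_verts Ls \<subseteq> {..<n} ==> shell n st Ls = Some Ls' ==> (\<forall>(r, t, d)\<in>set st. 1 \<le> t) ==> drawable Ls'"
proof (induction n st Ls rule: shell.induct)
 case (3 n r t d st R Ls)
 obtain x R' where xR: "drop r R @ take r R = x # R'" using 3(4) by (cases "drop r R @ take r R") auto
 obtain y bs where yb: "drop (t - 1) R' = y # bs" using 3(4) xR by (cases "drop (t - 1) R'") auto
 define as where "as = take (t - 1) R'"
 have R': "R' = as @ y # bs" using yb by (metis append_take_drop_id as_def)
 have ok: "d = 0 ==> t \<noteq> 1 \<and> bs \<noteq> [] \<and> (\<forall>L\<in>set (R # Ls). (x, y) \<notin> arcs L)"
  and sh: "shell (n + d) st ((y # bs @ x # [n..<n + d]) # (x # as @ y # rev [n..<n + d]) # Ls) = Some Ls'"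
  using 3(4) xR yb by (auto simp: as_def list_all_iff arcs_def split: if_splits)
 obtain j where j: "x # as @ y # bs = rotate j R"
 proof (cases "r < length R")
  case True
  then show ?thesis using that[of r] xR R' by (simp add: rotate_drop_take)
 next
  case False
  then show ?thesis using that[of 0] xR R' by simp
 qed
 have dr: "drawable ((x # as @ y # bs) # Ls)" unfolding j by (rule drawable_rotate[OF 3(2)])
 have "arcs (rotate i R) = arcs R" for i by (induction i) (simp_all add: rotate_Suc arcs_rotate1)
 then have aa: "all_arcs ((x # as @ y # bs) # Ls) = all_arcs (R # Ls)" unfolding j all_arcs_def by simp
 have vv: "all_verts ((x # as @ y # bs) # Ls) = all_verts (R # Ls)" unfolding j all_verts_def by simp
 have lt: "all_verts ((x # as @ y # bs) # Ls) \<subseteq> {..<n}" unfolding vv by (rule 3(3))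
 have "drawable ((y # bs @ x # [n..<n + d]) # (x # as @ y # rev [n..<n + d]) # Ls)"
 proof (rule drawable_step[OF dr])
  show "distinct [n..<n + d]" by simp
  show "set [n..<n + d] \<inter> all_verts ((x # as @ y # bs) # Ls) = {}" using lt by auto
  assume "[n..<n + d] = []"
  then have d0: "d = 0" by auto
  have t1: "1 \<le> t" using 3(5) by auto
  have "as \<noteq> []"
  proof
   assume "as = []"
   then have "t - 1 = 0 \<or> R' = []" by (simp add: as_def)
   then show False using ok[OF d0] t1 yb by auto
  qed
  moreover have "(x, y) \<notin> all_arcs (R # Ls)" using ok[OF d0] by (auto simp: all_arcs_def)
  ultimately show "as \<noteq> [] \<and> bs \<noteq> [] \<and> (x, y) \<notin> all_arcs ((x # as @ y # bs) # Ls)" unfolding aa using ok[OF d0] by blast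
 qed
 moreover have "all_verts ((y # bs @ x # [n..<n + d]) # (x # as @ y # rev [n..<n + d]) # Ls) \<subseteq> {..<n + d}"
  using lt by (auto simp: all_verts_def)
 moreover have "d = 0 \<longrightarrow> t \<noteq> 1 \<and> bs \<noteq> [] \<and> list_all (\<lambda>L. (x, y) \<notin> set (zip L (rotate1 L))) (R # Ls)"
  using ok by (auto simp: list_all_iff arcs_def)
 ultimately show ?case using 3(1)[OF xR yb] sh 3(5) unfolding as_def by auto
qed auto

definition rev_in where "rev_in A e \<longleftrightarrow> (snd e, fst e) \<in> set A"

text \<open>
  Here \<open>A\<close> lists the directed edges of the black faces and \<open>Ws\<close> the white faces.
\<close>

definition colouring_ok where "colouring_ok m A Ws \<longleftrightarrow>
 list_all (\<lambda>e. \<not> rev_in A e) A \<and>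
 list_all (\<lambda>L. length L = 2 * m \<and>
  (map (rev_in A) (zip L (rotate1 L)) = concat (replicate m [True, False]) \<or>
   map (rev_in A) (zip L (rotate1 L)) = concat (replicate m [False, True]))) Ws"

definition solid_ok where "solid_ok k m Ls \<longleftrightarrow>
 colouring_ok m (concat (map (\<lambda>L. zip L (rotate1 L)) (filter (\<lambda>L. length L = k) Ls))) (filter (\<lambda>L. length L \<noteq> k) Ls) \<and>
 k * length (filter (\<lambda>L. length L = k) Ls) + 4 = 2 * length Ls"

definition shelling where "shelling k m st \<longleftrightarrow> list_all (\<lambda>(r, t, d). 1 \<le> t) st \<and>
 (case shell k st [0 # rev [1..<k], [0..<k]] of None => False | Some Ls => solid_ok k m Ls)"

text \<open>
  The cuts for the truncated tetrahedron, octahedron and cube, and below for the truncated icosahedron and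
  dodecahedron. They are obtained by removing from the solid one face after another, such that each one meets the
  remaining part of the boundary in a path.
\<close>

lemma shelling33: "shelling 3 3 [(2,1,4),(3,1,1),(1,1,1),(2,3,2),(7,1,1),(4,5,0)]"
 by code_simp

lemma shelling43: "shelling 4 3 [(3,1,4),(4,1,2),(1,1,2),(3,3,2),(10,1,2),(9,3,2),(8,4,1),(11,2,1),(2,3,2),(11,4,1),(7,2,1),(9,5,0)]"
 by code_simp

lemma shelling34: "shelling 3 4 [(2,1,6),(3,1,1),(3,1,1),(7,1,1),(5,3,4),(10,1,1),(1,1,1),(7,5,2),(12,1,1),(4,5,2),(11,1,1),(13,7,0)]"
 by code_simp

section \<open>Prisms and truncated solids\<close>

lemma shelling53: "shelling 5 3 [(4,1,4),(5,1,3),(6,3,2),(10,1,3),(9,3,2),(2,3,2),(3,1,3),(17,3,2),(17,3,2),(14,2,2),(1,2,2),(19,3,2),(19,3,2),(16,2,2),(1,2,2),(2,3,2),(16,4,1),(19,2,2),(9,3,2),(15,4,1),(18,2,2),(2,3,2),(14,4,1),(1,4,1),(12,3,1),(2,3,2),(9,4,1),(1,4,1),(7,3,1),(9,5,0)]"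
 by code_simp

lemma shelling35: "shelling 3 5 [(2,1,8),(5,1,1),(8,1,1),(6,1,1),(10,1,1),(5,3,6),(15,1,1),(16,1,1),(4,1,1),(10,5,4),(18,1,1),(1,1,1),(15,5,4),(20,1,1),(1,1,1),(25,5,4),(24,1,1),(23,1,1),(2,7,2),(22,1,1),(24,5,4),(23,1,1),(22,1,1),(19,7,2),(21,1,1),(4,7,2),(18,1,1),(20,7,2),(15,1,1),(17,9,0)]"
 by code_simp

lemma concat_replicate_pair: "i < 2 * m ==> concat (replicate m [x, y]) ! i = (if i mod 2 = 0 then x else y)"
proof (induction m arbitrary: i)
 case (Suc m)
 show ?case
 proof (cases "i < 2")
  case True
  then have "i = 0 \<or> i = 1" by linarith
  then show ?thesis by auto
 next
  case False
  then obtain i' where i': "i = Suc (Suc i')" by (metis add_2_eq_Suc le_Suc_ex not_less)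
  then have "i' < 2 * m" using Suc.prems by simp
  then show ?thesis using Suc.IH[of i'] i' by simp
 qed
qed simp

lemma optimal_if_shelling:
 assumes sh: "shelling k m st" and k: "3 \<le> k" and m: "2 \<le> m"
 shows "\<exists>P. optimal k m P"
proof -
 from sh obtain Ls where Ls: "shell k st [0 # rev [1..<k], [0..<k]] = Some Ls" "solid_ok k m Ls" and t: "\<forall>(r, t, d)\<in>set st. 1 \<le> t"
  unfolding shelling_def list_all_iff by (cases "shell k st [0 # rev [1..<k], [0..<k]]") auto
 have vs: "all_verts [0 # rev [1..<k], [0..<k]] \<subseteq> {..<k}" using k by (auto simp: all_verts_def)
 have dr: "drawable Ls" by (rule drawable_shell[OF drawable_initial[OF k] vs Ls(1) t])
 then have dist: "distinct Ls" unfolding drawable_def drawing_def by blast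
 define B where "B = set (filter (\<lambda>L. length L = k) Ls)"
 define A where "A = concat (map (\<lambda>L. zip L (rotate1 L)) (filter (\<lambda>L. length L = k) Ls))"
 have A: "set A = \<Union>(arcs ` B)" unfolding A_def B_def set_concat set_map arcs_def by (simp only: image_image)
 have W: "set (filter (\<lambda>L. length L \<noteq> k) Ls) = set Ls - B" by (auto simp: B_def)
 have col: "colouring_ok m A (filter (\<lambda>L. length L \<noteq> k) Ls)" and cnt: "k * length (filter (\<lambda>L. length L = k) Ls) + 4 = 2 * length Ls"
  using Ls(2) unfolding solid_ok_def A_def by auto
 have cW: "length L = 2 * m" "map (rev_in A) (zip L (rotate1 L)) = concat (replicate m [True, False]) \<or>
   map (rev_in A) (zip L (rotate1 L)) = concat (replicate m [False, True])" if "L \<in> set Ls - B" for L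
  using col that unfolding colouring_ok_def list_all_iff W by auto
 show ?thesis
 proof (rule drawable_optimal[OF dr k m])
  show "B \<subseteq> set Ls" by (auto simp: B_def)
  show "\<And>L. L \<in> B ==> length L = k" by (auto simp: B_def)
  show "\<And>L. L \<in> set Ls - B ==> length L = 2 * m" by (rule cW(1))
  fix a b assume "(a, b) \<in> \<Union>(arcs ` B)"
  then have "(a, b) \<in> set A" using A by simp
  then have "\<not> rev_in A (a, b)" using col unfolding colouring_ok_def list_all_iff by blast
  then show "(b, a) \<notin> \<Union>(arcs ` B)" using A by (simp add: rev_in_def)
 next
  fix L assume L: "L \<in> set Ls - B"
  have n: "map (rev_in A) (zip L (rotate1 L)) ! i \<longleftrightarrow> (rotate1 L ! i, L ! i) \<in> \<Union>(arcs ` B)" if "i < 2 * m" for i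
   using that cW(1)[OF L] A by (simp add: rev_in_def)
  from cW(2)[OF L] show "\<exists>r<2. \<forall>i<2 * m. (rotate1 L ! i, L ! i) \<in> \<Union>(arcs ` B) \<longleftrightarrow> i mod 2 = r"
  proof
   assume e: "map (rev_in A) (zip L (rotate1 L)) = concat (replicate m [True, False])"
   have "(rotate1 L ! i, L ! i) \<in> \<Union>(arcs ` B) \<longleftrightarrow> i mod 2 = 0" if "i < 2 * m" for i
    using concat_replicate_pair[OF that, of True False] unfolding n[OF that, symmetric] e by simp
   then show ?thesis by (intro exI[of _ 0]) simp
  next
   assume e: "map (rev_in A) (zip L (rotate1 L)) = concat (replicate m [False, True])"
   have "(rotate1 L ! i, L ! i) \<in> \<Union>(arcs ` B) \<longleftrightarrow> i mod 2 = 1" if "i < 2 * m" for i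
    using concat_replicate_pair[OF that, of False True] unfolding n[OF that, symmetric] e by simp
   then show ?thesis by (intro exI[of _ 1]) simp
  qed
 next
  have "card B = length (filter (\<lambda>L. length L = k) Ls)" unfolding B_def using dist by (intro distinct_card) simp
  then show "k * card B + 4 = 2 * length Ls" using cnt by simp
 qed
qed

definition lateral :: "nat => nat => nat list" where "lateral k i = [i + 1, i, k + i, k + i + 1]"

lemma arcs_four: "arcs [a, b, c, d] = {(a, b), (b, c), (c, d), (d, a)}" by (auto simp: arcs_def)

lemma rev_upt_Suc: "a \<le> b ==> rev [a..<Suc b] = b # rev [a..<b]" by simp

lemma rev_upt_last: "a < b ==> rev [a..<b] = rev [Suc a..<b] @ [a]" by (simp add: upt_conv_Cons)

text \<open>
  The bottom is \<open>0, \<dots>, k - 1\<close>, and the top vertex over \<open>i\<close> is \<open>k + i\<close>.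
  Here \<open>i\<close> lateral faces have been cut off, so the current face runs from \<open>i\<close> along the
  finished part of the top and down to \<open>0\<close>, then along the free part of the bottom.
\<close>

lemma drawable_prism_part:
 assumes k: "3 \<le> k" and i: "1 \<le> i" "i < k"
 shows "drawable ((i # rev [k..<k + i + 1] @ 0 # rev [i + 1..<k]) # map (lateral k) (rev [0..<i]) @ [[0..<k]])"
 using i
proof (induction i rule: dec_induct)
 case base
 have "rev [1..<k] = rev [2..<k] @ [1]" using rev_upt_last[of 1 k] k by (simp add: numeral_2_eq_2)
 then have "drawable ((0 # rev [2..<k] @ [1]) # [[0..<k]])" using drawable_initial[OF k] by simp
 from drawable_rotate[OF this, of "length (0 # rev [2..<k])"]
 have "drawable ((1 # [] @ 0 # rev [2..<k]) # [[0..<k]])" using rotate_append[of "0 # rev [2..<k]" "[1]"] by simp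
 then have "drawable ((0 # rev [2..<k] @ 1 # [k + 1, k]) # (1 # [] @ 0 # rev [k + 1, k]) # [[0..<k]])"
  by (rule drawable_step) (use k in \<open>auto simp: all_verts_def\<close>)
 from drawable_rotate[OF this, of "length (0 # rev [2..<k])"]
 have "drawable (([1, k + 1, k] @ 0 # rev [2..<k]) # (1 # [] @ 0 # rev [k + 1, k]) # [[0..<k]])"
  using rotate_append[of "0 # rev [2..<k]" "[1, k + 1, k]"] by simp
 then show ?case by (simp add: lateral_def numeral_2_eq_2)
next
 case (step i)
 let ?Ls = "map (lateral k) (rev [0..<i]) @ [[0..<k]]"
 let ?bs = "rev [k..<k + i] @ 0 # rev [i + 2..<k]"
 have IH: "drawable ((i # rev [k..<k + i + 1] @ 0 # rev [i + 1..<k]) # ?Ls)" using step.IH step.prems by simp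
 have e1: "i # rev [k..<k + i + 1] @ 0 # rev [i + 1..<k] = (i # (k + i) # ?bs) @ [i + 1]"
  using rev_upt_last[of "i + 1" k] step.prems by simp
 have "drawable (((i + 1) # [i] @ (k + i) # ?bs) # ?Ls)"
  using drawable_rotate[OF IH[unfolded e1], of "length (i # (k + i) # ?bs)"] unfolding rotate_append by simp
 then have "drawable (((k + i) # ?bs @ (i + 1) # [k + i + 1]) # ((i + 1) # [i] @ (k + i) # rev [k + i + 1]) # ?Ls)"
  by (rule drawable_step) (use step.prems in \<open>auto simp: all_verts_def lateral_def\<close>)
 then have "drawable ((((k + i) # ?bs) @ [i + 1, k + i + 1]) # lateral k i # ?Ls)" by (simp add: lateral_def)
 from drawable_rotate[OF this, of "length ((k + i) # ?bs)"]
 have "drawable (([i + 1, k + i + 1] @ (k + i) # ?bs) # lateral k i # ?Ls)" unfolding rotate_append .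
 moreover have "[i + 1, k + i + 1] @ (k + i) # ?bs = Suc i # rev [k..<k + Suc i + 1] @ 0 # rev [Suc i + 1..<k]" by simp
 moreover have "lateral k i # ?Ls = map (lateral k) (rev [0..<Suc i]) @ [[0..<k]]" by simp
 ultimately show ?case by (simp only:)
qed

lemma drawable_prism:
 assumes k: "3 \<le> k"
 shows "drawable (rev [k..<2 * k] # [k, 0, k - 1, 2 * k - 1] # map (lateral k) (rev [0..<k - 1]) @ [[0..<k]])"
proof -
 let ?Ls = "map (lateral k) (rev [0..<k - 1]) @ [[0..<k]]"
 let ?bs = "rev [k + 1..<2 * k - 1]"
 have kk: "k + (k - 1) + 1 = Suc (2 * k - 1)" "k - 1 + 1 = k" "Suc (2 * k - 1) = 2 * k" using k by auto
 have e0: "rev [k..<2 * k - 1] = ?bs @ [k]" using rev_upt_last[of k "2 * k - 1"] k by simp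
 have e1: "rev [k..<Suc (2 * k - 1)] = (2 * k - 1) # ?bs @ [k]"
  using rev_upt_Suc[of k "2 * k - 1"] e0 k by simp
 have "drawable (((k - 1) # rev [k..<k + (k - 1) + 1] @ 0 # rev [k - 1 + 1..<k]) # ?Ls)"
  by (rule drawable_prism_part[OF k]) (use k in auto)
 then have "drawable (([k - 1, 2 * k - 1] @ ?bs @ [k, 0]) # ?Ls)" unfolding kk(1,2) e1 by simp
 then have "drawable ((([k - 1, 2 * k - 1] @ ?bs) @ [k, 0]) # ?Ls)" by simp
 from drawable_rotate[OF this, of "length ([k - 1, 2 * k - 1] @ ?bs)"]
 have d: "drawable ((k # [0, k - 1] @ (2 * k - 1) # ?bs) # ?Ls)" unfolding rotate_append by simp
 have bs: "?bs \<noteq> []" using k by simp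
 have no: "(k, 2 * k - 1) \<notin> all_arcs ((k # [0, k - 1] @ (2 * k - 1) # ?bs) # ?Ls)"
 proof
  assume "(k, 2 * k - 1) \<in> all_arcs ((k # [0, k - 1] @ (2 * k - 1) # ?bs) # ?Ls)"
  then obtain L where L: "L \<in> set ((k # [0, k - 1] @ (2 * k - 1) # ?bs) # ?Ls)" "(k, 2 * k - 1) \<in> arcs L" unfolding all_arcs_def by blast
  then consider "L = k # 0 # (k - 1) # (2 * k - 1) # ?bs" | i where "i < k - 1" "L = lateral k i" | "L = [0..<k]" by auto
  then show False
  proof cases
   case 1
   have "(k, 0) \<in> arcs L" unfolding 1 by (simp add: arcs_def)
   moreover have "distinct L" unfolding 1 using k by auto
   moreover obtain i j where "i < length L" "k = L ! i" "2 * k - 1 = rotate1 L ! i" "j < length L" "k = L ! j" "0 = rotate1 L ! j"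
    using L(2) \<open>(k, 0) \<in> arcs L\<close> unfolding arcs_nth by metis
   ultimately have "2 * k - 1 = 0" using nth_eq_iff_index_eq by metis
   then show False using k by simp
  next
   case 2 then show False using L(2) k by (auto simp: lateral_def arcs_four)
  next
   case 3 then show False using arcs_verts[OF L(2)] by simp
  qed
 qed
 have "drawable (((2 * k - 1) # ?bs @ k # []) # (k # [0, k - 1] @ (2 * k - 1) # rev []) # ?Ls)"
  by (rule drawable_step[OF d]) (use bs no in auto)
 then show ?thesis using e1 unfolding kk(3) by simp
qed

lemma drawable_no_both: assumes "drawable Ls" "L \<in> set Ls" "(a, b) \<in> arcs L" shows "(b, a) \<notin> arcs L"
proof -
 obtain loc p c H where "drawing loc p c H Ls" using assms(1) unfolding drawable_def by blast
 then interpret drawn loc p c H Ls by unfold_locales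
 show ?thesis by (rule no_both(1)[OF assms(2,3)])
qed

text \<open>
  The sides of a lateral face alternate between its two horizontal edges, towards bottom and top, and its vertical
  ones.
\<close>

lemma optimal_prism: assumes k: "3 \<le> k" shows "\<exists>P. optimal k 2 P"
proof -
 define T Bt where "T = rev [k..<2 * k]" and "Bt = [0..<k]"
 define Ls where "Ls = T # [k, 0, k - 1, 2 * k - 1] # map (lateral k) (rev [0..<k - 1]) @ [Bt]"
 have dr: "drawable Ls" unfolding Ls_def T_def Bt_def by (rule drawable_prism[OF k])
 have bot: "(i, Suc i) \<in> arcs Bt" if "Suc i < k" for i
  unfolding arcs_nth Bt_def using that by (intro exI[of _ i]) (simp add: nth_rotate1)
 have bot': "(k - 1, 0) \<in> arcs Bt"
  unfolding arcs_nth Bt_def using k by (intro exI[of _ "k - 1"]) (simp add: nth_rotate1)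
 have lenT: "length T = k" by (simp add: T_def)
 have T_nth: "T ! i = 2 * k - Suc i" if "i < k" for i using that by (simp add: T_def rev_nth)
 have top: "(k + i + 1, k + i) \<in> arcs T" if i: "Suc i < k" for i
 proof -
  have j: "k - 2 - i < k" "Suc (k - 2 - i) < k" using i by auto
  have ar: "2 * k - Suc (k - 2 - i) = k + i + 1" "2 * k - Suc (Suc (k - 2 - i)) = k + i" "Suc (k - 2 - i) mod k = Suc (k - 2 - i)"
   using i j by simp_all
  have "T ! (k - 2 - i) = k + i + 1" unfolding T_nth[OF j(1)] by (rule ar(1))
  moreover have "rotate1 T ! (k - 2 - i) = k + i"
   using nth_rotate1[of "k - 2 - i" T] T_nth[OF j(2)] j(1) unfolding lenT ar by simp
  ultimately have "T ! (k - 2 - i) = k + i + 1" "rotate1 T ! (k - 2 - i) = k + i" by auto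
  then show ?thesis unfolding arcs_nth lenT using j(1) by metis
 qed
 have top': "(k, 2 * k - 1) \<in> arcs T"
 proof -
  have j: "k - 1 < k" "0 < k" using k by auto
  have "T ! (k - 1) = k" "rotate1 T ! (k - 1) = 2 * k - 1"
   using T_nth[OF j(1)] T_nth[OF j(2)] nth_rotate1[of "k - 1" T] lenT k by simp_all
  then show ?thesis unfolding arcs_nth lenT using j(1) by metis
 qed
 have vT: "k \<le> a \<and> k \<le> b" if "(a, b) \<in> arcs T" for a b using arcs_verts[OF that] by (simp add: T_def)
 have vB: "a < k \<and> b < k" if "(a, b) \<in> arcs Bt" for a b using arcs_verts[OF that] by (simp add: Bt_def)
 have U: "\<Union>(arcs ` {T, Bt}) = arcs T \<union> arcs Bt" by simp
 have mixed: "(a, b) \<notin> arcs T \<union> arcs Bt" if "a < k \<and> k \<le> b \<or> k \<le> a \<and> b < k" for a b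
  using that vT vB by (meson UnE not_less)
 have ne: "T \<noteq> Bt"
 proof
  assume "T = Bt"
  then have "set T = set Bt" by simp
  then have "(0::nat) \<in> set T" using k by (simp add: Bt_def)
  then show False using k by (simp add: T_def)
 qed
 show ?thesis
 proof (rule drawable_optimal[OF dr k, where B = "{T, Bt}"])
  show "{T, Bt} \<subseteq> set Ls" by (simp add: Ls_def)
  show "\<And>L. L \<in> {T, Bt} ==> length L = k" by (auto simp: T_def Bt_def)
  show "\<And>L. L \<in> set Ls - {T, Bt} ==> length L = 2 * 2" by (auto simp: Ls_def lateral_def)
  show "k * card {T, Bt} + 4 = 2 * length Ls" using ne k by (simp add: Ls_def)
  fix a b assume ab: "(a, b) \<in> \<Union>(arcs ` {T, Bt})"
  have mem: "T \<in> set Ls" "Bt \<in> set Ls" by (simp_all add: Ls_def)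
  show "(b, a) \<notin> \<Union>(arcs ` {T, Bt})"
   using ab drawable_no_both[OF dr mem(1)] drawable_no_both[OF dr mem(2)] vT vB unfolding U by (metis UnE not_less)
 next
  fix L assume "L \<in> set Ls - {T, Bt}"
  then consider "L = [k, 0, k - 1, 2 * k - 1]" | i where "i < k - 1" "L = lateral k i" by (auto simp: Ls_def)
  then show "\<exists>r<2. \<forall>i<2 * 2. (rotate1 L ! i, L ! i) \<in> \<Union>(arcs ` {T, Bt}) \<longleftrightarrow> i mod 2 = r"
  proof cases
   case 1
   have n: "(0, k) \<notin> arcs T \<union> arcs Bt" "(k - 1, 0) \<in> arcs T \<union> arcs Bt" "(2 * k - 1, k - 1) \<notin> arcs T \<union> arcs Bt" "(k, 2 * k - 1) \<in> arcs T \<union> arcs Bt"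
   proof -
    have "k \<le> 2 * k - 1 \<and> k - 1 < k" "0 < k \<and> k \<le> k" using k by auto
    then show "(0, k) \<notin> arcs T \<union> arcs Bt" "(2 * k - 1, k - 1) \<notin> arcs T \<union> arcs Bt" using mixed by blast+
   qed (use bot' top' in auto)
   have "(rotate1 L ! i, L ! i) \<in> arcs T \<union> arcs Bt \<longleftrightarrow> i mod 2 = 1" if i: "i < 2 * 2" for i
   proof -
    consider "i = 0" | "i = 1" | "i = 2" | "i = 3" using i by linarith
    then show ?thesis by cases (use n in \<open>simp_all add: 1\<close>)
   qed
   then show ?thesis unfolding U by (intro exI[of _ 1]) simp
  next
   case (2 i)
   have ik: "Suc i < k" using 2(1) by simp
   have n: "(i, i + 1) \<in> arcs T \<union> arcs Bt" "(k + i, i) \<notin> arcs T \<union> arcs Bt" "(k + i + 1, k + i) \<in> arcs T \<union> arcs Bt" "(i + 1, k + i + 1) \<notin> arcs T \<union> arcs Bt"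
    using mixed bot[OF ik] top[OF ik] ik by auto
   have "(rotate1 L ! j, L ! j) \<in> arcs T \<union> arcs Bt \<longleftrightarrow> j mod 2 = 0" if j: "j < 2 * 2" for j
   proof -
    consider "j = 0" | "j = 1" | "j = 2" | "j = 3" using j by linarith
    then show ?thesis by cases (use n in \<open>simp_all add: 2(2) lateral_def\<close>)
   qed
   then show ?thesis unfolding U by (intro exI[of _ 0]) simp
  qed
 qed simp
qed

theorem theorem5:
 fixes k l :: nat
 assumes "\<exists>P. football_pattern k l 2 P"
 shows "(\<exists>Q. minimal_realisation k l 2 Q) \<and>
  (\<forall>P Q. football_pattern k l 2 P \<longrightarrow> minimal_realisation k l 2 Q \<longrightarrow> branched_cover_of P Q) \<and>
  (\<forall>Q Q'. minimal_realisation k l 2 Q \<longrightarrow> minimal_realisation k l 2 Q' \<longrightarrow> isomorphic_patterns Q Q')"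
proof (rule conclusion_from_optimal[OF assms])
 define m where "m = l div 2"
 obtain P where P: "football_pattern k l 2 P" using assms by blast
 then have "3 \<le> k" "3 \<le> l" "even l" by (auto simp: football_pattern_def)
 then have km: "3 \<le> k" "2 \<le> m" unfolding m_def by presburger+
 obtain g n h es dr where "football_map (verts P) (edges P) (faces P) g n h es dr (black P) (white P) k (l div 2)"
  using pattern_map[OF P] .
 then interpret football_map "verts P" "edges P" "faces P" g n h es dr "black P" "white P" k "l div 2" .
 have "m = 2 \<or> (k, m) \<in> {(3,3), (4,3), (5,3), (3,4), (3,5)}"
  unfolding m_def by (rule spherical_types[OF km[unfolded m_def] counts(2,3)])
 then consider "m = 2" | "k = 3" "m = 3" | "k = 4" "m = 3" | "k = 5" "m = 3" | "k = 3" "m = 4" | "k = 3" "m = 5" by auto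
 then show "\<exists>R. optimal k (l div 2) R"
  unfolding m_def[symmetric]
 proof cases
  case 1 then show "\<exists>R. optimal k m R" using optimal_prism[OF km(1)] by simp
 next
  case 2 show "\<exists>R. optimal k m R" unfolding 2 by (rule optimal_if_shelling[OF shelling33]) simp_all
 next
  case 3 show "\<exists>R. optimal k m R" unfolding 3 by (rule optimal_if_shelling[OF shelling43]) simp_all
 next
  case 4 show "\<exists>R. optimal k m R" unfolding 4 by (rule optimal_if_shelling[OF shelling53]) simp_all
 next
  case 5 show "\<exists>R. optimal k m R" unfolding 5 by (rule optimal_if_shelling[OF shelling34]) simp_all
 next
  case 6 show "\<exists>R. optimal k m R" unfolding 6 by (rule optimal_if_shelling[OF shelling35]) simp_all
 qed
qed

end
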